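(* Let $G$ be the fundamental group of a finite connected graph $(\mathcal{G}, X)$ of finitely generated free abelian groups such that, for every $e \in A$, $G_e$ is a proper subgroup of $G_{o(e)}$ and $\phi_e(G_e)$ is a proper subgroup of $G_{\tau(e)}$. Suppose furthermore that all vertex groups and edge groups have the same rank. Then the following conditions are equivalent: (i) $G$ is self-similar; (ii) $G$ is residually finite; (iii) $G$ is linear over $\mathbb{Z}$; (iv) $G$ is subgroup separable.
   Context: Graph of groups notation: $X$ is a finite connected graph (loops are allowed), $V(X)$ its vertices, $A$ an orientation of its edges $E(X)$, with $o(e)$ and $\tau(e)$ the beginning and the end of $e \in A$. For each $v\in V(X)$ a group $G_v$ is given, and for each $e \in A$ a subgroup $G_e \le G_{o(e)}$ and an isomorphism $\phi_e : G_e \to \phi_e(G_e) \leq G_{\tau(e)}$. Let $T$ be a maximal subtree of $X$. The fundamental group $G=\pi(\mathcal{G},X)$ is generated by the groups $G_v$ ($v\in V(X)$) and elements $t_e$ ($e \in A$), subject to the relations of each $G_v$, the relations $t_e g t_e^{-1} = \phi_e(g)$ for $e\in A$, $g\in G_e$, and $t_e = 1$ for $e \in A \cap E(T)$. Self-similar: for an integer $m\ge 2$ let $\mathcal{T}_m$ be the rooted tree in which every vertex has exactly $m$ descendants (children). Each automorphism $g$ of $\mathcal{T}_m$ can be written as $g = (g_0,\dots,g_{m-1})\sigma$, where $\sigma\in S_m$ is the permutation induced by $g$ on the first level and $g_0,\dots,g_{m-1} \in \mathrm{Aut}(\mathcal{T}_m)$ (the states of $g$) describe the action of $g$ on the $m$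 subtrees rooted at the first-level vertices, each such subtree being identified with $\mathcal{T}_m$ in the standard way. A group $G$ is self-similar if for some $m$ it has a faithful action on $\mathcal{T}_m$ by automorphisms such that, viewing $G \le \mathrm{Aut}(\mathcal{T}_m)$, all states $g_0,\dots,g_{m-1}$ of every $g\in G$ belong to $G$. A group is linear over $\mathbb{Z}$ if it embeds in $GL_k(\mathbb{Z})$ for some $k$. A group $G$ is subgroup separable if any two distinct finitely generated subgroups of $G$ have distinct images in some finite quotient of $G$. *)

theory Defs
  imports
    "HOL-Algebra.Free_Abelian_Groups"
    "HOL-Algebra.Bij"
    "HOL-Algebra.Generated_Groups"
    "Graph_Theory.Graph_Theory"
    "Jordan_Normal_Form.Matrix"
begin

section \<open>Maximal subtrees of oriented multigraphs\<close>

text \<open>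
  A graph with an orientation \<open>A\<close> of its edges is given as a digraph whose arcs are the elements
  of \<open>A\<close>; loops and multiple edges are allowed.  The cycles, forests and trees of the
  library are directed (two parallel arcs form a \<open>forest\<close> there), so trees in the undirected sense
  are defined via the graph in which each arc may be traversed in both directions.  In a circuit
  the underlying edges must be distinct, so that walking along an edge and back is not a circuit.
\<close>

definition both_directions :: "('v, 'e) pre_digraph \<Rightarrow> ('v, 'e \<times> bool) pre_digraph" where
  "both_directions X =
    \<lparr>verts = verts X, arcs = arcs X \<times> UNIV,
     tail = (\<lambda>(e, b). if b then tail X e else head X e),
     head = (\<lambda>(e, b). if b then head X e else tail X e)\<rparr>"

definition circuit :: "('v, 'e) pre_digraph \<Rightarrow> ('e \<times> bool) list \<Rightarrow> bool" where
  "circuit X p \<longleftrightarrow> pre_digraph.cycle (both_directions X) p \<and> distinct (map fst p)"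

definition undirected_tree :: "('v, 'e) pre_digraph \<Rightarrow> bool" where
  "undirected_tree X \<longleftrightarrow> Digraph_Component.connected X \<and> (\<nexists>p. circuit X p)"

definition maximal_subtree :: "('v, 'e) pre_digraph \<Rightarrow> ('v, 'e) pre_digraph \<Rightarrow> bool" where
  "maximal_subtree X T \<longleftrightarrow> pre_digraph.max_subgraph X undirected_tree T"


section \<open>Groups given by generators and relations\<close>

text \<open>Words in the letters \<open>(x, True)\<close>, standing for \<open>x\<close>, and \<open>(x, False)\<close>, standing for its inverse.\<close>

type_synonym 'x word = "('x \<times> bool) list"

definition words :: "'x set \<Rightarrow> 'x word set" where
  "words S = lists (S \<times> UNIV)"

inductive_set word_eq :: "'x set \<Rightarrow> ('x word \<times> 'x word) set \<Rightarrow> ('x word \<times> 'x word) set"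
  for S :: "'x set" and R :: "('x word \<times> 'x word) set" where
  refl: "w \<in> words S \<Longrightarrow> (w, w) \<in> word_eq S R"
| sym: "(u, v) \<in> word_eq S R \<Longrightarrow> (v, u) \<in> word_eq S R"
| trans: "(u, v) \<in> word_eq S R \<Longrightarrow> (v, w) \<in> word_eq S R \<Longrightarrow> (u, w) \<in> word_eq S R"
| append: "(u, u') \<in> word_eq S R \<Longrightarrow> (v, v') \<in> word_eq S R \<Longrightarrow> (u @ v, u' @ v') \<in> word_eq S R"
| cancel: "x \<in> S \<Longrightarrow> ([(x, b), (x, \<not> b)], []) \<in> word_eq S R"
| rel: "(u, v) \<in> R \<Longrightarrow> u \<in> words S \<Longrightarrow> v \<in> words S \<Longrightarrow> (u, v) \<in> word_eq S R"

definition presented_group :: "'x set \<Rightarrow> ('x word \<times> 'x word) set \<Rightarrow> 'x word set monoid" where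
  "presented_group S R =
    \<lparr>carrier = words S // word_eq S R,
     monoid.mult = (\<lambda>A B. \<Union>a\<in>A. \<Union>b\<in>B. word_eq S R `` {a @ b}),
     one = word_eq S R `` {[]}\<rparr>"

lemma word_eq_words: "(u, v) \<in> word_eq S R \<Longrightarrow> u \<in> words S \<and> v \<in> words S"
  by (induction rule: word_eq.induct) (auto simp: words_def)

lemma equiv_word_eq: "equiv (words S) (word_eq S R)"
proof (rule equivI)
  show "word_eq S R \<subseteq> words S \<times> words S" using word_eq_words by fast
  show "refl_on (words S) (word_eq S R)" by (auto simp: refl_on_def intro: word_eq.refl)
  show "Relation.sym (word_eq S R)" by (auto simp: sym_def intro: word_eq.sym)
  show "Relation.trans (word_eq S R)" by (auto simp: trans_def intro: word_eq.trans)
qed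

lemma presented_group_mult:
  assumes "u \<in> words S" "v \<in> words S"
  shows "word_eq S R `` {u} \<otimes>\<^bsub>presented_group S R\<^esub> word_eq S R `` {v} = word_eq S R `` {u @ v}"
proof -
  have "congruent2 (word_eq S R) (word_eq S R) (\<lambda>a b. word_eq S R `` {a @ b})"
    by (intro congruent2I' equiv_class_eq[OF equiv_word_eq] word_eq.append)
  from UN_equiv_class2[OF equiv_word_eq equiv_word_eq this assms]
  show ?thesis by (simp add: presented_group_def)
qed

lemma group_presented_group: "group (presented_group S R)"
proof (rule groupI)
  let ?G = "presented_group S R" and ?c = "\<lambda>w. word_eq S R `` {w}"
  have app: "u @ v \<in> words S" if "u \<in> words S" "v \<in> words S" for u v
    using that by (simp add: words_def)
  have nil: "[] \<in> words S" by (simp add: words_def)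
  have car: "A \<in> carrier ?G \<longleftrightarrow> (\<exists>w\<in>words S. A = ?c w)" for A
    by (auto simp: presented_group_def quotient_def)
  have one: "\<one>\<^bsub>?G\<^esub> = ?c []" by (simp add: presented_group_def)
  show "x \<otimes>\<^bsub>?G\<^esub> y \<in> carrier ?G" if "x \<in> carrier ?G" "y \<in> carrier ?G" for x y
    using that app by (auto simp: car presented_group_mult)
  show "\<one>\<^bsub>?G\<^esub> \<in> carrier ?G" using nil by (auto simp: car one)
  show "x \<otimes>\<^bsub>?G\<^esub> y \<otimes>\<^bsub>?G\<^esub> z = x \<otimes>\<^bsub>?G\<^esub> (y \<otimes>\<^bsub>?G\<^esub> z)"
    if "x \<in> carrier ?G" "y \<in> carrier ?G" "z \<in> carrier ?G" for x y z
    using that app by (auto simp: car presented_group_mult)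
  show "\<one>\<^bsub>?G\<^esub> \<otimes>\<^bsub>?G\<^esub> x = x" if "x \<in> carrier ?G" for x
    using that nil by (auto simp: car one presented_group_mult)
  have inv: "\<exists>v\<in>words S. (v @ w, []) \<in> word_eq S R" if "w \<in> words S" for w
    using that
  proof (induction w)
    case Nil
    then show ?case using nil by (auto intro: word_eq.refl)
  next
    case (Cons a w)
    obtain x b where a: "a = (x, b)" "x \<in> S" and w: "w \<in> words S"
      using Cons.prems by (cases a) (auto simp: words_def)
    obtain v where v: "v \<in> words S" "(v @ w, []) \<in> word_eq S R"
      using Cons.IH w by blast
    have "([(x, \<not> b), (x, b)] @ w, [] @ w) \<in> word_eq S R"
      using word_eq.append[OF word_eq.cancel[OF a(2), of "\<not> b"] word_eq.refl[OF w]] by simp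
    from word_eq.append[OF word_eq.refl[OF v(1)] this]
    have "((v @ [(x, \<not> b)]) @ a # w, v @ w) \<in> word_eq S R" by (simp add: a)
    with v(2) have "((v @ [(x, \<not> b)]) @ a # w, []) \<in> word_eq S R" by (rule word_eq.trans[rotated])
    moreover have "v @ [(x, \<not> b)] \<in> words S" using v(1) a by (simp add: words_def)
    ultimately show ?case by blast
  qed
  show "\<exists>y\<in>carrier ?G. y \<otimes>\<^bsub>?G\<^esub> x = \<one>\<^bsub>?G\<^esub>" if x: "x \<in> carrier ?G" for x
  proof -
    obtain w where w: "w \<in> words S" "x = ?c w" using x car by blast
    obtain v where v: "v \<in> words S" "(v @ w, []) \<in> word_eq S R" using inv w by blast
    have "?c v \<otimes>\<^bsub>?G\<^esub> x = \<one>\<^bsub>?G\<^esub>"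
      using w v equiv_class_eq[OF equiv_word_eq v(2)] by (simp add: presented_group_mult one)
    then show ?thesis using v(1) car by blast
  qed
qed


section \<open>Graphs of groups and their fundamental groups\<close>

locale graph_of_groups = fin_digraph X
  for X :: "('v, 'e) pre_digraph" +
  fixes Gv :: "'v \<Rightarrow> 'g monoid" and Ge :: "'e \<Rightarrow> 'g set" and \<phi> :: "'e \<Rightarrow> 'g \<Rightarrow> 'g"
  assumes connected: "Digraph_Component.connected X"
    and group_Gv: "v \<in> verts X \<Longrightarrow> group (Gv v)"
    and subgroup_Ge: "e \<in> arcs X \<Longrightarrow> subgroup (Ge e) (Gv (tail X e))"
    and subgroup_image: "e \<in> arcs X \<Longrightarrow> subgroup (\<phi> e ` Ge e) (Gv (head X e))"
    and iso_\<phi>: "e \<in> arcs X \<Longrightarrow>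
      \<phi> e \<in> iso (Gv (tail X e)\<lparr>carrier := Ge e\<rparr>) (Gv (head X e)\<lparr>carrier := \<phi> e ` Ge e\<rparr>)"

datatype ('v, 'e, 'g) generator = Vertex_Elem 'v 'g | Stable_Letter 'e

definition fundamental_generators ::
  "('v, 'e) pre_digraph \<Rightarrow> ('v \<Rightarrow> 'g monoid) \<Rightarrow> ('v, 'e, 'g) generator set" where
  "fundamental_generators X Gv =
    {Vertex_Elem v g | v g. v \<in> verts X \<and> g \<in> carrier (Gv v)} \<union> Stable_Letter ` arcs X"

text \<open>The relations of a vertex group are those of its multiplication table.\<close>

definition fundamental_relations ::
  "('v, 'e) pre_digraph \<Rightarrow> ('v \<Rightarrow> 'g monoid) \<Rightarrow> ('e \<Rightarrow> 'g set) \<Rightarrow> ('e \<Rightarrow> 'g \<Rightarrow> 'g)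
    \<Rightarrow> ('v, 'e) pre_digraph \<Rightarrow> (('v, 'e, 'g) generator word \<times> ('v, 'e, 'g) generator word) set" where
  "fundamental_relations X Gv Ge \<phi> T =
    {([(Vertex_Elem v g, True), (Vertex_Elem v h, True)], [(Vertex_Elem v (g \<otimes>\<^bsub>Gv v\<^esub> h), True)])
      | v g h. v \<in> verts X \<and> g \<in> carrier (Gv v) \<and> h \<in> carrier (Gv v)} \<union>
    {([(Stable_Letter e, True), (Vertex_Elem (tail X e) g, True), (Stable_Letter e, False)],
      [(Vertex_Elem (head X e) (\<phi> e g), True)])
      | e g. e \<in> arcs X \<and> g \<in> Ge e} \<union>
    {([(Stable_Letter e, True)], []) | e. e \<in> arcs X \<inter> arcs T}"

definition fundamental_group ::
  "('v, 'e) pre_digraph \<Rightarrow> ('v \<Rightarrow> 'g monoid) \<Rightarrow> ('e \<Rightarrow> 'g set) \<Rightarrow> ('e \<Rightarrow> 'g \<Rightarrow> 'g)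
    \<Rightarrow> ('v, 'e) pre_digraph \<Rightarrow> ('v, 'e, 'g) generator word set monoid" where
  "fundamental_group X Gv Ge \<phi> T =
    presented_group (fundamental_generators X Gv) (fundamental_relations X Gv Ge \<phi> T)"


section \<open>Group-theoretic properties\<close>

definition free_abelian_of_rank :: "('a, 'b) monoid_scheme \<Rightarrow> nat \<Rightarrow> bool" where
  "free_abelian_of_rank G n \<longleftrightarrow> G \<cong> free_Abelian_group {..<n}"

text \<open>
  The vertices of the \<open>m\<close>-ary rooted tree are the words over \<open>{..<m}\<close>; the children of \<open>u\<close> are the
  words \<open>u @ [x]\<close>, and the subtree rooted at \<open>[x]\<close> is identified with the whole tree by
  deleting the first letter.
\<close>

definition tree_aut :: "nat \<Rightarrow> (nat list \<Rightarrow> nat list) set" where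
  "tree_aut m = {f \<in> Bij (lists {..<m}). f [] = [] \<and>
     (\<forall>u\<in>lists {..<m}. \<forall>v\<in>lists {..<m}. (\<exists>x. v = u @ [x]) \<longleftrightarrow> (\<exists>y. f v = f u @ [y]))}"

definition tree_aut_group :: "nat \<Rightarrow> (nat list \<Rightarrow> nat list) monoid" where
  "tree_aut_group m = BijGroup (lists {..<m})\<lparr>carrier := tree_aut m\<rparr>"

definition state :: "nat \<Rightarrow> (nat list \<Rightarrow> nat list) \<Rightarrow> nat \<Rightarrow> nat list \<Rightarrow> nat list" where
  "state m f x = (\<lambda>w\<in>lists {..<m}. tl (f (x # w)))"

lemma group_tree_aut_group: "group (tree_aut_group m)"
  unfolding tree_aut_group_def
proof (intro group.subgroup_imp_group[OF group_BijGroup] group.subgroupI[OF group_BijGroup])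
  let ?W = "lists {..<m}"
  show "tree_aut m \<subseteq> carrier (BijGroup ?W)" by (auto simp: tree_aut_def BijGroup_def)
  show "tree_aut m \<noteq> {}"
  proof -
    have "(\<lambda>x\<in>?W. x) \<in> tree_aut m"
      unfolding tree_aut_def using id_Bij[of ?W] by (simp del: in_lists_conv_set)
    then show ?thesis by blast
  qed
  show "inv\<^bsub>BijGroup ?W\<^esub> f \<in> tree_aut m" if "f \<in> tree_aut m" for f
  proof -
    let ?g = "\<lambda>x\<in>?W. inv_into ?W f x"
    have f: "f \<in> Bij ?W" "f [] = []" and bij: "bij_betw f ?W ?W"
      and ch: "\<And>u v. u \<in> ?W \<Longrightarrow> v \<in> ?W \<Longrightarrow> (\<exists>x. v = u @ [x]) \<longleftrightarrow> (\<exists>y. f v = f u @ [y])"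
      using that by (auto simp: tree_aut_def Bij_def)
    have g: "?g u \<in> ?W" "f (?g u) = u" if "u \<in> ?W" for u
      using that f bij by (auto simp: Bij_inv_into_mem bij_betw_inv_into_right)
    have "?g [] = []"
      using bij f(2) by (simp add: inv_into_f_eq bij_betw_def)
    moreover have "(\<exists>x. v = u @ [x]) \<longleftrightarrow> (\<exists>y. ?g v = ?g u @ [y])" if "u \<in> ?W" "v \<in> ?W" for u v
      using ch[of "?g u" "?g v"] g[OF that(1)] g[OF that(2)] by simp
    ultimately have "?g \<in> tree_aut m"
      unfolding tree_aut_def using restrict_inv_into_Bij[OF f(1)] by blast
    then show ?thesis by (simp add: inv_BijGroup f(1))
  qed
  show "f \<otimes>\<^bsub>BijGroup ?W\<^esub> g \<in> tree_aut m" if "f \<in> tree_aut m" "g \<in> tree_aut m" for f g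
  proof -
    have fg: "f \<in> Bij ?W" "g \<in> Bij ?W" using that by (auto simp: tree_aut_def)
    have gW: "g u \<in> ?W" if "u \<in> ?W" for u using Bij_imp_funcset[OF fg(2)] that by blast
    have ch: "(\<exists>x. v = u @ [x]) \<longleftrightarrow> (\<exists>y. h v = h u @ [y])"
      if "h \<in> tree_aut m" "u \<in> ?W" "v \<in> ?W" for h u v
      using that unfolding tree_aut_def by blast
    have "(\<exists>x. v = u @ [x]) \<longleftrightarrow> (\<exists>y. compose ?W f g v = compose ?W f g u @ [y])"
      if "u \<in> ?W" "v \<in> ?W" for u v
      using ch[OF \<open>g \<in> tree_aut m\<close> that] ch[OF \<open>f \<in> tree_aut m\<close> gW[OF that(1)] gW[OF that(2)]] that
      by (simp add: compose_def)
    moreover have "compose ?W f g [] = []"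
      using that by (simp add: compose_def tree_aut_def)
    ultimately have "compose ?W f g \<in> tree_aut m"
      unfolding tree_aut_def using compose_Bij[OF fg] by blast
    then show ?thesis using fg by (simp add: BijGroup_def)
  qed
qed

definition self_similar :: "('a, 'b) monoid_scheme \<Rightarrow> bool" where
  "self_similar G \<longleftrightarrow> (\<exists>m\<ge>2. \<exists>\<rho>\<in>mon G (tree_aut_group m).
     \<forall>g\<in>carrier G. \<forall>x<m. state m (\<rho> g) x \<in> \<rho> ` carrier G)"

definition residually_finite :: "('a, 'b) monoid_scheme \<Rightarrow> bool" where
  "residually_finite G \<longleftrightarrow> (\<forall>g\<in>carrier G. g \<noteq> \<one>\<^bsub>G\<^esub> \<longrightarrow>
     (\<exists>N. N \<lhd> G \<and> finite (carrier (G Mod N)) \<and> g \<notin> N))"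

definition GL_int :: "nat \<Rightarrow> int mat monoid" where
  "GL_int k = units_of (ring_mat TYPE(int) k ())"

definition linear_over_int :: "('a, 'b) monoid_scheme \<Rightarrow> bool" where
  "linear_over_int G \<longleftrightarrow> (\<exists>k. mon G (GL_int k) \<noteq> {})"

definition fg_subgroup :: "'a set \<Rightarrow> ('a, 'b) monoid_scheme \<Rightarrow> bool" where
  "fg_subgroup H G \<longleftrightarrow> (\<exists>S. finite S \<and> S \<subseteq> carrier G \<and> H = generate G S)"

definition subgroup_separable :: "('a, 'b) monoid_scheme \<Rightarrow> bool" where
  "subgroup_separable G \<longleftrightarrow> (\<forall>H K. fg_subgroup H G \<and> fg_subgroup K G \<and> H \<noteq> K \<longrightarrow>
     (\<exists>N. N \<lhd> G \<and> finite (carrier (G Mod N)) \<and>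
          (\<lambda>g. N #>\<^bsub>G\<^esub> g) ` H \<noteq> (\<lambda>g. N #>\<^bsub>G\<^esub> g) ` K))"

end

(* Each of the other conditions gives residual finiteness at once.  Conversely, if G is residually
   finite, then the commutators [t a t^-1, b] with a outside G_e and b outside phi(G_e), which are
   nontrivial, survive in a finite quotient; this forces a lattice M, common to all vertex groups, that is
   normal in G.  The group G/M is virtually free: the subgroup N acts on a finite graph of edge cosets, and
   labelling the edges by ping-pong matrices A^i B^2 A^-i of SL2(Z) detects the elements of N outside M.
   The endomorphism sigma of G that fixes the stable letters and raises the vertex groups to the power
   d + 1 is the identity modulo M.  It makes G act on M by affine maps, which together with the labels gives
   linearity; Marshall Hall's theorem for the labels gives separability; and its inverse is a virtual
   endomorphism that divides M by d + 1, which together with a recursion for a free group gives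
   self-similarity. *)
theory Submission
  imports Defs "HOL-Algebra.Multiplicative_Group"
begin

section \<open>Finite quotients, presentations and cocycles\<close>

section \<open>Normal subgroups of finite index\<close>

text \<open>Cocycles take the place of actions on trees. A homomorphism from a presented group to a
  wreath product is an action on positions with a label at every position, so it is checked on the
  defining relations only; labels of stable letters that are constant on edge-group cosets always
  extend. That an element is nontrivial is then read off from ping-pong on labels, not from a normal
  form theorem.

  Why surviving commutators force a lattice: in a quotient where some \<open>a\<close> outside
  \<open>G_e\<close> becomes equal to an element of \<open>G_e\<close>, the commutator dies, because
  the vertex groups are abelian. So if enough commutators survive, the kernel meets both end groups
  of \<open>e\<close> inside the edge subgroups, and conjugation by \<open>t_e\<close> matches the
  two intersections.

  The remaining obstacle is the extension by \<open>M\<close>, about which virtual freeness of the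
  quotient says nothing. The map sending \<open>g\<close> to \<open>sigma g\<close> times the
  inverse of \<open>g\<close> is a crossed homomorphism into \<open>M\<close> that restricts to the
  \<open>d\<close>-th power on \<open>M\<close>, so the extension splits up to finite index. Each of
  the three conclusions treats \<open>M\<close> and the labels separately and then combines
  them.\<close>

definition finite_index_normal :: "'a set \<Rightarrow> ('a, 'b) monoid_scheme \<Rightarrow> bool" where
 "finite_index_normal N G \<longleftrightarrow> N \<lhd> G \<and> finite (carrier (G Mod N))"

lemma (in group) normalI_conj:
 assumes "subgroup N G" "\<And>g n. g \<in> carrier G \<Longrightarrow> n \<in> N \<Longrightarrow> g \<otimes> n \<otimes> inv g \<in> N"
 shows "N \<lhd> G"
 using assms by (simp add: normal_inv_iff)

lemma (in group) mem_rcos_iff: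
 assumes "subgroup N G" "g \<in> carrier G" "h \<in> carrier G"
 shows "h \<in> N #> g \<longleftrightarrow> h \<otimes> inv g \<in> N"
proof
 assume "h \<in> N #> g"
 then obtain n where "n \<in> N" "h = n \<otimes> g" by (auto simp: r_coset_def)
 moreover have "n \<in> carrier G" using assms(1) \<open>n \<in> N\<close> by (rule subgroup.mem_carrier)
 ultimately show "h \<otimes> inv g \<in> N" using assms by (simp add: m_assoc)
next
 assume a: "h \<otimes> inv g \<in> N"
 have "h = (h \<otimes> inv g) \<otimes> g" using assms by (simp add: m_assoc)
 with a show "h \<in> N #> g" unfolding r_coset_def by blast
qed

text \<open>The source of the finite quotients used below: congruence actions, levels of a rooted
  tree, cosets of powers of \<open>M\<close>, permutation representations. Two elements are in the
  same coset of the kernel iff they induce the same self-map of \<open>Y\<close>, and a finite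
  \<open>Y\<close> has finitely many self-maps.\<close>

lemma (in group) finite_index_normal_action_kernel:
 assumes fin: "finite Y"
  and cl: "\<And>g y. g \<in> carrier G \<Longrightarrow> y \<in> Y \<Longrightarrow> act g y \<in> Y"
  and one: "\<And>y. y \<in> Y \<Longrightarrow> act \<one> y = y"
  and mult: "\<And>g h y. g \<in> carrier G \<Longrightarrow> h \<in> carrier G \<Longrightarrow> y \<in> Y \<Longrightarrow> act (g \<otimes> h) y = act g (act h y)"
 shows "finite_index_normal {g \<in> carrier G. \<forall>y\<in>Y. act g y = y} G"
proof -
 let ?N = "{g \<in> carrier G. \<forall>y\<in>Y. act g y = y}"
 have inv: "act (inv g) (act g y) = y" "act g (act (inv g) y) = y" if "g \<in> carrier G" "y \<in> Y" for g y
  using that mult[of "inv g" g y] mult[of g "inv g" y] one by auto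
 have sub: "subgroup ?N G"
 proof (rule subgroupI)
  show "inv g \<in> ?N" if "g \<in> ?N" for g
  proof -
   have "act (inv g) y = y" if "y \<in> Y" for y using inv(1)[of g y] that \<open>g \<in> ?N\<close> by simp
   then show ?thesis using that by simp
  qed
 qed (use one mult in auto)
 have "?N \<lhd> G"
 proof (rule normalI_conj[OF sub])
  show "g \<otimes> n \<otimes> inv g \<in> ?N" if "g \<in> carrier G" "n \<in> ?N" for g n
   using that inv mult cl by auto
 qed
 moreover have "finite (rcosets ?N)"
 proof (rule finite_subset)
  show "rcosets ?N \<subseteq> (\<lambda>f. {h \<in> carrier G. \<forall>y\<in>Y. act h y = f y}) ` (Y \<rightarrow>\<^sub>E Y)"
  proof
   fix A assume "A \<in> rcosets ?N"
   then obtain g where g: "g \<in> carrier G" "A = ?N #> g" by (auto simp: RCOSETS_def)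
   have "h \<in> A \<longleftrightarrow> h \<in> carrier G \<and> (\<forall>y\<in>Y. act h y = act g y)" for h
   proof (cases "h \<in> carrier G")
    case True
    have "(\<forall>y\<in>Y. act (h \<otimes> inv g) y = y) \<longleftrightarrow> (\<forall>y\<in>Y. act h y = act g y)"
     using True g(1) inv[OF g(1)] mult[of h "inv g"] cl
     by (metis inv_closed)
    then show ?thesis using True g mem_rcos_iff[OF sub g(1) True] by simp
   next
    case False
    then show ?thesis using g r_coset_subset_G[of ?N g] by auto
   qed
   then have "A = {h \<in> carrier G. \<forall>y\<in>Y. act h y = (\<lambda>y\<in>Y. act g y) y}" by auto
   moreover have "(\<lambda>y\<in>Y. act g y) \<in> Y \<rightarrow>\<^sub>E Y" using cl g by auto
   ultimately show "A \<in> (\<lambda>f. {h \<in> carrier G. \<forall>y\<in>Y. act h y = f y}) ` (Y \<rightarrow>\<^sub>E Y)" by blast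
  qed
  show "finite ((\<lambda>f. {h \<in> carrier G. \<forall>y\<in>Y. act h y = f y}) ` (Y \<rightarrow>\<^sub>E Y))"
   using fin by (simp add: finite_PiE)
 qed
 ultimately show ?thesis by (simp add: finite_index_normal_def FactGroup_def)
qed

lemma (in group) finite_index_normal_carrier: "finite_index_normal (carrier G) G"
 using finite_index_normal_action_kernel[of "{} :: unit set" "\<lambda>g y. y"] by simp

lemma (in group) finite_index_normal_Int:
 assumes "finite_index_normal N G" "finite_index_normal N' G"
 shows "finite_index_normal (N \<inter> N') G"
proof -
 have N: "N \<lhd> G" "N' \<lhd> G" "finite (rcosets N)" "finite (rcosets N')"
  using assms by (auto simp: finite_index_normal_def FactGroup_def)
 have s: "subgroup N G" "subgroup N' G" using N by (auto simp: normal_imp_subgroup)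
 have si: "subgroup (N \<inter> N') G" using s by (rule subgroups_Inter_pair)
 have nor: "(N \<inter> N') \<lhd> G"
  using si N by (intro normalI_conj) (auto simp: normal.inv_op_closed2)
 have "rcosets (N \<inter> N') \<subseteq> (\<lambda>(A, B). A \<inter> B) ` ((rcosets N) \<times> (rcosets N'))"
 proof
  fix A assume "A \<in> rcosets (N \<inter> N')"
  then obtain g where g: "g \<in> carrier G" "A = (N \<inter> N') #> g" by (auto simp: RCOSETS_def)
  have "h \<in> A \<longleftrightarrow> h \<in> (N #> g) \<inter> (N' #> g)" for h
  proof (cases "h \<in> carrier G")
   case True
   then show ?thesis using g mem_rcos_iff[OF si g(1)] mem_rcos_iff[OF s(1) g(1)] mem_rcos_iff[OF s(2) g(1)] by auto
  next
   case False
   then show ?thesis using g r_coset_subset_G[of _ g] s by (meson IntE subgroup.subset subsetD si)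
  qed
  then have "A = (N #> g) \<inter> (N' #> g)" by blast
  moreover have "N #> g \<in> rcosets N" "N' #> g \<in> rcosets N'" using g(1) by (auto simp: RCOSETS_def)
  ultimately show "A \<in> (\<lambda>(A, B). A \<inter> B) ` ((rcosets N) \<times> (rcosets N'))" by force
 qed
 then have "finite (rcosets (N \<inter> N'))" using N(3,4) by (meson finite_SigmaI finite_imageI finite_subset)
 with nor show ?thesis by (simp add: finite_index_normal_def FactGroup_def)
qed

text \<open>The carrier is intersected in because the intersection of the empty family would be the
  whole type.\<close>

lemma (in group) finite_index_normal_INT:
 assumes "finite I" "\<And>i. i \<in> I \<Longrightarrow> finite_index_normal (N i) G"
 shows "finite_index_normal (carrier G \<inter> (\<Inter>i\<in>I. N i)) G"
 using assms
proof (induction I rule: finite_induct)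
 case empty
 then show ?case by (simp add: finite_index_normal_carrier)
next
 case (insert i I)
 have "carrier G \<inter> (\<Inter>j\<in>insert i I. N j) = N i \<inter> (carrier G \<inter> (\<Inter>j\<in>I. N j))" by auto
 then show ?case using finite_index_normal_Int[of "N i"] insert by simp
qed

lemma (in group) finite_index_normal_pow:
 assumes "finite_index_normal N G"
 obtains d :: nat where "d > 0" "\<And>g. g \<in> carrier G \<Longrightarrow> g [^] d \<in> N"
proof
 have n: "N \<lhd> G" "finite (carrier (G Mod N))" using assms by (auto simp: finite_index_normal_def)
 interpret Q: group "G Mod N" using n(1) by (rule normal.factorgroup_is_group)
 show "order (G Mod N) > 0" using n(2) Q.order_gt_0_iff_finite by simp
 fix g assume g: "g \<in> carrier G"
 interpret h: group_hom G "G Mod N" "\<lambda>a. N #> a"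
  using normal.r_coset_hom_Mod[OF n(1)] by unfold_locales
 have "N #> (g [^] order (G Mod N)) = (N #> g) [^]\<^bsub>G Mod N\<^esub> order (G Mod N)"
  using g by (simp add: h.hom_nat_pow)
 also have "\<dots> = \<one>\<^bsub>G Mod N\<^esub>" using g by (intro Q.pow_order_eq_1) simp
 finally have "N #> (g [^] order (G Mod N)) = N" by (simp add: FactGroup_def)
 then show "g [^] order (G Mod N) \<in> N"
  using g rcos_self[OF _ normal_imp_subgroup[OF n(1)]] by (metis nat_pow_closed)
qed

section \<open>Presented groups\<close>

definition word_val :: "('k, 'm) monoid_scheme \<Rightarrow> ('x \<Rightarrow> 'k) \<Rightarrow> 'x word \<Rightarrow> 'k" where
 "word_val K f w = foldr (\<lambda>(x, b) y. (if b then f x else inv\<^bsub>K\<^esub> f x) \<otimes>\<^bsub>K\<^esub> y) w \<one>\<^bsub>K\<^esub>"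

lemma word_val_simps [simp]:
 "word_val K f [] = \<one>\<^bsub>K\<^esub>"
 "word_val K f ((x, b) # w) = (if b then f x else inv\<^bsub>K\<^esub> f x) \<otimes>\<^bsub>K\<^esub> word_val K f w"
 by (simp_all add: word_val_def)

lemma words_simps [simp]:
 "[] \<in> words S" "(x, b) # w \<in> words S \<longleftrightarrow> x \<in> S \<and> w \<in> words S"
 "u @ v \<in> words S \<longleftrightarrow> u \<in> words S \<and> v \<in> words S"
 by (auto simp: words_def)

context group
begin

lemma word_val_closed [simp]: "f \<in> S \<rightarrow> carrier G \<Longrightarrow> w \<in> words S \<Longrightarrow> word_val G f w \<in> carrier G"
 by (induction w) (auto simp: Pi_iff)

lemma word_val_append:
 "f \<in> S \<rightarrow> carrier G \<Longrightarrow> u \<in> words S \<Longrightarrow> v \<in> words S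
  \<Longrightarrow> word_val G f (u @ v) = word_val G f u \<otimes> word_val G f v"
proof (induction u)
 case (Cons a u)
 obtain x b where a: "a = (x, b)" by (cases a)
 have "word_val G f u \<in> carrier G" "word_val G f v \<in> carrier G" "f x \<in> carrier G"
  using Cons.prems a word_val_closed[of f S] by auto
 then show ?case using Cons a by (simp add: m_assoc)
qed simp

lemma word_val_word_eq:
 assumes f: "f \<in> S \<rightarrow> carrier G"
  and rel: "\<And>u v. (u, v) \<in> R \<Longrightarrow> u \<in> words S \<Longrightarrow> v \<in> words S \<Longrightarrow> word_val G f u = word_val G f v"
 shows "(u, v) \<in> word_eq S R \<Longrightarrow> word_val G f u = word_val G f v"
proof (induction rule: word_eq.induct)
 case (append u u' v v')
 then show ?case using word_eq_words word_val_append[OF f] by (metis (no_types, opaque_lifting))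
next
 case (cancel x b)
 then have "f x \<in> carrier G" using f by auto
 then show ?case by (cases b) auto
qed (use rel in auto)

end

definition presented_gen :: "'x set \<Rightarrow> ('x word \<times> 'x word) set \<Rightarrow> 'x \<Rightarrow> 'x word set" where
 "presented_gen S R x = word_eq S R `` {[(x, True)]}"

lemma presented_carrier_iff: "A \<in> carrier (presented_group S R) \<longleftrightarrow> (\<exists>w\<in>words S. A = word_eq S R `` {w})"
 by (auto simp: presented_group_def quotient_def)

lemma presented_gen_closed [simp]: "x \<in> S \<Longrightarrow> presented_gen S R x \<in> carrier (presented_group S R)"
 by (force simp: presented_carrier_iff presented_gen_def)

lemma presented_one: "\<one>\<^bsub>presented_group S R\<^esub> = word_eq S R `` {[]}"
 by (simp add: presented_group_def)

lemma presented_gen_inv: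
 assumes "x \<in> S"
 shows "inv\<^bsub>presented_group S R\<^esub> presented_gen S R x = word_eq S R `` {[(x, False)]}"
proof -
 interpret group "presented_group S R" by (rule group_presented_group)
 have "word_eq S R `` {[(x, False)]} \<otimes>\<^bsub>presented_group S R\<^esub> presented_gen S R x = \<one>\<^bsub>presented_group S R\<^esub>"
  using assms word_eq.cancel[of x S False R]
  by (simp add: presented_gen_def presented_group_mult presented_one equiv_class_eq[OF equiv_word_eq])
 moreover have "word_eq S R `` {[(x, False)]} \<in> carrier (presented_group S R)"
  using assms by (force simp: presented_carrier_iff)
 ultimately show ?thesis using assms by (intro inv_equality) auto
qed

lemma presented_class_eq_word_val:
 assumes "w \<in> words S"
 shows "word_eq S R `` {w} = word_val (presented_group S R) (presented_gen S R) w"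
 using assms
proof (induction w)
 case Nil
 then show ?case by (simp add: presented_one)
next
 case (Cons a w)
 obtain x b where a: "a = (x, b)" by (cases a)
 have "word_eq S R `` {[(x, b)] @ w} = word_eq S R `` {[(x, b)]} \<otimes>\<^bsub>presented_group S R\<^esub> word_eq S R `` {w}"
  using Cons.prems a by (subst presented_group_mult) auto
 then show ?case using Cons a presented_gen_inv[of x S R] by (auto simp: presented_gen_def)
qed

lemma presented_rel:
 assumes "(u, v) \<in> R" "u \<in> words S" "v \<in> words S"
 shows "word_val (presented_group S R) (presented_gen S R) u = word_val (presented_group S R) (presented_gen S R) v"
 using assms word_eq.rel[OF assms] equiv_class_eq[OF equiv_word_eq]
 by (metis presented_class_eq_word_val)

lemma presented_induct [consumes 1, case_names one gen inv]:
 assumes "A \<in> carrier (presented_group S R)"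
  and "P \<one>\<^bsub>presented_group S R\<^esub>"
  and "\<And>x A. x \<in> S \<Longrightarrow> A \<in> carrier (presented_group S R) \<Longrightarrow> P A
   \<Longrightarrow> P (presented_gen S R x \<otimes>\<^bsub>presented_group S R\<^esub> A)"
  and "\<And>x A. x \<in> S \<Longrightarrow> A \<in> carrier (presented_group S R) \<Longrightarrow> P A
   \<Longrightarrow> P (inv\<^bsub>presented_group S R\<^esub> presented_gen S R x \<otimes>\<^bsub>presented_group S R\<^esub> A)"
 shows "P A"
proof -
 interpret group "presented_group S R" by (rule group_presented_group)
 have "P (word_val (presented_group S R) (presented_gen S R) w)" if "w \<in> words S" for w
  using that
 proof (induction w)
  case Nil
  then show ?case using assms(2) by simp
 next
  case (Cons a w)
  then show ?case
   using assms(3,4) word_val_closed[of "presented_gen S R" S w] by (cases a) auto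
 qed
 then show ?thesis using assms(1) by (auto simp: presented_carrier_iff presented_class_eq_word_val)
qed

text \<open>Von Dyck's theorem. The value on a class is computed on a chosen representative, and
  \<open>word_val_word_eq\<close> makes the choice irrelevant.\<close>

lemma presented_group_hom:
 assumes K: "group K" and f: "f \<in> S \<rightarrow> carrier K"
  and rel: "\<And>u v. (u, v) \<in> R \<Longrightarrow> u \<in> words S \<Longrightarrow> v \<in> words S \<Longrightarrow> word_val K f u = word_val K f v"
 obtains h where "h \<in> hom (presented_group S R) K" "\<And>x. x \<in> S \<Longrightarrow> h (presented_gen S R x) = f x"
proof -
 interpret K: group K by fact
 define h where "h A = word_val K f (SOME w. w \<in> A)" for A
 have h: "h (word_eq S R `` {w}) = word_val K f w" if "w \<in> words S" for w
 proof -
  have "(w, SOME v. v \<in> word_eq S R `` {w}) \<in> word_eq S R"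
   using someI[of "\<lambda>v. v \<in> word_eq S R `` {w}" w] that by (auto intro: word_eq.refl)
  then show ?thesis using K.word_val_word_eq[OF f rel] unfolding h_def by metis
 qed
 show thesis
 proof (rule that)
  show "h \<in> hom (presented_group S R) K"
   using h K.word_val_closed[OF f] K.word_val_append[OF f]
   by (auto simp: hom_def presented_carrier_iff presented_group_mult)
  show "h (presented_gen S R x) = f x" if "x \<in> S" for x
  proof -
   have "f x \<in> carrier K" using f that by auto
   then show ?thesis using h[of "[(x, True)]"] that by (simp add: presented_gen_def)
  qed
 qed
qed

section \<open>Cocycles and wreath products\<close>

text \<open>Maps from \<open>S\<close> to \<open>K\<close>, extended by \<open>S\<close> acting on
  itself by left translation. The multiplication is arranged so that a homomorphism into this group
  is exactly an action on \<open>S\<close> by translations together with a left cocycle; cocycles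
  with prescribed values on generators thus come from von Dyck's theorem.\<close>

definition wreath_group :: "('s, 'm) monoid_scheme \<Rightarrow> ('k, 'n) monoid_scheme \<Rightarrow> (('s \<Rightarrow> 'k) \<times> 's) monoid" where
 "wreath_group S K =
  \<lparr>carrier = (carrier S \<rightarrow>\<^sub>E carrier K) \<times> carrier S,
   monoid.mult = (\<lambda>(f, s) (f', s'). (\<lambda>p\<in>carrier S. f (s' \<otimes>\<^bsub>S\<^esub> p) \<otimes>\<^bsub>K\<^esub> f' p, s \<otimes>\<^bsub>S\<^esub> s')),
   one = (\<lambda>p\<in>carrier S. \<one>\<^bsub>K\<^esub>, \<one>\<^bsub>S\<^esub>)\<rparr>"

lemma group_wreath_group:
 assumes "group S" "group K"
 shows "group (wreath_group S K)"
proof -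
 interpret S: group S by fact
 interpret K: group K by fact
 have cl: "f p \<in> carrier K" if "f \<in> carrier S \<rightarrow>\<^sub>E carrier K" "p \<in> carrier S" for f p
  using that by auto
 show ?thesis
 proof (rule groupI)
  fix x assume "x \<in> carrier (wreath_group S K)"
  then obtain f s where x: "x = (f, s)" "f \<in> carrier S \<rightarrow>\<^sub>E carrier K" "s \<in> carrier S"
   by (auto simp: wreath_group_def)
  show "\<exists>y\<in>carrier (wreath_group S K). y \<otimes>\<^bsub>wreath_group S K\<^esub> x = \<one>\<^bsub>wreath_group S K\<^esub>"
  proof
   show "(\<lambda>p\<in>carrier S. inv\<^bsub>K\<^esub> f (inv\<^bsub>S\<^esub> s \<otimes>\<^bsub>S\<^esub> p), inv\<^bsub>S\<^esub> s) \<in> carrier (wreath_group S K)"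
    using x cl by (auto simp: wreath_group_def)
   show "(\<lambda>p\<in>carrier S. inv\<^bsub>K\<^esub> f (inv\<^bsub>S\<^esub> s \<otimes>\<^bsub>S\<^esub> p), inv\<^bsub>S\<^esub> s) \<otimes>\<^bsub>wreath_group S K\<^esub> x
     = \<one>\<^bsub>wreath_group S K\<^esub>"
    using x cl by (auto simp: wreath_group_def S.m_assoc[symmetric] intro!: restrict_ext)
  qed
  have "(\<lambda>p\<in>carrier S. \<one>\<^bsub>K\<^esub> \<otimes>\<^bsub>K\<^esub> f p) = f"
   using x(2) cl by (intro extensionalityI[of _ "carrier S"]) (auto simp: PiE_iff)
  moreover have "(\<lambda>p\<in>carrier S. (\<lambda>p\<in>carrier S. \<one>\<^bsub>K\<^esub>) (s \<otimes>\<^bsub>S\<^esub> p) \<otimes>\<^bsub>K\<^esub> f p) = (\<lambda>p\<in>carrier S. \<one>\<^bsub>K\<^esub> \<otimes>\<^bsub>K\<^esub> f p)"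
   using x(3) by (intro restrict_ext) simp
  ultimately show "\<one>\<^bsub>wreath_group S K\<^esub> \<otimes>\<^bsub>wreath_group S K\<^esub> x = x"
   using x by (simp add: wreath_group_def)
 next
  fix x y z
  assume "x \<in> carrier (wreath_group S K)" "y \<in> carrier (wreath_group S K)" "z \<in> carrier (wreath_group S K)"
  then obtain f s g t h u where xyz: "x = (f, s)" "y = (g, t)" "z = (h, u)"
    "f \<in> carrier S \<rightarrow>\<^sub>E carrier K" "g \<in> carrier S \<rightarrow>\<^sub>E carrier K" "h \<in> carrier S \<rightarrow>\<^sub>E carrier K"
    "s \<in> carrier S" "t \<in> carrier S" "u \<in> carrier S"
   by (auto simp: wreath_group_def)
  have "f (t \<otimes>\<^bsub>S\<^esub> (u \<otimes>\<^bsub>S\<^esub> p)) \<otimes>\<^bsub>K\<^esub> g (u \<otimes>\<^bsub>S\<^esub> p) \<otimes>\<^bsub>K\<^esub> h p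
    = f (t \<otimes>\<^bsub>S\<^esub> u \<otimes>\<^bsub>S\<^esub> p) \<otimes>\<^bsub>K\<^esub> (g (u \<otimes>\<^bsub>S\<^esub> p) \<otimes>\<^bsub>K\<^esub> h p)" if "p \<in> carrier S" for p
   using xyz(4-9) that by (simp add: cl S.m_assoc K.m_assoc)
  then show "x \<otimes>\<^bsub>wreath_group S K\<^esub> y \<otimes>\<^bsub>wreath_group S K\<^esub> z = x \<otimes>\<^bsub>wreath_group S K\<^esub> (y \<otimes>\<^bsub>wreath_group S K\<^esub> z)"
   using xyz(7-9) by (auto simp: xyz(1-3) wreath_group_def S.m_assoc intro!: restrict_ext)
 next
  fix x y
  assume "x \<in> carrier (wreath_group S K)" "y \<in> carrier (wreath_group S K)"
  then show "x \<otimes>\<^bsub>wreath_group S K\<^esub> y \<in> carrier (wreath_group S K)"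
   using cl by (auto simp: wreath_group_def)
 qed (auto simp: wreath_group_def)
qed

text \<open>A left cocycle: the label of \<open>g\<close> read at the position \<open>p\<close>.\<close>

definition cocycle ::
 "('a, 'b) monoid_scheme \<Rightarrow> ('q set) \<Rightarrow> ('k, 'm) monoid_scheme \<Rightarrow> ('a \<Rightarrow> 'q \<Rightarrow> 'q) \<Rightarrow> ('a \<Rightarrow> 'q \<Rightarrow> 'k) \<Rightarrow> bool" where
 "cocycle G Q K act l \<longleftrightarrow>
  (\<forall>g\<in>carrier G. \<forall>q\<in>Q. act g q \<in> Q \<and> l g q \<in> carrier K) \<and>
  (\<forall>q\<in>Q. act \<one>\<^bsub>G\<^esub> q = q) \<and>
  (\<forall>g\<in>carrier G. \<forall>h\<in>carrier G. \<forall>q\<in>Q. act (g \<otimes>\<^bsub>G\<^esub> h) q = act g (act h q) \<and>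
   l (g \<otimes>\<^bsub>G\<^esub> h) q = l g (act h q) \<otimes>\<^bsub>K\<^esub> l h q)"

lemma cocycleI:
 assumes "\<And>g q. g \<in> carrier G \<Longrightarrow> q \<in> Q \<Longrightarrow> act g q \<in> Q"
  and "\<And>g q. g \<in> carrier G \<Longrightarrow> q \<in> Q \<Longrightarrow> l g q \<in> carrier K"
  and "\<And>q. q \<in> Q \<Longrightarrow> act \<one>\<^bsub>G\<^esub> q = q"
  and "\<And>g h q. g \<in> carrier G \<Longrightarrow> h \<in> carrier G \<Longrightarrow> q \<in> Q \<Longrightarrow> act (g \<otimes>\<^bsub>G\<^esub> h) q = act g (act h q)"
  and "\<And>g h q. g \<in> carrier G \<Longrightarrow> h \<in> carrier G \<Longrightarrow> q \<in> Q \<Longrightarrow> l (g \<otimes>\<^bsub>G\<^esub> h) q = l g (act h q) \<otimes>\<^bsub>K\<^esub> l h q"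
 shows "cocycle G Q K act l"
 using assms by (simp add: cocycle_def)

lemma cocycleD:
 assumes "cocycle G Q K act l" "q \<in> Q"
 shows "g \<in> carrier G \<Longrightarrow> act g q \<in> Q" "g \<in> carrier G \<Longrightarrow> l g q \<in> carrier K" "act \<one>\<^bsub>G\<^esub> q = q"
  "g \<in> carrier G \<Longrightarrow> h \<in> carrier G \<Longrightarrow> act (g \<otimes>\<^bsub>G\<^esub> h) q = act g (act h q)"
  "g \<in> carrier G \<Longrightarrow> h \<in> carrier G \<Longrightarrow> l (g \<otimes>\<^bsub>G\<^esub> h) q = l g (act h q) \<otimes>\<^bsub>K\<^esub> l h q"
 using assms by (simp_all add: cocycle_def)

lemma cocycle_one:
 assumes c: "cocycle G Q K act l" "q \<in> Q" and K: "group K" and G: "group G"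
 shows "l \<one>\<^bsub>G\<^esub> q = \<one>\<^bsub>K\<^esub>"
proof -
 interpret G: group G by fact
 interpret K: group K by fact
 note c' = cocycleD[OF c]
 have "l \<one>\<^bsub>G\<^esub> q = l \<one>\<^bsub>G\<^esub> q \<otimes>\<^bsub>K\<^esub> l \<one>\<^bsub>G\<^esub> q" using c'(5)[of "\<one>\<^bsub>G\<^esub>" "\<one>\<^bsub>G\<^esub>"] c'(3) by simp
 then show ?thesis using c'(2)[of "\<one>\<^bsub>G\<^esub>"] by (simp add: K.l_cancel_one')
qed

lemma cocycle_inv:
 assumes c: "cocycle G Q K act l" "q \<in> Q" and K: "group K" and G: "group G" and g: "g \<in> carrier G"
 shows "l (inv\<^bsub>G\<^esub> g) q = inv\<^bsub>K\<^esub> l g (act (inv\<^bsub>G\<^esub> g) q)" "act g (act (inv\<^bsub>G\<^esub> g) q) = q"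
  "act (inv\<^bsub>G\<^esub> g) (act g q) = q"
proof -
 interpret G: group G by fact
 interpret K: group K by fact
 note c' = cocycleD[OF c]
 show 1: "act g (act (inv\<^bsub>G\<^esub> g) q) = q" using c'(4)[of g "inv\<^bsub>G\<^esub> g"] c'(3) g by simp
 show "act (inv\<^bsub>G\<^esub> g) (act g q) = q" using c'(4)[of "inv\<^bsub>G\<^esub> g" g] c'(3) g by simp
 have "\<one>\<^bsub>K\<^esub> = l g (act (inv\<^bsub>G\<^esub> g) q) \<otimes>\<^bsub>K\<^esub> l (inv\<^bsub>G\<^esub> g) q"
  using c'(5)[of g "inv\<^bsub>G\<^esub> g"] cocycle_one[OF c K G] g by simp
 then show "l (inv\<^bsub>G\<^esub> g) q = inv\<^bsub>K\<^esub> l g (act (inv\<^bsub>G\<^esub> g) q)"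
  using c' cocycleD[OF c(1), of "act (inv\<^bsub>G\<^esub> g) q"] g by (metis G.inv_closed K.inv_comm K.inv_equality)
qed

lemma cocycle_wreath_hom:
 assumes h: "h \<in> hom G (wreath_group S K)" and G: "group G" and S: "group S" and K: "group K"
 shows "cocycle G (carrier S) K (\<lambda>g p. snd (h g) \<otimes>\<^bsub>S\<^esub> p) (\<lambda>g. fst (h g))"
proof -
 interpret group_hom G "wreath_group S K" h
  using h G group_wreath_group[OF S K] by (simp add: group_hom_def group_hom_axioms_def)
 interpret S: group S by fact
 have c: "fst (h g) \<in> carrier S \<rightarrow>\<^sub>E carrier K" "snd (h g) \<in> carrier S" if "g \<in> carrier G" for g
  using hom_closed[OF that] by (auto simp: wreath_group_def)
 show ?thesis
  using c by (intro cocycleI) (auto simp: wreath_group_def S.m_assoc case_prod_beta)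
qed

section \<open>Spanning trees\<close>

section \<open>Trees grown by adding pendant arcs\<close>

text \<open>A tree with vertices \<open>W\<close> and arcs \<open>B\<close>, rooted at
  \<open>r\<close>, inside the arcs \<open>A\<close>. Only the end maps enter, so the notion serves
  both for \<open>X\<close> and for its finite cover. Each new arc has exactly one new end, which
  makes maps on the tree definable by recursion.\<close>

inductive grown :: "('e \<Rightarrow> 'v) \<Rightarrow> ('e \<Rightarrow> 'v) \<Rightarrow> 'e set \<Rightarrow> 'v \<Rightarrow> 'v set \<Rightarrow> 'e set \<Rightarrow> bool"
 for ta he A r where
 root: "grown ta he A r {r} {}"
| out: "grown ta he A r W B \<Longrightarrow> e \<in> A \<Longrightarrow> ta e \<in> W \<Longrightarrow> he e \<notin> W \<Longrightarrow> grown ta he A r (insert (he e) W) (insert e B)"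
| inn: "grown ta he A r W B \<Longrightarrow> e \<in> A \<Longrightarrow> he e \<in> W \<Longrightarrow> ta e \<notin> W \<Longrightarrow> grown ta he A r (insert (ta e) W) (insert e B)"

lemma grown_basic:
 "grown ta he A r W B \<Longrightarrow> finite B \<and> B \<subseteq> A \<and> r \<in> W \<and> ta ` B \<subseteq> W \<and> he ` B \<subseteq> W \<and> W \<subseteq> insert r (ta ` B \<union> he ` B)"
 by (induction rule: grown.induct) auto

text \<open>Take a grown tree with the most arcs: an arc with exactly one end in \<open>W\<close>
  could be added. The result is a spanning tree of the component of \<open>r\<close>.\<close>

lemma grown_maximal:
 assumes "finite A"
 obtains W B where "grown ta he A r W B" "\<And>e. e \<in> A \<Longrightarrow> ta e \<in> W \<longleftrightarrow> he e \<in> W"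
proof -
 let ?P = "\<lambda>(W, B). grown ta he A r W B"
 have "?P ({r}, {})" by (simp add: grown.root)
 moreover have "\<forall>y. ?P y \<longrightarrow> card (snd y) < Suc (card A)"
  using assms grown_basic by (fastforce simp: less_Suc_eq_le intro: card_mono)
 ultimately obtain WB where WB: "?P WB" "\<forall>y. ?P y \<longrightarrow> card (snd y) \<le> card (snd WB)"
  using ex_has_greatest_nat[of ?P _ "\<lambda>y. card (snd y)" "Suc (card A)"] by blast
 obtain W B where wb: "WB = (W, B)" by (cases WB)
 have g: "grown ta he A r W B" using WB wb by simp
 note b = grown_basic[OF g]
 have "ta e \<in> W \<longleftrightarrow> he e \<in> W" if e: "e \<in> A" for e
 proof (rule ccontr)
  assume ne: "\<not> (ta e \<in> W \<longleftrightarrow> he e \<in> W)"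
  then have "e \<notin> B" using b by auto
  then have c: "card (insert e B) = Suc (card B)" using b by simp
  obtain W' where "grown ta he A r W' (insert e B)"
   using ne grown.out[OF g e] grown.inn[OF g e] by blast
  then have "card (insert e B) \<le> card B" using WB(2) wb by auto
  with c show False by simp
 qed
 with g show thesis by (rule that)
qed

lemma grown_propagate:
 assumes "grown ta he A r W B" "P r" "\<And>e. e \<in> B \<Longrightarrow> P (ta e) \<longleftrightarrow> P (he e)"
 shows "v \<in> W \<Longrightarrow> P v"
 using assms by (induction arbitrary: v rule: grown.induct) auto

text \<open>The equation of a new arc determines the value at its new end, which occurs in no
  earlier equation. Applied to stable letters this gives the tree paths \<open>\<gamma>\<close>;
  applied to matrix labels it gives a gauge that trivialises the labels of the tree.\<close>

lemma grown_potential: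
 assumes K: "group K" and g: "grown ta he A r W B" and k: "k \<in> A \<rightarrow> carrier K"
 obtains \<gamma> where "\<gamma> r = \<one>\<^bsub>K\<^esub>" "\<And>v. v \<in> W \<Longrightarrow> \<gamma> v \<in> carrier K"
  "\<And>e. e \<in> B \<Longrightarrow> \<gamma> (he e) \<otimes>\<^bsub>K\<^esub> k e = \<gamma> (ta e)"
proof -
 interpret K: group K by fact
 have "\<exists>\<gamma>. \<gamma> r = \<one>\<^bsub>K\<^esub> \<and> (\<forall>v\<in>W. \<gamma> v \<in> carrier K) \<and> (\<forall>e\<in>B. \<gamma> (he e) \<otimes>\<^bsub>K\<^esub> k e = \<gamma> (ta e))"
  using g
 proof (induction rule: grown.induct)
  case root
  show ?case by (rule exI[of _ "\<lambda>_. \<one>\<^bsub>K\<^esub>"]) simp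
 next
  case (out W B e)
  then obtain \<gamma> where \<gamma>: "\<gamma> r = \<one>\<^bsub>K\<^esub>" "\<forall>v\<in>W. \<gamma> v \<in> carrier K" "\<forall>e\<in>B. \<gamma> (he e) \<otimes>\<^bsub>K\<^esub> k e = \<gamma> (ta e)" by blast
  have b: "r \<in> W" "\<And>f. f \<in> B \<Longrightarrow> ta f \<in> W" "\<And>f. f \<in> B \<Longrightarrow> he f \<in> W" using grown_basic[OF out(1)] by auto
  have ke: "k e \<in> carrier K" using k out by auto
  have ne: "ta f \<noteq> he e" "he f \<noteq> he e" if "f \<in> B" for f using that b out by metis+
  have "\<gamma> (ta e) \<in> carrier K" using \<gamma> out by auto
  then have "(\<gamma>(he e := \<gamma> (ta e) \<otimes>\<^bsub>K\<^esub> inv\<^bsub>K\<^esub> (k e))) (he e) \<otimes>\<^bsub>K\<^esub> k e = \<gamma> (ta e)" using ke by (simp add: K.m_assoc)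
  moreover have "ta e \<noteq> he e" "r \<noteq> he e" using out b by auto
  ultimately show ?case using \<gamma> ke ne \<open>\<gamma> (ta e) \<in> carrier K\<close>
   by (intro exI[of _ "\<gamma>(he e := \<gamma> (ta e) \<otimes>\<^bsub>K\<^esub> inv\<^bsub>K\<^esub> (k e))"]) auto
 next
  case (inn W B e)
  then obtain \<gamma> where \<gamma>: "\<gamma> r = \<one>\<^bsub>K\<^esub>" "\<forall>v\<in>W. \<gamma> v \<in> carrier K" "\<forall>e\<in>B. \<gamma> (he e) \<otimes>\<^bsub>K\<^esub> k e = \<gamma> (ta e)" by blast
  have b: "r \<in> W" "\<And>f. f \<in> B \<Longrightarrow> ta f \<in> W" "\<And>f. f \<in> B \<Longrightarrow> he f \<in> W" using grown_basic[OF inn(1)] by auto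
  have ke: "k e \<in> carrier K" using k inn by auto
  have ne: "ta f \<noteq> ta e" "he f \<noteq> ta e" if "f \<in> B" for f using that b inn by metis+
  have "\<gamma> (he e) \<in> carrier K" using \<gamma> inn by auto
  moreover have "he e \<noteq> ta e" "r \<noteq> ta e" using inn b by auto
  ultimately show ?case using \<gamma> ke ne
   by (intro exI[of _ "\<gamma>(ta e := \<gamma> (he e) \<otimes>\<^bsub>K\<^esub> k e)"]) auto
 qed
 then show thesis using that by blast
qed

subsection \<open>Maximal subtrees\<close>

lemma connected_no_crossing:
 assumes wf: "wf_digraph X" and con: "Digraph_Component.connected X"
  and r: "r \<in> W" "r \<in> verts X" and nc: "\<And>e. e \<in> arcs X \<Longrightarrow> tail X e \<in> W \<longleftrightarrow> head X e \<in> W"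
 shows "verts X \<subseteq> W"
proof
 fix v assume "v \<in> verts X"
 then have "reachable (with_proj (mk_symmetric X)) r v"
  using con r by (auto simp: connected_def strongly_connected_def mk_symmetric_def)
 then have "(r, v) \<in> rtrancl_on (pverts (mk_symmetric X)) (parcs (mk_symmetric X))"
  by (simp add: reachable_def)
 then show "v \<in> W"
 proof (induction rule: rtrancl_on_induct)
  case base
  then show ?case using r by simp
 next
  case (step y z)
  then show ?case using nc by (auto simp: mk_symmetric_def)
 qed
qed

lemma grown_connected:
 assumes wf: "wf_digraph X" and g: "grown (tail X) (head X) (arcs X) r (verts X) B"
 shows "Digraph_Component.connected X"
proof -
 let ?R = "\<lambda>u v. reachable (with_proj (mk_symmetric X)) u v"
 interpret S: wf_digraph "with_proj (mk_symmetric X)"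
  using wf by unfold_locales (auto simp: mk_symmetric_def wf_digraph_def)
 have r: "r \<in> verts X" "B \<subseteq> arcs X" using grown_basic[OF g] by auto
 have "?R r v \<and> ?R v r" if "v \<in> verts X" for v
 proof (rule grown_propagate[OF g _ _ that, where P = "\<lambda>v. ?R r v \<and> ?R v r"])
  show "?R r r \<and> ?R r r" using r S.reachable_refl[of r] by (simp add: mk_symmetric_def)
  fix e assume "e \<in> B"
  then have "(tail X e, head X e) \<in> parcs (mk_symmetric X)" "(head X e, tail X e) \<in> parcs (mk_symmetric X)"
   using r by (auto simp: mk_symmetric_def)
  then have "?R (tail X e) (head X e)" "?R (head X e) (tail X e)" by simp_all
  then show "(?R r (tail X e) \<and> ?R (tail X e) r) \<longleftrightarrow> (?R r (head X e) \<and> ?R (head X e) r)"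
   by (meson S.reachable_trans)
 qed
 then have "?R u v" if "u \<in> verts X" "v \<in> verts X" for u v
  using that by (meson S.reachable_trans)
 then show ?thesis using r by (auto simp: connected_def strongly_connected_def mk_symmetric_def)
qed

lemma both_directions_simps [simp]:
 "verts (both_directions X) = verts X" "arcs (both_directions X) = arcs X \<times> UNIV"
 "tail (both_directions X) (e, b) = (if b then tail X e else head X e)"
 "head (both_directions X) (e, b) = (if b then head X e else tail X e)"
 by (simp_all add: both_directions_def)

declare pre_digraph.cas.simps [simp] pre_digraph.awalk_verts.simps [simp]

lemma both_directions_cas_append:
 "pre_digraph.cas G u (p @ q) v \<longleftrightarrow> (\<exists>w. pre_digraph.cas G u p w \<and> pre_digraph.cas G w q v)"
 by (induction p arbitrary: u) auto

lemma awalk_verts_append: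
 "pre_digraph.cas G u p w \<Longrightarrow>
  pre_digraph.awalk_verts G u (p @ q) = butlast (pre_digraph.awalk_verts G u p) @ pre_digraph.awalk_verts G w q"
proof (induction p arbitrary: u)
 case (Cons a p)
 have "pre_digraph.awalk_verts G x y \<noteq> []" for x y by (cases y) auto
 then show ?case using Cons by auto
qed simp

lemma cas_last: "pre_digraph.cas G u p w \<Longrightarrow> last (pre_digraph.awalk_verts G u p) = w \<and> pre_digraph.awalk_verts G u p \<noteq> []"
 by (induction p arbitrary: u) auto

text \<open>Distinct arcs and distinct vertices are both tracked because closing such a path by an
  arc outside \<open>B\<close> has to give a circuit.\<close>

lemma grown_path:
 assumes g: "grown (tail X) (head X) A r W B" and u: "u \<in> W" and v: "v \<in> W"
 shows "\<exists>p. pre_digraph.cas (both_directions X) u p v \<and> fst ` set p \<subseteq> B \<and> distinct (map fst p)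
  \<and> distinct (pre_digraph.awalk_verts (both_directions X) u p)
  \<and> set (pre_digraph.awalk_verts (both_directions X) u p) \<subseteq> W"
 using g u v
proof (induction arbitrary: u v rule: grown.induct)
 case root
 then show ?case by (intro exI[of _ "[]"]) auto
next
 let ?c = "pre_digraph.cas (both_directions X)" and ?w = "pre_digraph.awalk_verts (both_directions X)"
 \<comment> \<open>One argument for both growth rules: \<open>x\<close> is the end of the new arc
   that was already present and \<open>z\<close> the new one.\<close>
 have step: "\<exists>p. ?c u p v \<and> fst ` set p \<subseteq> insert e B \<and> distinct (map fst p) \<and> distinct (?w u p) \<and> set (?w u p) \<subseteq> insert z W"
  if IH: "\<And>u v. u \<in> W \<Longrightarrow> v \<in> W \<Longrightarrow> \<exists>p. ?c u p v \<and> fst ` set p \<subseteq> B \<and> distinct (map fst p) \<and> distinct (?w u p) \<and> set (?w u p) \<subseteq> W"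
   and "grown (tail X) (head X) A r W B"
   and e: "{tail X e, head X e} = {x, z}" "x \<in> W" "z \<notin> W" and uv: "u \<in> insert z W" "v \<in> insert z W"
  for W B e x z u v
 proof -
  have eB: "e \<notin> B" using grown_basic[OF that(2)] e by (auto simp: doubleton_eq_iff)
  define b where "b \<longleftrightarrow> tail X e = x"
  have b: "tail (both_directions X) (e, b) = x" "head (both_directions X) (e, b) = z"
   using e by (auto simp: doubleton_eq_iff b_def)
  have b': "tail (both_directions X) (e, \<not> b) = z" "head (both_directions X) (e, \<not> b) = x"
   using b by (auto split: if_splits)
  consider "u = z" "v = z" | "u \<in> W" "v \<in> W" | "u \<in> W" "v = z" | "u = z" "v \<in> W" using uv by blast
  then show ?thesis
  proof cases
   case 1
   then show ?thesis by (intro exI[of _ "[]"]) auto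
  next
   case 2
   from IH[OF this] obtain p where "?c u p v" "fst ` set p \<subseteq> B" "distinct (map fst p)" "distinct (?w u p)" "set (?w u p) \<subseteq> W"
    by blast
   then show ?thesis by (intro exI[of _ p]) auto
  next
   case 3
   then obtain p where p: "?c u p x" "fst ` set p \<subseteq> B" "distinct (map fst p)" "distinct (?w u p)" "set (?w u p) \<subseteq> W"
    using IH[of u x] e by blast
   have "?w u (p @ [(e, b)]) = butlast (?w u p) @ [last (?w u p)] @ [z]"
    using awalk_verts_append[OF p(1), of "[(e, b)]"] cas_last[OF p(1)] b by (simp del: both_directions_simps)
   also have "\<dots> = ?w u p @ [z]" using cas_last[OF p(1)] by (metis append.assoc append_butlast_last_id)
   finally have "?w u (p @ [(e, b)]) = ?w u p @ [z]" .
   then show ?thesis using p b e(3) eB 3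
    by (intro exI[of _ "p @ [(e, b)]"]) (auto simp: both_directions_cas_append simp del: both_directions_simps)
  next
   case 4
   then obtain p where p: "?c x p v" "fst ` set p \<subseteq> B" "distinct (map fst p)" "distinct (?w x p)" "set (?w x p) \<subseteq> W"
    using IH[of x v] e by blast
   then show ?thesis using b' e(3) eB 4
    by (intro exI[of _ "(e, \<not> b) # p"]) (auto simp del: both_directions_simps)
  qed
 qed
 { case (out W B e)
  show ?case by (rule step[OF out.IH out.hyps(1)]) (use out in auto) }
 { case (inn W B e)
  show ?case by (rule step[OF inn.IH inn.hyps(1)]) (use inn in auto) }
qed

text \<open>Sum the increments of the indicator function of \<open>z\<close> along the closed walk.
  The total telescopes to zero, while an arc away from \<open>z\<close> contributes nothing and the
  arc \<open>e\<close>, walked at most once, would contribute 1 or -1.\<close>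

lemma circuit_off_pendant:
 assumes cas: "pre_digraph.cas (both_directions X) u p u" and d: "distinct (map fst p)"
  and w: "tail X e \<noteq> head X e" "z \<in> {tail X e, head X e}"
  and others: "\<And>f. f \<in> fst ` set p \<Longrightarrow> f \<noteq> e \<Longrightarrow> tail X f \<noteq> z \<and> head X f \<noteq> z"
 shows "e \<notin> fst ` set p"
proof
 let ?G = "both_directions X"
 let ?\<chi> = "\<lambda>x. if x = z then 1 else 0 :: int"
 let ?d = "\<lambda>a. ?\<chi> (head ?G a) - ?\<chi> (tail ?G a)"
 have tel: "(\<Sum>a\<leftarrow>q. ?d a) = ?\<chi> y - ?\<chi> x" if "pre_digraph.cas ?G x q y" for x y q
  using that by (induction q arbitrary: x) auto
 assume "e \<in> fst ` set p"
 then obtain b where "(e, b) \<in> set p" by force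
 then obtain p1 p2 where p: "p = p1 @ (e, b) # p2" by (meson split_list)
 have ne: "e \<notin> fst ` set p1" "e \<notin> fst ` set p2" using d p by auto
 have z0: "(\<Sum>a\<leftarrow>q. ?d a) = 0" if "set q \<subseteq> set p" "e \<notin> fst ` set q" for q
  using that
 proof (induction q)
  case (Cons a q)
  obtain f c where a: "a = (f, c)" by (cases a)
  have "f \<in> fst ` set p" "f \<noteq> e" using Cons.prems a by (force, auto)
  then show ?case using Cons others[of f] a by auto
 qed simp
 have "(\<Sum>a\<leftarrow>p1. ?d a) = 0" "(\<Sum>a\<leftarrow>p2. ?d a) = 0" using z0[of p1] z0[of p2] ne p by auto
 then have "0 = ?d (e, b)" using tel[OF cas] unfolding p by (simp del: both_directions_simps)
 then show False using w by (auto split: if_splits)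
qed

text \<open>Connects the maximal-subgraph definition of a tree with the inductive one, which later
  arguments use. Absence of circuits shows that the grown arcs are all arcs of \<open>T\<close>;
  maximality shows that \<open>T\<close> spans.\<close>

lemma maximal_subtree_grown:
 assumes fin: "fin_digraph X" and con: "Digraph_Component.connected X" and T: "maximal_subtree X T"
 obtains r where "r \<in> verts X" "arcs T \<subseteq> arcs X" "grown (tail X) (head X) (arcs X) r (verts X) (arcs T)"
proof -
 interpret fin_digraph X by fact
 have sub: "subgraph T X" and tree: "undirected_tree T"
  and max: "\<And>H. H \<noteq> T \<Longrightarrow> subgraph T H \<Longrightarrow> subgraph H X \<Longrightarrow> \<not> undirected_tree H"
  using T by (auto simp: maximal_subtree_def max_subgraph_def)
 have s: "verts T \<subseteq> verts X" "arcs T \<subseteq> arcs X" "wf_digraph T" "tail T = tail X" "head T = head X"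
  using sub by (auto simp: subgraph_def compatible_def)
 interpret T: wf_digraph T by fact
 have conT: "Digraph_Component.connected T" and noc: "\<And>p. \<not> circuit T p"
  using tree by (auto simp: undirected_tree_def)
 obtain r where r: "r \<in> verts T" using conT by (auto simp: connected_def strongly_connected_def mk_symmetric_def)
 have "finite (arcs T)" using s finite_arcs finite_subset by blast
 then obtain W B where g: "grown (tail X) (head X) (arcs T) r W B"
   and nc: "\<And>e. e \<in> arcs T \<Longrightarrow> tail X e \<in> W \<longleftrightarrow> head X e \<in> W"
  by (rule grown_maximal[where ta = "tail X" and he = "head X" and r = r]) blast
 note b = grown_basic[OF g]
 have "tail X ` B \<subseteq> verts T" "head X ` B \<subseteq> verts T"
  using b T.tail_in_verts T.head_in_verts s(4,5) by (force, force)
 then have "W \<subseteq> verts T" using b r by blast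
 moreover have "verts T \<subseteq> W" by (rule connected_no_crossing[OF s(3) conT _ r]) (use b nc s in auto)
 ultimately have W: "W = verts T" by blast
 \<comment> \<open>An arc of \<open>T\<close> that was not grown would close the tree path between
   its ends to a circuit.\<close>
 have B: "B = arcs T"
 proof (rule ccontr)
  assume "B \<noteq> arcs T"
  then obtain f where f: "f \<in> arcs T" "f \<notin> B" using b by blast
  have "tail X f \<in> W" "head X f \<in> W" using W f T.tail_in_verts T.head_in_verts s by metis+
  then obtain p where p: "pre_digraph.cas (both_directions X) (head X f) p (tail X f)" "fst ` set p \<subseteq> B" "distinct (map fst p)"
    "distinct (pre_digraph.awalk_verts (both_directions X) (head X f) p)"
   using grown_path[OF g] by blast
  have bd: "tail (both_directions T) = tail (both_directions X)" "head (both_directions T) = head (both_directions X)"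
   by (simp_all only: both_directions_def s pre_digraph.select_convs)
  have cas: "pre_digraph.cas (both_directions T) u q v = pre_digraph.cas (both_directions X) u q v" for u q v
   by (induction q arbitrary: u) (auto simp: bd simp del: both_directions_simps)
  have av: "pre_digraph.awalk_verts (both_directions T) u q = pre_digraph.awalk_verts (both_directions X) u q" for u q
   by (induction q arbitrary: u) (auto simp: bd simp del: both_directions_simps)
  have "set p \<subseteq> arcs T \<times> UNIV" using p(2) b by fastforce
  then have "circuit T ((f, True) # p)"
   using p f \<open>tail X f \<in> W\<close> W b unfolding circuit_def pre_digraph.cycle_def pre_digraph.awalk_def
   by (auto simp: cas av s intro!: exI[of _ "tail X f"])
  with noc show False by blast
 qed
 have "verts X \<subseteq> verts T"
 proof (rule connected_no_crossing[OF _ con r])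
  show "wf_digraph X" ..
  show "r \<in> verts X" using r s by auto
  fix e assume e: "e \<in> arcs X"
  show "tail X e \<in> verts T \<longleftrightarrow> head X e \<in> verts T"
  proof (rule ccontr)
   assume ne: "\<not> ?thesis"
   then obtain z where z: "z \<in> {tail X e, head X e}" "z \<notin> verts T" by blast
   \<comment> \<open>An arc of \<open>X\<close> leaving \<open>T\<close> can be added together with
     its far end \<open>z\<close>. No circuit arises, since \<open>e\<close> is the only arc at
     \<open>z\<close>; this contradicts maximality.\<close>
   define H where "H = \<lparr>verts = insert z (verts T), arcs = insert e (arcs T), tail = tail T, head = head T\<rparr>"
   have H: "verts H = insert z (verts T)" "arcs H = insert e (arcs T)" "tail H = tail X" "head H = head X"
    by (simp_all add: H_def s)
   have other: "{tail X e, head X e} \<subseteq> insert z (verts T)" using ne z by auto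
   have wfH: "wf_digraph H" using other T.tail_in_verts T.head_in_verts s by unfold_locales (auto simp: H)
   have eT: "e \<notin> arcs T" using ne T.tail_in_verts T.head_in_verts s by metis
   have "grown (tail X) (head X) (arcs H) r (verts T) (arcs T)"
   proof -
    have "grown (tail X) (head X) (arcs H) r W B" if "grown (tail X) (head X) (arcs T) r W B" for W B
     using that by (induction rule: grown.induct) (auto intro: grown.intros simp: H)
    then show ?thesis using g W B by blast
   qed
   then have gH: "grown (tail H) (head H) (arcs H) r (verts H) (insert e (arcs T))"
    using ne z grown.out[of "tail X" "head X" "arcs H" r "verts T" "arcs T" e]
     grown.inn[of "tail X" "head X" "arcs H" r "verts T" "arcs T" e] by (auto simp: H)
   have noH: "\<not> circuit H p" for p
   proof
    assume "circuit H p"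
    then obtain u where p: "u \<in> verts H" "set p \<subseteq> arcs H \<times> UNIV" "pre_digraph.cas (both_directions H) u p u"
      "distinct (tl (pre_digraph.awalk_verts (both_directions H) u p))" "p \<noteq> []" "distinct (map fst p)"
     by (auto simp: circuit_def pre_digraph.cycle_def pre_digraph.awalk_def)
    have "e \<notin> fst ` set p"
    proof (rule circuit_off_pendant[OF p(3,6), of _ z])
     show "tail H e \<noteq> head H e" using ne by (auto simp: H)
     show "z \<in> {tail H e, head H e}" using z by (simp add: H)
     fix f assume "f \<in> fst ` set p" "f \<noteq> e"
     then have "f \<in> arcs T" using p(2) by (auto simp: H)
     then show "tail H f \<noteq> z \<and> head H f \<noteq> z"
      using z T.tail_in_verts T.head_in_verts s by (metis H(3,4))
    qed
    then have pT: "set p \<subseteq> arcs T \<times> UNIV" using p(2) by (force simp: H)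
    obtain f c p' where pc: "p = (f, c) # p'" using p(5) by (cases p) auto
    have fT: "f \<in> arcs T" using pT pc by auto
    have "u \<in> verts T" using p(3) pc fT T.tail_in_verts[OF fT] T.head_in_verts[OF fT] by (auto simp: H s split: if_splits)
    moreover have "both_directions T = both_directions H\<lparr>verts := verts T, arcs := arcs T \<times> UNIV\<rparr>"
     by (simp only: both_directions_def H s(4,5) pre_digraph.select_convs pre_digraph.update_convs)
    moreover have "pre_digraph.cas (both_directions H\<lparr>verts := V, arcs := E\<rparr>) x q y = pre_digraph.cas (both_directions H) x q y" for V E x q y
     by (induction q arbitrary: x) auto
    moreover have "pre_digraph.awalk_verts (both_directions H\<lparr>verts := V, arcs := E\<rparr>) x q = pre_digraph.awalk_verts (both_directions H) x q" for V E x q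
     by (induction q arbitrary: x) auto
    ultimately have "circuit T p" using p pT
     unfolding circuit_def pre_digraph.cycle_def pre_digraph.awalk_def by auto
    with noc show False by blast
   qed
   have "undirected_tree H" using grown_connected[OF wfH gH] noH by (auto simp: undirected_tree_def)
   moreover have "subgraph T H" using wfH s by (auto simp: subgraph_def compatible_def H)
   moreover have "subgraph H X"
    using wfH s e z by (auto simp: subgraph_def compatible_def H wf_digraph_axioms)
   moreover have "H \<noteq> T" using H eT by auto
   ultimately show False using max by blast
  qed
 qed
 then have "verts T = verts X" using s by blast
 moreover have "grown (tail X) (head X) (arcs X) r W B"
  using g by (induction rule: grown.induct) (use s in \<open>auto intro: grown.intros\<close>)
 ultimately show thesis using that[of r] r s W B by simp
qed

section \<open>The fundamental group as a group of closed paths\<close>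

section \<open>Fundamental groups of graphs of groups\<close>

context graph_of_groups
begin

abbreviation (input) "FG B \<equiv> fundamental_group X Gv Ge \<phi> B"

definition vertex_elem :: "('v, 'e) pre_digraph \<Rightarrow> 'v \<Rightarrow> 'g \<Rightarrow> ('v, 'e, 'g) generator word set" where
 "vertex_elem B v g = presented_gen (fundamental_generators X Gv) (fundamental_relations X Gv Ge \<phi> B) (Vertex_Elem v g)"

definition stable_elem :: "('v, 'e) pre_digraph \<Rightarrow> 'e \<Rightarrow> ('v, 'e, 'g) generator word set" where
 "stable_elem B e = presented_gen (fundamental_generators X Gv) (fundamental_relations X Gv Ge \<phi> B) (Stable_Letter e)"

lemma Ge_carrier [simp]: "e \<in> arcs X \<Longrightarrow> g \<in> Ge e \<Longrightarrow> g \<in> carrier (Gv (tail X e))"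
 using subgroup_Ge subgroup.mem_carrier by metis

lemma phi_carrier [simp]: "e \<in> arcs X \<Longrightarrow> g \<in> Ge e \<Longrightarrow> \<phi> e g \<in> carrier (Gv (head X e))"
 using subgroup_image subgroup.mem_carrier by (metis imageI)

lemma phi_mult:
 "e \<in> arcs X \<Longrightarrow> g \<in> Ge e \<Longrightarrow> h \<in> Ge e
  \<Longrightarrow> \<phi> e (g \<otimes>\<^bsub>Gv (tail X e)\<^esub> h) = \<phi> e g \<otimes>\<^bsub>Gv (head X e)\<^esub> \<phi> e h"
 using iso_\<phi> by (fastforce simp: iso_def hom_def)

lemma phi_inj: "e \<in> arcs X \<Longrightarrow> inj_on (\<phi> e) (Ge e)"
 using iso_\<phi> by (auto simp: iso_def bij_betw_def)

lemma group_FG: "group (FG B)"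
 by (simp add: fundamental_group_def group_presented_group)

lemma vertex_elem_closed [simp]: "v \<in> verts X \<Longrightarrow> g \<in> carrier (Gv v) \<Longrightarrow> vertex_elem B v g \<in> carrier (FG B)"
 by (auto simp: vertex_elem_def fundamental_group_def fundamental_generators_def)

lemma stable_elem_closed [simp]: "e \<in> arcs X \<Longrightarrow> stable_elem B e \<in> carrier (FG B)"
 by (auto simp: stable_elem_def fundamental_group_def fundamental_generators_def)

lemma fundamental_generators_iff [simp]:
 "Vertex_Elem v g \<in> fundamental_generators X Gv \<longleftrightarrow> v \<in> verts X \<and> g \<in> carrier (Gv v)"
 "Stable_Letter e \<in> fundamental_generators X Gv \<longleftrightarrow> e \<in> arcs X"
 by (auto simp: fundamental_generators_def)

lemma vertex_elem_mult:
 assumes "v \<in> verts X" "g \<in> carrier (Gv v)" "h \<in> carrier (Gv v)"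
 shows "vertex_elem B v (g \<otimes>\<^bsub>Gv v\<^esub> h) = vertex_elem B v g \<otimes>\<^bsub>FG B\<^esub> vertex_elem B v h"
proof -
 interpret G: group "FG B" by (rule group_FG)
 interpret V: group "Gv v" using assms by (simp add: group_Gv)
 have "([(Vertex_Elem v g, True), (Vertex_Elem v h, True)], [(Vertex_Elem v (g \<otimes>\<^bsub>Gv v\<^esub> h), True)])
   \<in> fundamental_relations X Gv Ge \<phi> B"
  using assms unfolding fundamental_relations_def by blast
 from presented_rel[OF this, of "fundamental_generators X Gv", folded fundamental_group_def] show ?thesis
  using assms by (simp add: vertex_elem_def[symmetric] V.m_closed)
qed

lemma stable_elem_rel:
 assumes "e \<in> arcs X" "g \<in> Ge e"
 shows "stable_elem B e \<otimes>\<^bsub>FG B\<^esub> vertex_elem B (tail X e) g = vertex_elem B (head X e) (\<phi> e g) \<otimes>\<^bsub>FG B\<^esub> stable_elem B e"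
proof -
 interpret G: group "FG B" by (rule group_FG)
 have c: "stable_elem B e \<in> carrier (FG B)" "vertex_elem B (tail X e) g \<in> carrier (FG B)"
   "vertex_elem B (head X e) (\<phi> e g) \<in> carrier (FG B)"
  using assms by auto
 have "([(Stable_Letter e, True), (Vertex_Elem (tail X e) g, True), (Stable_Letter e, False)],
   [(Vertex_Elem (head X e) (\<phi> e g), True)]) \<in> fundamental_relations X Gv Ge \<phi> B"
  using assms unfolding fundamental_relations_def by blast
 from presented_rel[OF this, of "fundamental_generators X Gv"]
 have "stable_elem B e \<otimes>\<^bsub>FG B\<^esub> (vertex_elem B (tail X e) g \<otimes>\<^bsub>FG B\<^esub> inv\<^bsub>FG B\<^esub> stable_elem B e)
   = vertex_elem B (head X e) (\<phi> e g)"
  using assms c by (simp add: vertex_elem_def stable_elem_def fundamental_group_def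
    group.is_monoid[OF group_presented_group] monoid.r_one group.inv_closed[OF group_presented_group])
 then have "vertex_elem B (head X e) (\<phi> e g) \<otimes>\<^bsub>FG B\<^esub> stable_elem B e
   = stable_elem B e \<otimes>\<^bsub>FG B\<^esub> (vertex_elem B (tail X e) g \<otimes>\<^bsub>FG B\<^esub> inv\<^bsub>FG B\<^esub> stable_elem B e) \<otimes>\<^bsub>FG B\<^esub> stable_elem B e"
  by simp
 then show ?thesis using c by (simp add: G.m_assoc)
qed

lemma stable_elem_tree:
 assumes "e \<in> arcs X" "e \<in> arcs B"
 shows "stable_elem B e = \<one>\<^bsub>FG B\<^esub>"
proof -
 interpret G: group "FG B" by (rule group_FG)
 have "([(Stable_Letter e, True)], []) \<in> fundamental_relations X Gv Ge \<phi> B"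
  using assms unfolding fundamental_relations_def by blast
 from presented_rel[OF this, of "fundamental_generators X Gv", folded fundamental_group_def] show ?thesis
  using assms by (simp add: stable_elem_def[symmetric])
qed

lemma vertex_elem_group_hom: "v \<in> verts X \<Longrightarrow> group_hom (Gv v) (FG B) (vertex_elem B v)"
 using group_Gv group_FG vertex_elem_mult
 by (auto simp: group_hom_def group_hom_axioms_def hom_def)

text \<open>Inverses of vertex elements are vertex elements, so only stable letters need an inverse
  case.\<close>

lemma FG_induct [consumes 1, case_names one vertex stable stable_inv]:
 assumes "x \<in> carrier (FG B)" and one: "P \<one>\<^bsub>FG B\<^esub>"
  and vertex: "\<And>v g x. v \<in> verts X \<Longrightarrow> g \<in> carrier (Gv v) \<Longrightarrow> x \<in> carrier (FG B) \<Longrightarrow> P x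
   \<Longrightarrow> P (vertex_elem B v g \<otimes>\<^bsub>FG B\<^esub> x)"
  and stable: "\<And>e x. e \<in> arcs X \<Longrightarrow> x \<in> carrier (FG B) \<Longrightarrow> P x \<Longrightarrow> P (stable_elem B e \<otimes>\<^bsub>FG B\<^esub> x)"
  and stable_inv: "\<And>e x. e \<in> arcs X \<Longrightarrow> x \<in> carrier (FG B) \<Longrightarrow> P x
   \<Longrightarrow> P (inv\<^bsub>FG B\<^esub> stable_elem B e \<otimes>\<^bsub>FG B\<^esub> x)"
 shows "P x"
 using assms(1) unfolding fundamental_group_def
proof (induction rule: presented_induct)
 case one
 then show ?case using assms(2) by (simp add: fundamental_group_def)
next
 case (gen y A)
 then show ?case using vertex stable
  by (cases y) (auto simp: fundamental_group_def vertex_elem_def stable_elem_def)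
next
 case (inv y A)
 show ?case
 proof (cases y)
  case (Vertex_Elem v g)
  then have v: "v \<in> verts X" "g \<in> carrier (Gv v)" using inv by auto
  interpret h: group_hom "Gv v" "FG B" "vertex_elem B v" using v by (intro vertex_elem_group_hom)
  have "inv\<^bsub>FG B\<^esub> vertex_elem B v g = vertex_elem B v (inv\<^bsub>Gv v\<^esub> g)" using v by simp
  then show ?thesis
   using vertex[of v "inv\<^bsub>Gv v\<^esub> g" A] inv v Vertex_Elem by (auto simp: fundamental_group_def vertex_elem_def)
 next
  case (Stable_Letter e)
  then show ?thesis using inv stable_inv[of e A] by (auto simp: fundamental_group_def stable_elem_def)
 qed
qed

text \<open>Von Dyck's theorem for graphs of groups. The edge relation is stated without inverses,
  which is the form that is convenient to verify in matrix, affine and wreath groups.\<close>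

lemma FG_hom:
 assumes K: "group K" and \<alpha>: "\<And>v. v \<in> verts X \<Longrightarrow> \<alpha> v \<in> hom (Gv v) K"
  and s: "\<And>e. e \<in> arcs X \<Longrightarrow> s e \<in> carrier K"
  and rel: "\<And>e g. e \<in> arcs X \<Longrightarrow> g \<in> Ge e \<Longrightarrow> s e \<otimes>\<^bsub>K\<^esub> \<alpha> (tail X e) g = \<alpha> (head X e) (\<phi> e g) \<otimes>\<^bsub>K\<^esub> s e"
  and tree: "\<And>e. e \<in> arcs X \<Longrightarrow> e \<in> arcs B \<Longrightarrow> s e = \<one>\<^bsub>K\<^esub>"
 obtains h where "h \<in> hom (FG B) K"
  "\<And>v g. v \<in> verts X \<Longrightarrow> g \<in> carrier (Gv v) \<Longrightarrow> h (vertex_elem B v g) = \<alpha> v g"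
  "\<And>e. e \<in> arcs X \<Longrightarrow> h (stable_elem B e) = s e"
proof -
 interpret K: group K by fact
 define f where "f y = (case y of Vertex_Elem v g \<Rightarrow> \<alpha> v g | Stable_Letter e \<Rightarrow> s e)" for y
 have \<alpha>c: "\<alpha> v g \<in> carrier K" if "v \<in> verts X" "g \<in> carrier (Gv v)" for v g
  using \<alpha> that by (auto simp: hom_def)
 have fc: "f \<in> fundamental_generators X Gv \<rightarrow> carrier K"
  using \<alpha>c s by (auto simp: f_def fundamental_generators_def)
 obtain h where h: "h \<in> hom (presented_group (fundamental_generators X Gv) (fundamental_relations X Gv Ge \<phi> B)) K"
   "\<And>x. x \<in> fundamental_generators X Gv \<Longrightarrow> h (presented_gen (fundamental_generators X Gv) (fundamental_relations X Gv Ge \<phi> B) x) = f x"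
 proof (rule presented_group_hom[OF K fc])
  fix u v assume uv: "(u, v) \<in> fundamental_relations X Gv Ge \<phi> B"
  show "word_val K f u = word_val K f v"
   using uv unfolding fundamental_relations_def
  proof (elim UnE CollectE exE conjE, goal_cases)
   case (1 v g h)
   then show ?case using \<alpha>[of v] \<alpha>c by (auto simp: f_def hom_mult K.r_one)
  next
   case (2 e g)
   then have c: "s e \<in> carrier K" "\<alpha> (tail X e) g \<in> carrier K" "\<alpha> (head X e) (\<phi> e g) \<in> carrier K"
    using s \<alpha>c by auto
   have "s e \<otimes>\<^bsub>K\<^esub> (\<alpha> (tail X e) g \<otimes>\<^bsub>K\<^esub> inv\<^bsub>K\<^esub> s e) = s e \<otimes>\<^bsub>K\<^esub> \<alpha> (tail X e) g \<otimes>\<^bsub>K\<^esub> inv\<^bsub>K\<^esub> s e"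
    using c by (simp add: K.m_assoc)
   also have "\<dots> = \<alpha> (head X e) (\<phi> e g)" using rel[of e g] 2 c by (simp add: K.m_assoc)
   finally show ?case using 2 c by (auto simp: f_def)
  next
   case (3 e)
   then show ?case using tree s by (auto simp: f_def)
  qed
 qed blast
 show thesis
 proof (rule that)
  show "h \<in> hom (FG B) K" using h(1) by (simp add: fundamental_group_def)
 qed (auto simp: vertex_elem_def stable_elem_def h(2) f_def)
qed

subsection \<open>Paths\<close>

text \<open>Without the relations \<open>t\<^sub>e = 1\<close> for the arcs of the tree, the fundamental group is the group of
 all closed paths at a base vertex inside the larger group in which the arcs do not have to be composable.\<close>

abbreviation "UG \<equiv> FG (X\<lparr>arcs := {}\<rparr>)"
abbreviation "vel \<equiv> vertex_elem (X\<lparr>arcs := {}\<rparr>)"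
abbreviation "stl \<equiv> stable_elem (X\<lparr>arcs := {}\<rparr>)"

text \<open>Paths are read from right to left: \<open>path u v x\<close> starts at \<open>u\<close>,
  ends at \<open>v\<close>, and every step multiplies on the left.\<close>

inductive path :: "'v \<Rightarrow> 'v \<Rightarrow> ('v, 'e, 'g) generator word set \<Rightarrow> bool" for u where
 refl: "u \<in> verts X \<Longrightarrow> path u u \<one>\<^bsub>UG\<^esub>"
| vertex: "path u v x \<Longrightarrow> g \<in> carrier (Gv v) \<Longrightarrow> path u v (vel v g \<otimes>\<^bsub>UG\<^esub> x)"
| forward: "path u (tail X e) x \<Longrightarrow> e \<in> arcs X \<Longrightarrow> path u (head X e) (stl e \<otimes>\<^bsub>UG\<^esub> x)"
| backward: "path u (head X e) x \<Longrightarrow> e \<in> arcs X \<Longrightarrow> path u (tail X e) (inv\<^bsub>UG\<^esub> stl e \<otimes>\<^bsub>UG\<^esub> x)"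

lemma path_closed: "path u v x \<Longrightarrow> u \<in> verts X \<and> v \<in> verts X \<and> x \<in> carrier UG"
proof (induction rule: path.induct)
 case refl
 then show ?case using group.is_monoid[OF group_FG] by (auto intro!: monoid.one_closed)
next
 case (vertex v x g)
 then show ?case using group.is_monoid[OF group_FG] by (auto intro!: monoid.m_closed)
next
 case (forward e x)
 then show ?case using group.is_monoid[OF group_FG] by (auto intro!: monoid.m_closed)
next
 case (backward e x)
 then show ?case using group_FG group.is_monoid[OF group_FG] by (auto intro!: monoid.m_closed group.inv_closed)
qed

lemma path_trans: "path v w y \<Longrightarrow> path u v x \<Longrightarrow> path u w (y \<otimes>\<^bsub>UG\<^esub> x)"
proof (induction rule: path.induct)
 case refl
 interpret group UG by (rule group_FG)
 show ?case using refl path_closed[OF refl(2)] by simp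
next
 case (vertex w y g)
 interpret group UG by (rule group_FG)
 show ?case using path.vertex[OF vertex.IH[OF vertex.prems] vertex.hyps(2)] path_closed[OF vertex.prems] path_closed[OF vertex.hyps(1)] vertex.hyps(2)
  by (simp add: m_assoc)
next
 case (forward e y)
 interpret group UG by (rule group_FG)
 show ?case using path.forward[OF forward.IH[OF forward.prems] forward.hyps(2)] path_closed[OF forward.prems] path_closed[OF forward.hyps(1)] forward.hyps(2)
  by (simp add: m_assoc)
next
 case (backward e y)
 interpret group UG by (rule group_FG)
 show ?case using path.backward[OF backward.IH[OF backward.prems] backward.hyps(2)] path_closed[OF backward.prems] path_closed[OF backward.hyps(1)] backward.hyps(2)
  by (simp add: m_assoc)
qed

lemma path_single:
 shows "v \<in> verts X \<Longrightarrow> g \<in> carrier (Gv v) \<Longrightarrow> path v v (vel v g)"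
  and "e \<in> arcs X \<Longrightarrow> path (tail X e) (head X e) (stl e)"
  and "e \<in> arcs X \<Longrightarrow> path (head X e) (tail X e) (inv\<^bsub>UG\<^esub> stl e)"
proof -
 interpret group UG by (rule group_FG)
 show "path v v (vel v g)" if "v \<in> verts X" "g \<in> carrier (Gv v)"
  using path.vertex[OF path.refl, of v g] that by simp
 show "path (tail X e) (head X e) (stl e)" if "e \<in> arcs X"
  using path.forward[OF path.refl, of e] that by simp
 show "path (head X e) (tail X e) (inv\<^bsub>UG\<^esub> stl e)" if "e \<in> arcs X"
  using path.backward[OF path.refl, of e] that by simp
qed

lemma path_inv: "path u v x \<Longrightarrow> path v u (inv\<^bsub>UG\<^esub> x)"
proof (induction rule: path.induct)
 case refl
 interpret group UG by (rule group_FG)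
 show ?case using path.refl[OF refl] by simp
next
 case (vertex v x g)
 interpret group UG by (rule group_FG)
 have v: "v \<in> verts X" "x \<in> carrier UG" using path_closed vertex by blast+
 interpret h: group_hom "Gv v" UG "vel v" using v by (intro vertex_elem_group_hom)
 have "inv\<^bsub>UG\<^esub> (vel v g \<otimes>\<^bsub>UG\<^esub> x) = inv\<^bsub>UG\<^esub> x \<otimes>\<^bsub>UG\<^esub> vel v (inv\<^bsub>Gv v\<^esub> g)"
  using v vertex.hyps by (simp add: inv_mult_group)
 then show ?case using path_trans[OF vertex.IH path_single(1)[OF v(1), of "inv\<^bsub>Gv v\<^esub> g"]] vertex.hyps by simp
next
 case (forward e x)
 interpret group UG by (rule group_FG)
 show ?case using path_trans[OF forward.IH path_single(3)[OF forward.hyps(2)]] path_closed[OF forward.hyps(1)] forward.hyps(2)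
  by (simp add: inv_mult_group)
next
 case (backward e x)
 interpret group UG by (rule group_FG)
 show ?case using path_trans[OF backward.IH path_single(2)[OF backward.hyps(2)]] path_closed[OF backward.hyps(1)] backward.hyps(2)
  by (simp add: inv_mult_group)
qed

text \<open>In the wreath product the relation \<open>t g = \<phi>(g) t\<close> compares the label
  of \<open>t\<close> at the position moved by \<open>g\<close> with its label at the original
  position. So the only condition on the labels is invariance under the edge group, once vertex
  elements carry trivial labels.\<close>

lemma UG_cocycle:
 assumes S: "group S" and K: "group K" and \<pi>: "\<pi> \<in> hom UG S"
  and k: "\<And>e p. e \<in> arcs X \<Longrightarrow> p \<in> carrier S \<Longrightarrow> k e p \<in> carrier K"
  and inv: "\<And>e g p. e \<in> arcs X \<Longrightarrow> g \<in> Ge e \<Longrightarrow> p \<in> carrier S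
   \<Longrightarrow> k e (\<pi> (vel (tail X e) g) \<otimes>\<^bsub>S\<^esub> p) = k e p"
 obtains l where "cocycle UG (carrier S) K (\<lambda>x p. \<pi> x \<otimes>\<^bsub>S\<^esub> p) l"
  "\<And>v g p. v \<in> verts X \<Longrightarrow> g \<in> carrier (Gv v) \<Longrightarrow> p \<in> carrier S \<Longrightarrow> l (vel v g) p = \<one>\<^bsub>K\<^esub>"
  "\<And>e p. e \<in> arcs X \<Longrightarrow> p \<in> carrier S \<Longrightarrow> l (stl e) p = k e p"
proof -
 interpret U: group UG by (rule group_FG)
 interpret S: group S by fact
 interpret K: group K by fact
 interpret \<pi>: group_hom UG S \<pi> using \<pi> by unfold_locales
 let ?W = "wreath_group S K"
 let ?\<alpha> = "\<lambda>v g. (\<lambda>p\<in>carrier S. \<one>\<^bsub>K\<^esub>, \<pi> (vel v g))"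
 let ?s = "\<lambda>e. (\<lambda>p\<in>carrier S. k e p, \<pi> (stl e))"
 have \<pi>c: "\<pi> (vel v g) \<in> carrier S" if "v \<in> verts X" "g \<in> carrier (Gv v)" for v g using that by simp
 obtain h where h: "h \<in> hom UG ?W"
   "\<And>v g. v \<in> verts X \<Longrightarrow> g \<in> carrier (Gv v) \<Longrightarrow> h (vel v g) = ?\<alpha> v g"
   "\<And>e. e \<in> arcs X \<Longrightarrow> h (stl e) = ?s e"
 proof (rule FG_hom[OF group_wreath_group[OF S K], of ?\<alpha> ?s "X\<lparr>arcs := {}\<rparr>"])
  show "?\<alpha> v \<in> hom (Gv v) ?W" if "v \<in> verts X" for v
   using that \<pi>c by (auto simp: hom_def wreath_group_def vertex_elem_mult intro!: restrict_ext)
  show "?s e \<in> carrier ?W" if "e \<in> arcs X" for e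
   using that k by (auto simp: wreath_group_def)
  show "?s e \<otimes>\<^bsub>?W\<^esub> ?\<alpha> (tail X e) g = ?\<alpha> (head X e) (\<phi> e g) \<otimes>\<^bsub>?W\<^esub> ?s e" if "e \<in> arcs X" "g \<in> Ge e" for e g
  proof -
   have "\<pi> (stl e) \<otimes>\<^bsub>S\<^esub> \<pi> (vel (tail X e) g) = \<pi> (vel (head X e) (\<phi> e g)) \<otimes>\<^bsub>S\<^esub> \<pi> (stl e)"
    using stable_elem_rel[OF that, of "X\<lparr>arcs := {}\<rparr>"] that
    by (metis \<pi>.hom_mult Ge_carrier phi_carrier stable_elem_closed vertex_elem_closed tail_in_verts head_in_verts)
   then show ?thesis using that inv k \<pi>c[of "tail X e" g]
    by (auto simp: wreath_group_def intro!: restrict_ext)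
  qed
 qed auto
 interpret h: group_hom UG ?W h
  using h(1) group_wreath_group[OF S K] by (simp add: group_hom_def group_hom_axioms_def U.group_axioms)
 \<comment> \<open>The cocycle supplied by the wreath product acts through the second component of
   \<open>h\<close>; this identifies it with the given \<open>\<pi>\<close>, which agrees with it on
   generators.\<close>
 have snd: "snd (h x) = \<pi> x" if "x \<in> carrier UG" for x
  using that
 proof (induction rule: FG_induct)
  case one
  show ?case by (simp add: wreath_group_def)
 next
  case (vertex v g x)
  then have "h (vel v g \<otimes>\<^bsub>UG\<^esub> x) = h (vel v g) \<otimes>\<^bsub>?W\<^esub> h x" by simp
  then show ?case using vertex h(2) by (simp add: wreath_group_def case_prod_beta)
 next
  case (stable e x)
  then have "h (stl e \<otimes>\<^bsub>UG\<^esub> x) = h (stl e) \<otimes>\<^bsub>?W\<^esub> h x" by simp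
  then show ?case using stable h(3) by (simp add: wreath_group_def case_prod_beta)
 next
  case (stable_inv e x)
  define y where "y = inv\<^bsub>UG\<^esub> stl e \<otimes>\<^bsub>UG\<^esub> x"
  have y: "y \<in> carrier UG" "x = stl e \<otimes>\<^bsub>UG\<^esub> y"
   using stable_inv by (simp_all add: y_def U.m_assoc[symmetric])
  have c: "snd (h y) \<in> carrier S" using h.hom_closed[OF y(1)] by (auto simp: wreath_group_def)
  have "h x = h (stl e) \<otimes>\<^bsub>?W\<^esub> h y" using y stable_inv by simp
  then have "\<pi> x = \<pi> (stl e) \<otimes>\<^bsub>S\<^esub> snd (h y)" using stable_inv h(3) by (simp add: wreath_group_def case_prod_beta)
  then have "snd (h y) = inv\<^bsub>S\<^esub> \<pi> (stl e) \<otimes>\<^bsub>S\<^esub> \<pi> x" using c stable_inv by (simp add: S.m_assoc[symmetric])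
  then show ?case using stable_inv by (simp add: y_def)
 qed
 have "cocycle UG (carrier S) K (\<lambda>x p. snd (h x) \<otimes>\<^bsub>S\<^esub> p) (\<lambda>g. fst (h g))"
  by (rule cocycle_wreath_hom[OF h(1) U.group_axioms S K])
 then have "cocycle UG (carrier S) K (\<lambda>x p. \<pi> x \<otimes>\<^bsub>S\<^esub> p) (\<lambda>g. fst (h g))"
  using snd by (simp add: cocycle_def S.m_assoc)
 then show thesis by (rule that) (simp_all add: h(2,3))
qed

end

text \<open>Here \<open>\<gamma> v\<close> is the path in the tree from \<open>v\<close> to the base vertex, and \<open>j\<close> turns the elements of
 the fundamental group into closed paths at the base vertex.\<close>

locale based_graph_of_groups = graph_of_groups X Gv Ge \<phi>
 for X :: "('v, 'e) pre_digraph" and Gv :: "'v \<Rightarrow> 'g monoid" and Ge \<phi> +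
 fixes T :: "('v, 'e) pre_digraph" and r :: 'v
  and j q :: "('v, 'e, 'g) generator word set \<Rightarrow> ('v, 'e, 'g) generator word set"
  and \<gamma> :: "'v \<Rightarrow> ('v, 'e, 'g) generator word set"
 assumes r: "r \<in> verts X" and arcs_T: "arcs T \<subseteq> arcs X"
  and tree_T: "grown (tail X) (head X) (arcs X) r (verts X) (arcs T)"
  and j_hom: "j \<in> hom (FG T) UG" and q_hom: "q \<in> hom UG (FG T)"
  and j_vertex: "v \<in> verts X \<Longrightarrow> g \<in> carrier (Gv v)
   \<Longrightarrow> j (vertex_elem T v g) = \<gamma> v \<otimes>\<^bsub>UG\<^esub> vel v g \<otimes>\<^bsub>UG\<^esub> inv\<^bsub>UG\<^esub> \<gamma> v"
  and j_stable: "e \<in> arcs X \<Longrightarrow> j (stable_elem T e) = \<gamma> (head X e) \<otimes>\<^bsub>UG\<^esub> stl e \<otimes>\<^bsub>UG\<^esub> inv\<^bsub>UG\<^esub> \<gamma> (tail X e)"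
  and q_vertex: "v \<in> verts X \<Longrightarrow> g \<in> carrier (Gv v) \<Longrightarrow> q (vel v g) = vertex_elem T v g"
  and q_stable: "e \<in> arcs X \<Longrightarrow> q (stl e) = stable_elem T e"
  and path_\<gamma>: "v \<in> verts X \<Longrightarrow> path v r (\<gamma> v)"
  and q_\<gamma>: "v \<in> verts X \<Longrightarrow> q (\<gamma> v) = \<one>\<^bsub>FG T\<^esub>"
  and \<gamma>_r: "\<gamma> r = \<one>\<^bsub>UG\<^esub>"

text \<open>Conjugating by the potential of the stable letters along \<open>T\<close> turns every
  generator into a closed path at \<open>r\<close>; the image of a tree arc is trivial precisely by
  the equation of the potential.\<close>

lemma (in graph_of_groups) based_exists:
 assumes "maximal_subtree X T"
 obtains r j q \<gamma> where "based_graph_of_groups X Gv Ge \<phi> T r j q \<gamma>"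
proof -
 interpret U: group UG by (rule group_FG)
 interpret G: group "FG T" by (rule group_FG)
 obtain r where r: "r \<in> verts X" and sub: "arcs T \<subseteq> arcs X"
   and tree: "grown (tail X) (head X) (arcs X) r (verts X) (arcs T)"
  using maximal_subtree_grown[OF _ connected assms] fin_digraph_axioms by blast
 have st: "stl \<in> arcs X \<rightarrow> carrier UG" by simp
 obtain \<gamma> where \<gamma>: "\<gamma> r = \<one>\<^bsub>UG\<^esub>" "\<And>v. v \<in> verts X \<Longrightarrow> \<gamma> v \<in> carrier UG"
   "\<And>e. e \<in> arcs T \<Longrightarrow> \<gamma> (head X e) \<otimes>\<^bsub>UG\<^esub> stl e = \<gamma> (tail X e)"
  using grown_potential[OF U.group_axioms tree st] by blast
 have e: "tail X e \<in> verts X" "head X e \<in> verts X" "stl e \<in> carrier UG" if "e \<in> arcs T" for e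
  using that sub by auto
 have path: "path v r (\<gamma> v)" if "v \<in> verts X" for v
 proof (rule grown_propagate[OF tree _ _ that])
  show "path r r (\<gamma> r)" using r \<gamma>(1) by (simp add: path.refl)
  fix e assume eT: "e \<in> arcs T"
  then have eX: "e \<in> arcs X" using sub by auto
  have "\<gamma> (head X e) = \<gamma> (tail X e) \<otimes>\<^bsub>UG\<^esub> inv\<^bsub>UG\<^esub> stl e"
   using e[OF eT] \<gamma>(2)[of "head X e"] by (simp add: \<gamma>(3)[OF eT, symmetric] U.m_assoc)
  then show "path (tail X e) r (\<gamma> (tail X e)) \<longleftrightarrow> path (head X e) r (\<gamma> (head X e))"
   using path_trans[OF _ path_single(2)[OF eX], of r "\<gamma> (head X e)"]
    path_trans[OF _ path_single(3)[OF eX], of r "\<gamma> (tail X e)"] \<gamma>(3)[OF eT] by metis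
 qed
 have vc: "vel v g \<in> carrier UG" if "v \<in> verts X" "g \<in> carrier (Gv v)" for v g using that by simp
 have conj: "\<gamma> v \<otimes>\<^bsub>UG\<^esub> x \<otimes>\<^bsub>UG\<^esub> inv\<^bsub>UG\<^esub> \<gamma> w \<otimes>\<^bsub>UG\<^esub> (\<gamma> w \<otimes>\<^bsub>UG\<^esub> y \<otimes>\<^bsub>UG\<^esub> inv\<^bsub>UG\<^esub> \<gamma> z)
   = \<gamma> v \<otimes>\<^bsub>UG\<^esub> (x \<otimes>\<^bsub>UG\<^esub> y) \<otimes>\<^bsub>UG\<^esub> inv\<^bsub>UG\<^esub> \<gamma> z"
  if "v \<in> verts X" "w \<in> verts X" "z \<in> verts X" "x \<in> carrier UG" "y \<in> carrier UG" for v w z x y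
 proof -
  have "inv\<^bsub>UG\<^esub> \<gamma> w \<otimes>\<^bsub>UG\<^esub> (\<gamma> w \<otimes>\<^bsub>UG\<^esub> (y \<otimes>\<^bsub>UG\<^esub> inv\<^bsub>UG\<^esub> \<gamma> z)) = y \<otimes>\<^bsub>UG\<^esub> inv\<^bsub>UG\<^esub> \<gamma> z"
   using that \<gamma>(2) by (simp add: U.m_assoc[symmetric])
  then show ?thesis using that \<gamma>(2) by (simp add: U.m_assoc)
 qed
 obtain j where j: "j \<in> hom (FG T) UG"
   "\<And>v g. v \<in> verts X \<Longrightarrow> g \<in> carrier (Gv v) \<Longrightarrow> j (vertex_elem T v g) = \<gamma> v \<otimes>\<^bsub>UG\<^esub> vel v g \<otimes>\<^bsub>UG\<^esub> inv\<^bsub>UG\<^esub> \<gamma> v"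
   "\<And>e. e \<in> arcs X \<Longrightarrow> j (stable_elem T e) = \<gamma> (head X e) \<otimes>\<^bsub>UG\<^esub> stl e \<otimes>\<^bsub>UG\<^esub> inv\<^bsub>UG\<^esub> \<gamma> (tail X e)"
 proof (rule FG_hom[OF U.group_axioms, of "\<lambda>v g. \<gamma> v \<otimes>\<^bsub>UG\<^esub> vel v g \<otimes>\<^bsub>UG\<^esub> inv\<^bsub>UG\<^esub> \<gamma> v"
    "\<lambda>e. \<gamma> (head X e) \<otimes>\<^bsub>UG\<^esub> stl e \<otimes>\<^bsub>UG\<^esub> inv\<^bsub>UG\<^esub> \<gamma> (tail X e)" T])
  show "(\<lambda>g. \<gamma> v \<otimes>\<^bsub>UG\<^esub> vel v g \<otimes>\<^bsub>UG\<^esub> inv\<^bsub>UG\<^esub> \<gamma> v) \<in> hom (Gv v) UG" if "v \<in> verts X" for v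
   using that \<gamma>(2) conj by (auto simp: hom_def vertex_elem_mult)
  show "\<gamma> (head X e) \<otimes>\<^bsub>UG\<^esub> stl e \<otimes>\<^bsub>UG\<^esub> inv\<^bsub>UG\<^esub> \<gamma> (tail X e) \<in> carrier UG" if "e \<in> arcs X" for e
   using that \<gamma>(2) by simp
  show "\<gamma> (head X e) \<otimes>\<^bsub>UG\<^esub> stl e \<otimes>\<^bsub>UG\<^esub> inv\<^bsub>UG\<^esub> \<gamma> (tail X e) \<otimes>\<^bsub>UG\<^esub> (\<gamma> (tail X e) \<otimes>\<^bsub>UG\<^esub> vel (tail X e) g \<otimes>\<^bsub>UG\<^esub> inv\<^bsub>UG\<^esub> \<gamma> (tail X e))
    = \<gamma> (head X e) \<otimes>\<^bsub>UG\<^esub> vel (head X e) (\<phi> e g) \<otimes>\<^bsub>UG\<^esub> inv\<^bsub>UG\<^esub> \<gamma> (head X e) \<otimes>\<^bsub>UG\<^esub> (\<gamma> (head X e) \<otimes>\<^bsub>UG\<^esub> stl e \<otimes>\<^bsub>UG\<^esub> inv\<^bsub>UG\<^esub> \<gamma> (tail X e))"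
   if "e \<in> arcs X" "g \<in> Ge e" for e g
   using that by (simp add: conj stable_elem_rel)
  show "\<gamma> (head X e) \<otimes>\<^bsub>UG\<^esub> stl e \<otimes>\<^bsub>UG\<^esub> inv\<^bsub>UG\<^esub> \<gamma> (tail X e) = \<one>\<^bsub>UG\<^esub>" if "e \<in> arcs X" "e \<in> arcs T" for e
   using \<gamma>(2,3) that e by simp
 qed blast
 obtain q where q: "q \<in> hom UG (FG T)"
   "\<And>v g. v \<in> verts X \<Longrightarrow> g \<in> carrier (Gv v) \<Longrightarrow> q (vel v g) = vertex_elem T v g"
   "\<And>e. e \<in> arcs X \<Longrightarrow> q (stl e) = stable_elem T e"
 proof (rule FG_hom[OF G.group_axioms, of "vertex_elem T" "stable_elem T" "X\<lparr>arcs := {}\<rparr>"])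
  show "vertex_elem T v \<in> hom (Gv v) (FG T)" if "v \<in> verts X" for v
   using that by (auto simp: hom_def vertex_elem_mult)
 qed (auto simp: stable_elem_rel)
 interpret q: group_hom UG "FG T" q using q(1) by unfold_locales
 have q\<gamma>: "q (\<gamma> v) = \<one>\<^bsub>FG T\<^esub>" if "v \<in> verts X" for v
 proof (rule grown_propagate[OF tree _ _ that])
  show "q (\<gamma> r) = \<one>\<^bsub>FG T\<^esub>" by (simp add: \<gamma>(1))
  fix e assume eT: "e \<in> arcs T"
  then have "q (stl e) = \<one>\<^bsub>FG T\<^esub>" using sub q(3) stable_elem_tree by auto
  moreover have "q (\<gamma> (tail X e)) = q (\<gamma> (head X e)) \<otimes>\<^bsub>FG T\<^esub> q (stl e)"
   using \<gamma>(2,3) e[OF eT] eT by (metis q.hom_mult)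
  ultimately show "q (\<gamma> (tail X e)) = \<one>\<^bsub>FG T\<^esub> \<longleftrightarrow> q (\<gamma> (head X e)) = \<one>\<^bsub>FG T\<^esub>"
   using \<gamma>(2) e[OF eT] by simp
 qed
 show thesis
  by (rule that[of r j q \<gamma>], unfold_locales) (use r sub tree j q path q\<gamma> \<gamma>(1) in auto)
qed

context based_graph_of_groups
begin

sublocale U: group UG by (rule group_FG)
sublocale G: group "FG T" by (rule group_FG)
sublocale j: group_hom "FG T" UG j using j_hom by unfold_locales
sublocale q: group_hom UG "FG T" q using q_hom by unfold_locales

lemma \<gamma>_closed [simp]: "v \<in> verts X \<Longrightarrow> \<gamma> v \<in> carrier UG"
 using path_\<gamma> path_closed by blast

text \<open>Hence \<open>j\<close> embeds the fundamental group in the larger group, where cocycles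
  are available without a condition on tree arcs.\<close>

lemma q_j: "x \<in> carrier (FG T) \<Longrightarrow> q (j x) = x"
proof (induction rule: FG_induct)
 case one
 show ?case by simp
next
 case (vertex v g x)
 then show ?case by (simp add: j_vertex q_vertex q_\<gamma>)
next
 case (stable e x)
 then show ?case by (simp add: j_stable q_stable q_\<gamma>)
next
 case (stable_inv e x)
 then show ?case by (simp add: j_stable q_stable q_\<gamma>)
qed

lemma path_j: "x \<in> carrier (FG T) \<Longrightarrow> path r r (j x)"
proof (induction rule: FG_induct)
 case one
 show ?case using r by (simp add: path.refl)
next
 case (vertex v g x)
 have "path r r (\<gamma> v \<otimes>\<^bsub>UG\<^esub> vel v g \<otimes>\<^bsub>UG\<^esub> inv\<^bsub>UG\<^esub> \<gamma> v)"
  using vertex by (intro path_trans[OF path_trans[OF path_\<gamma> path_single(1)] path_inv[OF path_\<gamma>]])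
 then show ?case using vertex path_trans by (simp add: j_vertex)
next
 case (stable e x)
 have "path r r (\<gamma> (head X e) \<otimes>\<^bsub>UG\<^esub> stl e \<otimes>\<^bsub>UG\<^esub> inv\<^bsub>UG\<^esub> \<gamma> (tail X e))"
  using stable by (intro path_trans[OF path_trans[OF path_\<gamma> path_single(2)] path_inv[OF path_\<gamma>]]) auto
 then show ?case using stable path_trans by (simp add: j_stable)
next
 case (stable_inv e x)
 have "path r r (\<gamma> (head X e) \<otimes>\<^bsub>UG\<^esub> stl e \<otimes>\<^bsub>UG\<^esub> inv\<^bsub>UG\<^esub> \<gamma> (tail X e))"
  using stable_inv by (intro path_trans[OF path_trans[OF path_\<gamma> path_single(2)] path_inv[OF path_\<gamma>]]) auto
 then show ?case using stable_inv path_trans[OF path_inv] by (simp add: j_stable)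
qed

text \<open>At the base vertex, where \<open>\<gamma>\<close> is trivial, this says that
  \<open>j\<close> and \<open>q\<close> are inverse to each other on closed paths, so every closed
  path at \<open>r\<close> is the image of a group element.\<close>

lemma j_q: "path v w x \<Longrightarrow> j (q x) = \<gamma> w \<otimes>\<^bsub>UG\<^esub> x \<otimes>\<^bsub>UG\<^esub> inv\<^bsub>UG\<^esub> \<gamma> v"
proof (induction rule: path.induct)
 case refl
 then show ?case by simp
next
 case (vertex w x g)
 have c: "v \<in> verts X" "w \<in> verts X" "x \<in> carrier UG" using path_closed[OF vertex.hyps(1)] by auto
 have "inv\<^bsub>UG\<^esub> \<gamma> w \<otimes>\<^bsub>UG\<^esub> (\<gamma> w \<otimes>\<^bsub>UG\<^esub> (x \<otimes>\<^bsub>UG\<^esub> inv\<^bsub>UG\<^esub> \<gamma> v)) = x \<otimes>\<^bsub>UG\<^esub> inv\<^bsub>UG\<^esub> \<gamma> v"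
  using c by (simp add: U.m_assoc[symmetric])
 then show ?case using vertex c by (simp add: q_vertex j_vertex U.m_assoc)
next
 case (forward e x)
 have c: "v \<in> verts X" "tail X e \<in> verts X" "x \<in> carrier UG" using path_closed[OF forward.hyps(1)] by auto
 have "inv\<^bsub>UG\<^esub> \<gamma> (tail X e) \<otimes>\<^bsub>UG\<^esub> (\<gamma> (tail X e) \<otimes>\<^bsub>UG\<^esub> (x \<otimes>\<^bsub>UG\<^esub> inv\<^bsub>UG\<^esub> \<gamma> v)) = x \<otimes>\<^bsub>UG\<^esub> inv\<^bsub>UG\<^esub> \<gamma> v"
  using c by (simp add: U.m_assoc[symmetric])
 then show ?case using forward c by (simp add: q_stable j_stable U.m_assoc)
next
 case (backward e x)
 have c: "v \<in> verts X" "head X e \<in> verts X" "x \<in> carrier UG" using path_closed[OF backward.hyps(1)] by auto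
 have "inv\<^bsub>UG\<^esub> \<gamma> (head X e) \<otimes>\<^bsub>UG\<^esub> (\<gamma> (head X e) \<otimes>\<^bsub>UG\<^esub> (x \<otimes>\<^bsub>UG\<^esub> inv\<^bsub>UG\<^esub> \<gamma> v)) = x \<otimes>\<^bsub>UG\<^esub> inv\<^bsub>UG\<^esub> \<gamma> v"
  using c by (simp add: U.m_assoc[symmetric])
 then show ?case using backward c by (simp add: q_stable j_stable U.m_assoc U.inv_mult_group)
qed

lemma j_q_closed: "path r r x \<Longrightarrow> j (q x) = x"
 using j_q[of r r x] path_closed[of r r x] by (simp add: \<gamma>_r)

end

section \<open>Lattices and commensurations\<close>

section \<open>Integer lattices\<close>

text \<open>The integer vectors of length \<open>n\<close> as functions vanishing from
  \<open>n\<close> on. In this form the spaces are nested, so inductions on \<open>n\<close> can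
  drop the last coordinate without changing the vectors.\<close>

definition int_vecs :: "nat \<Rightarrow> (nat \<Rightarrow> int) set" where
 "int_vecs n = {f. \<forall>i\<ge>n. f i = 0}"

definition unit_vec :: "nat \<Rightarrow> nat \<Rightarrow> int" where
 "unit_vec k = (\<lambda>i. if i = k then 1 else 0)"

definition int_lattice :: "nat \<Rightarrow> (nat \<Rightarrow> int) set \<Rightarrow> bool" where
 "int_lattice n B \<longleftrightarrow> B \<subseteq> int_vecs n \<and> (\<lambda>_. 0) \<in> B \<and> (\<forall>f\<in>B. \<forall>g\<in>B. (\<lambda>i. f i - g i) \<in> B)"

lemma int_vecs_mem [simp]:
 "(\<lambda>_. 0) \<in> int_vecs n" "k < n \<Longrightarrow> unit_vec k \<in> int_vecs n"
 "f \<in> int_vecs n \<Longrightarrow> g \<in> int_vecs n \<Longrightarrow> (\<lambda>i. f i + g i) \<in> int_vecs n"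
 "f \<in> int_vecs n \<Longrightarrow> g \<in> int_vecs n \<Longrightarrow> (\<lambda>i. f i - g i) \<in> int_vecs n"
 "f \<in> int_vecs n \<Longrightarrow> (\<lambda>i. c * f i) \<in> int_vecs n"
 by (auto simp: int_vecs_def unit_vec_def)

lemma int_vecs_SucD:
 assumes "f \<in> int_vecs (Suc n)" "f n = 0"
 shows "f \<in> int_vecs n"
 unfolding int_vecs_def
proof (intro CollectI allI impI)
 fix i assume "n \<le> i"
 then show "f i = 0" using assms by (cases "i = n") (auto simp: int_vecs_def)
qed

lemma int_lattice_closed:
 assumes "int_lattice n B"
 shows "(\<lambda>_. 0) \<in> B" "f \<in> B \<Longrightarrow> g \<in> B \<Longrightarrow> (\<lambda>i. f i - g i) \<in> B"
  "f \<in> B \<Longrightarrow> g \<in> B \<Longrightarrow> (\<lambda>i. f i + g i) \<in> B" "f \<in> B \<Longrightarrow> (\<lambda>i. c * f i) \<in> B"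
  "f \<in> B \<Longrightarrow> f \<in> int_vecs n"
proof -
 show 0: "(\<lambda>_. 0) \<in> B" using assms by (simp add: int_lattice_def)
 show d: "(\<lambda>i. f i - g i) \<in> B" if "f \<in> B" "g \<in> B" for f g using that assms by (simp add: int_lattice_def)
 show "f \<in> B \<Longrightarrow> f \<in> int_vecs n" using assms by (auto simp: int_lattice_def)
 have a: "(\<lambda>i. f i + g i) \<in> B" if "f \<in> B" "g \<in> B" for f g
  using d[OF that(1) d[OF 0 that(2)]] by simp
 then show "f \<in> B \<Longrightarrow> g \<in> B \<Longrightarrow> (\<lambda>i. f i + g i) \<in> B" .
 show "(\<lambda>i. c * f i) \<in> B" if f: "f \<in> B"
 proof (induction c rule: int_induct[of _ 0])
  case base
  then show ?case using 0 by simp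
 next
  case (step1 c)
  then show ?case using a[OF step1(2) f] by (simp add: algebra_simps)
 next
  case (step2 c)
  then show ?case using d[OF step2(2) f] by (simp add: algebra_simps)
 qed
qed

lemma int_lattice_units:
 assumes B: "int_lattice n B" and u: "\<And>k. k < n \<Longrightarrow> unit_vec k \<in> B"
 shows "B = int_vecs n"
proof -
 have "f \<in> B" if "k \<le> n" "f \<in> int_vecs k" for k f
  using that
 proof (induction k arbitrary: f)
  case 0
  then have "f = (\<lambda>_. 0)" by (auto simp: int_vecs_def)
  then show ?case using int_lattice_closed(1)[OF B] by simp
 next
  case (Suc k)
  have "(\<lambda>i. f i - f k * unit_vec k i) \<in> int_vecs k"
   using Suc.prems by (auto simp: int_vecs_def unit_vec_def Suc_le_eq)
  then have "(\<lambda>i. f i - f k * unit_vec k i) \<in> B" using Suc by simp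
  moreover have "(\<lambda>i. f k * unit_vec k i) \<in> B"
   using Suc.prems u[of k] int_lattice_closed(4)[OF B] by simp
  ultimately have "(\<lambda>i. (f i - f k * unit_vec k i) + f k * unit_vec k i) \<in> B"
   by (rule int_lattice_closed(3)[OF B])
  then show ?case by simp
 qed
 then show ?thesis using B by (auto simp: int_lattice_def)
qed

text \<open>Gaussian elimination, cross-multiplied to stay in the integers. This dependence is the
  source of the finite-index statement for subgroups of equal rank.\<close>

lemma integer_relation:
 fixes v :: "'i \<Rightarrow> nat \<Rightarrow> int"
 assumes "finite I" "n < card I"
 shows "\<exists>c. (\<exists>i\<in>I. c i \<noteq> 0) \<and> (\<forall>j<n. (\<Sum>i\<in>I. c i * v i j) = 0)"
 using assms
proof (induction n arbitrary: I v)
 case 0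
 then show ?case by (intro exI[of _ "\<lambda>_. 1"]) (auto simp: card_gt_0_iff)
next
 case (Suc n)
 show ?case
 proof (cases "\<forall>i\<in>I. v i n = 0")
  case True
  obtain c where c: "\<exists>i\<in>I. c i \<noteq> 0" "\<forall>j<n. (\<Sum>i\<in>I. c i * v i j) = 0"
   using Suc.IH[of I v] Suc.prems by auto
  have "(\<Sum>i\<in>I. c i * v i j) = 0" if "j < Suc n" for j
   using c(2) True that by (cases "j = n") auto
  then show ?thesis using c(1) by blast
 next
  case False
  then obtain k where k: "k \<in> I" "v k n \<noteq> 0" by blast
  \<comment> \<open>Eliminates coordinate \<open>n\<close> with the pivot
    \<open>v k n\<close>.\<close>
  let ?w = "\<lambda>i j. v k n * v i j - v i n * v k j"
  have "n < card (I - {k})" using Suc.prems k by simp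
  from Suc.IH[OF _ this, of ?w]
  obtain c where c: "\<exists>i\<in>I - {k}. c i \<noteq> 0" "\<forall>j<n. (\<Sum>i\<in>I - {k}. c i * ?w i j) = 0"
   using Suc.prems(1) by blast
  \<comment> \<open>Translates a relation of the eliminated vectors back: the others are scaled by
    the pivot, and \<open>k\<close> collects what was subtracted.\<close>
  let ?c = "\<lambda>i. if i = k then - (\<Sum>i\<in>I - {k}. c i * v i n) else c i * v k n"
  have "(\<Sum>i\<in>I. ?c i * v i j) = (\<Sum>i\<in>I - {k}. c i * ?w i j)" for j
  proof -
   have "(\<Sum>i\<in>I. ?c i * v i j) = ?c k * v k j + (\<Sum>i\<in>I - {k}. ?c i * v i j)"
    using Suc.prems k by (simp add: sum.remove[of I k])
   also have "(\<Sum>i\<in>I - {k}. ?c i * v i j) = (\<Sum>i\<in>I - {k}. c i * v k n * v i j)"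
    by (rule sum.cong) auto
   also have "?c k * v k j = - (\<Sum>i\<in>I - {k}. c i * v i n * v k j)"
    by (simp add: sum_distrib_right)
   finally show ?thesis
    by (simp add: sum_subtractf right_diff_distrib mult.assoc)
  qed
  moreover have "(\<Sum>i\<in>I - {k}. c i * ?w i j) = 0" if "j < Suc n" for j
   using c(2) that by (cases "j = n") (auto simp: algebra_simps)
  moreover have "\<exists>i\<in>I. ?c i \<noteq> 0"
  proof -
   obtain i where "i \<in> I" "i \<noteq> k" "c i \<noteq> 0" using c(1) by blast
   then show ?thesis using k by (intro bexI[of _ i]) auto
  qed
  ultimately show ?thesis by (intro exI[of _ ?c]) simp
 qed
qed

text \<open>The vectors satisfying the formula form a lattice that contains the unit
  vectors.\<close>

lemma additive_int_vecs:
 fixes F :: "(nat \<Rightarrow> int) \<Rightarrow> nat \<Rightarrow> int"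
 assumes add: "\<And>f g. f \<in> int_vecs n \<Longrightarrow> g \<in> int_vecs n \<Longrightarrow> F (\<lambda>i. f i + g i) = (\<lambda>i. F f i + F g i)"
  and f: "f \<in> int_vecs n"
 shows "F f j = (\<Sum>k<n. f k * F (unit_vec k) j)"
proof -
 let ?B = "{f \<in> int_vecs n. \<forall>j. F f j = (\<Sum>k<n. f k * F (unit_vec k) j)}"
 have "F (\<lambda>_. 0) = (\<lambda>i. F (\<lambda>_. 0) i + F (\<lambda>_. 0) i)" using add[of "\<lambda>_. 0" "\<lambda>_. 0"] by simp
 then have 0: "F (\<lambda>_. 0) j = 0" for j by (metis add_cancel_right_right)
 have "int_lattice n ?B"
  unfolding int_lattice_def
 proof (intro conjI ballI)
  fix f g assume fg: "f \<in> ?B" "g \<in> ?B"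
  then have "F f = (\<lambda>i. F (\<lambda>i. f i - g i) i + F g i)" using add[of "\<lambda>i. f i - g i" g] by simp
  then have "F (\<lambda>i. f i - g i) j = F f j - F g j" for j by (simp add: fun_eq_iff)
  then show "(\<lambda>i. f i - g i) \<in> ?B" using fg by (auto simp: sum_subtractf algebra_simps)
 qed (use 0 in auto)
 moreover have "unit_vec k \<in> ?B" if "k < n" for k
 proof -
  have "(\<Sum>i<n. unit_vec k i * F (unit_vec i) j) = F (unit_vec k) j" for j
   using that by (simp add: unit_vec_def if_distrib[of "\<lambda>x. x * _"] cong: if_cong)
  then show ?thesis using that by simp
 qed
 ultimately have "?B = int_vecs n" by (rule int_lattice_units)
 then show ?thesis using f by blast
qed

lemma int_subgroup_generator:
 fixes J :: "int set"
 assumes 0: "0 \<in> J" and d: "\<And>x y. x \<in> J \<Longrightarrow> y \<in> J \<Longrightarrow> x - y \<in> J"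
 obtains k where "k \<in> J" "\<And>x. x \<in> J \<Longrightarrow> k dvd x"
proof (cases "J = {0}")
 case True
 then show ?thesis using that[of 0] by auto
next
 case False
 then obtain x where x: "x \<in> J" "x \<noteq> 0" using 0 by auto
 have neg: "- x \<in> J" if "x \<in> J" for x using d[OF 0 that] by simp
 have add: "x + y \<in> J" if "x \<in> J" "y \<in> J" for x y using d[OF that(1) neg[OF that(2)]] by simp
 have mul: "c * x \<in> J" if "x \<in> J" for c x
  by (induction c rule: int_induct[of _ 0]) (use 0 add d that in \<open>auto simp: algebra_simps\<close>)
 let ?P = "\<lambda>m. m > 0 \<and> int m \<in> J"
 have "?P (nat \<bar>x\<bar>)" using x neg[of x] by (cases "x > 0") auto
 then have P: "?P (LEAST m. ?P m)" by (rule LeastI)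
 define m where "m = int (LEAST m. ?P m)"
 show ?thesis
 proof (rule that[of m])
  show "m \<in> J" using P by (simp add: m_def)
  fix y assume y: "y \<in> J"
  have "y - (y div m) * m \<in> J" using d[OF y mul[OF \<open>m \<in> J\<close>]] .
  then have yJ: "y mod m \<in> J" by (simp add: minus_div_mult_eq_mod)
  have "m > 0" using P by (simp add: m_def)
  have "y mod m = 0"
  proof (rule ccontr)
   assume "y mod m \<noteq> 0"
   then have "?P (nat (y mod m))" using yJ \<open>m > 0\<close> by (simp add: order.not_eq_order_implies_strict)
   then have "(LEAST m. ?P m) \<le> nat (y mod m)" by (rule Least_le)
   then have "m \<le> y mod m" using pos_mod_sign[OF \<open>m > 0\<close>, of y] unfolding m_def by linarith
   then show False using pos_mod_bound[OF \<open>m > 0\<close>, of y] by simp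
  qed
  then show "m dvd y" by auto
 qed
qed

text \<open>The induction step for lattices: the last coordinates form a subgroup of the integers,
  hence are the multiples of that of one vector \<open>h\<close>, and the vectors with last
  coordinate zero form a lattice of smaller length.\<close>

lemma int_lattice_Suc:
 assumes B: "int_lattice (Suc n) B"
 obtains h where "h \<in> B" "\<And>f. f \<in> B \<Longrightarrow> h n dvd f n" "int_lattice n {f \<in> B. f n = 0}"
proof -
 let ?J = "(\<lambda>f. f n) ` B"
 have "0 \<in> ?J" using int_lattice_closed(1)[OF B] by force
 moreover have "x - y \<in> ?J" if "x \<in> ?J" "y \<in> ?J" for x y
  using that int_lattice_closed(2)[OF B] by force
 ultimately obtain k where k: "k \<in> ?J" "\<And>x. x \<in> ?J \<Longrightarrow> k dvd x"
  using int_subgroup_generator[of ?J] by blast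
 then obtain h where "h \<in> B" "k = h n" by blast
 moreover have "int_lattice n {f \<in> B. f n = 0}"
  using int_lattice_closed(1,2,5)[OF B] int_vecs_SucD unfolding int_lattice_def[of n] by auto
 ultimately show thesis using that k by blast
qed

text \<open>A basis of the sublattice with last coordinate zero is enlarged by \<open>h\<close>
  exactly when the last coordinate of \<open>h\<close> is nonzero. The rank is left
  unspecified.\<close>

lemma int_lattice_basis:
 assumes "int_lattice n B"
 obtains r b where "bij_betw b (int_vecs r) B"
  "\<And>f g. f \<in> int_vecs r \<Longrightarrow> g \<in> int_vecs r \<Longrightarrow> b (\<lambda>i. f i + g i) = (\<lambda>i. b f i + b g i)"
proof -
 have "\<exists>r b. bij_betw b (int_vecs r) B \<and> (\<forall>f\<in>int_vecs r. \<forall>g\<in>int_vecs r. b (\<lambda>i. f i + g i) = (\<lambda>i. b f i + b g i))"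
  using assms
 proof (induction n arbitrary: B)
  case 0
  then have "B = {\<lambda>_. 0}" by (auto simp: int_lattice_def int_vecs_def)
  moreover have "int_vecs 0 = {\<lambda>_. 0}" by (auto simp: int_vecs_def)
  ultimately show ?case by (intro exI[of _ 0] exI[of _ "\<lambda>f. f"]) (auto simp: bij_betw_def)
 next
  case (Suc n)
  let ?B = "{f \<in> B. f n = 0}"
  obtain h where h: "h \<in> B" "\<And>f. f \<in> B \<Longrightarrow> h n dvd f n" "int_lattice n ?B"
   using int_lattice_Suc[OF Suc.prems] by blast
  note cl = int_lattice_closed[OF Suc.prems]
  obtain r b where b: "bij_betw b (int_vecs r) ?B"
    "\<forall>f\<in>int_vecs r. \<forall>g\<in>int_vecs r. b (\<lambda>i. f i + g i) = (\<lambda>i. b f i + b g i)"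
   using Suc.IH[OF h(3)] by blast
  show ?case
  proof (cases "h n = 0")
   case True
   then have "?B = B" using h(2) by auto
   then show ?thesis using b by metis
  next
   case False
   let ?p = "\<lambda>f::nat \<Rightarrow> int. (\<lambda>i. if i < r then f i else 0)"
   let ?b = "\<lambda>f i. b (?p f) i + f r * h i"
   have p: "?p f \<in> int_vecs r" for f by (simp add: int_vecs_def)
   have bB: "b (?p f) \<in> B" "b (?p f) n = 0" for f using b(1) p by (auto dest: bij_betwE)
   have "bij_betw ?b (int_vecs (Suc r)) B"
    unfolding bij_betw_def
   proof
    show "inj_on ?b (int_vecs (Suc r))"
    proof (rule inj_onI)
     fix f g assume fg: "f \<in> int_vecs (Suc r)" "g \<in> int_vecs (Suc r)" and eq: "?b f = ?b g"
     have "?b f n = ?b g n" using eq by metis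
     then have r: "f r = g r" using bB False by simp
     have "b (?p f) = b (?p g)" using eq r by (simp add: fun_eq_iff)
     then have "?p f = ?p g" using b(1) p by (meson bij_betw_imp_inj_on inj_onD)
     then have "f i = g i" if "i < r" for i using that fun_cong[of "?p f" "?p g" i] by simp
     moreover have "f i = g i" if "i > r" for i using fg that by (simp add: int_vecs_def Suc_le_eq)
     ultimately show "f = g" using r by (metis ext linorder_neqE_nat)
    qed
    show "?b ` int_vecs (Suc r) = B"
    proof
     show "?b ` int_vecs (Suc r) \<subseteq> B"
      using cl(3)[OF bB(1) cl(4)[OF h(1)]] by blast
     show "B \<subseteq> ?b ` int_vecs (Suc r)"
     proof
      fix x assume x: "x \<in> B"
      obtain t where t: "x n = h n * t" using h(2)[OF x] by (auto simp: dvd_def)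
      have "(\<lambda>i. x i - t * h i) \<in> ?B" using cl(2)[OF x cl(4)[OF h(1)]] t by simp
      then obtain f where f: "f \<in> int_vecs r" "b f = (\<lambda>i. x i - t * h i)"
       using b(1) by (metis (no_types, lifting) bij_betw_def imageE)
      have "?p (f(r := t)) = f" using f(1) by (auto simp: int_vecs_def fun_eq_iff)
      then have "?b (f(r := t)) = x" using f(2) by simp
      moreover have "f(r := t) \<in> int_vecs (Suc r)" using f(1) by (simp add: int_vecs_def)
      ultimately show "x \<in> ?b ` int_vecs (Suc r)" by blast
     qed
    qed
   qed
   moreover have "?b (\<lambda>i. f i + g i) = (\<lambda>i. ?b f i + ?b g i)" for f g
   proof -
    have "?p (\<lambda>i. f i + g i) = (\<lambda>i. ?p f i + ?p g i)" by auto
    moreover have "b (\<lambda>i. ?p f i + ?p g i) = (\<lambda>i. b (?p f) i + b (?p g) i)" 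
     by (rule bspec[OF bspec[OF b(2) p[of f]] p[of g]])
    ultimately have "b (?p (\<lambda>i. f i + g i)) = (\<lambda>i. b (?p f) i + b (?p g) i)" by simp
    then show ?thesis by (simp add: algebra_simps)
   qed
   ultimately show ?thesis by (intro exI[of _ "Suc r"] exI[of _ ?b]) blast
  qed
 qed
 then show thesis using that by blast
qed

text \<open>Subgroup separability of free abelian groups, with quotients modulo multiples of
  \<open>l\<close>. Either the last coordinate already separates \<open>m\<close> from
  \<open>B\<close>, or a multiple of \<open>h\<close> brings the last coordinate of \<open>m\<close>
  to zero and induction applies.\<close>

lemma int_lattice_separable:
 assumes "int_lattice n B" "m \<in> int_vecs n" "m \<notin> B"
 shows "\<exists>l::nat. l > 0 \<and> (\<forall>b\<in>B. \<forall>z\<in>int_vecs n. m \<noteq> (\<lambda>i. b i + int l * z i))"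
 using assms
proof (induction n arbitrary: B m)
 case 0
 then show ?case by (auto simp: int_lattice_def int_vecs_def)
next
 case (Suc n)
 let ?B = "{f \<in> B. f n = 0}"
 obtain h where h: "h \<in> B" "\<And>f. f \<in> B \<Longrightarrow> h n dvd f n" "int_lattice n ?B"
  using int_lattice_Suc[OF Suc.prems(1)] by blast
 note cl = int_lattice_closed[OF Suc.prems(1)]
 show ?case
 proof (cases "h n dvd m n")
  case False
  \<comment> \<open>If \<open>h n\<close> is zero, all of \<open>B\<close> has last coordinate zero
    and any modulus exceeding the nonzero \<open>m n\<close> works; otherwise divisibility by
    \<open>h n\<close> is itself the test.\<close>
  define l where "l = (if h n = 0 then nat \<bar>m n\<bar> + 1 else nat \<bar>h n\<bar>)"
  have l: "l > 0" by (auto simp: l_def)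
  have "m \<noteq> (\<lambda>i. b i + int l * z i)" if "b \<in> B" for b z
  proof
   assume "m = (\<lambda>i. b i + int l * z i)"
   then have eq: "m n = b n + int l * z n" by metis
   show False
   proof (cases "h n = 0")
    case True
    then have "b n = 0" using h(2)[OF that] by simp
    then have "int l dvd m n" using eq by simp
    moreover have "m n \<noteq> 0" using False True by auto
    ultimately have "\<bar>int l\<bar> \<le> \<bar>m n\<bar>" by (rule dvd_imp_le_int[rotated])
    then show False using True by (simp add: l_def)
   next
    case hn: False
    then have "h n dvd int l" by (simp add: l_def)
    then show False using False eq h(2)[OF that] by (metis dvd_add dvd_mult2)
   qed
  qed
  then show ?thesis using l by blast
 next
  case True
  then obtain t where t: "m n = h n * t" by (auto simp: dvd_def)
  let ?m = "\<lambda>i. m i - t * h i"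
  have "?m \<in> int_vecs n"
  proof (rule int_vecs_SucD)
   show "?m \<in> int_vecs (Suc n)"
    by (rule int_vecs_mem(4)[OF Suc.prems(2) int_vecs_mem(5)[OF cl(5)[OF h(1)]]])
   show "?m n = 0" using t by (simp add: mult.commute)
  qed
  moreover have "?m \<notin> B"
  proof
   assume "?m \<in> B"
   from cl(3)[OF this cl(4)[OF h(1), of t]] show False using Suc.prems(3) by simp
  qed
  ultimately obtain l where l: "l > 0" "\<And>b z. b \<in> ?B \<Longrightarrow> z \<in> int_vecs n \<Longrightarrow> ?m \<noteq> (\<lambda>i. b i + int l * z i)"
   using Suc.IH[OF h(3), of ?m] by auto
  \<comment> \<open>Enlarging the modulus by this factor turns the last coordinate of the error term
    into a multiple of \<open>h n\<close>. The corresponding multiple of \<open>h\<close> can then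
    be moved into the lattice vector, which leaves an equation with last coordinate zero.\<close>
  define k where "k = (if h n = 0 then 1 else \<bar>h n\<bar>)"
  have k: "k > 0" by (simp add: k_def)
  have "m \<noteq> (\<lambda>i. b i + int (l * nat k) * z i)" if b: "b \<in> B" and z: "z \<in> int_vecs (Suc n)" for b z
  proof
   assume eq: "m = (\<lambda>i. b i + int (l * nat k) * z i)"
   have mi: "m i = b i + int l * k * z i" for i using k by (subst eq) simp
   define s where "s = (if h n = 0 then 0 else sgn (h n) * z n)"
   have ks: "k * z n = s * h n \<or> h n = 0"
    by (simp add: k_def s_def abs_sgn[of "h n"])
   let ?b = "\<lambda>i. (b i - t * h i) + int l * s * h i"
   let ?z = "\<lambda>i. k * z i - s * h i"
   have bB: "?b \<in> B"
    using cl(3)[OF cl(2)[OF b cl(4)[OF h(1), of t]] cl(4)[OF h(1), of "int l * s"]] by (simp add: mult.assoc)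
   have zn: "k * z n - s * h n = 0"
   proof (cases "h n = 0")
    case True
    then have "b n = 0" "m n = 0" using h(2)[OF b] t by auto
    then have "int l * k * z n = 0" using mi[of n] by simp
    then show ?thesis using l(1) k True by simp
   next
    case False
    then show ?thesis using ks by simp
   qed
   have e: "?m i = ?b i + int l * ?z i" for i using mi[of i] by (simp add: algebra_simps)
   have "?b n = 0" using e[of n] zn t by (simp add: mult.commute)
   then have "?b \<in> ?B" using bB by simp
   moreover have "?z \<in> int_vecs n"
   proof (rule int_vecs_SucD)
    show "?z \<in> int_vecs (Suc n)"
     by (rule int_vecs_mem(4)[OF int_vecs_mem(5)[OF z] int_vecs_mem(5)[OF cl(5)[OF h(1)]]])
    show "?z n = 0" by (rule zn)
   qed
   ultimately show False using l(2)[of ?b ?z] e by auto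
  qed
  moreover have "l * nat k > 0" using l k by simp
  ultimately show ?thesis by blast
 qed
qed

section \<open>Coordinates of free abelian groups\<close>

definition coordinates :: "('a, 'b) monoid_scheme \<Rightarrow> nat \<Rightarrow> ('a \<Rightarrow> nat \<Rightarrow> int) \<Rightarrow> bool" where
 "coordinates G n \<eta> \<longleftrightarrow> bij_betw \<eta> (carrier G) (int_vecs n) \<and>
  (\<forall>x\<in>carrier G. \<forall>y\<in>carrier G. \<eta> (x \<otimes>\<^bsub>G\<^esub> y) = (\<lambda>i. \<eta> x i + \<eta> y i))"

lemma free_abelian_coordinates:
 assumes "free_abelian_of_rank G n"
 obtains \<eta> where "coordinates G n \<eta>"
proof -
 obtain h where h: "h \<in> iso G (free_Abelian_group {..<n})"
  using assms by (auto simp: free_abelian_of_rank_def is_iso_def)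
 let ?F = "free_Abelian_group {..<n}"
 have bij: "bij_betw h (carrier G) (carrier ?F)" and hom: "\<And>x y. x \<in> carrier G \<Longrightarrow> y \<in> carrier G \<Longrightarrow> h (x \<otimes>\<^bsub>G\<^esub> y) = h x + h y"
  using h by (auto simp: iso_def hom_def free_Abelian_group_def)
 have "bij_betw poly_mapping.lookup (carrier ?F) (int_vecs n)"
  unfolding bij_betw_def
 proof
  show "inj_on poly_mapping.lookup (carrier ?F)" by (auto intro!: inj_onI poly_mapping_eqI simp: fun_eq_iff)
  show "poly_mapping.lookup ` carrier ?F = int_vecs n"
  proof
   show "poly_mapping.lookup ` carrier ?F \<subseteq> int_vecs n"
    by (auto simp: free_Abelian_group_def int_vecs_def keys_def subset_iff)
   show "int_vecs n \<subseteq> poly_mapping.lookup ` carrier ?F"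
   proof
    fix f assume f: "f \<in> int_vecs n"
    then have "{i. f i \<noteq> 0} \<subseteq> {..<n}" by (auto simp: int_vecs_def) (meson not_less)
    then have l: "poly_mapping.lookup (Abs_poly_mapping f) = f" by (simp add: finite_subset)
    then have "Poly_Mapping.keys (Abs_poly_mapping f) \<subseteq> {..<n}" using \<open>{i. f i \<noteq> 0} \<subseteq> {..<n}\<close> by (simp add: keys_def)
    then show "f \<in> poly_mapping.lookup ` carrier ?F" using l by (metis (mono_tags) free_Abelian_group_def image_eqI mem_Collect_eq partial_object.select_convs(1))
   qed
  qed
 qed
 then have "bij_betw (\<lambda>x. poly_mapping.lookup (h x)) (carrier G) (int_vecs n)"
  using bij_betw_trans[OF bij] by (simp add: comp_def)
 then have "coordinates G n (\<lambda>x. poly_mapping.lookup (h x))"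
  by (auto simp: coordinates_def hom lookup_add)
 then show thesis by (rule that)
qed

locale coordinate_group = group G for G (structure) +
 fixes n :: nat and \<eta> :: "'a \<Rightarrow> nat \<Rightarrow> int"
 assumes coordinates: "coordinates G n \<eta>"
begin

lemma \<eta>_mem [simp]: "x \<in> carrier G \<Longrightarrow> \<eta> x \<in> int_vecs n"
 using coordinates by (auto simp: coordinates_def dest: bij_betwE)

lemma \<eta>_eq_iff: "x \<in> carrier G \<Longrightarrow> y \<in> carrier G \<Longrightarrow> \<eta> x = \<eta> y \<longleftrightarrow> x = y"
 using coordinates by (auto simp: coordinates_def bij_betw_def inj_on_def)

lemma \<eta>_surj: "f \<in> int_vecs n \<Longrightarrow> \<exists>x\<in>carrier G. \<eta> x = f"
 using coordinates by (force simp: coordinates_def bij_betw_def image_iff dest!: equalityD2)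

lemma \<eta>_mult: "x \<in> carrier G \<Longrightarrow> y \<in> carrier G \<Longrightarrow> \<eta> (x \<otimes> y) = (\<lambda>i. \<eta> x i + \<eta> y i)"
 using coordinates by (auto simp: coordinates_def)

lemma \<eta>_one: "\<eta> \<one> = (\<lambda>_. 0)"
proof
 fix i
 have "\<eta> (\<one> \<otimes> \<one>) i = \<eta> \<one> i + \<eta> \<one> i" by (subst \<eta>_mult) auto
 then show "\<eta> \<one> i = 0" by simp
qed

lemma \<eta>_inv: "x \<in> carrier G \<Longrightarrow> \<eta> (inv x) = (\<lambda>i. - \<eta> x i)"
proof
 fix i assume x: "x \<in> carrier G"
 have "\<eta> (inv x \<otimes> x) i = \<eta> (inv x) i + \<eta> x i" using \<eta>_mult[of "inv x" x] x by simp
 then show "\<eta> (inv x) i = - \<eta> x i" using x \<eta>_one by simp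
qed

lemma \<eta>_pow: "x \<in> carrier G \<Longrightarrow> \<eta> (x [^] (k::nat)) = (\<lambda>i. int k * \<eta> x i)"
 by (induction k) (auto simp: \<eta>_one \<eta>_mult algebra_simps)

lemma commute: "x \<in> carrier G \<Longrightarrow> y \<in> carrier G \<Longrightarrow> x \<otimes> y = y \<otimes> x"
 by (subst \<eta>_eq_iff[symmetric]) (auto simp: \<eta>_mult)

lemma pow_inj:
 "x \<in> carrier G \<Longrightarrow> y \<in> carrier G \<Longrightarrow> (k::nat) > 0 \<Longrightarrow> x [^] k = y [^] k \<Longrightarrow> x = y"
 by (subst \<eta>_eq_iff[symmetric]) (auto simp: \<eta>_eq_iff[symmetric, of "x [^] k"] \<eta>_pow fun_eq_iff)

text \<open>Reducing all coordinates modulo \<open>k\<close> changes an element by a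
  \<open>k\<close>-th power, so the finite box of reduced coordinates represents every
  coset.\<close>

lemma finite_cosets:
 assumes H: "subgroup H G" and k: "(k::nat) > 0" "\<And>x. x \<in> carrier G \<Longrightarrow> x [^] k \<in> H"
 obtains R where "finite R" "R \<subseteq> carrier G" "\<And>x. x \<in> carrier G \<Longrightarrow> \<exists>r\<in>R. x \<otimes> inv r \<in> H"
proof -
 let ?D = "{f \<in> int_vecs n. \<forall>i<n. f i \<in> {0..<int k}}"
 let ?R = "{x \<in> carrier G. \<eta> x \<in> ?D}"
 have "?D \<subseteq> (\<lambda>g i. if i < n then g i else 0) ` ({..<n} \<rightarrow>\<^sub>E {0..<int k})"
 proof
  fix f assume f: "f \<in> ?D"
  then have "f = (\<lambda>i. if i < n then restrict f {..<n} i else 0)" by (auto simp: int_vecs_def)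
  moreover have "restrict f {..<n} \<in> {..<n} \<rightarrow>\<^sub>E {0..<int k}" using f by auto
  ultimately show "f \<in> (\<lambda>g i. if i < n then g i else 0) ` ({..<n} \<rightarrow>\<^sub>E {0..<int k})" by blast
 qed
 then have "finite ?D" by (rule finite_subset) (simp add: finite_PiE)
 moreover have "\<eta> ` ?R \<subseteq> ?D" by blast
 moreover have "inj_on \<eta> ?R" by (auto simp: inj_on_def \<eta>_eq_iff)
 ultimately have "finite ?R" by (meson finite_imageD finite_subset)
 moreover have "\<exists>r\<in>?R. x \<otimes> inv r \<in> H" if x: "x \<in> carrier G" for x
 proof -
  have "(\<lambda>i. \<eta> x i mod int k) \<in> ?D" using \<eta>_mem[OF x] k by (auto simp: int_vecs_def)
  moreover obtain r where r: "r \<in> carrier G" "\<eta> r = (\<lambda>i. \<eta> x i mod int k)"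
   using \<eta>_surj[of "\<lambda>i. \<eta> x i mod int k"] calculation by blast
  have "(\<lambda>i. \<eta> x i div int k) \<in> int_vecs n" using \<eta>_mem[OF x] by (auto simp: int_vecs_def)
  then obtain y where y: "y \<in> carrier G" "\<eta> y = (\<lambda>i. \<eta> x i div int k)" using \<eta>_surj by blast
  have "\<eta> (x \<otimes> inv r) = \<eta> (y [^] k)"
   using x y r by (auto simp: \<eta>_mult \<eta>_inv \<eta>_pow minus_mod_eq_mult_div)
  then have "x \<otimes> inv r = y [^] k" using x y r by (simp add: \<eta>_eq_iff)
  then have "x \<otimes> inv r \<in> H" using k y by simp
  moreover have "r \<in> ?R" using r calculation(1) by simp
  ultimately show ?thesis by blast
 qed
 ultimately show thesis using that[of ?R] by blast
qed

text \<open>The use made of equal ranks: a subgroup of the same rank has finite index, expressed by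
  a uniform exponent. Each element has some power in \<open>H\<close> by linear dependence on a
  basis of \<open>H\<close>, and the unit vectors give a common exponent.\<close>

lemma subgroup_same_rank:
 assumes H: "subgroup H G" and \<eta>': "coordinates (G\<lparr>carrier := H\<rparr>) n \<eta>'"
 obtains k :: nat where "k > 0" "\<And>x. x \<in> carrier G \<Longrightarrow> x [^] k \<in> H"
proof -
 interpret H: group "G\<lparr>carrier := H\<rparr>" using H by (rule subgroup_imp_group)
 interpret C: coordinate_group "G\<lparr>carrier := H\<rparr>" n \<eta>' using \<eta>' by unfold_locales
 have HG: "x \<in> carrier G" if "x \<in> H" for x using H that by (rule subgroup.mem_carrier)
 have "\<forall>f\<in>int_vecs n. \<exists>h. h \<in> H \<and> \<eta>' h = f" using C.\<eta>_surj by fastforce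
 then obtain z where z: "\<And>f. f \<in> int_vecs n \<Longrightarrow> z f \<in> H \<and> \<eta>' (z f) = f" by metis
 have z_add: "z (\<lambda>i. f i + g i) = z f \<otimes> z g" if "f \<in> int_vecs n" "g \<in> int_vecs n" for f g
  using z[of "\<lambda>i. f i + g i"] z[OF that(1)] z[OF that(2)] C.\<eta>_mult[of "z f" "z g"] that
   C.\<eta>_eq_iff[of "z (\<lambda>i. f i + g i)" "z f \<otimes> z g"] subgroup.m_closed[OF H] by auto
 have F: "\<eta> (z f) j = (\<Sum>k<n. f k * \<eta> (z (unit_vec k)) j)" if "f \<in> int_vecs n" for f j
  using that by (intro additive_int_vecs[of n "\<lambda>f. \<eta> (z f)"]) (use z z_add HG \<eta>_mult in auto)
 have ex: "\<exists>k::nat. k > 0 \<and> x [^] k \<in> H" if x: "x \<in> carrier G" for x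
 proof -
  \<comment> \<open>A basis of \<open>H\<close> followed by \<open>x\<close>: \<open>n + 1\<close>
    vectors with \<open>n\<close> entries. The coefficient of \<open>x\<close> in a relation is
    nonzero, since the basis itself is independent.\<close>
  let ?v = "\<lambda>i. if i < n then \<eta> (z (unit_vec i)) else \<eta> x"
  obtain c where c: "\<exists>i\<in>{..n}. c i \<noteq> 0" "\<forall>j<n. (\<Sum>i\<in>{..n}. c i * ?v i j) = 0"
   using integer_relation[of "{..n}" n ?v] by auto
  let ?f = "\<lambda>i. if i < n then c i else 0"
  have f: "?f \<in> int_vecs n" by (simp add: int_vecs_def)
  have "(\<Sum>i\<in>{..n}. c i * ?v i j) = (\<Sum>i<n. c i * ?v i j) + c n * \<eta> x j" for j
   by (simp add: lessThan_Suc_atMost[symmetric])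
  moreover have "(\<Sum>i<n. c i * ?v i j) = \<eta> (z ?f) j" for j
   unfolding F[OF f] by (intro sum.cong) auto
  ultimately have rel: "\<eta> (z ?f) j + c n * \<eta> x j = 0" for j
   using c(2) \<eta>_mem[OF x] \<eta>_mem[OF HG[OF conjunct1[OF z[OF f]]]] by (cases "j < n") (auto simp: int_vecs_def)
  have "c n \<noteq> 0"
  proof
   assume c0: "c n = 0"
   then have "\<eta> (z ?f) = \<eta> \<one>" using rel by (auto simp: \<eta>_one)
   then have "z ?f = \<one>" using z[OF f] HG by (simp add: \<eta>_eq_iff)
   then have "?f = (\<lambda>_. 0)" using z[OF f] C.\<eta>_one by simp
   then have "c i = 0" if "i < n" for i using that by (meson)
   then show False using c(1) c0 by (metis atMost_iff le_neq_implies_less)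
  qed
  define k where "k = nat \<bar>c n\<bar>"
  have k: "int k = \<bar>c n\<bar>" by (simp add: k_def)
  have "x [^] k \<in> H"
  proof (cases "c n > 0")
   case True
   then have "\<eta> (x [^] k) j = \<eta> (inv (z ?f)) j" for j
    using rel[of j] x z[OF f] HG k by (simp add: \<eta>_pow \<eta>_inv)
   then have "x [^] k = inv (z ?f)" using z[OF f] HG x by (simp add: \<eta>_eq_iff[symmetric] ext)
   then show ?thesis using z[OF f] subgroup.m_inv_closed[OF H] by auto
  next
   case False
   then have "\<eta> (x [^] k) j = \<eta> (z ?f) j" for j
    using rel[of j] x z[OF f] HG k by (simp add: \<eta>_pow)
   then have "x [^] k = z ?f" using z[OF f] HG x by (simp add: \<eta>_eq_iff[symmetric] ext)
   then show ?thesis using z[OF f] by auto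
  qed
  then show ?thesis using k \<open>c n \<noteq> 0\<close> by (intro exI[of _ k]) auto
 qed
 then obtain m where m: "\<And>x. x \<in> carrier G \<Longrightarrow> m x > 0 \<and> x [^] (m x :: nat) \<in> H" by metis
 obtain a where a: "\<And>f. f \<in> int_vecs n \<Longrightarrow> a f \<in> carrier G \<and> \<eta> (a f) = f" using \<eta>_surj by metis
 \<comment> \<open>The elements whose \<open>?k\<close>-th power lies in \<open>H\<close> form a
   lattice, and the product of the exponents of the unit vectors puts all of these into it.\<close>
 let ?k = "\<Prod>i<n. m (a (unit_vec i))"
 let ?B = "{f \<in> int_vecs n. a f [^] ?k \<in> H}"
 have powm: "(x \<otimes> inv y) [^] (k::nat) = x [^] k \<otimes> inv (y [^] k)" if "x \<in> carrier G" "y \<in> carrier G" for x y k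
  using that by (subst \<eta>_eq_iff[symmetric]) (auto simp: \<eta>_mult \<eta>_inv \<eta>_pow algebra_simps)
 have "?B = int_vecs n"
 proof (rule int_lattice_units)
  show "int_lattice n ?B"
   unfolding int_lattice_def
  proof (intro conjI ballI)
   have "a (\<lambda>_. 0) = \<one>" using a[of "\<lambda>_. 0"] \<eta>_eq_iff[of "a (\<lambda>_. 0)" \<one>] \<eta>_one by simp
   then show "(\<lambda>_. 0) \<in> ?B" using subgroup.one_closed[OF H] by simp
   fix f g assume fg: "f \<in> ?B" "g \<in> ?B"
   have "a (\<lambda>i. f i - g i) = a f \<otimes> inv (a g)"
    using fg a[of f] a[of g] a[of "\<lambda>i. f i - g i"] by (subst \<eta>_eq_iff[symmetric]) (auto simp: \<eta>_mult \<eta>_inv)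
   then show "(\<lambda>i. f i - g i) \<in> ?B"
    using fg a[of f] a[of g] powm subgroup.m_closed[OF H] subgroup.m_inv_closed[OF H] by auto
  qed auto
  fix k assume k: "k < n"
  then have "m (a (unit_vec k)) dvd ?k" by (intro dvd_prodI) auto
  then obtain d where d: "?k = m (a (unit_vec k)) * d" by (auto simp: dvd_def)
  have u: "a (unit_vec k) \<in> carrier G" using a k by simp
  then have "a (unit_vec k) [^] ?k = (a (unit_vec k) [^] m (a (unit_vec k))) [^] d" by (simp add: d nat_pow_pow)
  moreover have "x [^] (d::nat) \<in> H" if "x \<in> H" for x
   using that by (induction d) (auto simp: subgroup.one_closed[OF H] subgroup.m_closed[OF H])
  ultimately show "unit_vec k \<in> ?B" using k m[OF u] by simp
 qed
 moreover have "?k > 0" using m a by (intro prod_pos) auto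
 moreover have "x [^] ?k \<in> H" if x: "x \<in> carrier G" for x
 proof -
  have "\<eta> x \<in> ?B" using calculation(1) \<eta>_mem[OF x] by simp
  moreover have "a (\<eta> x) = x" using a[OF \<eta>_mem[OF x]] \<eta>_eq_iff[of "a (\<eta> x)" x] x by simp
  ultimately show ?thesis by simp
 qed
 ultimately show thesis using that by blast
qed

end

section \<open>Extending commensurations to rational vector spaces\<close>

definition rat_vecs :: "nat \<Rightarrow> (nat \<Rightarrow> rat) set" where
 "rat_vecs n = {f. \<forall>i\<ge>n. f i = 0}"

lemma rat_vecs_denominator:
 assumes "x \<in> rat_vecs n"
 obtains m :: nat and z where "m > 0" "z \<in> int_vecs n" "\<And>i. of_nat m * x i = of_int (z i)"
proof -
 define d where "d i = snd (quotient_of (x i))" for i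
 define m where "m = nat (\<Prod>i<n. d i)"
 have d: "d i > 0" for i using quotient_of_denom_pos[of "x i"] by (metis d_def prod.collapse)
 then have m: "int m = (\<Prod>i<n. d i)" by (simp add: m_def prod_nonneg less_imp_le)
 have "\<exists>z. of_nat m * x i = of_int z \<and> (i \<ge> n \<longrightarrow> z = 0)" for i
 proof (cases "i < n")
  case True
  then have "d i dvd int m" unfolding m by (intro dvd_prodI) auto
  then obtain c where c: "int m = d i * c" by (auto simp: dvd_def)
  have "x i = of_int (fst (quotient_of (x i))) / of_int (d i)"
   using quotient_of_div[of "x i"] by (simp add: d_def prod.collapse)
  then have "of_int (d i) * x i = of_int (fst (quotient_of (x i)))"
   using d[of i] by (metis less_irrefl nonzero_mult_div_cancel_left of_int_eq_0_iff times_divide_eq_right)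
  moreover have "of_nat m = (of_int c * of_int (d i) :: rat)"
   using arg_cong[OF c, of "of_int :: int \<Rightarrow> rat"] by simp
  ultimately have "of_nat m * x i = of_int (c * fst (quotient_of (x i)))" by simp
  then show ?thesis using True by (intro exI[of _ "c * fst (quotient_of (x i))"]) auto
 next
  case False
  then show ?thesis using assms by (auto simp: rat_vecs_def)
 qed
 then obtain z where "\<And>i. of_nat m * x i = of_int (z i) \<and> (i \<ge> n \<longrightarrow> z i = 0)" by metis
 moreover have "m > 0" using m d by (metis of_nat_0_less_iff prod_pos)
 ultimately show thesis using that by (auto simp: int_vecs_def)
qed

text \<open>An isomorphism between finite-index subgroups extends to the rational space: clear
  denominators, move into \<open>H\<close> by a power, apply \<psi> and divide back. The exponents
  \<open>k\<close> and \<open>l\<close> give totality and surjectivity. Additivity is all that is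
  recorded, since only translations have to be transported.\<close>

lemma commensuration_extends:
 assumes A: "coordinate_group A n \<eta>" and B: "coordinate_group B n \<theta>"
  and H: "subgroup H A" and \<psi>H: "subgroup (\<psi> ` H) B"
  and hom: "\<And>x y. x \<in> H \<Longrightarrow> y \<in> H \<Longrightarrow> \<psi> (x \<otimes>\<^bsub>A\<^esub> y) = \<psi> x \<otimes>\<^bsub>B\<^esub> \<psi> y" and inj: "inj_on \<psi> H"
  and powA: "k > 0" "\<And>x. x \<in> carrier A \<Longrightarrow> x [^]\<^bsub>A\<^esub> (k::nat) \<in> H"
  and powB: "l > 0" "\<And>x. x \<in> carrier B \<Longrightarrow> x [^]\<^bsub>B\<^esub> (l::nat) \<in> \<psi> ` H"
 obtains s where "bij_betw s (rat_vecs n) (rat_vecs n)"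
  "\<And>x y. x \<in> rat_vecs n \<Longrightarrow> y \<in> rat_vecs n \<Longrightarrow> s (\<lambda>i. x i + y i) = (\<lambda>i. s x i + s y i)"
  "\<And>h. h \<in> H \<Longrightarrow> s (\<lambda>i. of_int (\<eta> h i)) = (\<lambda>i. of_int (\<theta> (\<psi> h) i))"
proof -
 interpret A: coordinate_group A n \<eta> by fact
 interpret B: coordinate_group B n \<theta> by fact
 have HA: "h \<in> carrier A" "\<psi> h \<in> carrier B" if "h \<in> H" for h
  using that subgroup.mem_carrier[OF H] subgroup.mem_carrier[OF \<psi>H] by auto
 have Hpow: "h [^]\<^bsub>A\<^esub> (m::nat) \<in> H \<and> \<psi> (h [^]\<^bsub>A\<^esub> m) = \<psi> h [^]\<^bsub>B\<^esub> m" if "h \<in> H" for h m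
 proof (induction m)
  case 0
  have one: "\<one>\<^bsub>A\<^esub> \<in> H" using subgroup.one_closed[OF H] .
  then have "\<psi> \<one>\<^bsub>A\<^esub> = \<psi> \<one>\<^bsub>A\<^esub> \<otimes>\<^bsub>B\<^esub> \<psi> \<one>\<^bsub>A\<^esub>" using hom[of "\<one>\<^bsub>A\<^esub>" "\<one>\<^bsub>A\<^esub>"] by simp
  then show ?case using one HA(2)[OF one] by (simp add: B.l_cancel_one')
 next
  case (Suc m)
  then show ?case using that hom subgroup.m_closed[OF H] by simp
 qed
 \<comment> \<open>The element \<open>h\<close> represents \<open>m\<close> times the vector
   \<open>x\<close>. Two representations are compared by cross-multiplication, so that the choice in
   \<open>s\<close> does not matter.\<close>
 define P where "P x m h \<longleftrightarrow> m > 0 \<and> h \<in> H \<and> (\<forall>i. of_nat m * x i = of_int (\<eta> h i))" for x :: "nat \<Rightarrow> rat" and m h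
 have ex: "\<exists>m h. P x m h" if x: "x \<in> rat_vecs n" for x
 proof -
  obtain m z where mz: "m > 0" "z \<in> int_vecs n" "\<And>i. of_nat m * x i = of_int (z i)"
   using rat_vecs_denominator[OF x] by blast
  obtain a where a: "a \<in> carrier A" "\<eta> a = z" using A.\<eta>_surj mz by blast
  have "of_nat (m * k) * x i = of_int (\<eta> (a [^]\<^bsub>A\<^esub> k) i)" for i
   using mz(3)[of i] a by (simp add: A.\<eta>_pow mult.commute mult.left_commute)
  then show ?thesis using powA mz a unfolding P_def by (metis mult_pos_pos)
 qed
 have unique: "of_nat m' * \<theta>r i = of_nat m * \<theta>r' i"
  if "P x m h" "P x m' h'" "\<theta>r = (\<lambda>i. of_int (\<theta> (\<psi> h) i))" "\<theta>r' = (\<lambda>i. of_int (\<theta> (\<psi> h') i))"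
  for x m h m' h' i and \<theta>r \<theta>r' :: "nat \<Rightarrow> rat"
 proof -
  have "of_int (\<eta> (h [^]\<^bsub>A\<^esub> m') i) = (of_int (\<eta> (h' [^]\<^bsub>A\<^esub> m) i) :: rat)" for i
   using that(1,2) HA unfolding P_def by (simp add: A.\<eta>_pow) (metis mult.left_commute)
  then have "h [^]\<^bsub>A\<^esub> m' = h' [^]\<^bsub>A\<^esub> m"
   using that(1,2) HA A.\<eta>_eq_iff unfolding P_def by (metis A.nat_pow_closed ext of_int_eq_iff)
  then have "\<psi> h [^]\<^bsub>B\<^esub> m' = \<psi> h' [^]\<^bsub>B\<^esub> m" using Hpow that(1,2) unfolding P_def by metis
  then have "\<theta> (\<psi> h [^]\<^bsub>B\<^esub> m') i = \<theta> (\<psi> h' [^]\<^bsub>B\<^esub> m) i" by simp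
  then show ?thesis using that HA unfolding P_def by (simp add: B.\<eta>_pow) (metis of_int_mult of_int_of_nat_eq)
 qed
 define s where "s x = (let (m, h) = (SOME (m, h). P x m h) in (\<lambda>i. of_int (\<theta> (\<psi> h) i) / of_nat m :: rat))" for x
 have s: "s x = (\<lambda>i. of_int (\<theta> (\<psi> h) i) / of_nat m)" if p: "P x m h" for x m h
 proof -
  obtain m' h' where e: "(SOME (m, h). P x m h) = (m', h')" by (cases "SOME (m, h). P x m h")
  have "P x m' h'" using someI[of "\<lambda>(m, h). P x m h" "(m, h)"] p e by auto
  from unique[OF p this HOL.refl HOL.refl] have "of_int (\<theta> (\<psi> h') i) / of_nat m' = (of_int (\<theta> (\<psi> h) i) / of_nat m :: rat)" for i
   using p \<open>P x m' h'\<close> by (simp add: P_def field_simps)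
  then show ?thesis by (simp add: s_def e)
 qed
 have s_mem: "s x \<in> rat_vecs n" if x: "x \<in> rat_vecs n" for x
 proof -
  obtain m h where p: "P x m h" using ex[OF x] by blast
  then show ?thesis using s[OF p] B.\<eta>_mem[OF HA(2), of h] by (auto simp: P_def rat_vecs_def int_vecs_def)
 qed
 show thesis
 proof (rule that[of s])
  show "s (\<lambda>i. x i + y i) = (\<lambda>i. s x i + s y i)" if xy: "x \<in> rat_vecs n" "y \<in> rat_vecs n" for x y
  proof -
   obtain m h m' h' where p: "P x m h" "P y m' h'" using ex[OF xy(1)] ex[OF xy(2)] by blast
   let ?g = "h [^]\<^bsub>A\<^esub> m' \<otimes>\<^bsub>A\<^esub> h' [^]\<^bsub>A\<^esub> m"
   have m: "m > 0" "m' > 0" "h \<in> H" "h' \<in> H" using p by (auto simp: P_def)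
   have "of_nat (m * m') * (x i + y i) = of_int (\<eta> ?g i)" for i
   proof -
    have "of_nat (m * m') * (x i + y i) = of_nat m' * (of_nat m * x i) + of_nat m * (of_nat m' * y i)"
     by (simp add: algebra_simps)
    then show ?thesis using p m HA by (simp add: P_def A.\<eta>_mult A.\<eta>_pow)
   qed
   then have "P (\<lambda>i. x i + y i) (m * m') ?g"
    using m Hpow subgroup.m_closed[OF H] by (simp add: P_def)
   from s[OF this] show ?thesis
    unfolding s[OF p(1)] s[OF p(2)]
    using m Hpow hom HA by (simp add: B.\<eta>_mult B.\<eta>_pow add_divide_distrib)
  qed
  show "s (\<lambda>i. of_int (\<eta> h i)) = (\<lambda>i. of_int (\<theta> (\<psi> h) i))" if "h \<in> H" for h
   using s[of "\<lambda>i. of_int (\<eta> h i)" 1 h] that by (simp add: P_def)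
  show "bij_betw s (rat_vecs n) (rat_vecs n)"
   unfolding bij_betw_def
  proof
   show "inj_on s (rat_vecs n)"
   proof (rule inj_onI)
    fix x y assume xy: "x \<in> rat_vecs n" "y \<in> rat_vecs n" and eq: "s x = s y"
    obtain m h m' h' where p: "P x m h" "P y m' h'" using ex[OF xy(1)] ex[OF xy(2)] by blast
    have m: "m > 0" "m' > 0" "h \<in> H" "h' \<in> H" using p by (auto simp: P_def)
    have "of_int (\<theta> (\<psi> h) i) / of_nat m = (of_int (\<theta> (\<psi> h') i) / of_nat m' :: rat)" for i
     using eq s[OF p(1)] s[OF p(2)] by metis
    then have "of_int (int m' * \<theta> (\<psi> h) i) = (of_int (int m * \<theta> (\<psi> h') i) :: rat)" for i
     using m by (simp add: field_simps)
    then have "\<theta> (\<psi> h [^]\<^bsub>B\<^esub> m') = \<theta> (\<psi> h' [^]\<^bsub>B\<^esub> m)"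
     using m HA by (simp add: B.\<eta>_pow fun_eq_iff del: of_int_mult)
    then have "\<psi> h [^]\<^bsub>B\<^esub> m' = \<psi> h' [^]\<^bsub>B\<^esub> m" using m HA by (simp add: B.\<eta>_eq_iff)
    then have "h [^]\<^bsub>A\<^esub> m' = h' [^]\<^bsub>A\<^esub> m" using Hpow m inj by (metis inj_onD)
    then have "of_int (\<eta> (h [^]\<^bsub>A\<^esub> m') i) = (of_int (\<eta> (h' [^]\<^bsub>A\<^esub> m) i) :: rat)" for i by simp
    then have "of_nat m' * (of_nat m * x i) = of_nat m * (of_nat m' * y i)" for i
     using p m HA by (simp add: P_def A.\<eta>_pow)
    then show "x = y" using m by (auto simp: fun_eq_iff)
   qed
   show "s ` rat_vecs n = rat_vecs n"
   proof
    show "s ` rat_vecs n \<subseteq> rat_vecs n" using s_mem by blast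
    show "rat_vecs n \<subseteq> s ` rat_vecs n"
    proof
     fix y assume "y \<in> rat_vecs n"
     then obtain m z where mz: "m > 0" "z \<in> int_vecs n" "\<And>i. of_nat m * y i = of_int (z i)"
      using rat_vecs_denominator by blast
     obtain b where b: "b \<in> carrier B" "\<theta> b = z" using B.\<eta>_surj mz by blast
     obtain h where h: "h \<in> H" "b [^]\<^bsub>B\<^esub> l = \<psi> h" using powB b by blast
     let ?x = "\<lambda>i. of_int (\<eta> h i) / of_nat (m * l) :: rat"
     have "P ?x (m * l) h" using h mz powB by (simp add: P_def)
     from s[OF this] have "s ?x = (\<lambda>i. of_int (\<theta> (b [^]\<^bsub>B\<^esub> l) i) / of_nat (m * l))" by (simp add: h)
     also have "\<dots> = y"
     proof
      fix i
      have "of_int (\<theta> (b [^]\<^bsub>B\<^esub> l) i) = of_nat l * (of_nat m * y i)" using b mz by (simp add: B.\<eta>_pow)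
      then show "of_int (\<theta> (b [^]\<^bsub>B\<^esub> l) i) / of_nat (m * l) = y i" using mz(1) powB(1) by simp
     qed
     finally have "s ?x = y" .
     moreover have "?x \<in> rat_vecs n" using A.\<eta>_mem[OF HA(1)[OF h(1)]] by (auto simp: rat_vecs_def int_vecs_def)
     ultimately show "y \<in> s ` rat_vecs n" by blast
    qed
   qed
  qed
 qed
qed

section \<open>Affine action on a rational vector space\<close>

locale lattice_graph_of_groups = based_graph_of_groups X Gv Ge \<phi> T r j q \<gamma>
 for X :: "('v, 'e) pre_digraph" and Gv :: "'v \<Rightarrow> 'g monoid" and Ge \<phi> T r j q \<gamma> +
 fixes n :: nat and \<eta> :: "'v \<Rightarrow> 'g \<Rightarrow> nat \<Rightarrow> int"
 assumes coordinates_Gv: "v \<in> verts X \<Longrightarrow> coordinates (Gv v) n (\<eta> v)"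
  and Ge_pow: "e \<in> arcs X \<Longrightarrow> \<exists>k::nat. k > 0 \<and> (\<forall>x\<in>carrier (Gv (tail X e)). x [^]\<^bsub>Gv (tail X e)\<^esub> k \<in> Ge e)"
  and image_pow: "e \<in> arcs X \<Longrightarrow> \<exists>k::nat. k > 0 \<and> (\<forall>x\<in>carrier (Gv (head X e)). x [^]\<^bsub>Gv (head X e)\<^esub> k \<in> \<phi> e ` Ge e)"
  and Ge_proper: "e \<in> arcs X \<Longrightarrow> Ge e \<subset> carrier (Gv (tail X e))"
  and image_proper: "e \<in> arcs X \<Longrightarrow> \<phi> e ` Ge e \<subset> carrier (Gv (head X e))"
begin

lemma coordinate_group_Gv: "v \<in> verts X \<Longrightarrow> coordinate_group (Gv v) n (\<eta> v)"
 using coordinates_Gv group_Gv by (simp add: coordinate_group_def coordinate_group_axioms_def)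

abbreviation translation :: "(nat \<Rightarrow> int) \<Rightarrow> (nat \<Rightarrow> rat) \<Rightarrow> nat \<Rightarrow> rat" where
 "translation f \<equiv> (\<lambda>x\<in>rat_vecs n. \<lambda>i. x i + of_int (f i))"

lemma translation_Bij:
 assumes "f \<in> int_vecs n"
 shows "translation f \<in> Bij (rat_vecs n)"
proof -
 have "bij_betw (\<lambda>x i. x i + of_int (f i)) (rat_vecs n) (rat_vecs n)"
  by (rule bij_betw_byWitness[where f' = "\<lambda>x i. x i - of_int (f i)"])
   (use assms in \<open>auto simp: rat_vecs_def int_vecs_def\<close>)
 then show ?thesis unfolding Bij_def by (simp cong: bij_betw_cong)
qed

text \<open>The vertex groups act on \<open>\<rat>\<^sup>n\<close> by translations and the stable letters by the linear extensions
 of the maps \<open>\<phi>\<^sub>e\<close>.\<close>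

lemma affine_representation:
 obtains \<Theta> s where "\<Theta> \<in> hom UG (BijGroup (rat_vecs n))"
  "\<And>v g. v \<in> verts X \<Longrightarrow> g \<in> carrier (Gv v) \<Longrightarrow> \<Theta> (vel v g) = translation (\<eta> v g)"
  "\<And>e. e \<in> arcs X \<Longrightarrow> \<Theta> (stl e) = restrict (s e) (rat_vecs n)"
  "\<And>e x y. e \<in> arcs X \<Longrightarrow> x \<in> rat_vecs n \<Longrightarrow> y \<in> rat_vecs n \<Longrightarrow> s e (\<lambda>i. x i + y i) = (\<lambda>i. s e x i + s e y i)"
  "\<And>e. e \<in> arcs X \<Longrightarrow> bij_betw (s e) (rat_vecs n) (rat_vecs n)"
proof -
 let ?V = "rat_vecs n"
 have "\<forall>e\<in>arcs X. \<exists>s. bij_betw s ?V ?V \<and>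
  (\<forall>x\<in>?V. \<forall>y\<in>?V. s (\<lambda>i. x i + y i) = (\<lambda>i. s x i + s y i)) \<and>
  (\<forall>h\<in>Ge e. s (\<lambda>i. of_int (\<eta> (tail X e) h i)) = (\<lambda>i. of_int (\<eta> (head X e) (\<phi> e h) i)))"
 proof
  fix e assume e: "e \<in> arcs X"
  obtain k l :: nat where k: "k > 0" "\<And>x. x \<in> carrier (Gv (tail X e)) \<Longrightarrow> x [^]\<^bsub>Gv (tail X e)\<^esub> k \<in> Ge e"
    and l: "l > 0" "\<And>x. x \<in> carrier (Gv (head X e)) \<Longrightarrow> x [^]\<^bsub>Gv (head X e)\<^esub> l \<in> \<phi> e ` Ge e"
   using Ge_pow[OF e] image_pow[OF e] by blast
  have ends: "tail X e \<in> verts X" "head X e \<in> verts X" using e by auto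
  show "\<exists>s. bij_betw s ?V ?V \<and>
    (\<forall>x\<in>?V. \<forall>y\<in>?V. s (\<lambda>i. x i + y i) = (\<lambda>i. s x i + s y i)) \<and>
    (\<forall>h\<in>Ge e. s (\<lambda>i. of_int (\<eta> (tail X e) h i)) = (\<lambda>i. of_int (\<eta> (head X e) (\<phi> e h) i)))"
  proof (rule commensuration_extends[OF coordinate_group_Gv[OF ends(1)] coordinate_group_Gv[OF ends(2)]
     subgroup_Ge[OF e] subgroup_image[OF e] phi_mult[OF e] phi_inj[OF e] k l])
   fix s assume "bij_betw s ?V ?V"
    "\<And>x y. x \<in> ?V \<Longrightarrow> y \<in> ?V \<Longrightarrow> s (\<lambda>i. x i + y i) = (\<lambda>i. s x i + s y i)"
    "\<And>h. h \<in> Ge e \<Longrightarrow> s (\<lambda>i. of_int (\<eta> (tail X e) h i)) = (\<lambda>i. of_int (\<eta> (head X e) (\<phi> e h) i))"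
   then show ?thesis by blast
  qed
 qed
 from bchoice[OF this] obtain s where s0: "\<forall>e\<in>arcs X. bij_betw (s e) ?V ?V \<and>
  (\<forall>x\<in>?V. \<forall>y\<in>?V. s e (\<lambda>i. x i + y i) = (\<lambda>i. s e x i + s e y i)) \<and>
  (\<forall>h\<in>Ge e. s e (\<lambda>i. of_int (\<eta> (tail X e) h i)) = (\<lambda>i. of_int (\<eta> (head X e) (\<phi> e h) i)))" ..
 have s: "bij_betw (s e) ?V ?V" "x \<in> ?V \<Longrightarrow> y \<in> ?V \<Longrightarrow> s e (\<lambda>i. x i + y i) = (\<lambda>i. s e x i + s e y i)"
   "h \<in> Ge e \<Longrightarrow> s e (\<lambda>i. of_int (\<eta> (tail X e) h i)) = (\<lambda>i. of_int (\<eta> (head X e) (\<phi> e h) i))"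
  if "e \<in> arcs X" for e x y h
  using bspec[OF s0 that] by blast+
 have \<eta>V: "\<eta> v g \<in> int_vecs n" "(\<lambda>i. of_int (\<eta> v g i)) \<in> ?V" if "v \<in> verts X" "g \<in> carrier (Gv v)" for v g
  using coordinate_group.\<eta>_mem[OF coordinate_group_Gv[OF that(1)] that(2)] by (auto simp: rat_vecs_def int_vecs_def)
 have plusV: "(\<lambda>i. x i + y i) \<in> ?V" if "x \<in> ?V" "y \<in> ?V" for x y using that by (auto simp: rat_vecs_def)
 have sB: "restrict (s e) ?V \<in> Bij ?V" if "e \<in> arcs X" for e
  using s(1)[OF that] unfolding Bij_def by (simp cong: bij_betw_cong)
 have sV: "s e x \<in> ?V" if "e \<in> arcs X" "x \<in> ?V" for e x using bij_betw_apply[OF s(1)[OF that(1)] that(2)] .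
 have mult: "f \<otimes>\<^bsub>BijGroup ?V\<^esub> g = (\<lambda>x\<in>?V. f (g x))" if "f \<in> Bij ?V" "g \<in> Bij ?V" for f g
  using that by (simp add: BijGroup_def compose_def)
 obtain \<Theta> where "\<Theta> \<in> hom UG (BijGroup ?V)"
  "\<And>v g. v \<in> verts X \<Longrightarrow> g \<in> carrier (Gv v) \<Longrightarrow> \<Theta> (vel v g) = translation (\<eta> v g)"
  "\<And>e. e \<in> arcs X \<Longrightarrow> \<Theta> (stl e) = restrict (s e) ?V"
 proof (rule FG_hom[OF group_BijGroup, of "\<lambda>v g. translation (\<eta> v g)" ?V "\<lambda>e. restrict (s e) ?V" "X\<lparr>arcs := {}\<rparr>"])
  show "(\<lambda>g. translation (\<eta> v g)) \<in> hom (Gv v) (BijGroup ?V)" if v: "v \<in> verts X" for v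
  proof (rule homI)
   interpret coordinate_group "Gv v" n "\<eta> v" using coordinate_group_Gv[OF v] .
   fix x assume x: "x \<in> carrier (Gv v)"
   then show "translation (\<eta> v x) \<in> carrier (BijGroup ?V)" using translation_Bij \<eta>V[OF v] by (simp add: BijGroup_def)
   fix y assume y: "y \<in> carrier (Gv v)"
   show "translation (\<eta> v (x \<otimes>\<^bsub>Gv v\<^esub> y)) = translation (\<eta> v x) \<otimes>\<^bsub>BijGroup ?V\<^esub> translation (\<eta> v y)"
    using mult[OF translation_Bij translation_Bij, OF \<eta>V(1)[OF v x] \<eta>V(1)[OF v y]] plusV[OF _ \<eta>V(2)[OF v y]] x y
    by (simp add: \<eta>_mult add.assoc add.commute[of "of_int (\<eta> v x _)"] cong: restrict_cong)
  qed
  show "restrict (s e) ?V \<otimes>\<^bsub>BijGroup ?V\<^esub> translation (\<eta> (tail X e) g)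
    = translation (\<eta> (head X e) (\<phi> e g)) \<otimes>\<^bsub>BijGroup ?V\<^esub> restrict (s e) ?V" if e: "e \<in> arcs X" "g \<in> Ge e" for e g
  proof -
   have c: "\<eta> (tail X e) g \<in> int_vecs n" "(\<lambda>i. of_int (\<eta> (tail X e) g i)) \<in> ?V" "\<eta> (head X e) (\<phi> e g) \<in> int_vecs n"
    using e by (auto intro!: \<eta>V)
   have "s e (\<lambda>i. x i + of_int (\<eta> (tail X e) g i)) = (\<lambda>i. s e x i + of_int (\<eta> (head X e) (\<phi> e g) i))" if "x \<in> ?V" for x
    using s(2)[OF e(1) that c(2)] s(3)[OF e] by simp
   then show ?thesis
    using plusV[OF _ c(2)] sV[OF e(1)] mult[OF sB[OF e(1)] translation_Bij[OF c(1)]] mult[OF translation_Bij[OF c(3)] sB[OF e(1)]]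
    by (simp cong: restrict_cong)
  qed
 qed (use sB in \<open>auto simp: BijGroup_def\<close>)
 then show thesis using that[of \<Theta> s] s by blast
qed

text \<open>Vertex groups embed because different elements translate the origin to different
  points.\<close>

lemma vel_inj:
 assumes v: "v \<in> verts X" "g \<in> carrier (Gv v)" "h \<in> carrier (Gv v)" "vel v g = vel v h"
 shows "g = h"
proof (rule affine_representation)
 fix \<Theta> s assume \<Theta>: "\<Theta> \<in> hom UG (BijGroup (rat_vecs n))"
  "\<And>v g. v \<in> verts X \<Longrightarrow> g \<in> carrier (Gv v) \<Longrightarrow> \<Theta> (vel v g) = translation (\<eta> v g)"
  "\<And>e. e \<in> arcs X \<Longrightarrow> \<Theta> (stl e) = restrict (s e) (rat_vecs n)"
  "\<And>e x y. e \<in> arcs X \<Longrightarrow> x \<in> rat_vecs n \<Longrightarrow> y \<in> rat_vecs n \<Longrightarrow> s e (\<lambda>i. x i + y i) = (\<lambda>i. s e x i + s e y i)"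
  "\<And>e. e \<in> arcs X \<Longrightarrow> bij_betw (s e) (rat_vecs n) (rat_vecs n)"
 have "translation (\<eta> v g) = translation (\<eta> v h)" using arg_cong[OF v(4), of \<Theta>] by (simp only: \<Theta>(2)[OF v(1,2)] \<Theta>(2)[OF v(1,3)])
 then have "translation (\<eta> v g) (\<lambda>_. 0) i = translation (\<eta> v h) (\<lambda>_. 0) i" for i by simp
 then have "\<eta> v g = \<eta> v h" by (simp add: rat_vecs_def fun_eq_iff)
 then show ?thesis using coordinate_group.\<eta>_eq_iff[OF coordinate_group_Gv[OF v(1)] v(2,3)] by simp
qed

lemma vertex_elem_inj:
 assumes v: "v \<in> verts X" "g \<in> carrier (Gv v)" "h \<in> carrier (Gv v)" "vertex_elem T v g = vertex_elem T v h"
 shows "g = h"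
proof -
 have "\<gamma> v \<otimes>\<^bsub>UG\<^esub> vel v g \<otimes>\<^bsub>UG\<^esub> inv\<^bsub>UG\<^esub> \<gamma> v = \<gamma> v \<otimes>\<^bsub>UG\<^esub> vel v h \<otimes>\<^bsub>UG\<^esub> inv\<^bsub>UG\<^esub> \<gamma> v"
  using v j_vertex by metis
 then have "vel v g = vel v h" using v by simp
 then show ?thesis using vel_inj v by blast
qed

text \<open>The word \<open>[t a t\<inverse>, b]\<close> reads off the labels of the coset of \<open>t\<inverse> b\<inverse>\<close> with total \<open>-1\<close> or \<open>-2\<close>.\<close>

lemma commutator_ne_one:
 assumes e: "e \<in> arcs X" and a: "a \<in> carrier (Gv (tail X e))" "a \<notin> Ge e"
  and b: "b \<in> carrier (Gv (head X e))" "b \<notin> \<phi> e ` Ge e"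
 shows "stl e \<otimes>\<^bsub>UG\<^esub> (vel (tail X e) a \<otimes>\<^bsub>UG\<^esub> (inv\<^bsub>UG\<^esub> stl e \<otimes>\<^bsub>UG\<^esub> (vel (head X e) b \<otimes>\<^bsub>UG\<^esub>
  (stl e \<otimes>\<^bsub>UG\<^esub> (inv\<^bsub>UG\<^esub> vel (tail X e) a \<otimes>\<^bsub>UG\<^esub> (inv\<^bsub>UG\<^esub> stl e \<otimes>\<^bsub>UG\<^esub> inv\<^bsub>UG\<^esub> vel (head X e) b)))))) \<noteq> \<one>\<^bsub>UG\<^esub>"
  (is "?w \<noteq> _")
proof (rule affine_representation)
 let ?V = "rat_vecs n" and ?o = "tail X e" and ?\<tau> = "head X e"
 fix \<Theta> s assume \<Theta>: "\<Theta> \<in> hom UG (BijGroup (rat_vecs n))"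
  "\<And>v g. v \<in> verts X \<Longrightarrow> g \<in> carrier (Gv v) \<Longrightarrow> \<Theta> (vel v g) = translation (\<eta> v g)"
  "\<And>e. e \<in> arcs X \<Longrightarrow> \<Theta> (stl e) = restrict (s e) (rat_vecs n)"
  "\<And>e x y. e \<in> arcs X \<Longrightarrow> x \<in> rat_vecs n \<Longrightarrow> y \<in> rat_vecs n \<Longrightarrow> s e (\<lambda>i. x i + y i) = (\<lambda>i. s e x i + s e y i)"
  "\<And>e. e \<in> arcs X \<Longrightarrow> bij_betw (s e) (rat_vecs n) (rat_vecs n)"
 let ?S = "BijGroup ?V"
 interpret S: group ?S by (rule group_BijGroup)
 interpret \<Theta>: group_hom UG ?S \<Theta> using \<Theta>(1) by unfold_locales
 interpret Vo: group_hom "Gv ?o" UG "vel ?o" using e by (intro vertex_elem_group_hom) simp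
 interpret V\<tau>: group_hom "Gv ?\<tau>" UG "vel ?\<tau>" using e by (intro vertex_elem_group_hom) simp
 define \<alpha> \<beta> t where "\<alpha> = \<Theta> (vel ?o a)" and "\<beta> = \<Theta> (vel ?\<tau> b)" and "t = \<Theta> (stl e)"
 have c: "vel ?o a \<in> carrier UG" "vel ?\<tau> b \<in> carrier UG" "stl e \<in> carrier UG" using e a b by auto
 then have c': "\<alpha> \<in> carrier ?S" "\<beta> \<in> carrier ?S" "t \<in> carrier ?S" by (auto simp: \<alpha>_def \<beta>_def t_def)
 let ?C = "(\<lambda>g. \<Theta> (vel ?o g)) ` Ge e"
 have C: "subgroup ?C ?S"
 proof -
  interpret h: group_hom "Gv ?o" ?S "\<lambda>g. \<Theta> (vel ?o g)"
   by unfold_locales (auto simp: hom_def vertex_elem_mult e)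
  show ?thesis using subgroup_Ge[OF e] by (rule h.subgroup_img_is_subgroup)
 qed
 have Tinj: "g = h" if "v \<in> verts X" "g \<in> carrier (Gv v)" "h \<in> carrier (Gv v)" "\<Theta> (vel v g) = \<Theta> (vel v h)" for v g h
 proof -
  have "translation (\<eta> v g) = translation (\<eta> v h)"
   using that(4) by (simp only: \<Theta>(2)[OF that(1,2)] \<Theta>(2)[OF that(1,3)])
  then have "translation (\<eta> v g) (\<lambda>_. 0) i = translation (\<eta> v h) (\<lambda>_. 0) i" for i by simp
  then have "\<eta> v g = \<eta> v h" by (simp add: rat_vecs_def fun_eq_iff)
  then show ?thesis using coordinate_group.\<eta>_eq_iff[OF coordinate_group_Gv[OF that(1)] that(2,3)] by simp
 qed
 \<comment> \<open>The position reached after the last two letters of the word, read from the right: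
   first \<open>b\<close> inverse, then \<open>t\<close> inverse.\<close>
 define p0 where "p0 = inv\<^bsub>?S\<^esub> t \<otimes>\<^bsub>?S\<^esub> inv\<^bsub>?S\<^esub> \<beta>"
 have p0: "p0 \<in> carrier ?S" using c' by (simp add: p0_def)
 \<comment> \<open>Counts crossings of \<open>e\<close> that start in the single coset of
   \<open>p0\<close> and gives every other arc the label zero. Labels are indispensable: the affine
   group itself does not see the commutator, because there both entries are translations.\<close>
 define k where "k e' p = (if e' = e \<and> p \<in> ?C #>\<^bsub>?S\<^esub> p0 then 1 else 0 :: int)" for e' p
 have kC: "k e p = (if p \<otimes>\<^bsub>?S\<^esub> inv\<^bsub>?S\<^esub> p0 \<in> ?C then 1 else 0)" if "p \<in> carrier ?S" for p
  using S.mem_rcos_iff[OF C p0 that] by (simp add: k_def)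
 obtain l where l: "cocycle UG (carrier ?S) integer_group (\<lambda>x p. \<Theta> x \<otimes>\<^bsub>?S\<^esub> p) l"
  "\<And>v g p. v \<in> verts X \<Longrightarrow> g \<in> carrier (Gv v) \<Longrightarrow> p \<in> carrier ?S \<Longrightarrow> l (vel v g) p = \<one>\<^bsub>integer_group\<^esub>"
  "\<And>e p. e \<in> arcs X \<Longrightarrow> p \<in> carrier ?S \<Longrightarrow> l (stl e) p = k e p"
 proof (rule UG_cocycle[OF S.group_axioms group_integer_group \<Theta>(1), of k])
  fix e' g p assume e': "e' \<in> arcs X" "g \<in> Ge e'" "p \<in> carrier ?S"
  show "k e' (\<Theta> (vel (tail X e') g) \<otimes>\<^bsub>?S\<^esub> p) = k e' p"
  proof (cases "e' = e")
   case True
   let ?g = "\<Theta> (vel ?o g)"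
   have g: "?g \<in> ?C" "?g \<in> carrier ?S" using e' True by auto
   have "?g \<otimes>\<^bsub>?S\<^esub> p \<otimes>\<^bsub>?S\<^esub> inv\<^bsub>?S\<^esub> p0 = ?g \<otimes>\<^bsub>?S\<^esub> (p \<otimes>\<^bsub>?S\<^esub> inv\<^bsub>?S\<^esub> p0)"
    using g e' p0 by (simp add: S.m_assoc)
   moreover have "?g \<otimes>\<^bsub>?S\<^esub> y \<in> ?C \<longleftrightarrow> y \<in> ?C" if "y \<in> carrier ?S" for y
   proof
    assume "?g \<otimes>\<^bsub>?S\<^esub> y \<in> ?C"
    then have "inv\<^bsub>?S\<^esub> ?g \<otimes>\<^bsub>?S\<^esub> (?g \<otimes>\<^bsub>?S\<^esub> y) \<in> ?C" using g C by (simp add: subgroup.m_closed subgroup.m_inv_closed)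
    then show "y \<in> ?C" using g that by (simp add: S.m_assoc[symmetric])
   qed (use g C in \<open>simp add: subgroup.m_closed\<close>)
   ultimately show ?thesis using True e' g p0 kC by simp
  qed (simp add: k_def)
 qed auto
 note cc = cocycleD[OF l(1)] and ci = cocycle_inv[OF l(1) _ group_integer_group U.group_axioms]
 have la: "l (inv\<^bsub>UG\<^esub> vel ?o a) p = 0" if "p \<in> carrier ?S" for p
  using l(2)[of ?o "inv\<^bsub>Gv ?o\<^esub> a" p] a e that by simp
 have lb: "l (inv\<^bsub>UG\<^esub> vel ?\<tau> b) p = 0" if "p \<in> carrier ?S" for p
  using l(2)[of ?\<tau> "inv\<^bsub>Gv ?\<tau>\<^esub> b" p] b e that by simp
 have lt: "l (inv\<^bsub>UG\<^esub> stl e) p = - k e (inv\<^bsub>?S\<^esub> t \<otimes>\<^bsub>?S\<^esub> p)" if "p \<in> carrier ?S" for p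
 proof -
  have "\<Theta> (inv\<^bsub>UG\<^esub> stl e) = inv\<^bsub>?S\<^esub> t" using \<Theta>.hom_inv[OF c(3)] by (simp add: t_def)
  then show ?thesis using ci(1)[OF that c(3)] that c' l(3)[OF e, of "inv\<^bsub>?S\<^esub> t \<otimes>\<^bsub>?S\<^esub> p"] by simp
 qed
 let ?p = "inv\<^bsub>?S\<^esub> \<alpha> \<otimes>\<^bsub>?S\<^esub> p0"
 let ?q = "inv\<^bsub>?S\<^esub> t \<otimes>\<^bsub>?S\<^esub> (\<beta> \<otimes>\<^bsub>?S\<^esub> (t \<otimes>\<^bsub>?S\<^esub> ?p))"
 \<comment> \<open>The four letters \<open>t\<close> or its inverse, read from the right, contribute
   at \<open>p0\<close>, \<open>?p\<close>, \<open>?q\<close> and finally at \<alpha> times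
   \<open>?q\<close>. A crossing against the arc counts negatively and is indexed by the position at
   its tail.\<close>
 have lw: "l ?w \<one>\<^bsub>?S\<^esub> = k e (\<alpha> \<otimes>\<^bsub>?S\<^esub> ?q) - k e ?q + k e ?p - k e p0"
  using c c' e a b la lb lt l(2,3) p0 by (simp add: cc \<alpha>_def[symmetric] \<beta>_def[symmetric] t_def[symmetric] p0_def[symmetric])
 have 1: "k e p0 = 1" using kC[OF p0] p0 subgroup.one_closed[OF C] by simp
 have aC: "\<alpha> \<notin> ?C"
 proof
  assume "\<alpha> \<in> ?C"
  then obtain g where "g \<in> Ge e" "\<Theta> (vel ?o a) = \<Theta> (vel ?o g)" by (auto simp: \<alpha>_def)
  then show False using Tinj[of ?o a g] a e by auto
 qed
 have 2: "k e ?p = 0"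
 proof -
  have "?p \<otimes>\<^bsub>?S\<^esub> inv\<^bsub>?S\<^esub> p0 = inv\<^bsub>?S\<^esub> \<alpha>" using c' p0 by (simp add: S.m_assoc)
  moreover have "inv\<^bsub>?S\<^esub> \<alpha> \<notin> ?C" using aC c' subgroup.m_inv_closed[OF C, of "inv\<^bsub>?S\<^esub> \<alpha>"] by auto
  ultimately show ?thesis using kC[of ?p] c' p0 by simp
 qed
 define x where "x = t \<otimes>\<^bsub>?S\<^esub> \<alpha> \<otimes>\<^bsub>?S\<^esub> inv\<^bsub>?S\<^esub> t"
 have x: "x \<in> carrier ?S" using c' by (simp add: x_def)
 \<comment> \<open>A linear map conjugates a translation to a translation, so \<open>x\<close>
   commutes with \<beta>.\<close>
 have xb: "x \<otimes>\<^bsub>?S\<^esub> \<beta> = \<beta> \<otimes>\<^bsub>?S\<^esub> x"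
 proof -
  let ?f = "\<lambda>i. of_int (\<eta> ?o a i) :: rat"
  have \<eta>V: "\<eta> ?o a \<in> int_vecs n" "\<eta> ?\<tau> b \<in> int_vecs n"
   using coordinate_group.\<eta>_mem[OF coordinate_group_Gv] e a b by auto
  have fV: "?f \<in> ?V" "(\<lambda>i. of_int (\<eta> ?\<tau> b i)) \<in> ?V" using \<eta>V by (auto simp: rat_vecs_def int_vecs_def)
  have plusV: "(\<lambda>i. x i + y i) \<in> ?V" if "x \<in> ?V" "y \<in> ?V" for x y using that by (auto simp: rat_vecs_def)
  have \<alpha>: "\<alpha> = translation (\<eta> ?o a)" and \<beta>: "\<beta> = translation (\<eta> ?\<tau> b)" and t: "t = restrict (s e) ?V"
   using \<Theta>(2,3) e a b by (auto simp: \<alpha>_def \<beta>_def t_def)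
  have sV: "s e y \<in> ?V" if "y \<in> ?V" for y using bij_betw_apply[OF \<Theta>(5)[OF e] that] .
  define \<tau>' where "\<tau>' = (\<lambda>y\<in>?V. \<lambda>i. y i + s e ?f i)"
  have "bij_betw (\<lambda>y i. y i + s e ?f i) ?V ?V"
   by (rule bij_betw_byWitness[where f' = "\<lambda>y i. y i - s e ?f i"])
    (use sV[OF fV(1)] in \<open>auto simp: rat_vecs_def\<close>)
  then have \<tau>'B: "\<tau>' \<in> Bij ?V" unfolding Bij_def \<tau>'_def by (simp cong: bij_betw_cong)
  have B: "\<alpha> \<in> Bij ?V" "\<beta> \<in> Bij ?V" "t \<in> Bij ?V" using c' by (auto simp: BijGroup_def)
  have mult: "f \<otimes>\<^bsub>?S\<^esub> g = (\<lambda>x\<in>?V. f (g x))" if "f \<in> Bij ?V" "g \<in> Bij ?V" for f g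
   using that by (simp add: BijGroup_def compose_def)
  have "t \<otimes>\<^bsub>?S\<^esub> \<alpha> = \<tau>' \<otimes>\<^bsub>?S\<^esub> t"
   unfolding mult[OF B(3,1)] mult[OF \<tau>'B B(3)]
   using plusV[OF _ fV(1)] sV \<Theta>(4)[OF e _ fV(1)] by (simp add: \<alpha> t \<tau>'_def cong: restrict_cong)
  moreover have \<tau>'c: "\<tau>' \<in> carrier ?S" using \<tau>'B by (simp add: BijGroup_def)
  ultimately have "x = \<tau>'" using c' by (simp add: x_def S.m_assoc)
  moreover have "\<tau>' \<otimes>\<^bsub>?S\<^esub> \<beta> = \<beta> \<otimes>\<^bsub>?S\<^esub> \<tau>'"
   unfolding mult[OF \<tau>'B B(2)] mult[OF B(2) \<tau>'B]
   using plusV[OF _ fV(2)] plusV[OF _ sV[OF fV(1)]] by (simp add: \<beta> \<tau>'_def add.assoc add.commute[of "s e _ _"] cong: restrict_cong)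
  ultimately show ?thesis by simp
 qed
 \<comment> \<open>By this commutation \<open>t\<close> conjugates the displacement of the last
   position from \<open>p0\<close> to \<beta>. If the displacement were in the edge group,
   \<open>b\<close> would be in its image.\<close>
 have 3: "k e (\<alpha> \<otimes>\<^bsub>?S\<^esub> ?q) = 0"
 proof -
  let ?y = "\<alpha> \<otimes>\<^bsub>?S\<^esub> ?q \<otimes>\<^bsub>?S\<^esub> inv\<^bsub>?S\<^esub> p0"
  have "t \<otimes>\<^bsub>?S\<^esub> ?y = x \<otimes>\<^bsub>?S\<^esub> \<beta> \<otimes>\<^bsub>?S\<^esub> inv\<^bsub>?S\<^esub> x \<otimes>\<^bsub>?S\<^esub> t"
   using c' p0 by (simp add: x_def S.m_assoc S.inv_mult_group)
  also have "\<dots> = \<beta> \<otimes>\<^bsub>?S\<^esub> t" using xb x c' by (simp add: S.m_assoc)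
  finally have ty: "t \<otimes>\<^bsub>?S\<^esub> ?y = \<beta> \<otimes>\<^bsub>?S\<^esub> t" .
  have "?y \<notin> ?C"
  proof
   assume "?y \<in> ?C"
   then obtain g where g: "g \<in> Ge e" "?y = \<Theta> (vel ?o g)" by blast
   have "\<Theta> (stl e) \<otimes>\<^bsub>?S\<^esub> \<Theta> (vel ?o g) = \<Theta> (vel ?\<tau> (\<phi> e g)) \<otimes>\<^bsub>?S\<^esub> \<Theta> (stl e)"
    using arg_cong[OF stable_elem_rel[OF e g(1), of "X\<lparr>arcs := {}\<rparr>"], of \<Theta>] e g(1) by simp
   then have "\<beta> \<otimes>\<^bsub>?S\<^esub> t = \<Theta> (vel ?\<tau> (\<phi> e g)) \<otimes>\<^bsub>?S\<^esub> t" using ty g by (simp add: t_def)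
   moreover have "\<Theta> (vel ?\<tau> (\<phi> e g)) \<in> carrier ?S" using e g by simp
   ultimately have "\<Theta> (vel ?\<tau> b) = \<Theta> (vel ?\<tau> (\<phi> e g))" using c' by (simp add: \<beta>_def)
   then have "b = \<phi> e g" using Tinj[of ?\<tau> b "\<phi> e g"] b e g by simp
   then show False using b g by blast
  qed
  then show ?thesis using kC[of "\<alpha> \<otimes>\<^bsub>?S\<^esub> ?q"] c' p0 by simp
 qed
 have "k e ?q \<ge> 0" by (simp add: k_def)
 then have "l ?w \<one>\<^bsub>?S\<^esub> < 0" using lw 1 2 3 by simp
 moreover have "l \<one>\<^bsub>UG\<^esub> \<one>\<^bsub>?S\<^esub> = 0" using cocycle_one[OF l(1) _ group_integer_group U.group_axioms] by simp
 ultimately show ?thesis by auto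
qed

end

section \<open>From residual finiteness to a normal lattice\<close>

section \<open>Residually finite groups have a normal lattice\<close>

definition power_set :: "('a, 'b) monoid_scheme \<Rightarrow> 'a set \<Rightarrow> nat \<Rightarrow> 'a set" where
 "power_set G M k = (\<lambda>m. m [^]\<^bsub>G\<^esub> k) ` M"

context lattice_graph_of_groups
begin

abbreviation (input) "FT \<equiv> FG T"
abbreviation (input) FT_mult (infixl "\<cdot>" 70) where "x \<cdot> y \<equiv> x \<otimes>\<^bsub>FG T\<^esub> y"
abbreviation "ve \<equiv> vertex_elem T"
abbreviation "st \<equiv> stable_elem T"

definition commutator_elem :: "'e \<Rightarrow> 'g \<Rightarrow> 'g \<Rightarrow> ('v, 'e, 'g) generator word set" where
 "commutator_elem e a b = st e \<cdot> (ve (tail X e) a \<cdot> (inv\<^bsub>FT\<^esub> st e \<cdot> (ve (head X e) b \<cdot>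
  (st e \<cdot> (inv\<^bsub>FT\<^esub> ve (tail X e) a \<cdot> (inv\<^bsub>FT\<^esub> st e \<cdot> inv\<^bsub>FT\<^esub> ve (head X e) b))))))"

lemma commutator_elem_closed:
 "e \<in> arcs X \<Longrightarrow> a \<in> carrier (Gv (tail X e)) \<Longrightarrow> b \<in> carrier (Gv (head X e)) \<Longrightarrow> commutator_elem e a b \<in> carrier FT"
 by (simp add: commutator_elem_def)

lemma commutator_elem_ne_one:
 assumes e: "e \<in> arcs X" and a: "a \<in> carrier (Gv (tail X e))" "a \<notin> Ge e"
  and b: "b \<in> carrier (Gv (head X e))" "b \<notin> \<phi> e ` Ge e"
 shows "commutator_elem e a b \<noteq> \<one>\<^bsub>FT\<^esub>"
proof
 let ?o = "tail X e" and ?\<tau> = "head X e"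
 let ?w = "stl e \<otimes>\<^bsub>UG\<^esub> (vel ?o a \<otimes>\<^bsub>UG\<^esub> (inv\<^bsub>UG\<^esub> stl e \<otimes>\<^bsub>UG\<^esub> (vel ?\<tau> b \<otimes>\<^bsub>UG\<^esub>
  (stl e \<otimes>\<^bsub>UG\<^esub> (inv\<^bsub>UG\<^esub> vel ?o a \<otimes>\<^bsub>UG\<^esub> (inv\<^bsub>UG\<^esub> stl e \<otimes>\<^bsub>UG\<^esub> inv\<^bsub>UG\<^esub> vel ?\<tau> b))))))"
 have ends: "?o \<in> verts X" "?\<tau> \<in> verts X" using e by auto
 note p = path_single(1)[OF ends(1) a(1)] path_single(1)[OF ends(2) b(1)] path_single(2,3)[OF e]
 have w: "path ?\<tau> ?\<tau> ?w"
  by (rule path_trans[OF p(3) path_trans[OF p(1) path_trans[OF p(4) path_trans[OF p(2)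
   path_trans[OF p(3) path_trans[OF path_inv[OF p(1)] path_trans[OF p(4) path_inv[OF p(2)]]]]]]]])
 then have wc: "?w \<in> carrier UG" by (simp add: path_closed)
 assume "commutator_elem e a b = \<one>\<^bsub>FT\<^esub>"
 then have "q ?w = \<one>\<^bsub>FT\<^esub>" using e ends a b by (simp add: commutator_elem_def q_vertex q_stable)
 then have "\<gamma> ?\<tau> \<otimes>\<^bsub>UG\<^esub> ?w \<otimes>\<^bsub>UG\<^esub> inv\<^bsub>UG\<^esub> \<gamma> ?\<tau> = \<one>\<^bsub>UG\<^esub>" using j_q[OF w] by simp
 moreover have "w = \<one>\<^bsub>UG\<^esub>" if "w \<in> carrier UG" "\<gamma> ?\<tau> \<otimes>\<^bsub>UG\<^esub> w \<otimes>\<^bsub>UG\<^esub> inv\<^bsub>UG\<^esub> \<gamma> ?\<tau> = \<one>\<^bsub>UG\<^esub>" for w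
 proof -
  have "\<gamma> ?\<tau> \<otimes>\<^bsub>UG\<^esub> w = \<gamma> ?\<tau>"
   using U.inv_solve_right[of "\<one>\<^bsub>UG\<^esub>" "\<gamma> ?\<tau> \<otimes>\<^bsub>UG\<^esub> w" "\<gamma> ?\<tau>"] that ends by simp
  then show ?thesis using that ends by simp
 qed
 ultimately have "?w = \<one>\<^bsub>UG\<^esub>" using wc by blast
 then show False using commutator_ne_one[OF e a b] by blast
qed

text \<open>If \<open>a\<close> becomes equal to \<open>g\<close>, then its conjugate by
  \<open>t\<close> becomes equal to \<open>\<phi> e g\<close>, which commutes with \<open>b\<close>
  in the abelian group at the head. If \<open>b\<close> becomes \<open>\<phi> e g\<close>, then
  conjugating back gives \<open>g\<close>, which commutes with \<open>a\<close> in the group at the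
  tail.\<close>

lemma commutator_elem_trivial:
 assumes h: "h \<in> hom FT Q" and Q: "group Q" and e: "e \<in> arcs X"
  and a: "a \<in> carrier (Gv (tail X e))" and b: "b \<in> carrier (Gv (head X e))" and g: "g \<in> Ge e"
  and eq: "h (ve (tail X e) a) = h (ve (tail X e) g) \<or> h (ve (head X e) b) = h (ve (head X e) (\<phi> e g))"
 shows "h (commutator_elem e a b) = \<one>\<^bsub>Q\<^esub>"
proof -
 let ?o = "tail X e" and ?\<tau> = "head X e"
 interpret Q: group Q by fact
 interpret h: group_hom FT Q h using h by unfold_locales
 have ends: "?o \<in> verts X" "?\<tau> \<in> verts X" using e by auto
 interpret Vo: coordinate_group "Gv ?o" n "\<eta> ?o" using coordinate_group_Gv[OF ends(1)] .
 interpret V\<tau>: coordinate_group "Gv ?\<tau>" n "\<eta> ?\<tau>" using coordinate_group_Gv[OF ends(2)] .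
 define t A B C D where "t = h (st e)" and "A = h (ve ?o a)" and "B = h (ve ?\<tau> b)"
  and "C = h (ve ?o g)" and "D = h (ve ?\<tau> (\<phi> e g))"
 have c: "t \<in> carrier Q" "A \<in> carrier Q" "B \<in> carrier Q" "C \<in> carrier Q" "D \<in> carrier Q"
  using e a b g by (auto simp: t_def A_def B_def C_def D_def)
 have tC: "t \<otimes>\<^bsub>Q\<^esub> C = D \<otimes>\<^bsub>Q\<^esub> t"
  using arg_cong[OF stable_elem_rel[OF e g, of T], of h] e g by (simp add: t_def C_def D_def)
 have BD: "B \<otimes>\<^bsub>Q\<^esub> D = D \<otimes>\<^bsub>Q\<^esub> B"
  using V\<tau>.commute[of b "\<phi> e g"] b g e ends
  by (simp add: B_def D_def h.hom_mult[symmetric] vertex_elem_mult[symmetric])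
 have AC: "A \<otimes>\<^bsub>Q\<^esub> C = C \<otimes>\<^bsub>Q\<^esub> A"
  using Vo.commute[of a g] a g e ends
  by (simp add: A_def C_def h.hom_mult[symmetric] vertex_elem_mult[symmetric])
 have D: "D = t \<otimes>\<^bsub>Q\<^esub> C \<otimes>\<^bsub>Q\<^esub> inv\<^bsub>Q\<^esub> t" using tC c by (simp add: Q.m_assoc)
 define x where "x = t \<otimes>\<^bsub>Q\<^esub> A \<otimes>\<^bsub>Q\<^esub> inv\<^bsub>Q\<^esub> t"
 have x: "x \<in> carrier Q" using c by (simp add: x_def)
 have xB: "x \<otimes>\<^bsub>Q\<^esub> B = B \<otimes>\<^bsub>Q\<^esub> x"
 proof (cases "A = C")
  case True
  then show ?thesis using D BD by (simp add: x_def)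
 next
  case False
  then have BD': "B = D" using eq by (simp add: A_def B_def C_def D_def)
  have "x \<otimes>\<^bsub>Q\<^esub> D = t \<otimes>\<^bsub>Q\<^esub> (A \<otimes>\<^bsub>Q\<^esub> C) \<otimes>\<^bsub>Q\<^esub> inv\<^bsub>Q\<^esub> t"
   using c by (simp add: x_def D Q.m_assoc Q.inv_solve_left'[symmetric] Q.m_assoc[symmetric, of "inv\<^bsub>Q\<^esub> t" t])
  also have "\<dots> = D \<otimes>\<^bsub>Q\<^esub> x" unfolding AC
   using c by (simp add: x_def D Q.m_assoc Q.m_assoc[symmetric, of "inv\<^bsub>Q\<^esub> t" t])
  finally show ?thesis by (simp add: BD')
 qed
 have "h (commutator_elem e a b) = t \<otimes>\<^bsub>Q\<^esub> (A \<otimes>\<^bsub>Q\<^esub> (inv\<^bsub>Q\<^esub> t \<otimes>\<^bsub>Q\<^esub> (B \<otimes>\<^bsub>Q\<^esub> (t \<otimes>\<^bsub>Q\<^esub> (inv\<^bsub>Q\<^esub> A \<otimes>\<^bsub>Q\<^esub> (inv\<^bsub>Q\<^esub> t \<otimes>\<^bsub>Q\<^esub> inv\<^bsub>Q\<^esub> B))))))"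
  using e a b by (simp add: commutator_elem_def t_def A_def B_def)
 also have "\<dots> = x \<otimes>\<^bsub>Q\<^esub> B \<otimes>\<^bsub>Q\<^esub> inv\<^bsub>Q\<^esub> x \<otimes>\<^bsub>Q\<^esub> inv\<^bsub>Q\<^esub> B"
  using c by (simp add: x_def Q.m_assoc Q.inv_mult_group)
 also have "\<dots> = \<one>\<^bsub>Q\<^esub>" unfolding xB using x c by (simp add: Q.m_assoc)
 finally show ?thesis .
qed

text \<open>Common form of the arguments at the two ends of an arc: \<open>A\<close> is the vertex
  group, \<open>H\<close> the edge subgroup and \<open>w\<close> the commutator. Only finitely many
  representatives \<open>y\<close> of \<open>A\<close> modulo \<open>H\<close> need a surviving
  \<open>w y\<close>. If the image of \<open>x\<close> is in \<open>N\<close> and \<open>x\<close>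
  differs from \<open>y\<close> by an element of \<open>H\<close>, then \<open>y\<close> agrees
  modulo \<open>N\<close> with an element of \<open>H\<close>; so \<open>w y\<close> dies, which
  forces \<open>y\<close>, and with it \<open>x\<close>, into \<open>H\<close>.\<close>

lemma residually_finite_avoid:
 assumes rf: "residually_finite FT" and V: "coordinate_group A n \<theta>" and H: "subgroup H A"
  and k: "(k::nat) > 0" "\<And>x. x \<in> carrier A \<Longrightarrow> x [^]\<^bsub>A\<^esub> k \<in> H"
  and \<iota>: "\<iota> \<in> hom A FT"
  and w: "\<And>x. x \<in> carrier A \<Longrightarrow> x \<notin> H \<Longrightarrow> w x \<in> carrier FT \<and> w x \<noteq> \<one>\<^bsub>FT\<^esub>"
  and triv: "\<And>N x c. N \<lhd> FT \<Longrightarrow> x \<in> carrier A \<Longrightarrow> c \<in> H \<Longrightarrow> N #>\<^bsub>FT\<^esub> \<iota> x = N #>\<^bsub>FT\<^esub> \<iota> c \<Longrightarrow> w x \<in> N"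
 shows "\<exists>N. finite_index_normal N FT \<and> (\<forall>x\<in>carrier A. \<iota> x \<in> N \<longrightarrow> x \<in> H)"
proof -
 interpret A: coordinate_group A n \<theta> by fact
 interpret \<iota>: group_hom A FT \<iota> using \<iota> by unfold_locales
 obtain R where R: "finite R" "R \<subseteq> carrier A" "\<And>x. x \<in> carrier A \<Longrightarrow> \<exists>r\<in>R. x \<otimes>\<^bsub>A\<^esub> inv\<^bsub>A\<^esub> r \<in> H"
  using A.finite_cosets[OF H k] by blast
 have "\<exists>N. finite_index_normal N FT \<and> (x \<notin> H \<longrightarrow> w x \<notin> N)" if "x \<in> R" for x
 proof (cases "x \<in> H")
  case True
  then show ?thesis using G.finite_index_normal_carrier by blast
 next
  case False
  then show ?thesis using rf w[of x] that R(2) unfolding residually_finite_def finite_index_normal_def by blast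
 qed
 then obtain N where N: "\<And>x. x \<in> R \<Longrightarrow> finite_index_normal (N x) FT \<and> (x \<notin> H \<longrightarrow> w x \<notin> N x)" by metis
 show ?thesis
 proof (intro exI conjI ballI impI)
  show "finite_index_normal (carrier FT \<inter> (\<Inter>x\<in>R. N x)) FT"
   using N R(1) by (intro G.finite_index_normal_INT) auto
  fix x assume x: "x \<in> carrier A" "\<iota> x \<in> carrier FT \<inter> (\<Inter>x\<in>R. N x)"
  obtain y where y: "y \<in> R" "x \<otimes>\<^bsub>A\<^esub> inv\<^bsub>A\<^esub> y \<in> H" using R(3)[OF x(1)] by blast
  have yA: "y \<in> carrier A" using y R by auto
  let ?c = "x \<otimes>\<^bsub>A\<^esub> inv\<^bsub>A\<^esub> y"
  have nor: "N y \<lhd> FT" using N[OF y(1)] by (simp add: finite_index_normal_def)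
  have s: "subgroup (N y) FT" using nor by (rule normal_imp_subgroup)
  have c: "inv\<^bsub>A\<^esub> ?c \<in> H" using y(2) by (rule subgroup.m_inv_closed[OF H])
  have "inv\<^bsub>A\<^esub> ?c = y \<otimes>\<^bsub>A\<^esub> inv\<^bsub>A\<^esub> x" using x yA by (simp add: A.inv_mult_group)
  then have "\<iota> y \<cdot> inv\<^bsub>FT\<^esub> \<iota> (inv\<^bsub>A\<^esub> ?c) = \<iota> y \<cdot> (\<iota> x \<cdot> inv\<^bsub>FT\<^esub> \<iota> y)"
   using x yA by (simp add: G.inv_mult_group)
  also have "\<dots> \<in> N y"
   using normal.inv_op_closed2[OF nor, of "\<iota> y" "\<iota> x"] x y yA by (simp add: G.m_assoc)
  finally have "\<iota> y \<in> N y #>\<^bsub>FT\<^esub> \<iota> (inv\<^bsub>A\<^esub> ?c)" using G.mem_rcos_iff[OF s] x yA by simp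
  then have "N y #>\<^bsub>FT\<^esub> \<iota> y = N y #>\<^bsub>FT\<^esub> \<iota> (inv\<^bsub>A\<^esub> ?c)"
   using G.repr_independence[of "\<iota> y" "N y" "\<iota> (inv\<^bsub>A\<^esub> ?c)"] s x yA by simp
  then have "w y \<in> N y" using triv[OF nor yA c] by blast
  then have yH: "y \<in> H" using N y by blast
  have "?c \<otimes>\<^bsub>A\<^esub> y \<in> H" using y(2) yH by (rule subgroup.m_closed[OF H])
  then show "x \<in> H" using x yA by (simp add: A.m_assoc)
 qed
qed

text \<open>One kernel for all arcs and both ends, by finite intersection. It meets each vertex
  group inside every incident edge subgroup, which is what lets stable letters carry these
  intersections to each other.\<close>

lemma residually_finite_separates_edges:
 assumes rf: "residually_finite FT"
 obtains N where "finite_index_normal N FT"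
  "\<And>e a. e \<in> arcs X \<Longrightarrow> a \<in> carrier (Gv (tail X e)) \<Longrightarrow> ve (tail X e) a \<in> N \<Longrightarrow> a \<in> Ge e"
  "\<And>e b. e \<in> arcs X \<Longrightarrow> b \<in> carrier (Gv (head X e)) \<Longrightarrow> ve (head X e) b \<in> N \<Longrightarrow> b \<in> \<phi> e ` Ge e"
proof -
 have "\<exists>N. finite_index_normal N FT \<and>
   (\<forall>a\<in>carrier (Gv (tail X e)). ve (tail X e) a \<in> N \<longrightarrow> a \<in> Ge e) \<and>
   (\<forall>b\<in>carrier (Gv (head X e)). ve (head X e) b \<in> N \<longrightarrow> b \<in> \<phi> e ` Ge e)" if e: "e \<in> arcs X" for e
 proof -
  have ends: "tail X e \<in> verts X" "head X e \<in> verts X" using e by auto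
  obtain a b where a: "a \<in> carrier (Gv (tail X e))" "a \<notin> Ge e" and b: "b \<in> carrier (Gv (head X e))" "b \<notin> \<phi> e ` Ge e"
   using Ge_proper[OF e] image_proper[OF e] by blast
  obtain k l :: nat where k: "k > 0" "\<And>x. x \<in> carrier (Gv (tail X e)) \<Longrightarrow> x [^]\<^bsub>Gv (tail X e)\<^esub> k \<in> Ge e"
    and l: "l > 0" "\<And>x. x \<in> carrier (Gv (head X e)) \<Longrightarrow> x [^]\<^bsub>Gv (head X e)\<^esub> l \<in> \<phi> e ` Ge e"
   using Ge_pow[OF e] image_pow[OF e] by blast
  have mem: "y \<in> N" if "N \<lhd> FT" "y \<in> carrier FT" "N #>\<^bsub>FT\<^esub> y = \<one>\<^bsub>FT Mod N\<^esub>" for N y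
   using that G.rcos_self[OF that(2) normal_imp_subgroup[OF that(1)]] by (simp add: FactGroup_def)
  have "\<exists>N. finite_index_normal N FT \<and> (\<forall>x\<in>carrier (Gv (tail X e)). ve (tail X e) x \<in> N \<longrightarrow> x \<in> Ge e)"
  proof (rule residually_finite_avoid[OF rf coordinate_group_Gv[OF ends(1)] subgroup_Ge[OF e] k, of "ve (tail X e)" "\<lambda>x. commutator_elem e x b"])
   show "ve (tail X e) \<in> hom (Gv (tail X e)) FT" using ends by (auto simp: hom_def vertex_elem_mult)
   show "commutator_elem e x b \<in> carrier FT \<and> commutator_elem e x b \<noteq> \<one>\<^bsub>FT\<^esub>"
    if "x \<in> carrier (Gv (tail X e))" "x \<notin> Ge e" for x
    using that b e commutator_elem_closed commutator_elem_ne_one by blast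
   show "commutator_elem e x b \<in> N" if N: "N \<lhd> FT" and x: "x \<in> carrier (Gv (tail X e))" "c \<in> Ge e"
     "N #>\<^bsub>FT\<^esub> ve (tail X e) x = N #>\<^bsub>FT\<^esub> ve (tail X e) c" for N x c
    using commutator_elem_trivial[OF normal.r_coset_hom_Mod[OF N] normal.factorgroup_is_group[OF N] e x(1) b(1) x(2)] x(3)
     mem[OF N commutator_elem_closed[OF e x(1) b(1)]] by blast
  qed
  then obtain N1 where N1: "finite_index_normal N1 FT" "\<forall>x\<in>carrier (Gv (tail X e)). ve (tail X e) x \<in> N1 \<longrightarrow> x \<in> Ge e"
   by blast
  have "\<exists>N. finite_index_normal N FT \<and> (\<forall>x\<in>carrier (Gv (head X e)). ve (head X e) x \<in> N \<longrightarrow> x \<in> \<phi> e ` Ge e)"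
  proof (rule residually_finite_avoid[OF rf coordinate_group_Gv[OF ends(2)] subgroup_image[OF e] l, of "ve (head X e)" "\<lambda>x. commutator_elem e a x"])
   show "ve (head X e) \<in> hom (Gv (head X e)) FT" using ends by (auto simp: hom_def vertex_elem_mult)
   show "commutator_elem e a x \<in> carrier FT \<and> commutator_elem e a x \<noteq> \<one>\<^bsub>FT\<^esub>"
    if "x \<in> carrier (Gv (head X e))" "x \<notin> \<phi> e ` Ge e" for x
    using that a e commutator_elem_closed commutator_elem_ne_one by blast
   show "commutator_elem e a x \<in> N" if N: "N \<lhd> FT" and x: "x \<in> carrier (Gv (head X e))" "c \<in> \<phi> e ` Ge e"
     "N #>\<^bsub>FT\<^esub> ve (head X e) x = N #>\<^bsub>FT\<^esub> ve (head X e) c" for N x c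
   proof -
    obtain g where g: "g \<in> Ge e" "c = \<phi> e g" using x(2) by blast
    show ?thesis
     using commutator_elem_trivial[OF normal.r_coset_hom_Mod[OF N] normal.factorgroup_is_group[OF N] e a(1) x(1) g(1)] x(3) g(2)
      mem[OF N commutator_elem_closed[OF e a(1) x(1)]] by blast
   qed
  qed
  then obtain N2 where N2: "finite_index_normal N2 FT" "\<forall>x\<in>carrier (Gv (head X e)). ve (head X e) x \<in> N2 \<longrightarrow> x \<in> \<phi> e ` Ge e"
   by blast
  show ?thesis using G.finite_index_normal_Int[OF N1(1) N2(1)] N1(2) N2(2) by blast
 qed
 then have "\<forall>e\<in>arcs X. \<exists>N. finite_index_normal N FT \<and>
   (\<forall>a\<in>carrier (Gv (tail X e)). ve (tail X e) a \<in> N \<longrightarrow> a \<in> Ge e) \<and>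
   (\<forall>b\<in>carrier (Gv (head X e)). ve (head X e) b \<in> N \<longrightarrow> b \<in> \<phi> e ` Ge e)" ..
 from bchoice[OF this] obtain N where N0: "\<forall>e\<in>arcs X. finite_index_normal (N e) FT \<and>
   (\<forall>a\<in>carrier (Gv (tail X e)). ve (tail X e) a \<in> N e \<longrightarrow> a \<in> Ge e) \<and>
   (\<forall>b\<in>carrier (Gv (head X e)). ve (head X e) b \<in> N e \<longrightarrow> b \<in> \<phi> e ` Ge e)" ..
 have N: "finite_index_normal (N e) FT"
   "a \<in> carrier (Gv (tail X e)) \<Longrightarrow> ve (tail X e) a \<in> N e \<Longrightarrow> a \<in> Ge e"
   "b \<in> carrier (Gv (head X e)) \<Longrightarrow> ve (head X e) b \<in> N e \<Longrightarrow> b \<in> \<phi> e ` Ge e" if "e \<in> arcs X" for e a b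
  using bspec[OF N0 that] by blast+
 have "finite_index_normal (carrier FT \<inter> (\<Inter>e\<in>arcs X. N e)) FT"
  using N(1) by (intro G.finite_index_normal_INT) auto
 then show thesis
 proof (rule that)
  show "a \<in> Ge e" if e: "e \<in> arcs X" "a \<in> carrier (Gv (tail X e))"
   and "ve (tail X e) a \<in> carrier FT \<inter> (\<Inter>e\<in>arcs X. N e)" for e a
   by (rule N(2)[OF e]) (use that in blast)
  show "b \<in> \<phi> e ` Ge e" if e: "e \<in> arcs X" "b \<in> carrier (Gv (head X e))"
   and "ve (head X e) b \<in> carrier FT \<inter> (\<Inter>e\<in>arcs X. N e)" for e b
   by (rule N(3)[OF e]) (use that in blast)
 qed
qed

end

locale normal_lattice = lattice_graph_of_groups X Gv Ge \<phi> T r j q \<gamma> n \<eta>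
 for X :: "('v, 'e) pre_digraph" and Gv :: "'v \<Rightarrow> 'g monoid" and Ge \<phi> T r j q \<gamma> n \<eta> +
 fixes M :: "('v, 'e, 'g) generator word set set" and d :: nat
 assumes M_normal: "M \<lhd> FG T"
  and M_vertex: "v \<in> verts X \<Longrightarrow> M \<subseteq> vertex_elem T v ` carrier (Gv v)"
  and M_tail: "e \<in> arcs X \<Longrightarrow> a \<in> carrier (Gv (tail X e)) \<Longrightarrow> vertex_elem T (tail X e) a \<in> M \<Longrightarrow> a \<in> Ge e"
  and M_head: "e \<in> arcs X \<Longrightarrow> b \<in> carrier (Gv (head X e)) \<Longrightarrow> vertex_elem T (head X e) b \<in> M \<Longrightarrow> b \<in> \<phi> e ` Ge e"
  and d: "d > 0" and vertex_pow_M: "v \<in> verts X \<Longrightarrow> g \<in> carrier (Gv v) \<Longrightarrow> vertex_elem T v g [^]\<^bsub>FG T\<^esub> d \<in> M"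

text \<open>The lattice is the intersection of \<open>N\<close> with a vertex group. Conjugation by
  a stable letter maps the intersection at the tail onto the one at the head, and elements of a
  vertex group act trivially on its own intersection. The exponent \<open>d\<close> comes from the
  finite index of \<open>N\<close>.\<close>

lemma (in lattice_graph_of_groups) normal_lattice_exists:
 assumes "residually_finite (FG T)"
 obtains M d where "normal_lattice X Gv Ge \<phi> T r j q \<gamma> n \<eta> M d"
proof -
 obtain N where N: "finite_index_normal N FT"
  "\<And>e a. e \<in> arcs X \<Longrightarrow> a \<in> carrier (Gv (tail X e)) \<Longrightarrow> ve (tail X e) a \<in> N \<Longrightarrow> a \<in> Ge e"
  "\<And>e b. e \<in> arcs X \<Longrightarrow> b \<in> carrier (Gv (head X e)) \<Longrightarrow> ve (head X e) b \<in> N \<Longrightarrow> b \<in> \<phi> e ` Ge e"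
  using residually_finite_separates_edges[OF assms] by blast
 have nor: "N \<lhd> FT" using N by (simp add: finite_index_normal_def)
 have sN: "subgroup N FT" using nor by (rule normal_imp_subgroup)
 obtain d :: nat where d: "d > 0" "\<And>g. g \<in> carrier FT \<Longrightarrow> g [^]\<^bsub>FT\<^esub> d \<in> N"
  using G.finite_index_normal_pow[OF N(1)] by blast
 define Mv where "Mv v = N \<inter> ve v ` carrier (Gv v)" for v
 define M where "M = Mv r"
 have up: "ve (head X e) (\<phi> e a) = st e \<cdot> ve (tail X e) a \<cdot> inv\<^bsub>FT\<^esub> st e" if "e \<in> arcs X" "a \<in> Ge e" for e a
  using stable_elem_rel[OF that, of T] that by (simp add: G.m_assoc)
 have fw: "st e \<cdot> m \<cdot> inv\<^bsub>FT\<^esub> st e \<in> Mv (head X e)" if e: "e \<in> arcs X" and m: "m \<in> Mv (tail X e)" for e m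
 proof -
  obtain a where a: "a \<in> carrier (Gv (tail X e))" "m = ve (tail X e) a" "m \<in> N" using m by (auto simp: Mv_def)
  then have "a \<in> Ge e" using N(2) e by blast
  then show ?thesis
   using up[OF e] a normal.inv_op_closed2[OF nor _ a(3), of "st e"] e unfolding Mv_def by (metis IntI image_eqI phi_carrier stable_elem_closed)
 qed
 have bw: "inv\<^bsub>FT\<^esub> st e \<cdot> m \<cdot> st e \<in> Mv (tail X e)" if e: "e \<in> arcs X" and m: "m \<in> Mv (head X e)" for e m
 proof -
  obtain b where b: "b \<in> carrier (Gv (head X e))" "m = ve (head X e) b" "m \<in> N" using m by (auto simp: Mv_def)
  then obtain g where g: "g \<in> Ge e" "b = \<phi> e g" using N(3) e by blast
  have "inv\<^bsub>FT\<^esub> st e \<cdot> m \<cdot> st e = ve (tail X e) g"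
  proof -
   have "inv\<^bsub>FT\<^esub> st e \<cdot> m \<cdot> st e = inv\<^bsub>FT\<^esub> st e \<cdot> (st e \<cdot> ve (tail X e) g)"
    using b g e by (simp add: G.m_assoc stable_elem_rel)
   then show ?thesis using g e by (simp add: G.m_assoc[symmetric])
  qed
  then show ?thesis
   using b g e normal.inv_op_closed1[OF nor _ b(3), of "st e"] unfolding Mv_def by (metis IntI image_eqI Ge_carrier stable_elem_closed)
 qed
 \<comment> \<open>Along an arc of \<open>T\<close> the stable letter is trivial, so the
   intersections at its ends are equal as subsets of the group. This makes the lattice independent
   of the vertex.\<close>
 have MvM: "Mv v = M" if "v \<in> verts X" for v
 proof (rule grown_propagate[OF tree_T _ _ that])
  show "Mv r = M" by (simp add: M_def)
  fix e assume "e \<in> arcs T"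
  then have e: "e \<in> arcs X" and 1: "st e = \<one>\<^bsub>FT\<^esub>" using arcs_T stable_elem_tree by auto
  have sub: "Mv v \<subseteq> carrier FT" for v using subgroup.subset[OF sN] by (auto simp: Mv_def)
  have "Mv (tail X e) = Mv (head X e)"
  proof
   show "Mv (tail X e) \<subseteq> Mv (head X e)"
   proof
    fix m assume m: "m \<in> Mv (tail X e)"
    then show "m \<in> Mv (head X e)" using fw[OF e m] subsetD[OF sub m] by (simp add: 1)
   qed
   show "Mv (head X e) \<subseteq> Mv (tail X e)"
   proof
    fix m assume m: "m \<in> Mv (head X e)"
    then show "m \<in> Mv (tail X e)" using bw[OF e m] subsetD[OF sub m] by (simp add: 1)
   qed
  qed
  then show "Mv (tail X e) = M \<longleftrightarrow> Mv (head X e) = M" by simp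
 qed
 have sM: "subgroup M FT"
 proof -
  interpret h: group_hom "Gv r" FT "ve r" using r by (rule vertex_elem_group_hom)
  have "subgroup (ve r ` carrier (Gv r)) FT" by (rule h.img_is_subgroup)
  then show ?thesis unfolding M_def Mv_def by (rule G.subgroups_Inter_pair[OF sN])
 qed
 have conj: "\<forall>m\<in>M. g \<cdot> m \<cdot> inv\<^bsub>FT\<^esub> g \<in> M" if "g \<in> carrier FT" for g
  using that
 proof (induction rule: FG_induct)
  case one
  then show ?case using subgroup.mem_carrier[OF sM] by simp
 next
  case (vertex v g x)
  show ?case
  proof
   fix m assume m: "m \<in> M"
   let ?m = "x \<cdot> m \<cdot> inv\<^bsub>FT\<^esub> x"
   have mM: "?m \<in> M" using vertex m by blast
   \<comment> \<open>Since \<open>M\<close> is also the intersection at \<open>v\<close>, the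
     conjugate lies in the abelian vertex group of \<open>v\<close> and is fixed by
     \<open>ve v g\<close>.\<close>
   then obtain a where a: "a \<in> carrier (Gv v)" "?m = ve v a" using MvM[OF vertex(1)] by (auto simp: Mv_def)
   interpret V: coordinate_group "Gv v" n "\<eta> v" using coordinate_group_Gv[OF vertex(1)] .
   have "ve v g \<cdot> ?m = ?m \<cdot> ve v g"
    unfolding a(2) using V.commute[of g a] vertex a by (simp add: vertex_elem_mult[symmetric])
   moreover have mc: "m \<in> carrier FT" "?m \<in> carrier FT" using m mM subgroup.mem_carrier[OF sM] by auto
   moreover have "ve v g \<cdot> x \<cdot> m \<cdot> inv\<^bsub>FT\<^esub> (ve v g \<cdot> x) = ve v g \<cdot> ?m \<cdot> inv\<^bsub>FT\<^esub> ve v g"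
    using vertex mc(1) by (simp add: G.m_assoc G.inv_mult_group)
   ultimately show "ve v g \<cdot> x \<cdot> m \<cdot> inv\<^bsub>FT\<^esub> (ve v g \<cdot> x) \<in> M"
    using vertex mM a(2) by (simp add: G.m_assoc del: a(2))
  qed
 next
  case (stable e x)
  show ?case
  proof
   fix m assume m: "m \<in> M"
   have mc: "m \<in> carrier FT" using m subgroup.mem_carrier[OF sM] by auto
   have "st e \<cdot> x \<cdot> m \<cdot> inv\<^bsub>FT\<^esub> (st e \<cdot> x) = st e \<cdot> (x \<cdot> m \<cdot> inv\<^bsub>FT\<^esub> x) \<cdot> inv\<^bsub>FT\<^esub> st e"
    using stable mc by (simp add: G.m_assoc G.inv_mult_group)
   then show "st e \<cdot> x \<cdot> m \<cdot> inv\<^bsub>FT\<^esub> (st e \<cdot> x) \<in> M"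
    using fw[OF stable(1)] MvM stable m by simp
  qed
 next
  case (stable_inv e x)
  show ?case
  proof
   fix m assume m: "m \<in> M"
   have mc: "m \<in> carrier FT" using m subgroup.mem_carrier[OF sM] by auto
   have "inv\<^bsub>FT\<^esub> st e \<cdot> x \<cdot> m \<cdot> inv\<^bsub>FT\<^esub> (inv\<^bsub>FT\<^esub> st e \<cdot> x)
     = inv\<^bsub>FT\<^esub> st e \<cdot> (x \<cdot> m \<cdot> inv\<^bsub>FT\<^esub> x) \<cdot> st e"
    using stable_inv mc by (simp add: G.m_assoc G.inv_mult_group)
   then show "inv\<^bsub>FT\<^esub> st e \<cdot> x \<cdot> m \<cdot> inv\<^bsub>FT\<^esub> (inv\<^bsub>FT\<^esub> st e \<cdot> x) \<in> M"
    using bw[OF stable_inv(1)] MvM stable_inv m by simp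
  qed
 qed
 have "normal_lattice X Gv Ge \<phi> T r j q \<gamma> n \<eta> M d"
 proof (rule normal_lattice.intro[OF lattice_graph_of_groups_axioms], rule normal_lattice_axioms.intro)
  show "M \<lhd> FT" using conj by (intro G.normalI_conj[OF sM]) blast
  show "M \<subseteq> ve v ` carrier (Gv v)" if "v \<in> verts X" for v using MvM[OF that] by (auto simp: Mv_def)
  show "a \<in> Ge e" if "e \<in> arcs X" "a \<in> carrier (Gv (tail X e))" "ve (tail X e) a \<in> M" for e a
   using that N(2) by (auto simp: M_def Mv_def)
  show "b \<in> \<phi> e ` Ge e" if "e \<in> arcs X" "b \<in> carrier (Gv (head X e))" "ve (head X e) b \<in> M" for e b
   using that N(3) by (auto simp: M_def Mv_def)
  show "d > 0" by (rule d(1))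
  show "ve v g [^]\<^bsub>FT\<^esub> d \<in> M" if v: "v \<in> verts X" "g \<in> carrier (Gv v)" for v g
  proof -
   interpret h: group_hom "Gv v" FT "ve v" using v by (intro vertex_elem_group_hom)
   have "ve v g [^]\<^bsub>FT\<^esub> d = ve v (g [^]\<^bsub>Gv v\<^esub> d)" using v by (simp add: h.hom_nat_pow)
   moreover have "g [^]\<^bsub>Gv v\<^esub> d \<in> carrier (Gv v)" using v by simp
   ultimately have "ve v g [^]\<^bsub>FT\<^esub> d \<in> Mv v" using d(2)[of "ve v g"] v by (auto simp: Mv_def)
   then show ?thesis using MvM v by simp
  qed
 qed
 then show thesis by (rule that)
qed

context normal_lattice
begin

lemma M_subgroup: "subgroup M FT"
 using M_normal by (rule normal_imp_subgroup)

lemma M_carrier [simp]: "m \<in> M \<Longrightarrow> m \<in> carrier FT"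
 using M_subgroup by (rule subgroup.mem_carrier)

lemma M_conj: "g \<in> carrier FT \<Longrightarrow> m \<in> M \<Longrightarrow> g \<cdot> m \<cdot> inv\<^bsub>FT\<^esub> g \<in> M"
 using M_normal by (rule normal.inv_op_closed2)

lemma ve_commute:
 assumes "v \<in> verts X" "g \<in> carrier (Gv v)" "h \<in> carrier (Gv v)"
 shows "ve v g \<cdot> ve v h = ve v h \<cdot> ve v g"
proof -
 interpret V: coordinate_group "Gv v" n "\<eta> v" using coordinate_group_Gv[OF assms(1)] .
 show ?thesis using assms V.commute[of g h] by (simp add: vertex_elem_mult[symmetric])
qed

lemma ve_M_commute:
 assumes "v \<in> verts X" "g \<in> carrier (Gv v)" "m \<in> M"
 shows "ve v g \<cdot> m = m \<cdot> ve v g"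
 using M_vertex[OF assms(1)] assms ve_commute by blast

lemma M_commute: "m \<in> M \<Longrightarrow> m' \<in> M \<Longrightarrow> m \<cdot> m' = m' \<cdot> m"
 using M_vertex[OF r] r ve_M_commute by blast

lemma ve_pow: "v \<in> verts X \<Longrightarrow> g \<in> carrier (Gv v) \<Longrightarrow> ve v (g [^]\<^bsub>Gv v\<^esub> (k::nat)) = ve v g [^]\<^bsub>FT\<^esub> k"
 using group_hom.hom_nat_pow[OF vertex_elem_group_hom] by metis

lemma ve_pow_inj:
 assumes "v \<in> verts X" "g \<in> carrier (Gv v)" "h \<in> carrier (Gv v)" "(k::nat) > 0" "ve v g [^]\<^bsub>FT\<^esub> k = ve v h [^]\<^bsub>FT\<^esub> k"
 shows "g = h"
proof -
 interpret V: coordinate_group "Gv v" n "\<eta> v" using coordinate_group_Gv[OF assms(1)] .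
 have "ve v (g [^]\<^bsub>Gv v\<^esub> k) = ve v (h [^]\<^bsub>Gv v\<^esub> k)" using assms by (simp add: ve_pow)
 then have "g [^]\<^bsub>Gv v\<^esub> k = h [^]\<^bsub>Gv v\<^esub> k" using assms vertex_elem_inj[of v] by simp
 then show ?thesis using V.pow_inj assms by blast
qed

lemma M_pow_inj:
 assumes "m \<in> M" "m' \<in> M" "(k::nat) > 0" "m [^]\<^bsub>FT\<^esub> k = m' [^]\<^bsub>FT\<^esub> k"
 shows "m = m'"
proof -
 obtain g h where "g \<in> carrier (Gv r)" "h \<in> carrier (Gv r)" "m = ve r g" "m' = ve r h"
  using M_vertex[OF r] assms by blast
 then show ?thesis using ve_pow_inj[OF r] assms by metis
qed

lemma M_pow_closed: "m \<in> M \<Longrightarrow> m [^]\<^bsub>FT\<^esub> (k::nat) \<in> M"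
 by (induction k) (auto simp: subgroup.one_closed[OF M_subgroup] subgroup.m_closed[OF M_subgroup])

lemma power_set_subgroup: "subgroup (power_set FT M k) FT"
proof (rule G.subgroupI)
 show "power_set FT M k \<subseteq> carrier FT" by (auto simp: power_set_def)
 show "power_set FT M k \<noteq> {}" using subgroup.one_closed[OF M_subgroup] by (auto simp: power_set_def)
 show "inv\<^bsub>FT\<^esub> x \<in> power_set FT M k" if x: "x \<in> power_set FT M k" for x
 proof -
  obtain m where m: "m \<in> M" "x = m [^]\<^bsub>FT\<^esub> k" using x by (auto simp: power_set_def)
  then have "inv\<^bsub>FT\<^esub> x = (inv\<^bsub>FT\<^esub> m) [^]\<^bsub>FT\<^esub> k" by (simp add: G.nat_pow_inv)
  then show ?thesis using m subgroup.m_inv_closed[OF M_subgroup] by (auto simp: power_set_def)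
 qed
 show "x \<cdot> y \<in> power_set FT M k" if "x \<in> power_set FT M k" "y \<in> power_set FT M k" for x y
 proof -
  obtain m m' where m: "m \<in> M" "x = m [^]\<^bsub>FT\<^esub> k" "m' \<in> M" "y = m' [^]\<^bsub>FT\<^esub> k"
   using \<open>x \<in> power_set FT M k\<close> \<open>y \<in> power_set FT M k\<close> by (auto simp: power_set_def)
  then have "x \<cdot> y = (m \<cdot> m') [^]\<^bsub>FT\<^esub> k" 
   using G.pow_mult_distrib[OF M_commute[OF m(1,3)], of k] by simp
  then show ?thesis using m subgroup.m_closed[OF M_subgroup] by (auto simp: power_set_def)
 qed
qed

lemma power_set_M: "power_set FT M k \<subseteq> M"
 using M_pow_closed by (auto simp: power_set_def)

lemma power_set_conj:
 assumes g: "g \<in> carrier FT" and x: "x \<in> power_set FT M k"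
 shows "g \<cdot> x \<cdot> inv\<^bsub>FT\<^esub> g \<in> power_set FT M k"
proof -
 obtain m where m: "m \<in> M" "x = m [^]\<^bsub>FT\<^esub> k" using x by (auto simp: power_set_def)
 have "g \<cdot> m [^]\<^bsub>FT\<^esub> k \<cdot> inv\<^bsub>FT\<^esub> g = (g \<cdot> m \<cdot> inv\<^bsub>FT\<^esub> g) [^]\<^bsub>FT\<^esub> k"
 proof (induction k)
  case 0
  then show ?case using g by simp
 next
  case (Suc k)
  let ?c = "\<lambda>x. g \<cdot> x \<cdot> inv\<^bsub>FT\<^esub> g"
  have mult: "?c x \<cdot> ?c y = ?c (x \<cdot> y)" if "x \<in> carrier FT" "y \<in> carrier FT" for x y
  proof -
   have "?c x \<cdot> ?c y = g \<cdot> x \<cdot> (inv\<^bsub>FT\<^esub> g \<cdot> g) \<cdot> y \<cdot> inv\<^bsub>FT\<^esub> g"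
    using g that by (simp only: G.m_assoc G.m_closed G.inv_closed)
   then show ?thesis using g that by (simp add: G.m_assoc)
  qed
  have "?c (m [^]\<^bsub>FT\<^esub> Suc k) = ?c (m [^]\<^bsub>FT\<^esub> k) \<cdot> ?c m" using m(1) mult by simp
  then show ?case unfolding Suc by simp
 qed
 then show ?thesis using m M_conj[OF g m(1)] by (auto simp: power_set_def)
qed

text \<open>The exponent is \<open>d + 1\<close> because \<open>d\<close>-th powers of vertex
  elements lie in \<open>M\<close>. Raising to a power is compatible with every \<phi>, which is why
  such an endomorphism exists; the choice operator only names it.\<close>

definition sigma :: "('v, 'e, 'g) generator word set \<Rightarrow> ('v, 'e, 'g) generator word set" where
 "sigma = (SOME s. s \<in> hom FT FT \<and> (\<forall>v\<in>verts X. \<forall>g\<in>carrier (Gv v). s (ve v g) = ve v g [^]\<^bsub>FT\<^esub> Suc d) \<and>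
  (\<forall>e\<in>arcs X. s (st e) = st e))"

lemma sigma:
 shows sigma_hom: "sigma \<in> hom FT FT"
  and sigma_ve: "v \<in> verts X \<Longrightarrow> g \<in> carrier (Gv v) \<Longrightarrow> sigma (ve v g) = ve v g [^]\<^bsub>FT\<^esub> Suc d"
  and sigma_st: "e \<in> arcs X \<Longrightarrow> sigma (st e) = st e"
proof -
 have "\<exists>s. s \<in> hom FT FT \<and> (\<forall>v\<in>verts X. \<forall>g\<in>carrier (Gv v). s (ve v g) = ve v g [^]\<^bsub>FT\<^esub> Suc d) \<and>
  (\<forall>e\<in>arcs X. s (st e) = st e)"
 proof (rule FG_hom[OF G.group_axioms, of "\<lambda>v g. ve v g [^]\<^bsub>FT\<^esub> Suc d" st T])
  show "(\<lambda>g. ve v g [^]\<^bsub>FT\<^esub> Suc d) \<in> hom (Gv v) FT" if "v \<in> verts X" for v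
   using that G.pow_mult_distrib[OF ve_commute[OF that], of _ _ "Suc d"]
   by (auto simp: hom_def vertex_elem_mult simp del: nat_pow_Suc)
  show "st e \<cdot> ve (tail X e) g [^]\<^bsub>FT\<^esub> Suc d = ve (head X e) (\<phi> e g) [^]\<^bsub>FT\<^esub> Suc d \<cdot> st e"
   if e: "e \<in> arcs X" "g \<in> Ge e" for e g
  proof -
   have c: "st e \<in> carrier FT" "ve (tail X e) g \<in> carrier FT" "ve (head X e) (\<phi> e g) \<in> carrier FT" using e by auto
   have "st e \<cdot> ve (tail X e) g [^]\<^bsub>FT\<^esub> k = ve (head X e) (\<phi> e g) [^]\<^bsub>FT\<^esub> k \<cdot> st e" for k :: nat
   proof (induction k)
    case (Suc k)
    have "st e \<cdot> ve (tail X e) g [^]\<^bsub>FT\<^esub> Suc k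
      = st e \<cdot> ve (tail X e) g [^]\<^bsub>FT\<^esub> k \<cdot> ve (tail X e) g"
     using c by (simp add: G.m_assoc)
    also have "\<dots> = ve (head X e) (\<phi> e g) [^]\<^bsub>FT\<^esub> k \<cdot> (st e \<cdot> ve (tail X e) g)"
     unfolding Suc using c by (simp add: G.m_assoc)
    also have "\<dots> = ve (head X e) (\<phi> e g) [^]\<^bsub>FT\<^esub> Suc k \<cdot> st e"
     unfolding stable_elem_rel[OF e] using c by (simp add: G.m_assoc)
    finally show ?case .
   qed (use c in simp)
   then show ?thesis .
  qed
  show "st e \<in> carrier FT" if "e \<in> arcs X" for e using that by simp
  show "st e = \<one>\<^bsub>FT\<^esub>" if "e \<in> arcs X" "e \<in> arcs T" for e using that by (rule stable_elem_tree)
 next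
  fix h assume "h \<in> hom FT FT" "\<And>v g. v \<in> verts X \<Longrightarrow> g \<in> carrier (Gv v) \<Longrightarrow> h (ve v g) = ve v g [^]\<^bsub>FT\<^esub> Suc d"
   "\<And>e. e \<in> arcs X \<Longrightarrow> h (st e) = st e"
  then show "\<exists>s. s \<in> hom FT FT \<and> (\<forall>v\<in>verts X. \<forall>g\<in>carrier (Gv v). s (ve v g) = ve v g [^]\<^bsub>FT\<^esub> Suc d) \<and>
   (\<forall>e\<in>arcs X. s (st e) = st e)" by blast
 qed
 from someI_ex[OF this, folded sigma_def] show "sigma \<in> hom FT FT"
  "v \<in> verts X \<Longrightarrow> g \<in> carrier (Gv v) \<Longrightarrow> sigma (ve v g) = ve v g [^]\<^bsub>FT\<^esub> Suc d"
  "e \<in> arcs X \<Longrightarrow> sigma (st e) = st e" by blast+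
qed

sublocale sigma: group_hom FT FT sigma
 using sigma_hom by unfold_locales

lemma sigma_mod: "g \<in> carrier FT \<Longrightarrow> sigma g \<cdot> inv\<^bsub>FT\<^esub> g \<in> M"
proof (induction rule: FG_induct)
 case one
 then show ?case by (simp add: subgroup.one_closed[OF M_subgroup])
next
 case (vertex v g x)
 let ?m = "sigma x \<cdot> inv\<^bsub>FT\<^esub> x"
 have c: "ve v g \<in> carrier FT" "?m \<in> carrier FT" using vertex by auto
 have "sigma (ve v g \<cdot> x) \<cdot> inv\<^bsub>FT\<^esub> (ve v g \<cdot> x)
   = ve v g [^]\<^bsub>FT\<^esub> d \<cdot> (ve v g \<cdot> ?m \<cdot> inv\<^bsub>FT\<^esub> ve v g)"
  using vertex c(1) by (simp add: sigma_ve G.inv_mult_group G.m_assoc)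
 also have "\<dots> \<in> M"
  by (rule subgroup.m_closed[OF M_subgroup vertex_pow_M[OF vertex(1,2)] M_conj[OF c(1) vertex(4)]])
 finally show ?case .
next
 case (stable e x)
 let ?m = "sigma x \<cdot> inv\<^bsub>FT\<^esub> x"
 have c: "st e \<in> carrier FT" using stable by auto
 have "sigma (st e \<cdot> x) \<cdot> inv\<^bsub>FT\<^esub> (st e \<cdot> x) = st e \<cdot> ?m \<cdot> inv\<^bsub>FT\<^esub> st e"
  using stable c by (simp add: sigma_st G.inv_mult_group G.m_assoc)
 then show ?case using M_conj[OF c] stable by simp
next
 case (stable_inv e x)
 let ?m = "sigma x \<cdot> inv\<^bsub>FT\<^esub> x"
 have c: "st e \<in> carrier FT" using stable_inv by auto
 have "sigma (inv\<^bsub>FT\<^esub> st e \<cdot> x) \<cdot> inv\<^bsub>FT\<^esub> (inv\<^bsub>FT\<^esub> st e \<cdot> x)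
   = inv\<^bsub>FT\<^esub> st e \<cdot> ?m \<cdot> inv\<^bsub>FT\<^esub> (inv\<^bsub>FT\<^esub> st e)"
  using stable_inv c by (simp add: sigma_st G.inv_mult_group G.m_assoc)
 then show ?case using M_conj[OF G.inv_closed[OF c]] stable_inv by simp
qed

lemma sigma_M: "m \<in> M \<Longrightarrow> sigma m = m [^]\<^bsub>FT\<^esub> Suc d"
 using M_vertex[OF r] r sigma_ve by blast

lemma sigma_mem_M_iff:
 assumes g: "g \<in> carrier FT"
 shows "sigma g \<in> M \<longleftrightarrow> g \<in> M"
proof
 assume "sigma g \<in> M"
 then have "inv\<^bsub>FT\<^esub> (sigma g \<cdot> inv\<^bsub>FT\<^esub> g) \<cdot> sigma g \<in> M"
  using sigma_mod[OF g] by (simp add: subgroup.m_closed[OF M_subgroup] subgroup.m_inv_closed[OF M_subgroup])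
 then show "g \<in> M" using g by (simp add: G.inv_mult_group G.m_assoc)
qed (metis sigma_M M_pow_closed)

text \<open>Being the identity modulo \<open>M\<close>, the endomorphism has its kernel inside
  \<open>M\<close>, and there it is an injective power map.\<close>

lemma sigma_inj: "inj_on sigma (carrier FT)"
proof (rule inj_onI)
 fix g h assume gh: "g \<in> carrier FT" "h \<in> carrier FT" "sigma g = sigma h"
 let ?x = "g \<cdot> inv\<^bsub>FT\<^esub> h"
 have x: "?x \<in> carrier FT" "sigma ?x = \<one>\<^bsub>FT\<^esub>" using gh by auto
 then have "?x \<in> M" using sigma_mem_M_iff[OF x(1)] subgroup.one_closed[OF M_subgroup] by simp
 moreover have "?x [^]\<^bsub>FT\<^esub> Suc d = \<one>\<^bsub>FT\<^esub> [^]\<^bsub>FT\<^esub> Suc d"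
  using sigma_M[OF calculation] x(2) G.nat_pow_one[of "Suc d"] by argo
 ultimately have "?x = \<one>\<^bsub>FT\<^esub>" using M_pow_inj[of ?x "\<one>\<^bsub>FT\<^esub>" "Suc d"] subgroup.one_closed[OF M_subgroup] by blast
 then show "g = h" using gh G.inv_equality[of g "inv\<^bsub>FT\<^esub> h"] by (metis G.inv_closed G.inv_inv)
qed

text \<open>Counted inside the vertex group at \<open>r\<close>, where coordinates are available: a
  \<open>d\<close>-th power is in \<open>M\<close>, so a power with exponent \<open>d * k\<close> is
  a \<open>k\<close>-th power of an element of \<open>M\<close>.\<close>

lemma finite_M_cosets:
 assumes k: "k > 0"
 shows "finite ((\<lambda>m. (\<lambda>x. m \<cdot> x) ` power_set FT M k) ` M)"
proof -
 let ?P = "power_set FT M k"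
 interpret V: coordinate_group "Gv r" n "\<eta> r" using coordinate_group_Gv[OF r] .
 interpret ve: group_hom "Gv r" FT "ve r" using r by (rule vertex_elem_group_hom)
 let ?H = "{a \<in> carrier (Gv r). ve r a \<in> ?P}"
 have H: "subgroup ?H (Gv r)"
  using subgroup.one_closed[OF power_set_subgroup, of k] subgroup.m_closed[OF power_set_subgroup, of _ k]
   subgroup.m_inv_closed[OF power_set_subgroup, of _ k]
  by (intro V.subgroupI) (auto intro!: exI[of _ "\<one>\<^bsub>Gv r\<^esub>"])
 have "a [^]\<^bsub>Gv r\<^esub> (d * k) \<in> ?H" if "a \<in> carrier (Gv r)" for a
 proof -
  have "ve r (a [^]\<^bsub>Gv r\<^esub> (d * k)) = (ve r a [^]\<^bsub>FT\<^esub> d) [^]\<^bsub>FT\<^esub> k"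
   using that r by (simp add: ve_pow G.nat_pow_pow)
  then show ?thesis using vertex_pow_M[OF r that] that by (auto simp: power_set_def)
 qed
 then obtain R where R: "finite R" "R \<subseteq> carrier (Gv r)" "\<And>x. x \<in> carrier (Gv r) \<Longrightarrow> \<exists>y\<in>R. x \<otimes>\<^bsub>Gv r\<^esub> inv\<^bsub>Gv r\<^esub> y \<in> ?H"
  using V.finite_cosets[OF H, of "d * k"] d k by auto
 have "(\<lambda>m. (\<lambda>x. m \<cdot> x) ` ?P) ` M \<subseteq> (\<lambda>y. {z \<in> carrier FT. z \<cdot> inv\<^bsub>FT\<^esub> ve r y \<in> ?P}) ` R"
 proof
  fix A assume "A \<in> (\<lambda>m. (\<lambda>x. m \<cdot> x) ` ?P) ` M"
  then obtain m where m: "m \<in> M" "A = (\<lambda>x. m \<cdot> x) ` ?P" by blast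
  then obtain x where x: "x \<in> carrier (Gv r)" "m = ve r x" using M_vertex[OF r] by blast
  then obtain y where y: "y \<in> R" "x \<otimes>\<^bsub>Gv r\<^esub> inv\<^bsub>Gv r\<^esub> y \<in> ?H" using R by blast
  have yc: "y \<in> carrier (Gv r)" using y R by blast
  then have my: "m \<cdot> inv\<^bsub>FT\<^esub> ve r y \<in> ?P" using x y r by (auto simp: ve.hom_mult)
  have Pc: "p \<in> carrier FT" if "p \<in> ?P" for p using subsetD[OF power_set_M that] by simp
  have vc: "ve r y \<in> carrier FT" using yc by simp
  have mp: "p \<cdot> m = m \<cdot> p" if "p \<in> ?P" for p
   using M_commute[OF subsetD[OF power_set_M that] m(1)] .
  have "z \<in> A \<longleftrightarrow> z \<cdot> inv\<^bsub>FT\<^esub> ve r y \<in> ?P" if z: "z \<in> carrier FT" for z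
  proof
   assume "z \<in> A"
   then obtain p where p: "p \<in> ?P" "z = p \<cdot> m" using m mp by auto
   then have "z \<cdot> inv\<^bsub>FT\<^esub> ve r y = p \<cdot> (m \<cdot> inv\<^bsub>FT\<^esub> ve r y)" using m vc Pc by (simp add: G.m_assoc)
   then show "z \<cdot> inv\<^bsub>FT\<^esub> ve r y \<in> ?P" using subgroup.m_closed[OF power_set_subgroup p(1) my] by simp
  next
   assume a: "z \<cdot> inv\<^bsub>FT\<^esub> ve r y \<in> ?P"
   let ?p = "(z \<cdot> inv\<^bsub>FT\<^esub> ve r y) \<cdot> inv\<^bsub>FT\<^esub> (m \<cdot> inv\<^bsub>FT\<^esub> ve r y)"
   have p: "?p \<in> ?P" using a my by (simp add: subgroup.m_closed[OF power_set_subgroup] subgroup.m_inv_closed[OF power_set_subgroup])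
   have "inv\<^bsub>FT\<^esub> ve r y \<cdot> (ve r y \<cdot> inv\<^bsub>FT\<^esub> m) = inv\<^bsub>FT\<^esub> m"
    using m vc by (simp add: G.m_assoc[symmetric])
   then have "?p = z \<cdot> inv\<^bsub>FT\<^esub> m" using z m vc by (simp add: G.inv_mult_group G.m_assoc)
   then have "z = ?p \<cdot> m" using z m by (simp add: G.m_assoc)
   then show "z \<in> A" using m p mp by auto
  qed
  moreover have "A \<subseteq> carrier FT" using m Pc by auto
  ultimately have "A = {z \<in> carrier FT. z \<cdot> inv\<^bsub>FT\<^esub> ve r y \<in> ?P}" by blast
  then show "A \<in> (\<lambda>y. {z \<in> carrier FT. z \<cdot> inv\<^bsub>FT\<^esub> ve r y \<in> ?P}) ` R" using y by blast
 qed
 then show ?thesis using R(1) by (meson finite_imageI finite_subset)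
qed

text \<open>The twisted conjugation \<open>m \<mapsto> \<sigma>(g) m g\<inverse>\<close> is an affine action on \<open>M\<close> in which \<open>g \<in> G\<^sub>v\<close>
 acts as the translation by \<open>g\<^sup>d\<close>; reducing it modulo \<open>dl\<close> gives a finite quotient that meets
 the vertex groups in the lattice of \<open>l\<close>-th powers.\<close>

lemma lattice_quotient:
 assumes l: "(l::nat) > 0"
 obtains N where "finite_index_normal N FT"
  "\<And>v g. v \<in> verts X \<Longrightarrow> g \<in> carrier (Gv v) \<Longrightarrow> ve v g \<in> N \<longleftrightarrow> ve v g \<in> power_set FT M l"
proof -
 let ?P = "power_set FT M (d * l)"
 let ?co = "\<lambda>m. (\<lambda>x. m \<cdot> x) ` ?P"
 let ?Y = "?co ` M"
 define act where "act g A = (\<lambda>x. sigma g \<cdot> x \<cdot> inv\<^bsub>FT\<^esub> g) ` A" for g A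
 have P: "subgroup ?P FT" by (rule power_set_subgroup)
 have Pc: "p \<in> carrier FT" if "p \<in> ?P" for p using subsetD[OF power_set_M that] by simp
 have YC: "A \<subseteq> carrier FT" if "A \<in> ?Y" for A using that Pc by auto
 have tw: "sigma g \<cdot> m \<cdot> inv\<^bsub>FT\<^esub> g \<in> M" if g: "g \<in> carrier FT" and m: "m \<in> M" for g m
 proof -
  have "sigma g \<cdot> m \<cdot> inv\<^bsub>FT\<^esub> g = (sigma g \<cdot> inv\<^bsub>FT\<^esub> g) \<cdot> (g \<cdot> m \<cdot> inv\<^bsub>FT\<^esub> g)"
  proof -
   have "inv\<^bsub>FT\<^esub> g \<cdot> (g \<cdot> (m \<cdot> inv\<^bsub>FT\<^esub> g)) = m \<cdot> inv\<^bsub>FT\<^esub> g"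
    using g m by (simp add: G.m_assoc[symmetric])
   then show ?thesis using g m by (simp add: G.m_assoc)
  qed
  then show ?thesis using sigma_mod[OF g] M_conj[OF g m] by (simp add: subgroup.m_closed[OF M_subgroup])
 qed
 \<comment> \<open>Twisted conjugation splits into a left factor in \<open>M\<close> and an honest
   conjugation, which permutes the subgroup of powers. Hence cosets go to cosets.\<close>
 have act_co: "act g (?co m) = ?co (sigma g \<cdot> m \<cdot> inv\<^bsub>FT\<^esub> g)" if g: "g \<in> carrier FT" and m: "m \<in> M" for g m
 proof -
  have e: "sigma g \<cdot> (m \<cdot> x) \<cdot> inv\<^bsub>FT\<^esub> g
    = sigma g \<cdot> m \<cdot> inv\<^bsub>FT\<^esub> g \<cdot> (g \<cdot> x \<cdot> inv\<^bsub>FT\<^esub> g)" if "x \<in> carrier FT" for x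
  proof -
   have "inv\<^bsub>FT\<^esub> g \<cdot> (g \<cdot> (x \<cdot> inv\<^bsub>FT\<^esub> g)) = x \<cdot> inv\<^bsub>FT\<^esub> g"
    using g that by (simp add: G.m_assoc[symmetric])
   then show ?thesis using g m that by (simp add: G.m_assoc)
  qed
  have "(\<lambda>x. g \<cdot> x \<cdot> inv\<^bsub>FT\<^esub> g) ` ?P = ?P"
  proof
   show "(\<lambda>x. g \<cdot> x \<cdot> inv\<^bsub>FT\<^esub> g) ` ?P \<subseteq> ?P" using power_set_conj[OF g] by blast
   show "?P \<subseteq> (\<lambda>x. g \<cdot> x \<cdot> inv\<^bsub>FT\<^esub> g) ` ?P"
   proof
    fix x assume x: "x \<in> ?P"
    have "x = g \<cdot> (inv\<^bsub>FT\<^esub> g \<cdot> x \<cdot> g) \<cdot> inv\<^bsub>FT\<^esub> g"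
    proof -
     have "g \<cdot> (inv\<^bsub>FT\<^esub> g \<cdot> x) = x" using g Pc[OF x] by (simp add: G.m_assoc[symmetric])
     then show ?thesis using g Pc[OF x] by (simp add: G.m_assoc[symmetric]) (simp add: G.m_assoc)
    qed
    moreover have "inv\<^bsub>FT\<^esub> g \<cdot> x \<cdot> g \<in> ?P" using power_set_conj[OF G.inv_closed[OF g] x] g by simp
    ultimately show "x \<in> (\<lambda>x. g \<cdot> x \<cdot> inv\<^bsub>FT\<^esub> g) ` ?P" by blast
   qed
  qed
  moreover have "act g (?co m) = (\<lambda>y. sigma g \<cdot> m \<cdot> inv\<^bsub>FT\<^esub> g \<cdot> y) ` (\<lambda>x. g \<cdot> x \<cdot> inv\<^bsub>FT\<^esub> g) ` ?P"
   unfolding act_def image_image using e Pc by (intro image_cong) auto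
  ultimately show ?thesis by simp
 qed
 have fin: "finite_index_normal {g \<in> carrier FT. \<forall>A\<in>?Y. act g A = A} FT"
 proof (rule G.finite_index_normal_action_kernel)
  show "finite ?Y" using d l by (intro finite_M_cosets) simp
  show "act g A \<in> ?Y" if "g \<in> carrier FT" "A \<in> ?Y" for g A using that act_co tw by auto
  show "act \<one>\<^bsub>FT\<^esub> A = A" if "A \<in> ?Y" for A
  proof -
   have "(\<lambda>x. sigma \<one>\<^bsub>FT\<^esub> \<cdot> x \<cdot> inv\<^bsub>FT\<^esub> \<one>\<^bsub>FT\<^esub>) ` A = (\<lambda>x. x) ` A"
    using YC[OF that] by (intro image_cong) auto
   then show ?thesis by (simp add: act_def)
  qed
  show "act (g \<cdot> h) A = act g (act h A)" if "g \<in> carrier FT" "h \<in> carrier FT" "A \<in> ?Y" for g h A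
   unfolding act_def image_image using that YC[OF that(3)]
   by (intro image_cong) (auto simp: G.inv_mult_group G.m_assoc dest!: subsetD)
 qed
 have "ve v g \<in> {g \<in> carrier FT. \<forall>A\<in>?Y. act g A = A} \<longleftrightarrow> ve v g \<in> power_set FT M l"
  if v: "v \<in> verts X" "g \<in> carrier (Gv v)" for v g
 proof -
  have vc: "ve v g \<in> carrier FT" using v by simp
  let ?x = "ve v g [^]\<^bsub>FT\<^esub> d"
  have xM: "?x \<in> M" using vertex_pow_M v by simp
  have act: "act (ve v g) (?co m) = ?co (?x \<cdot> m)" if m: "m \<in> M" for m
  proof -
   have "sigma (ve v g) \<cdot> m \<cdot> inv\<^bsub>FT\<^esub> ve v g = ?x \<cdot> (ve v g \<cdot> m \<cdot> inv\<^bsub>FT\<^esub> ve v g)"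
    using v vc m by (simp add: sigma_ve G.m_assoc)
   also have "ve v g \<cdot> m \<cdot> inv\<^bsub>FT\<^esub> ve v g = m"
    unfolding ve_M_commute[OF v m] using vc m by (simp add: G.m_assoc)
   finally show ?thesis using act_co[OF vc m] by simp
  qed
  have "(\<forall>A\<in>?Y. act (ve v g) A = A) \<longleftrightarrow> ?x \<in> ?P"
  proof
   assume "\<forall>A\<in>?Y. act (ve v g) A = A"
   then have "act (ve v g) (?co \<one>\<^bsub>FT\<^esub>) = ?co \<one>\<^bsub>FT\<^esub>" using subgroup.one_closed[OF M_subgroup] by blast
   then have eq: "?co ?x = ?co \<one>\<^bsub>FT\<^esub>" using act[OF subgroup.one_closed[OF M_subgroup]] vc by simp
   have "?x \<cdot> \<one>\<^bsub>FT\<^esub> \<in> ?co ?x" by (rule imageI[OF subgroup.one_closed[OF P]])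
   then have "?x \<cdot> \<one>\<^bsub>FT\<^esub> \<in> ?co \<one>\<^bsub>FT\<^esub>" unfolding eq .
   then show "?x \<in> ?P"
   proof
    fix p assume p: "?x \<cdot> \<one>\<^bsub>FT\<^esub> = \<one>\<^bsub>FT\<^esub> \<cdot> p" "p \<in> ?P"
    then show "?x \<in> ?P" using vc Pc[OF p(2)] by simp
   qed
  next
   assume x: "?x \<in> ?P"
   show "\<forall>A\<in>?Y. act (ve v g) A = A"
   proof
    fix A assume "A \<in> ?Y"
    then obtain m where m: "m \<in> M" "A = ?co m" by blast
    have "?co (?x \<cdot> m) = ?co m"
    proof
     show "?co (?x \<cdot> m) \<subseteq> ?co m"
     proof
      fix z assume "z \<in> ?co (?x \<cdot> m)"
      then obtain p where p: "p \<in> ?P" "z = ?x \<cdot> m \<cdot> p" by blast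
      have "z = m \<cdot> ?x \<cdot> p" unfolding p(2) M_commute[OF xM m(1)] ..
      then have "z = m \<cdot> (?x \<cdot> p)" using m vc Pc[OF p(1)] by (simp add: G.m_assoc)
      then show "z \<in> ?co m" using subgroup.m_closed[OF P x p(1)] by blast
     qed
     show "?co m \<subseteq> ?co (?x \<cdot> m)"
     proof
      fix z assume "z \<in> ?co m"
      then obtain p where p: "p \<in> ?P" "z = m \<cdot> p" by blast
      let ?p = "inv\<^bsub>FT\<^esub> ?x \<cdot> p"
      have "?x \<cdot> m \<cdot> ?p = m \<cdot> ?x \<cdot> ?p" unfolding M_commute[OF xM m(1)] ..
      also have "\<dots> = m \<cdot> (?x \<cdot> ?p)" using m vc Pc[OF p(1)] by (simp add: G.m_assoc)
      also have "?x \<cdot> ?p = p" using vc Pc[OF p(1)] by (simp add: G.m_assoc[symmetric])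
      finally have "z = ?x \<cdot> m \<cdot> ?p" using p by simp
      moreover have "?p \<in> ?P" using x p by (simp add: subgroup.m_closed[OF P] subgroup.m_inv_closed[OF P])
      ultimately show "z \<in> ?co (?x \<cdot> m)" by blast
     qed
    qed
    then show "act (ve v g) A = A" using act[OF m(1)] m by simp
   qed
  qed
  \<comment> \<open>The exponent \<open>d\<close> cancels because taking \<open>d\<close>-th powers
    is injective on a vertex group, and the root in \<open>M\<close> can be written as an element of
    the group at \<open>v\<close>.\<close>
  also have "\<dots> \<longleftrightarrow> ve v g \<in> power_set FT M l"
  proof
   assume "?x \<in> ?P"
   then obtain m where m: "m \<in> M" "?x = m [^]\<^bsub>FT\<^esub> (d * l)" by (auto simp: power_set_def)
   then obtain h where h: "h \<in> carrier (Gv v)" "m = ve v h" using M_vertex v by blast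
   interpret V: group "Gv v" using group_Gv v by simp
   have "ve v g [^]\<^bsub>FT\<^esub> d = ve v (h [^]\<^bsub>Gv v\<^esub> l) [^]\<^bsub>FT\<^esub> d"
    using m h v by (simp add: ve_pow G.nat_pow_pow mult.commute)
   then have "g = h [^]\<^bsub>Gv v\<^esub> l" using ve_pow_inj[OF v(1,2) _ d] h by simp
   then show "ve v g \<in> power_set FT M l" using m h v by (auto simp: power_set_def ve_pow)
  next
   assume "ve v g \<in> power_set FT M l"
   then obtain m where "m \<in> M" "ve v g = m [^]\<^bsub>FT\<^esub> l" by (auto simp: power_set_def)
   then show "?x \<in> ?P" by (auto simp: power_set_def G.nat_pow_pow mult.commute)
  qed
  finally show ?thesis using vc by simp
 qed
 then show thesis using that[OF fin] by blast
qed

end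

section \<open>Ping-pong and labels over a finite quotient\<close>

section \<open>Ping-pong in the modular group\<close>

type_synonym mat2 = "int \<times> int \<times> int \<times> int"

fun mat2_mult :: "mat2 \<Rightarrow> mat2 \<Rightarrow> mat2" where
 "mat2_mult (a, b, c, d) (a', b', c', d') = (a * a' + b * c', a * b' + b * d', c * a' + d * c', c * b' + d * d')"

fun mat2_vec :: "mat2 \<Rightarrow> int \<times> int \<Rightarrow> int \<times> int" where
 "mat2_vec (a, b, c, d) (u, v) = (a * u + b * v, c * u + d * v)"

definition SL2 :: "mat2 monoid" where
 "SL2 = \<lparr>carrier = {(a, b, c, d). a * d - b * c = 1}, monoid.mult = mat2_mult, one = (1, 0, 0, 1)\<rparr>"

lemma SL2_simps [simp]:
 "(a, b, c, d) \<in> carrier SL2 \<longleftrightarrow> a * d - b * c = 1" "\<one>\<^bsub>SL2\<^esub> = (1, 0, 0, 1)" "x \<otimes>\<^bsub>SL2\<^esub> y = mat2_mult x y"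
 by (simp_all add: SL2_def)

lemma group_SL2: "group SL2"
proof (rule groupI)
 fix x assume x: "x \<in> carrier SL2"
 obtain a b c d where abcd: "x = (a, b, c, d)" by (metis prod.exhaust)
 show "\<exists>y\<in>carrier SL2. y \<otimes>\<^bsub>SL2\<^esub> x = \<one>\<^bsub>SL2\<^esub>"
  using x by (intro bexI[of _ "(d, - b, - c, a)"]) (auto simp: abcd algebra_simps)
 fix y assume y: "y \<in> carrier SL2"
 obtain a' b' c' d' where abcd': "y = (a', b', c', d')" by (metis prod.exhaust)
 have "(a * a' + b * c') * (c * b' + d * d') - (a * b' + b * d') * (c * a' + d * c')
   = (a * d - b * c) * (a' * d' - b' * c')" by (simp add: algebra_simps)
 then show "x \<otimes>\<^bsub>SL2\<^esub> y \<in> carrier SL2" using x y by (simp add: abcd abcd')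
 fix z :: mat2
 obtain a'' b'' c'' d'' where "z = (a'', b'', c'', d'')" by (metis prod.exhaust)
 then show "x \<otimes>\<^bsub>SL2\<^esub> y \<otimes>\<^bsub>SL2\<^esub> z = x \<otimes>\<^bsub>SL2\<^esub> (y \<otimes>\<^bsub>SL2\<^esub> z)"
  by (simp add: abcd abcd' algebra_simps)
next
 fix x :: mat2
 obtain a b c d where "x = (a, b, c, d)" by (metis prod.exhaust)
 then show "\<one>\<^bsub>SL2\<^esub> \<otimes>\<^bsub>SL2\<^esub> x = x" by simp
qed simp

lemma SL2_inv: "(a, b, c, d) \<in> carrier SL2 \<Longrightarrow> inv\<^bsub>SL2\<^esub> (a, b, c, d) = (d, - b, - c, a)"
 by (rule group.inv_equality[OF group_SL2]) (auto simp: algebra_simps)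

lemma mat2_vec_mult: "mat2_vec (mat2_mult x y) z = mat2_vec x (mat2_vec y z)"
proof -
 obtain a b c d a' b' c' d' u v where "x = (a, b, c, d)" "y = (a', b', c', d')" "z = (u, v)" by (metis prod.exhaust)
 then show ?thesis by (simp add: algebra_simps)
qed

text \<open>The matrix \<open>A\<^sup>i B\<^bsup>2s\<^esup> A\<^bsup>-i\<^esup>\<close> for the transvections \<open>A = (1, 2, 0, 1)\<close> and \<open>B = (1, 0, 2, 1)\<close>.\<close>

definition ping_mat :: "int \<Rightarrow> int \<Rightarrow> mat2" where
 "ping_mat i s = (1 + 8 * i * s, - 16 * i * i * s, 4 * s, 1 - 8 * i * s)"

text \<open>Undoing the conjugation by the \<open>i\<close>-th power of \<open>A\<close> replaces
  \<open>u\<close> by \<open>u - 2 * i * v\<close>. In these coordinates the region is a cone around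
  the vertical axis, and the sign \<open>s\<close> separates the attracting cone of the generator
  from that of its inverse.\<close>

definition ping_region :: "int \<Rightarrow> int \<Rightarrow> (int \<times> int) \<Rightarrow> bool" where
 "ping_region i s = (\<lambda>(u, v). u - 2 * i * v \<noteq> 0 \<and> \<bar>v\<bar> > \<bar>u - 2 * i * v\<bar> \<and> s * ((u - 2 * i * v) * v) > 0)"

lemma ping_mat_SL2 [simp]: "ping_mat i s \<in> carrier SL2"
 by (simp add: ping_mat_def algebra_simps)

lemma ping_mat_inv: "inv\<^bsub>SL2\<^esub> ping_mat i s = ping_mat i (- s)"
 using ping_mat_SL2[of i s] unfolding ping_mat_def by (subst SL2_inv) auto

lemma ping_region_nonzero: "ping_region i s z \<Longrightarrow> snd z \<noteq> 0"
 by (auto simp: ping_region_def)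

text \<open>With \<open>w = u - 2 * i * v\<close> the matrix fixes \<open>w\<close> and adds
  \<open>4 * s * w\<close> to \<open>v\<close>. If \<open>z\<close> comes from another index, or is
  the start vector, then \<open>v\<close> is shorter than \<open>w\<close> and the added term
  dominates; if it comes from the same index and sign, then both terms have the same sign and add
  up. The excluded case is backtracking.\<close>

lemma ping_step:
 assumes s: "s = 1 \<or> s = - 1"
  and z: "z = (1, 0) \<or> (\<exists>j t. ping_region j t z \<and> (t = 1 \<or> t = - 1) \<and> \<not> (j = i \<and> t = - s))"
 shows "ping_region i s (mat2_vec (ping_mat i s) z)"
proof -
 obtain u v where uv: "z = (u, v)" by (cases z)
 define w where "w = u - 2 * i * v"
 have img: "mat2_vec (ping_mat i s) z = (u + 8 * i * s * w, v + 4 * s * w)"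
  by (simp add: uv ping_mat_def w_def algebra_simps)
 have new: "u + 8 * i * s * w - 2 * i * (v + 4 * s * w) = w" by (simp add: w_def algebra_simps)
 have "w \<noteq> 0 \<and> (\<bar>v\<bar> \<le> \<bar>w\<bar> \<or> s * (w * v) > 0)"
  using z
 proof
  assume "z = (1, 0)"
  then show ?thesis by (simp add: uv w_def)
 next
  assume "\<exists>j t. ping_region j t z \<and> (t = 1 \<or> t = - 1) \<and> \<not> (j = i \<and> t = - s)"
  then obtain j t where jt: "ping_region j t (u, v)" "t = 1 \<or> t = - 1" "\<not> (j = i \<and> t = - s)" using uv by auto
  show ?thesis
  proof (cases "j = i")
   case True
   then have "t = s" using jt s by auto
   then show ?thesis using jt(1) True by (simp add: ping_region_def w_def)
  next
   case False
   let ?x = "u - 2 * j * v"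
   have x: "\<bar>v\<bar> > \<bar>?x\<bar>" using jt(1) by (simp add: ping_region_def)
   have "w = ?x + 2 * (j - i) * v" by (simp add: w_def algebra_simps)
   moreover have "\<bar>2 * (j - i) * v\<bar> \<ge> 2 * \<bar>v\<bar>"
   proof -
    have "\<bar>j - i\<bar> \<ge> 1" using False by linarith
    then have "2 * (\<bar>j - i\<bar> * \<bar>v\<bar>) \<ge> 2 * (1 * \<bar>v\<bar>)" by (intro mult_left_mono mult_right_mono) auto
    then show ?thesis unfolding abs_mult by simp
   qed
   ultimately have "\<bar>w\<bar> > \<bar>v\<bar>" using x by linarith
   then show ?thesis by auto
  qed
 qed
 then have w: "w \<noteq> 0" and c: "\<bar>v\<bar> \<le> \<bar>w\<bar> \<or> s * (w * v) > 0" by auto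
 have ss: "s * s = 1" using s by auto
 have "w * w > 0" using w zero_less_power2[of w] by (simp add: power2_eq_square)
 have e: "s * (w * (v + 4 * s * w)) = s * (w * v) + 4 * (w * w)" using ss by (simp add: algebra_simps)
 have "\<bar>v + 4 * s * w\<bar> > \<bar>w\<bar> \<and> s * (w * (v + 4 * s * w)) > 0"
  using c
 proof
  assume a: "\<bar>v\<bar> \<le> \<bar>w\<bar>"
  have "\<bar>4 * s * w\<bar> = 4 * \<bar>w\<bar>" using s by auto
  then have "\<bar>v + 4 * s * w\<bar> > \<bar>w\<bar>" using a w by linarith
  moreover have "\<bar>s * (w * v)\<bar> \<le> w * w"
  proof -
   have "\<bar>s * (w * v)\<bar> = \<bar>w\<bar> * \<bar>v\<bar>" using s by (auto simp: abs_mult)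
   also have "\<dots> \<le> \<bar>w\<bar> * \<bar>w\<bar>" using a by (intro mult_left_mono) auto
   finally show ?thesis by simp
  qed
  ultimately show ?thesis using e \<open>w * w > 0\<close> by linarith
 next
  assume a: "s * (w * v) > 0"
  then have pos: "s * (w * (v + 4 * s * w)) > 0" using e \<open>w * w > 0\<close> by linarith
  have "s = 1 \<and> w * v > 0 \<or> s = - 1 \<and> w * v < 0" using a s by auto
  then have "(w > 0 \<and> s * v > 0) \<or> (w < 0 \<and> s * v < 0)" by (auto simp: zero_less_mult_iff mult_less_0_iff)
  moreover have "\<bar>v + 4 * s * w\<bar> = \<bar>s * v + 4 * w\<bar>" using s by auto
  ultimately have "\<bar>v + 4 * s * w\<bar> > \<bar>w\<bar>" by linarith
  with pos show ?thesis by blast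
 qed
 then show ?thesis using w new unfolding img ping_region_def by (simp add: algebra_simps)
qed

section \<open>Labels of paths over a finite quotient\<close>

text \<open>The kernel \<open>N\<close> meets every vertex group in the \<open>l\<close>-th powers
  of \<open>M\<close>. The parameter \<open>l\<close> is there for separability, which has to choose
  it large; linearity and self-similarity use \<open>l = 1\<close>.\<close>

locale lattice_quotient = normal_lattice X Gv Ge \<phi> T r j q \<gamma> n \<eta> M d
 for X :: "('v, 'e) pre_digraph" and Gv :: "'v \<Rightarrow> 'g monoid" and Ge \<phi> T r j q \<gamma> n \<eta> M d +
 fixes l :: nat and N :: "('v, 'e, 'g) generator word set set"
 assumes l: "l > 0" and N: "finite_index_normal N (FG T)"
  and N_vertex: "v \<in> verts X \<Longrightarrow> g \<in> carrier (Gv v) \<Longrightarrow> vertex_elem T v g \<in> N \<longleftrightarrow> vertex_elem T v g \<in> power_set (FG T) M l"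
begin

definition Q :: "('v, 'e, 'g) generator word set set monoid" where
 "Q = FT Mod N"

lemma Q_one: "\<one>\<^bsub>Q\<^esub> = N"
 by (simp add: Q_def FactGroup_def)

lemma N_normal: "N \<lhd> FT" using N by (simp add: finite_index_normal_def)

lemma N_subgroup: "subgroup N FT" using N_normal by (rule normal_imp_subgroup)

lemma finite_Q [simp]: "finite (carrier Q)" using N by (simp add: Q_def finite_index_normal_def)

sublocale Q: group Q
 unfolding Q_def using N_normal by (rule normal.factorgroup_is_group)

lemma coset_hom_Q: "(\<lambda>x. N #>\<^bsub>FT\<^esub> x) \<in> hom FT Q"
 unfolding Q_def using N_normal by (rule normal.r_coset_hom_Mod)

definition pos :: "('v, 'e, 'g) generator word set \<Rightarrow> ('v, 'e, 'g) generator word set set" where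
 "pos x = N #>\<^bsub>FT\<^esub> q x"

sublocale pos: group_hom UG Q pos
proof -
 have "pos = (\<lambda>x. N #>\<^bsub>FT\<^esub> x) \<circ> q" by (auto simp: pos_def)
 then have "pos \<in> hom UG Q"
  using hom_compose[OF q_hom coset_hom_Q] by simp
 then show "group_hom UG Q pos" by unfold_locales
qed

lemma pos_j: "g \<in> carrier FT \<Longrightarrow> pos (j g) = N #>\<^bsub>FT\<^esub> g"
 by (simp add: pos_def q_j)

lemma coset_one_iff: "g \<in> carrier FT \<Longrightarrow> N #>\<^bsub>FT\<^esub> g = \<one>\<^bsub>Q\<^esub> \<longleftrightarrow> g \<in> N"
 unfolding Q_one using G.rcos_self[OF _ N_subgroup, of g] G.coset_join2[OF _ N_subgroup, of g] by metis

lemma pos_one_iff: "g \<in> carrier FT \<Longrightarrow> pos (j g) = \<one>\<^bsub>Q\<^esub> \<longleftrightarrow> g \<in> N"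
 by (simp add: pos_j coset_one_iff)

lemma pos_vel_one_iff: "v \<in> verts X \<Longrightarrow> g \<in> carrier (Gv v) \<Longrightarrow> pos (vel v g) = \<one>\<^bsub>Q\<^esub> \<longleftrightarrow> ve v g \<in> N"
 by (simp add: pos_def q_vertex coset_one_iff)

lemma pos_vel_eq:
 assumes v: "v \<in> verts X" "a \<in> carrier (Gv v)" "b \<in> carrier (Gv v)" "pos (vel v a) = pos (vel v b)"
 shows "ve v (a \<otimes>\<^bsub>Gv v\<^esub> inv\<^bsub>Gv v\<^esub> b) \<in> M"
proof -
 interpret h: group_hom "Gv v" UG "vel v" using v by (intro vertex_elem_group_hom)
 let ?c = "a \<otimes>\<^bsub>Gv v\<^esub> inv\<^bsub>Gv v\<^esub> b"
 have "pos (vel v ?c) = \<one>\<^bsub>Q\<^esub>" using v by simp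
 then have "ve v ?c \<in> N" using pos_vel_one_iff[of v ?c] v by simp
 then show ?thesis using N_vertex[of v ?c] v power_set_M by auto
qed

text \<open>The orbits of the edge groups on the finite quotient are the arcs of the finite graph
  obtained by dividing the Bass-Serre tree by \<open>N\<close>. An arc is indexed by the positions
  at its tail.\<close>

definition edge_coset :: "'e \<Rightarrow> ('v, 'e, 'g) generator word set set \<Rightarrow> ('v, 'e, 'g) generator word set set set" where
 "edge_coset e p = (\<lambda>g. pos (vel (tail X e) g) \<otimes>\<^bsub>Q\<^esub> p) ` Ge e"

definition edge_cosets :: "('e \<times> ('v, 'e, 'g) generator word set set set) set" where
 "edge_cosets = (\<Union>e\<in>arcs X. {(e, edge_coset e p) | p. p \<in> carrier Q})"

lemma edge_cosetsI [simp]: "e \<in> arcs X \<Longrightarrow> p \<in> carrier Q \<Longrightarrow> (e, edge_coset e p) \<in> edge_cosets"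
 by (auto simp: edge_cosets_def)

lemma finite_edge_cosets: "finite edge_cosets"
proof -
 have "edge_cosets = (\<Union>e\<in>arcs X. (\<lambda>p. (e, edge_coset e p)) ` carrier Q)" by (auto simp: edge_cosets_def)
 then show ?thesis by simp
qed

lemma edge_coset_self:
 assumes "e \<in> arcs X" "p \<in> carrier Q"
 shows "p \<in> edge_coset e p"
proof -
 interpret h: group_hom "Gv (tail X e)" UG "vel (tail X e)" using assms by (intro vertex_elem_group_hom) simp
 have "\<one>\<^bsub>Gv (tail X e)\<^esub> \<in> Ge e" using subgroup_Ge[OF assms(1)] by (rule subgroup.one_closed)
 moreover have "p = pos (vel (tail X e) \<one>\<^bsub>Gv (tail X e)\<^esub>) \<otimes>\<^bsub>Q\<^esub> p" using assms by simp
 ultimately show ?thesis unfolding edge_coset_def by blast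
qed

lemma edge_coset_shift:
 assumes "e \<in> arcs X" "g \<in> Ge e" "p \<in> carrier Q"
 shows "edge_coset e (pos (vel (tail X e) g) \<otimes>\<^bsub>Q\<^esub> p) = edge_coset e p"
proof -
 let ?o = "tail X e"
 interpret h: group_hom "Gv ?o" UG "vel ?o" using assms by (intro vertex_elem_group_hom) simp
 have s: "subgroup (Ge e) (Gv ?o)" using assms subgroup_Ge by simp
 have c: "h \<in> carrier (Gv ?o)" if "h \<in> Ge e" for h using that assms by simp
 have sub: "edge_coset e (pos (vel ?o g) \<otimes>\<^bsub>Q\<^esub> p) \<subseteq> edge_coset e p" if "g \<in> Ge e" "p \<in> carrier Q" for g p
 proof
  fix x assume "x \<in> edge_coset e (pos (vel ?o g) \<otimes>\<^bsub>Q\<^esub> p)"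
  then obtain h where h: "h \<in> Ge e" "x = pos (vel ?o h) \<otimes>\<^bsub>Q\<^esub> (pos (vel ?o g) \<otimes>\<^bsub>Q\<^esub> p)" by (auto simp: edge_coset_def)
  then have "x = pos (vel ?o (h \<otimes>\<^bsub>Gv ?o\<^esub> g)) \<otimes>\<^bsub>Q\<^esub> p" using that c by (simp add: Q.m_assoc)
  then show "x \<in> edge_coset e p" using subgroup.m_closed[OF s h(1) that(1)] by (auto simp: edge_coset_def)
 qed
 have "edge_coset e p \<subseteq> edge_coset e (pos (vel ?o g) \<otimes>\<^bsub>Q\<^esub> p)"
 proof -
  have "pos (vel ?o (inv\<^bsub>Gv ?o\<^esub> g)) \<otimes>\<^bsub>Q\<^esub> (pos (vel ?o g) \<otimes>\<^bsub>Q\<^esub> p) = p"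
   using assms c by (simp add: Q.m_assoc[symmetric])
  then show ?thesis
   using sub[of "inv\<^bsub>Gv ?o\<^esub> g" "pos (vel ?o g) \<otimes>\<^bsub>Q\<^esub> p"] subgroup.m_inv_closed[OF s] assms c by simp
 qed
 then show ?thesis using sub assms by blast
qed

text \<open>The product of the arc labels \<open>\<kappa>\<close> along the lift of a path that
  starts at a given position. The target group stays a parameter: matrices, free groups and the
  integers all occur.\<close>

definition label :: "('k, 'm) monoid_scheme \<Rightarrow> ('e \<times> ('v, 'e, 'g) generator word set set set \<Rightarrow> 'k)
  \<Rightarrow> ('v, 'e, 'g) generator word set \<Rightarrow> ('v, 'e, 'g) generator word set set \<Rightarrow> 'k" where
 "label K \<kappa> = (SOME lab. cocycle UG (carrier Q) K (\<lambda>x p. pos x \<otimes>\<^bsub>Q\<^esub> p) lab \<and>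
  (\<forall>v\<in>verts X. \<forall>g\<in>carrier (Gv v). \<forall>p\<in>carrier Q. lab (vel v g) p = \<one>\<^bsub>K\<^esub>) \<and>
  (\<forall>e\<in>arcs X. \<forall>p\<in>carrier Q. lab (stl e) p = \<kappa> (e, edge_coset e p)))"

lemma label:
 assumes K: "group K" and \<kappa>: "\<kappa> \<in> edge_cosets \<rightarrow> carrier K"
 shows label_cocycle: "cocycle UG (carrier Q) K (\<lambda>x p. pos x \<otimes>\<^bsub>Q\<^esub> p) (label K \<kappa>)"
  and label_vel: "v \<in> verts X \<Longrightarrow> g \<in> carrier (Gv v) \<Longrightarrow> p \<in> carrier Q \<Longrightarrow> label K \<kappa> (vel v g) p = \<one>\<^bsub>K\<^esub>"
  and label_stl: "e \<in> arcs X \<Longrightarrow> p \<in> carrier Q \<Longrightarrow> label K \<kappa> (stl e) p = \<kappa> (e, edge_coset e p)"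
proof -
 have "\<exists>lab. cocycle UG (carrier Q) K (\<lambda>x p. pos x \<otimes>\<^bsub>Q\<^esub> p) lab \<and>
  (\<forall>v\<in>verts X. \<forall>g\<in>carrier (Gv v). \<forall>p\<in>carrier Q. lab (vel v g) p = \<one>\<^bsub>K\<^esub>) \<and>
  (\<forall>e\<in>arcs X. \<forall>p\<in>carrier Q. lab (stl e) p = \<kappa> (e, edge_coset e p))"
 proof (rule UG_cocycle[OF Q.group_axioms K pos.homh, of "\<lambda>e p. \<kappa> (e, edge_coset e p)"])
  show "\<kappa> (e, edge_coset e p) \<in> carrier K" if "e \<in> arcs X" "p \<in> carrier Q" for e p
   using \<kappa> edge_cosetsI[OF that] by blast
  show "\<kappa> (e, edge_coset e (pos (vel (tail X e) g) \<otimes>\<^bsub>Q\<^esub> p)) = \<kappa> (e, edge_coset e p)"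
   if "e \<in> arcs X" "g \<in> Ge e" "p \<in> carrier Q" for e g p
   using edge_coset_shift[OF that] by simp
 next
  fix lab assume "cocycle UG (carrier Q) K (\<lambda>x p. pos x \<otimes>\<^bsub>Q\<^esub> p) lab"
   "\<And>v g p. v \<in> verts X \<Longrightarrow> g \<in> carrier (Gv v) \<Longrightarrow> p \<in> carrier Q \<Longrightarrow> lab (vel v g) p = \<one>\<^bsub>K\<^esub>"
   "\<And>e p. e \<in> arcs X \<Longrightarrow> p \<in> carrier Q \<Longrightarrow> lab (stl e) p = \<kappa> (e, edge_coset e p)"
  then show "\<exists>lab. cocycle UG (carrier Q) K (\<lambda>x p. pos x \<otimes>\<^bsub>Q\<^esub> p) lab \<and>
   (\<forall>v\<in>verts X. \<forall>g\<in>carrier (Gv v). \<forall>p\<in>carrier Q. lab (vel v g) p = \<one>\<^bsub>K\<^esub>) \<and>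
   (\<forall>e\<in>arcs X. \<forall>p\<in>carrier Q. lab (stl e) p = \<kappa> (e, edge_coset e p))" by blast
 qed
 from someI_ex[OF this, folded label_def]
 show "cocycle UG (carrier Q) K (\<lambda>x p. pos x \<otimes>\<^bsub>Q\<^esub> p) (label K \<kappa>)"
  "v \<in> verts X \<Longrightarrow> g \<in> carrier (Gv v) \<Longrightarrow> p \<in> carrier Q \<Longrightarrow> label K \<kappa> (vel v g) p = \<one>\<^bsub>K\<^esub>"
  "e \<in> arcs X \<Longrightarrow> p \<in> carrier Q \<Longrightarrow> label K \<kappa> (stl e) p = \<kappa> (e, edge_coset e p)" by blast+
qed

lemma label_stl_inv:
 assumes K: "group K" and \<kappa>: "\<kappa> \<in> edge_cosets \<rightarrow> carrier K" and e: "e \<in> arcs X" "p \<in> carrier Q"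
 shows "label K \<kappa> (inv\<^bsub>UG\<^esub> stl e) p = inv\<^bsub>K\<^esub> \<kappa> (e, edge_coset e (inv\<^bsub>Q\<^esub> pos (stl e) \<otimes>\<^bsub>Q\<^esub> p))"
 using cocycle_inv(1)[OF label_cocycle[OF K \<kappa>] e(2) K U.group_axioms, of "stl e"] label_stl[OF K \<kappa> e(1)] e by simp

text \<open>Labels in a free group are therefore finer than their matrix images, which lets the
  ping-pong statement be transferred to free groups.\<close>

lemma label_hom:
 assumes K: "group K" and K': "group K'" and \<kappa>: "\<kappa> \<in> edge_cosets \<rightarrow> carrier K" and f: "f \<in> hom K K'"
  and \<kappa>': "\<And>\<epsilon>. \<epsilon> \<in> edge_cosets \<Longrightarrow> \<kappa>' \<epsilon> = f (\<kappa> \<epsilon>)" and x: "x \<in> carrier UG" and p: "p \<in> carrier Q"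
 shows "label K' \<kappa>' x p = f (label K \<kappa> x p)"
 using x p
proof (induction arbitrary: p rule: FG_induct)
 interpret f: group_hom K K' f using K K' f by (simp add: group_hom_def group_hom_axioms_def)
 have \<kappa>'c: "\<kappa>' \<in> edge_cosets \<rightarrow> carrier K'"
  using f.hom_closed[OF funcset_mem[OF \<kappa>]] \<kappa>' by simp
 note c = cocycleD[OF label_cocycle[OF K \<kappa>]] and c' = cocycleD[OF label_cocycle[OF K' \<kappa>'c]]
 {
  case one
  then show ?case
   using cocycle_one[OF label_cocycle[OF K \<kappa>] _ K U.group_axioms] cocycle_one[OF label_cocycle[OF K' \<kappa>'c] _ K' U.group_axioms] by simp
 next
  case (vertex v g x)
  then show ?case using c(2,5) c'(5) label_vel[OF K \<kappa>] label_vel[OF K' \<kappa>'c] by simp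
 next
  case (stable e x)
  have "\<kappa> (e, edge_coset e (pos x \<otimes>\<^bsub>Q\<^esub> p)) \<in> carrier K" using \<kappa> stable by (auto intro!: funcset_mem[OF \<kappa>])
  then show ?case using stable c(2,5) c'(5) label_stl[OF K \<kappa>] label_stl[OF K' \<kappa>'c] \<kappa>' by simp
 next
  case (stable_inv e x)
  have "\<kappa> (e, edge_coset e (inv\<^bsub>Q\<^esub> pos (stl e) \<otimes>\<^bsub>Q\<^esub> (pos x \<otimes>\<^bsub>Q\<^esub> p))) \<in> carrier K"
   using stable_inv by (auto intro!: funcset_mem[OF \<kappa>])
  then show ?case using stable_inv c(2,5) c'(5) label_stl_inv[OF K \<kappa>] label_stl_inv[OF K' \<kappa>'c] \<kappa>' by simp
 }
qed

subsection \<open>Reduced paths\<close>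

text \<open>The third argument remembers the last arc and its direction, so that a turn back along
  it is allowed only with a vertex element outside the edge subgroup. Again letters are added on the
  left.\<close>

inductive reduced_path :: "'v \<Rightarrow> ('v, 'e, 'g) generator word set \<Rightarrow> ('e \<times> bool) option \<Rightarrow> bool" where
 start: "reduced_path r \<one>\<^bsub>UG\<^esub> None"
| forward: "reduced_path (tail X e) u lst \<Longrightarrow> e \<in> arcs X \<Longrightarrow> a \<in> carrier (Gv (tail X e)) \<Longrightarrow> \<not> (lst = Some (e, False) \<and> a \<in> Ge e)
  \<Longrightarrow> reduced_path (head X e) (stl e \<otimes>\<^bsub>UG\<^esub> (vel (tail X e) a \<otimes>\<^bsub>UG\<^esub> u)) (Some (e, True))"
| backward: "reduced_path (head X e) u lst \<Longrightarrow> e \<in> arcs X \<Longrightarrow> a \<in> carrier (Gv (head X e)) \<Longrightarrow> \<not> (lst = Some (e, True) \<and> a \<in> \<phi> e ` Ge e)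
  \<Longrightarrow> reduced_path (tail X e) (inv\<^bsub>UG\<^esub> stl e \<otimes>\<^bsub>UG\<^esub> (vel (head X e) a \<otimes>\<^bsub>UG\<^esub> u)) (Some (e, False))"

lemma reduced_path_closed: "reduced_path v u lst \<Longrightarrow> v \<in> verts X \<and> u \<in> carrier UG"
 by (induction rule: reduced_path.induct) (auto simp: r)

lemma reduced_path_SomeD:
 assumes "reduced_path v u (Some (e, b))"
 shows "\<exists>u' a lst. e \<in> arcs X \<and> v = (if b then head X e else tail X e) \<and>
  reduced_path (if b then tail X e else head X e) u' lst \<and> a \<in> carrier (Gv (if b then tail X e else head X e)) \<and>
  u = (if b then stl e else inv\<^bsub>UG\<^esub> stl e) \<otimes>\<^bsub>UG\<^esub> (vel (if b then tail X e else head X e) a \<otimes>\<^bsub>UG\<^esub> u')"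
 using assms by (cases rule: reduced_path.cases) auto

text \<open>A turn back through an element of the edge subgroup is removed by the relation of the
  stable letter and absorbed into the neighbouring vertex element. Existence of a reduced form
  suffices; in place of its uniqueness comes ping-pong.\<close>

lemma path_reduced:
 assumes "path r v x"
 shows "\<exists>u a lst. reduced_path v u lst \<and> a \<in> carrier (Gv v) \<and> x = vel v a \<otimes>\<^bsub>UG\<^esub> u"
 using assms
proof (induction rule: path.induct)
 case refl
 interpret h: group_hom "Gv r" UG "vel r" using refl by (intro vertex_elem_group_hom)
 show ?case by (intro exI[of _ "\<one>\<^bsub>UG\<^esub>"] exI[of _ "\<one>\<^bsub>Gv r\<^esub>"] exI[of _ None]) (simp add: reduced_path.start)
next
 case (vertex v x g)
 then obtain u a lst where u: "reduced_path v u lst" "a \<in> carrier (Gv v)" "x = vel v a \<otimes>\<^bsub>UG\<^esub> u" by blast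
 have v: "v \<in> verts X" "u \<in> carrier UG" using reduced_path_closed[OF u(1)] by auto
 interpret h: group_hom "Gv v" UG "vel v" using v by (intro vertex_elem_group_hom)
 have "vel v g \<otimes>\<^bsub>UG\<^esub> x = vel v (g \<otimes>\<^bsub>Gv v\<^esub> a) \<otimes>\<^bsub>UG\<^esub> u" using u v vertex by (simp add: U.m_assoc)
 moreover have "g \<otimes>\<^bsub>Gv v\<^esub> a \<in> carrier (Gv v)" using u vertex by simp
 ultimately show ?case using u(1) by blast
next
 case (forward e x)
 then obtain u a lst where u: "reduced_path (tail X e) u lst" "a \<in> carrier (Gv (tail X e))" "x = vel (tail X e) a \<otimes>\<^bsub>UG\<^esub> u" by blast
 have uc: "u \<in> carrier UG" using reduced_path_closed[OF u(1)] by auto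
 interpret h: group_hom "Gv (head X e)" UG "vel (head X e)" using forward by (intro vertex_elem_group_hom) simp
 show ?case
 proof (cases "lst = Some (e, False) \<and> a \<in> Ge e")
  case True
  then have a: "a \<in> Ge e" by simp
  obtain u' a' lst' where u': "reduced_path (head X e) u' lst'" "a' \<in> carrier (Gv (head X e))"
    "u = inv\<^bsub>UG\<^esub> stl e \<otimes>\<^bsub>UG\<^esub> (vel (head X e) a' \<otimes>\<^bsub>UG\<^esub> u')"
   using u(1) True reduced_path_SomeD[of "tail X e" u e False] by auto
  have u'c: "u' \<in> carrier UG" using reduced_path_closed[OF u'(1)] by auto
  have "stl e \<otimes>\<^bsub>UG\<^esub> x = (stl e \<otimes>\<^bsub>UG\<^esub> vel (tail X e) a) \<otimes>\<^bsub>UG\<^esub> u"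
   using u uc forward by (simp add: U.m_assoc)
  also have "\<dots> = vel (head X e) (\<phi> e a) \<otimes>\<^bsub>UG\<^esub> (stl e \<otimes>\<^bsub>UG\<^esub> u)"
   using stable_elem_rel[OF forward(2) a, of "X\<lparr>arcs := {}\<rparr>"] uc forward a by (simp add: U.m_assoc)
  also have "stl e \<otimes>\<^bsub>UG\<^esub> u = vel (head X e) a' \<otimes>\<^bsub>UG\<^esub> u'"
   using u' u'c forward by (simp add: U.m_assoc[symmetric])
  also have "vel (head X e) (\<phi> e a) \<otimes>\<^bsub>UG\<^esub> (vel (head X e) a' \<otimes>\<^bsub>UG\<^esub> u') = vel (head X e) (\<phi> e a \<otimes>\<^bsub>Gv (head X e)\<^esub> a') \<otimes>\<^bsub>UG\<^esub> u'"
   using u' u'c forward a by (simp add: U.m_assoc)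
  finally show ?thesis using u' phi_carrier[OF forward(2) a] by (meson h.G.m_closed)
 next
  case False
  show ?thesis
   using reduced_path.forward[OF u(1) forward(2) u(2) False] u uc forward
   by (intro exI[of _ "stl e \<otimes>\<^bsub>UG\<^esub> x"] exI[of _ "\<one>\<^bsub>Gv (head X e)\<^esub>"] exI[of _ "Some (e, True)"]) simp
 qed
next
 case (backward e x)
 then obtain u a lst where u: "reduced_path (head X e) u lst" "a \<in> carrier (Gv (head X e))" "x = vel (head X e) a \<otimes>\<^bsub>UG\<^esub> u" by blast
 have uc: "u \<in> carrier UG" using reduced_path_closed[OF u(1)] by auto
 interpret h: group_hom "Gv (tail X e)" UG "vel (tail X e)" using backward by (intro vertex_elem_group_hom) simp
 show ?case
 proof (cases "lst = Some (e, True) \<and> a \<in> \<phi> e ` Ge e")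
  case True
  then obtain g where g: "g \<in> Ge e" "a = \<phi> e g" by blast
  obtain u' a' lst' where u': "reduced_path (tail X e) u' lst'" "a' \<in> carrier (Gv (tail X e))"
    "u = stl e \<otimes>\<^bsub>UG\<^esub> (vel (tail X e) a' \<otimes>\<^bsub>UG\<^esub> u')"
   using u(1) True reduced_path_SomeD[of "head X e" u e True] by auto
  have u'c: "u' \<in> carrier UG" using reduced_path_closed[OF u'(1)] by auto
  let ?y = "vel (tail X e) a' \<otimes>\<^bsub>UG\<^esub> u'"
  have yc: "?y \<in> carrier UG" using u' u'c backward by simp
  have "x = (vel (head X e) (\<phi> e g) \<otimes>\<^bsub>UG\<^esub> stl e) \<otimes>\<^bsub>UG\<^esub> ?y"
   using u u' g yc backward by (simp add: U.m_assoc)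
  also have "\<dots> = stl e \<otimes>\<^bsub>UG\<^esub> (vel (tail X e) g \<otimes>\<^bsub>UG\<^esub> ?y)"
   using stable_elem_rel[OF backward(2) g(1), of "X\<lparr>arcs := {}\<rparr>", symmetric] yc backward g by (simp add: U.m_assoc)
  finally have "inv\<^bsub>UG\<^esub> stl e \<otimes>\<^bsub>UG\<^esub> x = vel (tail X e) g \<otimes>\<^bsub>UG\<^esub> ?y"
   using yc backward g by (simp add: U.m_assoc[symmetric])
  also have "\<dots> = vel (tail X e) (g \<otimes>\<^bsub>Gv (tail X e)\<^esub> a') \<otimes>\<^bsub>UG\<^esub> u'"
   using u' u'c backward g by (simp add: U.m_assoc)
  finally show ?thesis using u' Ge_carrier[OF backward(2) g(1)] by (meson h.G.m_closed)
 next
  case False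
  show ?thesis
   using reduced_path.backward[OF u(1) backward(2) u(2) False] u uc backward
   by (intro exI[of _ "inv\<^bsub>UG\<^esub> stl e \<otimes>\<^bsub>UG\<^esub> x"] exI[of _ "\<one>\<^bsub>Gv (tail X e)\<^esub>"] exI[of _ "Some (e, False)"]) simp
 qed
qed

definition edge_index :: "'e \<times> ('v, 'e, 'g) generator word set set set \<Rightarrow> nat" where
 "edge_index = (SOME f. inj_on f edge_cosets)"

lemma edge_index_inj: "inj_on edge_index edge_cosets"
 using finite_imp_inj_to_nat_seg[OF finite_edge_cosets] unfolding edge_index_def by (metis someI_ex)

abbreviation "sl_label \<equiv> label SL2 (\<lambda>\<epsilon>. ping_mat (int (edge_index \<epsilon>)) 1)"

lemma sl_label: "(\<lambda>\<epsilon>. ping_mat (int (edge_index \<epsilon>)) 1) \<in> edge_cosets \<rightarrow> carrier SL2"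
 by simp

lemma edge_index_eqD:
 assumes "e \<in> arcs X" "e' \<in> arcs X" "p \<in> carrier Q" "p' \<in> carrier Q"
  "int (edge_index (e, edge_coset e p)) = int (edge_index (e', edge_coset e' p'))"
 shows "e = e'" "\<exists>g\<in>Ge e. p' = pos (vel (tail X e) g) \<otimes>\<^bsub>Q\<^esub> p"
proof -
 have eq: "(e, edge_coset e p) = (e', edge_coset e' p')"
  using assms edge_index_inj by (auto dest!: inj_onD)
 then show "e = e'" by simp
 show "\<exists>g\<in>Ge e. p' = pos (vel (tail X e) g) \<otimes>\<^bsub>Q\<^esub> p"
 proof -
  have "p' \<in> edge_coset e p" using edge_coset_self[OF assms(2,4)] eq by (metis prod.inject)
  then show ?thesis by (auto simp: edge_coset_def)
 qed
qed

text \<open>After each arc the image of the vector \<open>(1, 0)\<close> lies in the region of this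
  arc and direction. After a forward crossing the position at the tail is recovered by undoing the
  stable letter.\<close>

lemma reduced_path_label:
 assumes "reduced_path v u lst"
 shows "case lst of None \<Rightarrow> u = \<one>\<^bsub>UG\<^esub> \<and> v = r
  | Some (e, b) \<Rightarrow> e \<in> arcs X \<and> ping_region (int (edge_index (e, edge_coset e (if b then inv\<^bsub>Q\<^esub> pos (stl e) \<otimes>\<^bsub>Q\<^esub> pos u else pos u))))
    (if b then 1 else - 1) (mat2_vec (sl_label u \<one>\<^bsub>Q\<^esub>) (1, 0))"
 using assms
proof (induction rule: reduced_path.induct)
 note c = cocycleD[OF label_cocycle[OF group_SL2 sl_label]]
 have one: "\<one>\<^bsub>Q\<^esub> \<in> carrier Q" by simp
 have lab: "sl_label (y \<otimes>\<^bsub>UG\<^esub> (vel v a \<otimes>\<^bsub>UG\<^esub> u)) \<one>\<^bsub>Q\<^esub> = mat2_mult (sl_label y (pos (vel v a) \<otimes>\<^bsub>Q\<^esub> pos u)) (sl_label u \<one>\<^bsub>Q\<^esub>)"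
  if "v \<in> verts X" "a \<in> carrier (Gv v)" "u \<in> carrier UG" "y \<in> carrier UG" for v a u y
 proof -
  have "sl_label (vel v a \<otimes>\<^bsub>UG\<^esub> u) \<one>\<^bsub>Q\<^esub> = sl_label u \<one>\<^bsub>Q\<^esub>"
   using c(5)[OF one, of "vel v a" u] label_vel[OF group_SL2 sl_label, of v a "pos u"] c(2)[OF one, of u] that
    monoid.l_one[OF group.is_monoid[OF group_SL2], of "sl_label u \<one>\<^bsub>Q\<^esub>"] by simp
  then show ?thesis using c(5)[OF one, of y "vel v a \<otimes>\<^bsub>UG\<^esub> u"] that by simp
 qed
 {
  case start
  then show ?case by simp
 next
  case (forward e u lst a)
  have u: "tail X e \<in> verts X" "u \<in> carrier UG" using reduced_path_closed[OF forward(1)] by auto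
  let ?p = "pos (vel (tail X e) a) \<otimes>\<^bsub>Q\<^esub> pos u"
  let ?i = "int (edge_index (e, edge_coset e ?p))"
  let ?z = "mat2_vec (sl_label u \<one>\<^bsub>Q\<^esub>) (1, 0)"
  have p: "?p \<in> carrier Q" using u forward by simp
  have "ping_region ?i 1 (mat2_vec (ping_mat ?i 1) ?z)"
  proof (rule ping_step, simp)
   show "?z = (1, 0) \<or> (\<exists>j t. ping_region j t ?z \<and> (t = 1 \<or> t = - 1) \<and> \<not> (j = ?i \<and> t = - 1))"
   proof (cases lst)
    case None
    then have "u = \<one>\<^bsub>UG\<^esub>" using forward by simp
    then show ?thesis using cocycle_one[OF label_cocycle[OF group_SL2 sl_label] one group_SL2 U.group_axioms] by simp
   next
    case (Some eb)
    obtain e' b where eb: "eb = (e', b)" by (cases eb)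
    have e': "e' \<in> arcs X" and reg: "ping_region (int (edge_index (e', edge_coset e' (if b then inv\<^bsub>Q\<^esub> pos (stl e') \<otimes>\<^bsub>Q\<^esub> pos u else pos u))))
      (if b then 1 else - 1) ?z" using forward(5) Some eb by auto
    show ?thesis
    proof (cases b)
     case True
     then have "ping_region (int (edge_index (e', edge_coset e' (inv\<^bsub>Q\<^esub> pos (stl e') \<otimes>\<^bsub>Q\<^esub> pos u)))) 1 ?z"
      using reg by simp
     moreover have "(1::int) \<noteq> - 1" by simp
     ultimately show ?thesis by blast
    next
     case False
     \<comment> \<open>Crossing the same arc back would give \<open>a\<close> the same position as
       some \<open>g\<close> in the edge subgroup. Then \<open>a\<close> and \<open>g\<close> differ
       by an element of \<open>M\<close>, which lies inside the edge subgroup, so \<open>a\<close>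
       lies there too, against reducedness.\<close>
     have "int (edge_index (e', edge_coset e' (pos u))) \<noteq> ?i"
     proof
      assume eq: "int (edge_index (e', edge_coset e' (pos u))) = ?i"
      have "e' = e" using edge_index_eqD(1)[OF e' forward(2) _ p eq] u by simp
      then obtain g where g: "g \<in> Ge e" "?p = pos (vel (tail X e) g) \<otimes>\<^bsub>Q\<^esub> pos u"
       using edge_index_eqD(2)[OF e' forward(2) _ p eq] u by auto
      then have "pos (vel (tail X e) a) = pos (vel (tail X e) g)" using u forward g by simp
      then have "ve (tail X e) (a \<otimes>\<^bsub>Gv (tail X e)\<^esub> inv\<^bsub>Gv (tail X e)\<^esub> g) \<in> M"
       using pos_vel_eq u forward g by simp
      interpret V: group "Gv (tail X e)" using u by (simp add: group_Gv)
      have "a \<otimes>\<^bsub>Gv (tail X e)\<^esub> inv\<^bsub>Gv (tail X e)\<^esub> g \<in> Ge e"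
       by (rule M_tail[OF forward(2)]) (use forward g \<open>_ \<in> M\<close> in auto)
      then have "a \<otimes>\<^bsub>Gv (tail X e)\<^esub> inv\<^bsub>Gv (tail X e)\<^esub> g \<otimes>\<^bsub>Gv (tail X e)\<^esub> g \<in> Ge e"
       by (rule subgroup.m_closed[OF subgroup_Ge[OF forward(2)] _ g(1)])
      then have "a \<in> Ge e" using forward g by (simp add: V.m_assoc)
      then show False using forward(4) Some eb False \<open>e' = e\<close> by simp
     qed
     moreover have "ping_region (int (edge_index (e', edge_coset e' (pos u)))) (- 1) ?z"
      using reg False by simp
     ultimately show ?thesis by blast
    qed
   qed
  qed
  moreover have "sl_label (stl e \<otimes>\<^bsub>UG\<^esub> (vel (tail X e) a \<otimes>\<^bsub>UG\<^esub> u)) \<one>\<^bsub>Q\<^esub> = mat2_mult (ping_mat ?i 1) (sl_label u \<one>\<^bsub>Q\<^esub>)"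
   using lab[OF u(1) forward(3) u(2), of "stl e"] label_stl[OF group_SL2 sl_label forward(2) p] forward(2) by simp
  moreover have "inv\<^bsub>Q\<^esub> pos (stl e) \<otimes>\<^bsub>Q\<^esub> pos (stl e \<otimes>\<^bsub>UG\<^esub> (vel (tail X e) a \<otimes>\<^bsub>UG\<^esub> u)) = ?p"
   using u forward by (simp add: Q.m_assoc[symmetric])
  ultimately show ?case using forward(2) by (simp add: mat2_vec_mult)
 next
  case (backward e u lst a)
  have u: "head X e \<in> verts X" "u \<in> carrier UG" using reduced_path_closed[OF backward(1)] by auto
  let ?p' = "pos (vel (head X e) a) \<otimes>\<^bsub>Q\<^esub> pos u"
  let ?p = "inv\<^bsub>Q\<^esub> pos (stl e) \<otimes>\<^bsub>Q\<^esub> ?p'"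
  let ?i = "int (edge_index (e, edge_coset e ?p))"
  let ?z = "mat2_vec (sl_label u \<one>\<^bsub>Q\<^esub>) (1, 0)"
  have p: "?p' \<in> carrier Q" "?p \<in> carrier Q" using u backward by auto
  have "ping_region ?i (- 1) (mat2_vec (ping_mat ?i (- 1)) ?z)"
  proof (rule ping_step, simp)
   show "?z = (1, 0) \<or> (\<exists>j t. ping_region j t ?z \<and> (t = 1 \<or> t = - 1) \<and> \<not> (j = ?i \<and> t = - (- 1)))"
   proof (cases lst)
    case None
    then have "u = \<one>\<^bsub>UG\<^esub>" using backward by simp
    then show ?thesis using cocycle_one[OF label_cocycle[OF group_SL2 sl_label] one group_SL2 U.group_axioms] by simp
   next
    case (Some eb)
    obtain e' b where eb: "eb = (e', b)" by (cases eb)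
    have e': "e' \<in> arcs X" and reg: "ping_region (int (edge_index (e', edge_coset e' (if b then inv\<^bsub>Q\<^esub> pos (stl e') \<otimes>\<^bsub>Q\<^esub> pos u else pos u))))
      (if b then 1 else - 1) ?z" using backward(5) Some eb by auto
    show ?thesis
    proof (cases b)
     case False
     then have "ping_region (int (edge_index (e', edge_coset e' (pos u)))) (- 1) ?z"
      using reg by simp
     moreover have "(- 1 :: int) \<noteq> - (- 1)" by simp
     ultimately show ?thesis by blast
    next
     case True
     have pu: "inv\<^bsub>Q\<^esub> pos (stl e') \<otimes>\<^bsub>Q\<^esub> pos u \<in> carrier Q" using u e' by simp
     have "int (edge_index (e', edge_coset e' (inv\<^bsub>Q\<^esub> pos (stl e') \<otimes>\<^bsub>Q\<^esub> pos u))) \<noteq> ?i"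
     proof
      assume eq: "int (edge_index (e', edge_coset e' (inv\<^bsub>Q\<^esub> pos (stl e') \<otimes>\<^bsub>Q\<^esub> pos u))) = ?i"
      have ee: "e' = e" using edge_index_eqD(1)[OF e' backward(2) pu p(2) eq] by simp
      then obtain g where g: "g \<in> Ge e" "?p = pos (vel (tail X e) g) \<otimes>\<^bsub>Q\<^esub> (inv\<^bsub>Q\<^esub> pos (stl e) \<otimes>\<^bsub>Q\<^esub> pos u)"
       using edge_index_eqD(2)[OF e' backward(2) pu p(2) eq] by auto
      let ?t = "pos (stl e)" and ?h = "pos (vel (head X e) (\<phi> e g))"
      have c': "?t \<in> carrier Q" "?h \<in> carrier Q" "pos (vel (tail X e) g) \<in> carrier Q" "pos u \<in> carrier Q"
       using backward g u by auto
      have th: "?t \<otimes>\<^bsub>Q\<^esub> pos (vel (tail X e) g) = ?h \<otimes>\<^bsub>Q\<^esub> ?t"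
       using arg_cong[OF stable_elem_rel[OF backward(2) g(1), of "X\<lparr>arcs := {}\<rparr>"], of pos] backward(2) g by simp
      have "?p' = ?t \<otimes>\<^bsub>Q\<^esub> ?p" using p c' by (simp add: Q.m_assoc[symmetric])
      also have "\<dots> = ?t \<otimes>\<^bsub>Q\<^esub> pos (vel (tail X e) g) \<otimes>\<^bsub>Q\<^esub> (inv\<^bsub>Q\<^esub> ?t \<otimes>\<^bsub>Q\<^esub> pos u)"
       unfolding g(2) using c' by (simp add: Q.m_assoc)
      also have "\<dots> = ?h \<otimes>\<^bsub>Q\<^esub> (?t \<otimes>\<^bsub>Q\<^esub> (inv\<^bsub>Q\<^esub> ?t \<otimes>\<^bsub>Q\<^esub> pos u))"
       unfolding th using c' by (simp add: Q.m_assoc)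
      also have "?t \<otimes>\<^bsub>Q\<^esub> (inv\<^bsub>Q\<^esub> ?t \<otimes>\<^bsub>Q\<^esub> pos u) = pos u" using c' by (simp add: Q.m_assoc[symmetric])
      finally have "pos (vel (head X e) a) = ?h" using c' u backward by simp
      then have "ve (head X e) (a \<otimes>\<^bsub>Gv (head X e)\<^esub> inv\<^bsub>Gv (head X e)\<^esub> \<phi> e g) \<in> M"
       using pos_vel_eq u backward g by simp
      interpret V: group "Gv (head X e)" using u by (simp add: group_Gv)
      have "a \<otimes>\<^bsub>Gv (head X e)\<^esub> inv\<^bsub>Gv (head X e)\<^esub> \<phi> e g \<in> \<phi> e ` Ge e"
       by (rule M_head[OF backward(2)]) (use backward g \<open>_ \<in> M\<close> in auto)
      then have "a \<otimes>\<^bsub>Gv (head X e)\<^esub> inv\<^bsub>Gv (head X e)\<^esub> \<phi> e g \<otimes>\<^bsub>Gv (head X e)\<^esub> \<phi> e g \<in> \<phi> e ` Ge e"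
       by (rule subgroup.m_closed[OF subgroup_image[OF backward(2)] _ imageI[OF g(1)]])
      then have "a \<in> \<phi> e ` Ge e" using backward g by (simp add: V.m_assoc)
      then show False using backward(4) Some eb True ee by simp
     qed
     moreover have "ping_region (int (edge_index (e', edge_coset e' (inv\<^bsub>Q\<^esub> pos (stl e') \<otimes>\<^bsub>Q\<^esub> pos u)))) 1 ?z"
      using reg True by simp
     ultimately show ?thesis by blast
    qed
   qed
  qed
  moreover have "sl_label (inv\<^bsub>UG\<^esub> stl e \<otimes>\<^bsub>UG\<^esub> (vel (head X e) a \<otimes>\<^bsub>UG\<^esub> u)) \<one>\<^bsub>Q\<^esub> = mat2_mult (ping_mat ?i (- 1)) (sl_label u \<one>\<^bsub>Q\<^esub>)"
   using lab[OF u(1) backward(3) u(2), of "inv\<^bsub>UG\<^esub> stl e"] label_stl_inv[OF group_SL2 sl_label backward(2) p(1)] backward(2)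
   by (simp add: ping_mat_inv)
  moreover have "pos (inv\<^bsub>UG\<^esub> stl e \<otimes>\<^bsub>UG\<^esub> (vel (head X e) a \<otimes>\<^bsub>UG\<^esub> u)) = ?p"
   using u backward by simp
  ultimately show ?case using backward(2) by (simp add: mat2_vec_mult)
 }
qed

text \<open>Ping-pong makes the lower left entry of the label of a reduced path through at least one
 stable letter nonzero.\<close>

lemma sl_label_kernel:
 assumes g: "g \<in> N" and c: "fst (snd (snd (sl_label (j g) \<one>\<^bsub>Q\<^esub>))) = 0"
 shows "g \<in> power_set FT M l"
proof -
 have gc: "g \<in> carrier FT" using g N_subgroup by (rule subgroup.mem_carrier[rotated])
 obtain u a lst where u: "reduced_path r u lst" "a \<in> carrier (Gv r)" "j g = vel r a \<otimes>\<^bsub>UG\<^esub> u"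
  using path_reduced[OF path_j[OF gc]] by blast
 have uc: "u \<in> carrier UG" using reduced_path_closed[OF u(1)] by simp
 note cc = cocycleD[OF label_cocycle[OF group_SL2 sl_label]]
 have one: "\<one>\<^bsub>Q\<^esub> \<in> carrier Q" by simp
 have "sl_label (j g) \<one>\<^bsub>Q\<^esub> = sl_label u \<one>\<^bsub>Q\<^esub>"
  unfolding u(3) using cc(5)[OF one, of "vel r a" u] label_vel[OF group_SL2 sl_label, of r a "pos u"] cc(2)[OF one, of u] u uc r
   monoid.l_one[OF group.is_monoid[OF group_SL2], of "sl_label u \<one>\<^bsub>Q\<^esub>"] by simp
 moreover obtain a' b' c' d' where abcd: "sl_label u \<one>\<^bsub>Q\<^esub> = (a', b', c', d')" by (metis prod.exhaust)
 ultimately have "snd (mat2_vec (sl_label u \<one>\<^bsub>Q\<^esub>) (1, 0)) = 0" using c by simp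
 moreover have "snd (mat2_vec (sl_label u \<one>\<^bsub>Q\<^esub>) (1, 0)) \<noteq> 0" if "lst = Some (e, b)" for e b
 proof (rule ping_region_nonzero)
  show "ping_region (int (edge_index (e, edge_coset e (if b then inv\<^bsub>Q\<^esub> pos (stl e) \<otimes>\<^bsub>Q\<^esub> pos u else pos u))))
    (if b then 1 else - 1) (mat2_vec (sl_label u \<one>\<^bsub>Q\<^esub>) (1, 0))"
   using reduced_path_label[OF u(1)] that by simp
 qed
 ultimately have "lst = None" by (cases lst) auto
 then have "u = \<one>\<^bsub>UG\<^esub>" using reduced_path_label[OF u(1)] by simp
 then have "j g = vel r a" using u r by simp
 then have "g = ve r a" using q_j[OF gc] u r by (simp add: q_vertex)
 then show ?thesis using g N_vertex[OF r u(2)] by simp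
qed

end

section \<open>Linearity\<close>

section \<open>Linearity over the integers\<close>

text \<open>A faithful action by automorphisms on a free abelian group is an integral
  representation; the columns of the matrix are the images of the unit vectors.\<close>

lemma linear_over_int_action:
 assumes G: "group G" and A: "coordinate_group A k \<eta>"
  and cl: "\<And>g x. g \<in> carrier G \<Longrightarrow> x \<in> carrier A \<Longrightarrow> act g x \<in> carrier A"
  and add: "\<And>g x y. g \<in> carrier G \<Longrightarrow> x \<in> carrier A \<Longrightarrow> y \<in> carrier A \<Longrightarrow> act g (x \<otimes>\<^bsub>A\<^esub> y) = act g x \<otimes>\<^bsub>A\<^esub> act g y"
  and mult: "\<And>g h x. g \<in> carrier G \<Longrightarrow> h \<in> carrier G \<Longrightarrow> x \<in> carrier A \<Longrightarrow> act (g \<otimes>\<^bsub>G\<^esub> h) x = act g (act h x)"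
  and one: "\<And>x. x \<in> carrier A \<Longrightarrow> act \<one>\<^bsub>G\<^esub> x = x"
  and faithful: "\<And>g. g \<in> carrier G \<Longrightarrow> (\<And>x. x \<in> carrier A \<Longrightarrow> act g x = x) \<Longrightarrow> g = \<one>\<^bsub>G\<^esub>"
 shows "linear_over_int G"
proof -
 interpret G: group G by fact
 interpret A: coordinate_group A k \<eta> by fact
 have "\<forall>f\<in>int_vecs k. \<exists>x. x \<in> carrier A \<and> \<eta> x = f" using A.\<eta>_surj by blast
 then obtain z where z: "\<And>f. f \<in> int_vecs k \<Longrightarrow> z f \<in> carrier A \<and> \<eta> (z f) = f" by metis
 have z\<eta>: "z (\<eta> x) = x" if "x \<in> carrier A" for x
  using z[OF A.\<eta>_mem[OF that]] A.\<eta>_eq_iff[of "z (\<eta> x)" x] that by simp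
 have z_add: "z (\<lambda>i. f i + g i) = z f \<otimes>\<^bsub>A\<^esub> z g" if "f \<in> int_vecs k" "g \<in> int_vecs k" for f g
  using z[of "\<lambda>i. f i + g i"] z[OF that(1)] z[OF that(2)] A.\<eta>_mult[of "z f" "z g"] that
   A.\<eta>_eq_iff[of "z (\<lambda>i. f i + g i)" "z f \<otimes>\<^bsub>A\<^esub> z g"] by auto
 define F where "F g f = \<eta> (act g (z f))" for g f
 have Fm: "F g f \<in> int_vecs k" if "g \<in> carrier G" "f \<in> int_vecs k" for g f
  using that z cl by (simp add: F_def)
 have F_exp: "F g f j = (\<Sum>l<k. f l * F g (unit_vec l) j)" if g: "g \<in> carrier G" and f: "f \<in> int_vecs k" for g f j
 proof (rule additive_int_vecs[OF _ f])
  fix f f' assume "f \<in> int_vecs k" "f' \<in> int_vecs k"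
  then show "F g (\<lambda>i. f i + f' i) = (\<lambda>i. F g f i + F g f' i)"
   using z g cl z_add add A.\<eta>_mult by (simp add: F_def)
 qed
 have F_mult: "F (g \<otimes>\<^bsub>G\<^esub> h) f = F g (F h f)" if "g \<in> carrier G" "h \<in> carrier G" "f \<in> int_vecs k" for g h f
  using that z cl mult z\<eta> by (simp add: F_def)
 define H where "H g = Matrix.mat k k (\<lambda>(i, j). F g (unit_vec j) i)" for g
 have Hc: "H g \<in> carrier_mat k k" for g by (simp add: H_def)
 have H_mult: "H (g \<otimes>\<^bsub>G\<^esub> h) = H g * H h" if gh: "g \<in> carrier G" "h \<in> carrier G" for g h
 proof (rule eq_matI)
  fix i j assume "i < dim_row (H g * H h)" "j < dim_col (H g * H h)"
  then have ij: "i < k" "j < k" by (auto simp: H_def)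
  have "(H g * H h) $$ (i, j) = (\<Sum>l<k. F g (unit_vec l) i * F h (unit_vec j) l)"
   using ij by (simp add: H_def scalar_prod_def lessThan_atLeast0)
  also have "\<dots> = F g (F h (unit_vec j)) i"
   using F_exp[OF gh(1) Fm[OF gh(2)], of "unit_vec j" i] ij by (simp add: mult.commute)
  also have "\<dots> = H (g \<otimes>\<^bsub>G\<^esub> h) $$ (i, j)" using ij gh by (simp add: H_def F_mult)
  finally show "H (g \<otimes>\<^bsub>G\<^esub> h) $$ (i, j) = (H g * H h) $$ (i, j)" ..
 qed (auto simp: H_def)
 have "F \<one>\<^bsub>G\<^esub> (unit_vec j) = unit_vec j" if "j < k" for j using one z that by (simp add: F_def)
 then have H_one: "H \<one>\<^bsub>G\<^esub> = 1\<^sub>m k"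
  by (intro eq_matI) (auto simp: H_def unit_vec_def)
 let ?R = "ring_mat TYPE(int) k ()"
 have units: "H g \<in> Units ?R" if g: "g \<in> carrier G" for g
  using H_mult[OF g G.inv_closed[OF g]] H_mult[OF G.inv_closed[OF g] g] g H_one Hc
  unfolding Units_def by (auto simp: ring_mat_def intro!: bexI[of _ "H (inv\<^bsub>G\<^esub> g)"])
 have "H \<in> mon G (GL_int k)"
  unfolding mon_def
 proof (intro CollectI conjI)
  show "H \<in> hom G (GL_int k)"
   using units H_mult by (auto simp: hom_def GL_int_def units_of_def) (simp add: ring_mat_def)
  show "inj_on H (carrier G)"
  proof (rule inj_onI)
   fix g h assume gh: "g \<in> carrier G" "h \<in> carrier G" and eq: "H g = H h"
   have "F g (unit_vec j) = F h (unit_vec j)" if j: "j < k" for j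
   proof
    fix i
    show "F g (unit_vec j) i = F h (unit_vec j) i"
    proof (cases "i < k")
     case True
     then show ?thesis using arg_cong[OF eq, of "\<lambda>A. A $$ (i, j)"] j by (simp add: H_def)
    next
     case False
     then show ?thesis
      using Fm[OF gh(1) int_vecs_mem(2)[OF j]] Fm[OF gh(2) int_vecs_mem(2)[OF j]] by (simp add: int_vecs_def)
    qed
   qed
   then have "F g f = F h f" if "f \<in> int_vecs k" for f
    using F_exp[OF gh(1) that] F_exp[OF gh(2) that] by (simp add: fun_eq_iff)
   then have e: "act g x = act h x" if "x \<in> carrier A" for x
    using that z\<eta>[OF that] A.\<eta>_mem[OF that] cl gh A.\<eta>_eq_iff unfolding F_def by metis
   have "inv\<^bsub>G\<^esub> h \<otimes>\<^bsub>G\<^esub> g = \<one>\<^bsub>G\<^esub>"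
    using gh e one cl mult[of "inv\<^bsub>G\<^esub> h" g] mult[of "inv\<^bsub>G\<^esub> h" h] by (intro faithful) auto
   then show "g = h" using gh by (metis G.inv_equality G.inv_inv G.inv_closed)
  qed
 qed
 then show ?thesis unfolding linear_over_int_def by blast
qed

lemma coordinates_integer_group: "coordinates integer_group 1 (\<lambda>z i. if i = 0 then z else 0)"
 unfolding coordinates_def
proof
 show "bij_betw (\<lambda>z i. if i = 0 then z else 0) (carrier integer_group) (int_vecs 1)"
  by (rule bij_betw_byWitness[where f' = "\<lambda>f. f 0"]) (auto simp: int_vecs_def fun_eq_iff)
qed auto

lemma coordinates_DirProd:
 assumes "coordinates A a \<eta>" "coordinates B b \<theta>"
 shows "coordinates (A \<times>\<times> B) (a + b) (\<lambda>(x, y) i. if i < a then \<eta> x i else \<theta> y (i - a))"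
 unfolding coordinates_def
proof
 have A: "bij_betw \<eta> (carrier A) (int_vecs a)" and B: "bij_betw \<theta> (carrier B) (int_vecs b)"
  using assms by (auto simp: coordinates_def)
 show "bij_betw (\<lambda>(x, y) i. if i < a then \<eta> x i else \<theta> y (i - a)) (carrier (A \<times>\<times> B)) (int_vecs (a + b))"
 proof (rule bij_betw_byWitness[where f' = "\<lambda>f. (the_inv_into (carrier A) \<eta> (\<lambda>i. if i < a then f i else 0),
    the_inv_into (carrier B) \<theta> (\<lambda>i. f (i + a)))"])
  have 1: "(\<lambda>i. if i < a then \<eta> x i else 0) = \<eta> x" if "x \<in> carrier A" for x
   using bij_betwE[OF A] that by (auto simp: int_vecs_def fun_eq_iff)
  show "\<forall>xy\<in>carrier (A \<times>\<times> B). (\<lambda>f. (the_inv_into (carrier A) \<eta> (\<lambda>i. if i < a then f i else 0),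
    the_inv_into (carrier B) \<theta> (\<lambda>i. f (i + a)))) ((\<lambda>(x, y) i. if i < a then \<eta> x i else \<theta> y (i - a)) xy) = xy"
   using A B 1 by (auto simp: bij_betw_def the_inv_into_f_f cong: if_cong)
  have fA: "(\<lambda>i. if i < a then f i else 0) \<in> \<eta> ` carrier A" for f
   using A by (auto simp: bij_betw_def int_vecs_def)
  have fB: "(\<lambda>i. f (i + a)) \<in> \<theta> ` carrier B" if "f \<in> int_vecs (a + b)" for f
   using B that by (auto simp: bij_betw_def int_vecs_def)
  show "\<forall>f\<in>int_vecs (a + b). (\<lambda>(x, y) i. if i < a then \<eta> x i else \<theta> y (i - a))
    (the_inv_into (carrier A) \<eta> (\<lambda>i. if i < a then f i else 0), the_inv_into (carrier B) \<theta> (\<lambda>i. f (i + a))) = f"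
   using A B fA fB by (auto simp: bij_betw_def f_the_inv_into_f fun_eq_iff)
  show "(\<lambda>(x, y) i. if i < a then \<eta> x i else \<theta> y (i - a)) ` carrier (A \<times>\<times> B) \<subseteq> int_vecs (a + b)"
   using bij_betwE[OF B] by (auto simp: int_vecs_def)
  show "(\<lambda>f. (the_inv_into (carrier A) \<eta> (\<lambda>i. if i < a then f i else 0),
    the_inv_into (carrier B) \<theta> (\<lambda>i. f (i + a)))) ` int_vecs (a + b) \<subseteq> carrier (A \<times>\<times> B)"
   using fA fB A B by (auto simp: bij_betw_def intro!: the_inv_into_into)
 qed
qed (use assms in \<open>auto simp: coordinates_def fun_eq_iff\<close>)

definition fun_group :: "'i set \<Rightarrow> ('i \<Rightarrow> int) monoid" where
 "fun_group I = \<lparr>carrier = {f. \<forall>i. i \<notin> I \<longrightarrow> f i = 0}, monoid.mult = (\<lambda>f g i. f i + g i), one = (\<lambda>_. 0)\<rparr>"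

lemma group_fun_group: "group (fun_group I)"
proof (rule groupI)
 show "\<exists>g\<in>carrier (fun_group I). g \<otimes>\<^bsub>fun_group I\<^esub> f = \<one>\<^bsub>fun_group I\<^esub>" if "f \<in> carrier (fun_group I)" for f
  using that by (intro bexI[of _ "\<lambda>i. - f i"]) (auto simp: fun_group_def)
qed (auto simp: fun_group_def add.assoc)

lemma coordinates_fun_group:
 assumes "finite I"
 obtains \<eta> where "coordinates (fun_group I) (card I) \<eta>"
proof -
 obtain e where e: "bij_betw e {..<card I} I" using ex_bij_betw_nat_finite[OF assms] by (auto simp: lessThan_atLeast0)
 let ?\<eta> = "\<lambda>f i. if i < card I then f (e i) else 0"
 have "bij_betw ?\<eta> (carrier (fun_group I)) (int_vecs (card I))"
 proof (rule bij_betw_byWitness[where f' = "\<lambda>f x. if x \<in> I then f (the_inv_into {..<card I} e x) else 0"])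
  have inv: "e (the_inv_into {..<card I} e x) = x" "the_inv_into {..<card I} e x < card I" if "x \<in> I" for x
   using e that f_the_inv_into_f_bij_betw[OF e] bij_betw_the_inv_into[OF e] by (auto dest: bij_betwE)
  show "\<forall>f\<in>carrier (fun_group I). (\<lambda>x. if x \<in> I then ?\<eta> f (the_inv_into {..<card I} e x) else 0) = f"
   using inv by (auto simp: fun_group_def fun_eq_iff)
  show "\<forall>f\<in>int_vecs (card I). ?\<eta> (\<lambda>x. if x \<in> I then f (the_inv_into {..<card I} e x) else 0) = f"
   using e by (auto simp: int_vecs_def fun_eq_iff bij_betw_def the_inv_into_f_f)
 qed (auto simp: fun_group_def int_vecs_def)
 then have "coordinates (fun_group I) (card I) ?\<eta>" by (auto simp: coordinates_def fun_group_def)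
 then show thesis by (rule that)
qed

context normal_lattice
begin

text \<open>Transport \<open>M\<close> into the coordinate lattice of the group at \<open>r\<close>
  and take a basis there.\<close>

lemma coordinates_M:
 obtains k \<theta> where "coordinates (FT\<lparr>carrier := M\<rparr>) k \<theta>"
proof -
 interpret V: coordinate_group "Gv r" n "\<eta> r" using coordinate_group_Gv[OF r] .
 interpret h: group_hom "Gv r" FT "ve r" using r by (rule vertex_elem_group_hom)
 let ?H = "{a \<in> carrier (Gv r). ve r a \<in> M}"
 have lat: "int_lattice n (\<eta> r ` ?H)"
  unfolding int_lattice_def
 proof (intro conjI ballI)
  show "(\<lambda>_. 0) \<in> \<eta> r ` ?H"
   using V.\<eta>_one subgroup.one_closed[OF M_subgroup] by (intro image_eqI[of _ _ "\<one>\<^bsub>Gv r\<^esub>"]) auto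
  fix f g assume "f \<in> \<eta> r ` ?H" "g \<in> \<eta> r ` ?H"
  then obtain x y where xy: "x \<in> ?H" "y \<in> ?H" "f = \<eta> r x" "g = \<eta> r y" by blast
  then have "(\<lambda>i. f i - g i) = \<eta> r (x \<otimes>\<^bsub>Gv r\<^esub> inv\<^bsub>Gv r\<^esub> y)" by (simp add: V.\<eta>_mult V.\<eta>_inv)
  moreover have "x \<otimes>\<^bsub>Gv r\<^esub> inv\<^bsub>Gv r\<^esub> y \<in> ?H"
   using xy subgroup.m_closed[OF M_subgroup] subgroup.m_inv_closed[OF M_subgroup] by simp
  ultimately show "(\<lambda>i. f i - g i) \<in> \<eta> r ` ?H" by blast
 qed auto
 have "\<exists>k b. bij_betw b (int_vecs k) (\<eta> r ` ?H) \<and>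
   (\<forall>f\<in>int_vecs k. \<forall>g\<in>int_vecs k. b (\<lambda>i. f i + g i) = (\<lambda>i. b f i + b g i))"
  by (rule int_lattice_basis[OF lat]) blast
 then obtain k b where b0: "bij_betw b (int_vecs k) (\<eta> r ` ?H) \<and>
   (\<forall>f\<in>int_vecs k. \<forall>g\<in>int_vecs k. b (\<lambda>i. f i + g i) = (\<lambda>i. b f i + b g i))" by (elim exE)
 then have b1: "bij_betw b (int_vecs k) (\<eta> r ` ?H)" by simp
 have b2: "b (\<lambda>i. f i + g i) = (\<lambda>i. b f i + b g i)" if "f \<in> int_vecs k" "g \<in> int_vecs k" for f g
  using b0 that by blast
 note b = b1 b2
 define c where "c = the_inv_into (int_vecs k) b"
 define u where "u = the_inv_into ?H (ve r)"
 have veH: "bij_betw (ve r) ?H M"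
  unfolding bij_betw_def using M_vertex[OF r] vertex_elem_inj[OF r] by (auto simp: inj_on_def)
 have uH: "bij_betw u M ?H" unfolding u_def using veH by (rule bij_betw_the_inv_into)
 have ve_u: "ve r (u m) = m" if "m \<in> M" for m
  unfolding u_def using f_the_inv_into_f_bij_betw[OF veH, of m] that by simp
 have uc: "u m \<in> carrier (Gv r)" if "m \<in> M" for m using bij_betwE[OF uH] that by auto
 have cb: "bij_betw c (\<eta> r ` ?H) (int_vecs k)" unfolding c_def using b(1) by (rule bij_betw_the_inv_into)
 have b_c: "b (c x) = x" if "x \<in> \<eta> r ` ?H" for x
  unfolding c_def using f_the_inv_into_f_bij_betw[OF b(1), of x] that by simp
 have \<eta>H: "bij_betw (\<eta> r) ?H (\<eta> r ` ?H)" by (auto simp: bij_betw_def inj_on_def V.\<eta>_eq_iff)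
 have "coordinates (FT\<lparr>carrier := M\<rparr>) k (\<lambda>m. c (\<eta> r (u m)))"
  unfolding coordinates_def
 proof (intro conjI ballI)
  show "bij_betw (\<lambda>m. c (\<eta> r (u m))) (carrier (FT\<lparr>carrier := M\<rparr>)) (int_vecs k)"
   using bij_betw_trans[OF bij_betw_trans[OF uH \<eta>H] cb] by (simp add: comp_def)
  fix x y assume xy: "x \<in> carrier (FT\<lparr>carrier := M\<rparr>)" "y \<in> carrier (FT\<lparr>carrier := M\<rparr>)"
  then have M: "x \<in> M" "y \<in> M" by auto
  have mM: "x \<cdot> y \<in> M" using M subgroup.m_closed[OF M_subgroup] by simp
  have "ve r (u (x \<cdot> y)) = ve r (u x \<otimes>\<^bsub>Gv r\<^esub> u y)" using M mM uc ve_u by simp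
  then have u: "u (x \<cdot> y) = u x \<otimes>\<^bsub>Gv r\<^esub> u y" using vertex_elem_inj[OF r] M mM uc by simp
  have mem: "\<eta> r (u m) \<in> \<eta> r ` ?H" if "m \<in> M" for m using bij_betwE[OF uH] that by blast
  have cm: "c (\<eta> r (u m)) \<in> int_vecs k" if "m \<in> M" for m using bij_betwE[OF cb] mem that by blast
  have "b (\<lambda>i. c (\<eta> r (u x)) i + c (\<eta> r (u y)) i) = (\<lambda>i. \<eta> r (u x) i + \<eta> r (u y) i)"
   using b(2)[OF cm[OF M(1)] cm[OF M(2)]] b_c mem M by simp
  also have "\<dots> = b (c (\<eta> r (u (x \<cdot> y))))" using b_c[OF mem[OF mM]] u M uc by (simp add: V.\<eta>_mult)
  finally have "(\<lambda>i. c (\<eta> r (u x)) i + c (\<eta> r (u y)) i) = c (\<eta> r (u (x \<cdot> y)))"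
   using inj_onD[OF bij_betw_imp_inj_on[OF b(1)] _ int_vecs_mem(3)[OF cm[OF M(1)] cm[OF M(2)]] cm[OF mM]] by blast
  then show "c (\<eta> r (u (x \<otimes>\<^bsub>FT\<lparr>carrier := M\<rparr>\<^esub> y))) = (\<lambda>i. c (\<eta> r (u x)) i + c (\<eta> r (u y)) i)" by simp
 qed
 then show thesis by (rule that)
qed

end

context lattice_quotient
begin

text \<open>The module is a sum of two pieces: \<open>M\<close> with one extra integer coordinate,
  which makes the affine action of the crossed homomorphism \<open>\<delta>\<close> linear, and
  pairs of integers indexed by the positions, which carry the representation induced from the matrix
  labels. The second piece detects everything outside \<open>M\<close>, the first piece detects
  \<open>M\<close>.\<close>

lemma linear: "linear_over_int FT"
proof -
 let ?M = "FT\<lparr>carrier := M\<rparr>"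
 obtain k \<theta> where \<theta>: "coordinates ?M k \<theta>" by (rule coordinates_M)
 interpret M: group ?M using M_subgroup by (rule G.subgroup_imp_group)
 interpret MC: comm_group ?M using M_commute by (intro M.group_comm_groupI) simp
 let ?I = "carrier Q \<times> (UNIV :: bool set)"
 have finI: "finite ?I" by simp
 obtain \<eta>F where \<eta>F: "coordinates (fun_group ?I) (card ?I) \<eta>F" using coordinates_fun_group[OF finI] by blast
 let ?A = "(?M \<times>\<times> integer_group) \<times>\<times> fun_group ?I"
 obtain \<eta>A where "coordinates ?A (k + 1 + card ?I) \<eta>A"
  using coordinates_DirProd[OF coordinates_DirProd[OF \<theta> coordinates_integer_group] \<eta>F] by blast
 then have cA: "coordinate_group ?A (k + 1 + card ?I) \<eta>A"
  using DirProd_group[OF DirProd_group[OF M.group_axioms group_integer_group] group_fun_group]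
  by (simp add: coordinate_group_def coordinate_group_axioms_def)
 define \<delta> where "\<delta> g = sigma g \<cdot> inv\<^bsub>FT\<^esub> g" for g
 have \<delta>: "\<delta> g \<in> M" if "g \<in> carrier FT" for g using that by (simp add: \<delta>_def sigma_mod)
 define cj where "cj g m = g \<cdot> m \<cdot> inv\<^bsub>FT\<^esub> g" for g m
 have cj_M: "cj g m \<in> M" if "g \<in> carrier FT" "m \<in> M" for g m using M_conj that by (simp add: cj_def)
 have cj_mult: "cj g (m \<cdot> m') = cj g m \<cdot> cj g m'" if "g \<in> carrier FT" "m \<in> M" "m' \<in> M" for g m m'
 proof -
  have "inv\<^bsub>FT\<^esub> g \<cdot> (g \<cdot> (m' \<cdot> inv\<^bsub>FT\<^esub> g)) = m' \<cdot> inv\<^bsub>FT\<^esub> g"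
   using that by (simp add: G.m_assoc[symmetric])
  then show ?thesis using that by (simp add: cj_def G.m_assoc)
 qed
 have cj_cj: "cj (g \<cdot> h) m = cj g (cj h m)" if "g \<in> carrier FT" "h \<in> carrier FT" "m \<in> M" for g h m
  using that by (simp add: cj_def G.m_assoc G.inv_mult_group)
 have cj_pow: "cj g (m [^]\<^bsub>?M\<^esub> (z::int)) = cj g m [^]\<^bsub>?M\<^esub> z" if "g \<in> carrier FT" "m \<in> M" for g m z
 proof -
  interpret c: group_hom ?M ?M "cj g"
   using cj_M cj_mult that by unfold_locales (auto simp: hom_def)
  show ?thesis using c.hom_int_pow[of m z] that by simp
 qed
 \<comment> \<open>The crossed homomorphism rule; its two factors may be written in either order
   since \<open>M\<close> is abelian.\<close>
 have \<delta>_mult: "\<delta> (g \<cdot> h) = cj g (\<delta> h) \<cdot> \<delta> g" if "g \<in> carrier FT" "h \<in> carrier FT" for g h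
 proof -
  have "\<delta> g \<cdot> cj g (\<delta> h) = \<delta> (g \<cdot> h)"
  proof -
   have "inv\<^bsub>FT\<^esub> g \<cdot> (g \<cdot> x) = x" if "x \<in> carrier FT" for x
    using that \<open>g \<in> carrier FT\<close> by (simp add: G.m_assoc[symmetric])
   then show ?thesis using that by (simp add: \<delta>_def cj_def G.m_assoc G.inv_mult_group)
  qed
  then show ?thesis using M_commute \<delta> cj_M that by simp
 qed
 define act1 where "act1 g = (\<lambda>(m, z). (cj g m \<cdot> \<delta> g [^]\<^bsub>?M\<^esub> (z::int), z))" for g
 define vec where "vec f p = (f (p, False), f (p, True))" for f :: "('v, 'e, 'g) generator word set set \<times> bool \<Rightarrow> int" and p
 \<comment> \<open>The value at \<open>p\<close> is obtained from the position that \<open>g\<close>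
   carries to \<open>p\<close>, multiplied by the label read there.\<close>
 define act2 where "act2 g f = (\<lambda>(p, b). if p \<in> carrier Q then
   (if b then snd else fst) (mat2_vec (sl_label (j g) (inv\<^bsub>Q\<^esub> pos (j g) \<otimes>\<^bsub>Q\<^esub> p)) (vec f (inv\<^bsub>Q\<^esub> pos (j g) \<otimes>\<^bsub>Q\<^esub> p))) else 0)" for g f
 have vec_act2: "vec (act2 g f) p = mat2_vec (sl_label (j g) (inv\<^bsub>Q\<^esub> pos (j g) \<otimes>\<^bsub>Q\<^esub> p)) (vec f (inv\<^bsub>Q\<^esub> pos (j g) \<otimes>\<^bsub>Q\<^esub> p))"
  if "p \<in> carrier Q" for g f p
  using that by (simp add: vec_def act2_def)
 have vec_eqI: "f = f'" if "f \<in> carrier (fun_group ?I)" "f' \<in> carrier (fun_group ?I)" "\<And>p. p \<in> carrier Q \<Longrightarrow> vec f p = vec f' p" for f f'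
 proof
  fix pb show "f pb = f' pb"
  proof (cases "fst pb \<in> carrier Q")
   case True
   then show ?thesis using that(3)[of "fst pb"] by (cases pb; cases "snd pb") (auto simp: vec_def)
  next
   case False
   then show ?thesis using that(1,2) by (cases pb) (auto simp: fun_group_def)
  qed
 qed
 have act2_mem: "act2 g f \<in> carrier (fun_group ?I)" for g f by (auto simp: act2_def fun_group_def)
 note cc = cocycleD[OF label_cocycle[OF group_SL2 sl_label]]
 show ?thesis
 proof (rule linear_over_int_action[OF G.group_axioms cA, of "\<lambda>g (x, f). (act1 g x, act2 g f)"])
  fix g assume g: "g \<in> carrier FT"
  fix x assume x: "x \<in> carrier ?A"
  obtain m z f where xx: "x = ((m, z), f)" "m \<in> M" using x by (cases x) (auto simp: DirProd_def)
  show "(case x of (x, f) \<Rightarrow> (act1 g x, act2 g f)) \<in> carrier ?A"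
   using xx g cj_M \<delta> M.int_pow_closed[of "\<delta> g" z] act2_mem subgroup.m_closed[OF M_subgroup]
   by (auto simp: DirProd_def act1_def)
  fix y assume y: "y \<in> carrier ?A"
  obtain m' z' f' where yy: "y = ((m', z'), f')" "m' \<in> M" using y by (cases y) (auto simp: DirProd_def)
  have "act1 g (m \<cdot> m', z + z') = act1 g (m, z) \<otimes>\<^bsub>?M \<times>\<times> integer_group\<^esub> act1 g (m', z')"
  proof -
   let ?d = "\<delta> g"
   have c: "cj g m \<in> M" "cj g m' \<in> M" "?d [^]\<^bsub>?M\<^esub> z \<in> M" "?d [^]\<^bsub>?M\<^esub> z' \<in> M"
    using cj_M g xx yy M.int_pow_closed[of ?d z] M.int_pow_closed[of ?d z'] \<delta> by auto
   have "?d [^]\<^bsub>?M\<^esub> (z + z') = ?d [^]\<^bsub>?M\<^esub> z \<cdot> ?d [^]\<^bsub>?M\<^esub> z'"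
    using M.int_pow_mult[of ?d z z'] \<delta>[OF g] by simp
   moreover have "a \<cdot> b \<cdot> (c \<cdot> e) = a \<cdot> c \<cdot> (b \<cdot> e)"
    if "a \<in> M" "b \<in> M" "c \<in> M" "e \<in> M" for a b c e
   proof -
    have "b \<cdot> (c \<cdot> e) = c \<cdot> (b \<cdot> e)"
     using M_commute[of b c] that by (simp add: G.m_assoc[symmetric])
    then show ?thesis using that by (simp add: G.m_assoc)
   qed
   ultimately show ?thesis
    using c cj_mult[OF g xx(2) yy(2)] by (simp add: act1_def)
  qed
  moreover have "act2 g (\<lambda>i. f i + f' i) = (\<lambda>i. act2 g f i + act2 g f' i)"
  proof -
   have v: "vec (\<lambda>i. f i + f' i) p = (fst (vec f p) + fst (vec f' p), snd (vec f p) + snd (vec f' p))" for p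
    by (simp add: vec_def)
   have lin: "mat2_vec A (u + u', w + w') = (fst (mat2_vec A (u, w)) + fst (mat2_vec A (u', w')), snd (mat2_vec A (u, w)) + snd (mat2_vec A (u', w')))" for A u u' w w'
    by (cases A) (auto simp: algebra_simps)
   show ?thesis by (auto simp: act2_def v lin fun_eq_iff)
  qed
  ultimately show "(case x \<otimes>\<^bsub>?A\<^esub> y of (x, f) \<Rightarrow> (act1 g x, act2 g f))
    = (case x of (x, f) \<Rightarrow> (act1 g x, act2 g f)) \<otimes>\<^bsub>?A\<^esub> (case y of (x, f) \<Rightarrow> (act1 g x, act2 g f))"
   by (simp add: xx yy) (simp add: fun_group_def)
 next
  fix g h x assume gh: "g \<in> carrier FT" "h \<in> carrier FT" and x: "x \<in> carrier ?A"
  obtain m z f where xx: "x = ((m, z), f)" "m \<in> M" using x by (cases x) (auto simp: DirProd_def)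
  have "act1 (g \<cdot> h) (m, z) = act1 g (act1 h (m, z))"
  proof -
   have c: "cj g (cj h m) \<in> M" "cj g (\<delta> h) \<in> M" "\<delta> g \<in> M" "cj h m \<in> M" "\<delta> h [^]\<^bsub>?M\<^esub> z \<in> M"
     "cj g (\<delta> h) [^]\<^bsub>?M\<^esub> z \<in> M" "\<delta> g [^]\<^bsub>?M\<^esub> z \<in> M"
    using cj_M \<delta> gh xx M.int_pow_closed[of "\<delta> h" z] M.int_pow_closed[of "cj g (\<delta> h)" z] M.int_pow_closed[of "\<delta> g" z] by auto
   have "\<delta> (g \<cdot> h) [^]\<^bsub>?M\<^esub> z = cj g (\<delta> h) [^]\<^bsub>?M\<^esub> z \<cdot> \<delta> g [^]\<^bsub>?M\<^esub> z"
    using MC.int_pow_distrib[of "cj g (\<delta> h)" "\<delta> g" z] c \<delta>_mult[OF gh] by simp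
   moreover have "cj g (cj h m \<cdot> \<delta> h [^]\<^bsub>?M\<^esub> z) = cj g (cj h m) \<cdot> cj g (\<delta> h) [^]\<^bsub>?M\<^esub> z"
    using cj_mult[OF gh(1) c(4,5)] cj_pow[OF gh(1) \<delta>[OF gh(2)]] by simp
   ultimately show ?thesis using c cj_cj[OF gh xx(2)] by (simp add: act1_def G.m_assoc)
  qed
  moreover have "act2 (g \<cdot> h) f = act2 g (act2 h f)"
  proof (rule vec_eqI[OF act2_mem act2_mem])
   fix p assume p: "p \<in> carrier Q"
   have jc: "j g \<in> carrier UG" "j h \<in> carrier UG" using gh by auto
   let ?p = "inv\<^bsub>Q\<^esub> pos (j g) \<otimes>\<^bsub>Q\<^esub> p"
   let ?p2 = "inv\<^bsub>Q\<^esub> pos (j h) \<otimes>\<^bsub>Q\<^esub> ?p"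
   have pc: "?p \<in> carrier Q" "?p2 \<in> carrier Q" using jc p by auto
   have e: "inv\<^bsub>Q\<^esub> pos (j (g \<cdot> h)) \<otimes>\<^bsub>Q\<^esub> p = ?p2" using gh jc p by (simp add: Q.inv_mult_group Q.m_assoc)
   have "pos (j h) \<otimes>\<^bsub>Q\<^esub> ?p2 = ?p" using jc pc by (simp add: Q.m_assoc[symmetric])
   then have "sl_label (j (g \<cdot> h)) ?p2 = mat2_mult (sl_label (j g) ?p) (sl_label (j h) ?p2)"
    using cc(5)[OF pc(2) jc] gh by simp
   then show "vec (act2 (g \<cdot> h) f) p = vec (act2 g (act2 h f)) p"
    using vec_act2[OF p] vec_act2[OF pc(1)] by (simp add: e mat2_vec_mult)
  qed
  ultimately show "(case x of (x, f) \<Rightarrow> (act1 (g \<cdot> h) x, act2 (g \<cdot> h) f))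
    = (case (case x of (x, f) \<Rightarrow> (act1 h x, act2 h f)) of (x, f) \<Rightarrow> (act1 g x, act2 g f))"
   by (simp add: xx)
 next
  fix x assume x: "x \<in> carrier ?A"
  obtain m z f where xx: "x = ((m, z), f)" "m \<in> M" "f \<in> carrier (fun_group ?I)" using x by (cases x) (auto simp: DirProd_def)
  have "\<delta> \<one>\<^bsub>FT\<^esub> = \<one>\<^bsub>?M\<^esub>" by (simp add: \<delta>_def)
  then have "act1 \<one>\<^bsub>FT\<^esub> (m, z) = (m, z)" using xx M.int_pow_one[of z] by (simp add: act1_def cj_def)
  moreover have "act2 \<one>\<^bsub>FT\<^esub> f = f"
  proof (rule vec_eqI[OF act2_mem xx(3)])
   fix p assume p: "p \<in> carrier Q"
   then have "sl_label \<one>\<^bsub>UG\<^esub> p = (1, 0, 0, 1)"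
    using cocycle_one[OF label_cocycle[OF group_SL2 sl_label] p group_SL2 U.group_axioms] by simp
   then show "vec (act2 \<one>\<^bsub>FT\<^esub> f) p = vec f p" using vec_act2[OF p, of "\<one>\<^bsub>FT\<^esub>" f] p by (cases "vec f p") simp
  qed
  ultimately show "(case x of (x, f) \<Rightarrow> (act1 \<one>\<^bsub>FT\<^esub> x, act2 \<one>\<^bsub>FT\<^esub> f)) = x" by (simp add: xx)
 next
  fix g assume g: "g \<in> carrier FT" and triv: "\<And>x. x \<in> carrier ?A \<Longrightarrow> (case x of (x, f) \<Rightarrow> (act1 g x, act2 g f)) = x"
  have oneM: "\<one>\<^bsub>FT\<^esub> \<in> M" using subgroup.one_closed[OF M_subgroup] .
  \<comment> \<open>The first unit vector at the trivial position. Its image is the first column of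
    the label of \<open>g\<close>, placed at the position of \<open>g\<close>. In the affine part,
    the element with \<open>z = 1\<close> shows \<open>\<delta> g\<close>.\<close>
  let ?f = "\<lambda>pb. if pb = (\<one>\<^bsub>Q\<^esub>, False) then 1 else 0 :: int"
  have fA: "?f \<in> carrier (fun_group ?I)" by (auto simp: fun_group_def)
  have "((\<one>\<^bsub>FT\<^esub>, 1), ?f) \<in> carrier ?A" using oneM fA by (simp add: DirProd_def)
  from triv[OF this] have a1: "act1 g (\<one>\<^bsub>FT\<^esub>, 1) = (\<one>\<^bsub>FT\<^esub>, 1)" and a2: "act2 g ?f = ?f" by auto
  have p: "pos (j g) \<in> carrier Q" using g by simp
  obtain a b c e where abc: "sl_label (j g) \<one>\<^bsub>Q\<^esub> = (a, b, c, e)" by (metis prod.exhaust)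
  have det: "a * e - b * c = 1" using cc(2)[of "\<one>\<^bsub>Q\<^esub>" "j g"] g abc by simp
  have "vec (act2 g ?f) (pos (j g)) = (a, c)"
   using vec_act2[OF p] p abc by (simp add: vec_def)
  then have ac: "vec ?f (pos (j g)) = (a, c)" using a2 by simp
  \<comment> \<open>If the position moved, the first column of the label would be zero, against
    determinant one.\<close>
  have p1: "pos (j g) = \<one>\<^bsub>Q\<^esub>"
  proof (rule ccontr)
   assume "pos (j g) \<noteq> \<one>\<^bsub>Q\<^esub>"
   then have "a = 0" "c = 0" using ac by (auto simp: vec_def)
   then show False using det by simp
  qed
  then have "c = 0" using ac by (simp add: vec_def)
  moreover have "g \<in> N" using p1 pos_one_iff[OF g] by simp
  ultimately have gM: "g \<in> M" using sl_label_kernel[of g] abc power_set_M by auto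
  have "\<delta> g = \<one>\<^bsub>FT\<^esub>"
   using a1 g \<delta>[OF g] M.int_pow_1[of "\<delta> g"] by (simp add: act1_def cj_def)
  then have "sigma g = g" using g unfolding \<delta>_def by (metis G.inv_closed G.inv_equality G.inv_inv sigma.hom_closed)
  then have "g [^]\<^bsub>FT\<^esub> d \<cdot> g = g" using sigma_M[OF gM] by simp
  then have "g [^]\<^bsub>FT\<^esub> d = \<one>\<^bsub>FT\<^esub>" using g by simp
  then have "g [^]\<^bsub>FT\<^esub> d = \<one>\<^bsub>FT\<^esub> [^]\<^bsub>FT\<^esub> d" by simp
  then show "g = \<one>\<^bsub>FT\<^esub>" using M_pow_inj[OF gM oneM d] by simp
 qed
qed

end

section \<open>Subgroup separability\<close>

section \<open>Subgroup separability\<close>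

text \<open>Schreier's lemma: the intersection of a finitely generated subgroup with a normal
  subgroup of finite index is finitely generated, by the transversal corrections of the generators
  and their inverses.\<close>

lemma (in group) schreier_generators:
 assumes N: "finite_index_normal N G" and S: "finite S" "S \<subseteq> carrier G"
 obtains S1 where "finite S1" "S1 \<subseteq> generate G S \<inter> N" "generate G S \<inter> N \<subseteq> generate G S1"
proof -
 let ?H = "generate G S"
 have nor: "N \<lhd> G" and finQ: "finite (carrier (G Mod N))" using N by (auto simp: finite_index_normal_def)
 have sN: "subgroup N G" using nor by (rule normal_imp_subgroup)
 have sH: "subgroup ?H G" using S by (intro generate_is_subgroup)
 have HG: "x \<in> carrier G" if "x \<in> ?H" for x using sH that by (rule subgroup.mem_carrier)
 let ?\<pi> = "\<lambda>x. N #> x"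
 have coset: "?\<pi> x = ?\<pi> y \<longleftrightarrow> x \<otimes> inv y \<in> N" if "x \<in> carrier G" "y \<in> carrier G" for x y
 proof -
  have "?\<pi> x = ?\<pi> y \<longleftrightarrow> x \<in> ?\<pi> y"
   using rcos_self[OF that(1) sN] repr_independence[OF _ that(2) sN, of x] by auto
  then show ?thesis using mem_rcos_iff[OF sN that(2,1)] by simp
 qed
 \<comment> \<open>The trivial coset must be represented by the identity; then
   \<open>s \<one> h = h\<close> for every \<open>h\<close> in the intersection.\<close>
 define \<tau> where "\<tau> c = (if c = ?\<pi> \<one> then \<one> else SOME h. h \<in> ?H \<and> ?\<pi> h = c)" for c
 have \<tau>: "\<tau> (?\<pi> h) \<in> ?H \<and> ?\<pi> (\<tau> (?\<pi> h)) = ?\<pi> h" if "h \<in> ?H" for h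
 proof (cases "?\<pi> h = ?\<pi> \<one>")
  case True
  then show ?thesis by (simp add: \<tau>_def generate.one)
 next
  case False
  then show ?thesis unfolding \<tau>_def using someI[of "\<lambda>x. x \<in> ?H \<and> ?\<pi> x = ?\<pi> h" h] that by simp
 qed
 define s where "s x h = \<tau> (?\<pi> x) \<otimes> h \<otimes> inv \<tau> (?\<pi> (x \<otimes> h))" for x h
 let ?S = "S \<union> (\<lambda>x. inv x) ` S"
 define S1 where "S1 = (\<lambda>(c, h). \<tau> c \<otimes> h \<otimes> inv \<tau> (?\<pi> (\<tau> c \<otimes> h))) ` (?\<pi> ` ?H \<times> ?S)"
 have SH: "h \<in> ?H" if "h \<in> ?S" for h using that by (auto intro: generate.incl generate.inv)
 have sN': "s x h \<in> ?H \<inter> N" if "x \<in> ?H" "h \<in> ?H" for x h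
 proof
  have xh: "x \<otimes> h \<in> ?H" using that by (rule generate.eng)
  let ?a = "\<tau> (?\<pi> x)" and ?b = "\<tau> (?\<pi> (x \<otimes> h))"
  have ab: "?a \<in> ?H" "?b \<in> ?H" "?\<pi> ?a = ?\<pi> x" "?\<pi> ?b = ?\<pi> (x \<otimes> h)" using \<tau> that xh by auto
  show "s x h \<in> ?H" unfolding s_def using ab that sH by (simp add: subgroup.m_closed subgroup.m_inv_closed)
  have "?\<pi> (?a \<otimes> h) = ?\<pi> (x \<otimes> h)"
  proof -
   have "?a \<otimes> inv x \<in> N" using coset ab that HG by simp
   moreover have "?a \<otimes> h \<otimes> inv (x \<otimes> h) = ?a \<otimes> inv x"
   proof -
    have "h \<otimes> (inv h \<otimes> inv x) = inv x" using that HG by (simp add: m_assoc[symmetric])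
    then show ?thesis using that ab HG by (simp add: inv_mult_group m_assoc)
   qed
   ultimately show ?thesis using coset[of "?a \<otimes> h" "x \<otimes> h"] that ab HG by simp
  qed
  then show "s x h \<in> N" unfolding s_def using coset[of "?a \<otimes> h" ?b] ab that HG by simp
 qed
 \<comment> \<open>This cocycle rule rewrites a product of generators as a product of Schreier
   generators, read at moving starting points.\<close>
 have s_mult: "s x (h \<otimes> h') = s x h \<otimes> s (x \<otimes> h) h'" if "x \<in> ?H" "h \<in> ?H" "h' \<in> ?H" for x h h'
 proof -
  let ?a = "\<tau> (?\<pi> x)" and ?b = "\<tau> (?\<pi> (x \<otimes> h))" and ?c = "\<tau> (?\<pi> (x \<otimes> h \<otimes> h'))"
  have c: "?a \<in> carrier G" "?b \<in> carrier G" "?c \<in> carrier G" "x \<in> carrier G" "h \<in> carrier G" "h' \<in> carrier G"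
   using \<tau> that HG generate.eng by metis+
  have "inv ?b \<otimes> (?b \<otimes> (h' \<otimes> inv ?c)) = h' \<otimes> inv ?c" using c by (simp add: m_assoc[symmetric])
  then show ?thesis using c by (simp add: s_def m_assoc)
 qed
 have sS1: "s x h \<in> S1" if "x \<in> ?H" "h \<in> ?S" for x h
 proof -
  let ?a = "\<tau> (?\<pi> x)"
  have a: "?a \<in> ?H" "?\<pi> ?a = ?\<pi> x" using \<tau> that by auto
  have c: "x \<in> carrier G" "h \<in> carrier G" "?a \<in> carrier G" using that a SH HG by auto
  have "?\<pi> (?a \<otimes> h) = ?\<pi> (x \<otimes> h)"
  proof -
   have "h \<otimes> (inv h \<otimes> inv x) = inv x" using c by (simp add: m_assoc[symmetric])
   then have "?a \<otimes> h \<otimes> inv (x \<otimes> h) = ?a \<otimes> inv x" using c by (simp add: inv_mult_group m_assoc)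
   then show ?thesis using coset[of "?a \<otimes> h" "x \<otimes> h"] coset[of ?a x] c a by simp
  qed
  then have "s x h = (\<lambda>(c, h). \<tau> c \<otimes> h \<otimes> inv \<tau> (?\<pi> (\<tau> c \<otimes> h))) (?\<pi> x, h)" by (simp add: s_def)
  then show ?thesis unfolding S1_def by (rule image_eqI) (use that in blast)
 qed
 have S1H: "S1 \<subseteq> ?H \<inter> N"
 proof
  fix y assume "y \<in> S1"
  then obtain c h where ch: "c \<in> ?\<pi> ` ?H" "h \<in> ?S" "y = \<tau> c \<otimes> h \<otimes> inv \<tau> (?\<pi> (\<tau> c \<otimes> h))"
   unfolding S1_def by auto
  obtain x where "x \<in> ?H" "c = ?\<pi> x" using ch(1) by (rule imageE)
  then have xh: "x \<in> ?H" "h \<in> ?S" "y = \<tau> (?\<pi> x) \<otimes> h \<otimes> inv \<tau> (?\<pi> (\<tau> (?\<pi> x) \<otimes> h))"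
   using ch by simp_all
  have t: "\<tau> (?\<pi> x) \<in> ?H" "?\<pi> (\<tau> (?\<pi> x)) = ?\<pi> x" using \<tau> xh by auto
  then have "y = s (\<tau> (?\<pi> x)) h" using xh by (simp add: s_def)
  then show "y \<in> ?H \<inter> N" using sN' t SH xh by blast
 qed
 have gen: "\<forall>x\<in>?H. s x h \<in> generate G S1" if "h \<in> ?H" for h
  using that
 proof (induction rule: generate.induct)
  case one
  show ?case
  proof
   fix x assume "x \<in> ?H"
   then have "s x \<one> = \<one>" using \<tau>[of x] HG by (simp add: s_def)
   then show "s x \<one> \<in> generate G S1" by (simp add: generate.one)
  qed
 next
  case (incl h)
  then show ?case by (intro ballI) (rule generate.incl, rule sS1, auto)
 next
  case (inv h)
  then show ?case by (intro ballI) (rule generate.incl, rule sS1, auto)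
 next
  case (eng h1 h2)
  then show ?case using s_mult by (auto intro!: generate.eng)
 qed
 show thesis
 proof (rule that)
  have "?\<pi> ` ?H \<subseteq> carrier (G Mod N)" using HG by (auto simp: FactGroup_def RCOSETS_def)
  then have "finite (?\<pi> ` ?H)" using finQ finite_subset by blast
  then show "finite S1" unfolding S1_def using S by simp
  show "S1 \<subseteq> ?H \<inter> N" by (rule S1H)
  show "?H \<inter> N \<subseteq> generate G S1"
  proof
   fix h assume h: "h \<in> ?H \<inter> N"
   have "?\<pi> h = ?\<pi> \<one>" using coset[of h \<one>] h HG by simp
   then have "s \<one> h = h" using h HG by (simp add: s_def \<tau>_def)
   then show "h \<in> generate G S1" using gen h generate.one by (metis IntE)
  qed
 qed
qed

lemma finite_partial_bij_extends:
 assumes Y: "finite Y" and D: "D \<subseteq> Y" "f ` D \<subseteq> Y" and inj: "inj_on f D"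
 shows "\<exists>g. bij_betw g Y Y \<and> (\<forall>x\<in>D. g x = f x)"
proof -
 have finD: "finite D" using Y D(1) by (rule finite_subset[rotated])
 have "card (Y - D) = card (Y - f ` D)"
  using Y D finD card_image[OF inj] by (simp add: card_Diff_subset)
 then obtain h where h: "bij_betw h (Y - D) (Y - f ` D)"
  using finite_same_card_bij[of "Y - D" "Y - f ` D"] Y by auto
 let ?g = "\<lambda>x. if x \<in> D then f x else h x"
 have "bij_betw ?g D (f ` D) \<longleftrightarrow> bij_betw f D (f ` D)" by (rule bij_betw_cong) simp
 then have "bij_betw ?g D (f ` D)" using inj by (simp add: bij_betw_def)
 moreover have "bij_betw ?g (Y - D) (Y - f ` D) \<longleftrightarrow> bij_betw h (Y - D) (Y - f ` D)"
  by (rule bij_betw_cong) simp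
 then have "bij_betw ?g (Y - D) (Y - f ` D)" using h by simp
 ultimately have "bij_betw ?g (D \<union> (Y - D)) (f ` D \<union> (Y - f ` D))" by (rule bij_betw_combine) auto
 moreover have "D \<union> (Y - D) = Y" "f ` D \<union> (Y - f ` D) = Y" using D by auto
 ultimately show ?thesis by (intro exI[of _ ?g]) simp
qed

abbreviation "free_group E \<equiv> presented_group E {}"
abbreviation "free_gen E \<equiv> presented_gen E {}"

lemma free_group_hom:
 assumes "group K" "f \<in> E \<rightarrow> carrier K"
 obtains h where "h \<in> hom (free_group E) K" "\<And>x. x \<in> E \<Longrightarrow> h (free_gen E x) = f x"
 using presented_group_hom[OF assms, of "{}"] by auto

text \<open>Marshall Hall's theorem: the generators act partially on a finite piece of the coset space, and
 the partial injections extend to permutations.\<close>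

lemma free_group_separable:
 assumes W: "finite W" "W \<subseteq> carrier (free_group E)" and w: "w \<in> carrier (free_group E)" "w \<notin> generate (free_group E) W"
 shows "\<exists>(Y :: 'x word set set set) h y0. finite Y \<and> h \<in> hom (free_group (E :: 'x set)) (BijGroup Y) \<and> y0 \<in> Y
  \<and> (\<forall>x\<in>W. h x y0 = y0) \<and> h w y0 \<noteq> y0"
proof -
 let ?F = "free_group E"
 interpret F: group ?F by (rule group_presented_group)
 let ?P = "generate ?F W"
 have sP: "subgroup ?P ?F" using W by (intro F.generate_is_subgroup)
 have Pc: "x \<in> carrier ?F" if "x \<in> ?P" for x using sP that by (rule subgroup.mem_carrier)
 define co where "co x = (\<lambda>p. x \<otimes>\<^bsub>?F\<^esub> p) ` ?P" for x
 define act where "act x A = (\<lambda>y. x \<otimes>\<^bsub>?F\<^esub> y) ` A" for x A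
 have act_co: "act x (co y) = co (x \<otimes>\<^bsub>?F\<^esub> y)" if "x \<in> carrier ?F" "y \<in> carrier ?F" for x y
  unfolding act_def co_def image_image using that Pc by (intro image_cong) (auto simp: F.m_assoc)
 have co_one: "co x = co \<one>\<^bsub>?F\<^esub> \<longleftrightarrow> x \<in> ?P" if x: "x \<in> carrier ?F" for x
 proof
  assume e: "co x = co \<one>\<^bsub>?F\<^esub>"
  have "x \<otimes>\<^bsub>?F\<^esub> \<one>\<^bsub>?F\<^esub> \<in> co x" unfolding co_def by (rule imageI) (rule generate.one)
  then have "x \<in> co \<one>\<^bsub>?F\<^esub>" using x e by simp
  then show "x \<in> ?P" using Pc by (auto simp: co_def)
 next
  assume xP: "x \<in> ?P"
  have "co x = ?P"
  proof
   show "co x \<subseteq> ?P" using generate.eng[OF xP] by (auto simp: co_def)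
   show "?P \<subseteq> co x"
   proof
    fix p assume p: "p \<in> ?P"
    then have "p = x \<otimes>\<^bsub>?F\<^esub> (inv\<^bsub>?F\<^esub> x \<otimes>\<^bsub>?F\<^esub> p)" using x Pc by (simp add: F.m_assoc[symmetric])
    moreover have "inv\<^bsub>?F\<^esub> x \<otimes>\<^bsub>?F\<^esub> p \<in> ?P" using xP p sP by (simp add: subgroup.m_closed subgroup.m_inv_closed)
    ultimately show "p \<in> co x" unfolding co_def by blast
   qed
  qed
  also have "?P = co \<one>\<^bsub>?F\<^esub>" using Pc by (auto simp: co_def image_iff)
  finally show "co x = co \<one>\<^bsub>?F\<^esub>" .
 qed
 let ?v = "word_val ?F (free_gen E)"
 have gens: "free_gen E \<in> E \<rightarrow> carrier ?F" by simp
 have "\<forall>x\<in>carrier ?F. \<exists>u. u \<in> words E \<and> ?v u = x"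
  by (auto simp: presented_carrier_iff presented_class_eq_word_val)
 then obtain rep where rep: "\<And>x. x \<in> carrier ?F \<Longrightarrow> rep x \<in> words E \<and> ?v (rep x) = x" by metis
 \<comment> \<open>The cosets visited by the suffixes of a word. Collected for representing words of
   \<open>w\<close> and of all elements of \<open>W\<close>, they form a finite piece on which these
   words never leave the partial action.\<close>
 define T where "T u = (\<lambda>i. co (?v (drop i u))) ` {..length u}" for u
 define Y where "Y = (\<Union>x\<in>insert w W. T (rep x))"
 have finY: "finite Y" using W(1) by (simp add: Y_def T_def)
 have y0: "co \<one>\<^bsub>?F\<^esub> \<in> Y"
 proof -
  have "co (?v (drop (length (rep w)) (rep w))) \<in> T (rep w)" unfolding T_def by (intro imageI) simp
  then show ?thesis by (auto simp: Y_def)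
 qed
 have Yco: "\<exists>x\<in>carrier ?F. y = co x" if "y \<in> Y" for y
 proof -
  obtain x i where x: "x \<in> insert w W" "y = co (?v (drop i (rep x)))" using \<open>y \<in> Y\<close> unfolding Y_def T_def by blast
  have "rep x \<in> words E" using rep x W w by auto
  then have "drop i (rep x) \<in> words E" using set_drop_subset by (fastforce simp: words_def)
  then have "?v (drop i (rep x)) \<in> carrier ?F" using F.word_val_closed[OF gens] by blast
  then show ?thesis using x by blast
 qed
 have "\<exists>g. bij_betw g Y Y \<and> (\<forall>y\<in>{y \<in> Y. act (free_gen E x) y \<in> Y}. g y = act (free_gen E x) y)" if x: "x \<in> E" for x
 proof (rule finite_partial_bij_extends[OF finY])
  let ?x = "free_gen E x"
  have xc: "?x \<in> carrier ?F" using x by simp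
  have undo: "act (inv\<^bsub>?F\<^esub> ?x) (act ?x y) = y" if y: "y \<in> Y" for y
  proof -
   obtain z where z: "z \<in> carrier ?F" "y = co z" using Yco[OF y] by blast
   then show ?thesis using xc by (simp add: act_co F.m_assoc[symmetric])
  qed
  show "inj_on (act ?x) {y \<in> Y. act ?x y \<in> Y}" by (rule inj_on_inverseI[of _ "act (inv\<^bsub>?F\<^esub> ?x)"]) (use undo in simp)
 qed auto
 then obtain g where g: "\<And>x. x \<in> E \<Longrightarrow> bij_betw (g x) Y Y"
   "\<And>x y. x \<in> E \<Longrightarrow> y \<in> Y \<Longrightarrow> act (free_gen E x) y \<in> Y \<Longrightarrow> g x y = act (free_gen E x) y"
  by (metis (mono_tags, lifting) mem_Collect_eq)
 have gB: "restrict (g x) Y \<in> Bij Y" if "x \<in> E" for x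
  using g(1)[OF that] unfolding Bij_def by (simp cong: bij_betw_cong)
 interpret B: group "BijGroup Y" by (rule group_BijGroup)
 obtain h where h: "h \<in> hom ?F (BijGroup Y)" "\<And>x. x \<in> E \<Longrightarrow> h (free_gen E x) = restrict (g x) Y"
  using free_group_hom[OF group_BijGroup, of "\<lambda>x. restrict (g x) Y" E Y] gB by (auto simp: BijGroup_def)
 interpret h: group_hom ?F "BijGroup Y" h using h(1) by unfold_locales
 have hB: "h x \<in> Bij Y" if "x \<in> carrier ?F" for x using h.hom_closed[OF that] by (simp add: BijGroup_def)
 have h_mult: "h (x \<otimes>\<^bsub>?F\<^esub> y) z = h x (h y z)" if "x \<in> carrier ?F" "y \<in> carrier ?F" "z \<in> Y" for x y z
  using that h.hom_mult[OF that(1,2)] hB by (simp add: BijGroup_def compose_def)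
 have h_inv: "h (inv\<^bsub>?F\<^esub> x) (h x z) = z" if "x \<in> carrier ?F" "z \<in> Y" for x z
  using h_mult[of "inv\<^bsub>?F\<^esub> x" x z] that by (simp add: BijGroup_def)
 \<comment> \<open>As every suffix stays inside \<open>Y\<close>, only values where the permutations
   agree with the true action on cosets are used.\<close>
 have traj: "h (?v u) (co \<one>\<^bsub>?F\<^esub>) = co (?v u)" if "u \<in> words E" "T u \<subseteq> Y" for u
  using that
 proof (induction u)
  case Nil
  then show ?case using y0 by (simp add: BijGroup_def)
 next
  case (Cons a u)
  obtain x b where a: "a = (x, b)" by (cases a)
  have x: "x \<in> E" "u \<in> words E" using Cons.prems a by auto
  have c: "?v u \<in> carrier ?F" "free_gen E x \<in> carrier ?F" using F.word_val_closed[OF gens x(2)] x by auto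
  have "co (?v (drop i (a # u))) \<in> Y" if "i \<le> Suc (length u)" for i
   using Cons.prems(2) that unfolding T_def by auto
  from this[of 0] this[of 1] have top: "co (?v (a # u)) \<in> Y" and nxt: "co (?v u) \<in> Y" by simp_all
  have "T u \<subseteq> T (a # u)"
  proof
   fix y assume "y \<in> T u"
   then obtain i where "i \<le> length u" "y = co (?v (drop (Suc i) (a # u)))" by (auto simp: T_def)
   then show "y \<in> T (a # u)" unfolding T_def by (intro image_eqI[of _ _ "Suc i"]) auto
  qed
  then have IH: "h (?v u) (co \<one>\<^bsub>?F\<^esub>) = co (?v u)" using Cons x by blast
  show ?case
  proof (cases b)
   case True
   have "h (?v (a # u)) (co \<one>\<^bsub>?F\<^esub>) = h (free_gen E x) (h (?v u) (co \<one>\<^bsub>?F\<^esub>))"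
    using a True h_mult[OF c(2,1) y0] by simp
   then have "h (?v (a # u)) (co \<one>\<^bsub>?F\<^esub>) = g x (co (?v u))" using x IH nxt by (simp add: h(2))
   also have "\<dots> = act (free_gen E x) (co (?v u))" using g(2)[OF x(1) nxt] top a True c act_co by simp
   finally show ?thesis using act_co c a True by simp
  next
   case False
   let ?x = "free_gen E x"
   \<comment> \<open>An inverse letter is read backwards: the generator takes the new coset to the
     old one inside \<open>Y\<close>, so the inverse of the extended permutation does what the true
     action does.\<close>
   have e: "act ?x (co (?v (a # u))) = co (?v u)"
   proof -
    have "?x \<otimes>\<^bsub>?F\<^esub> (inv\<^bsub>?F\<^esub> ?x \<otimes>\<^bsub>?F\<^esub> ?v u) = ?v u" using c by (simp add: F.m_assoc[symmetric])
    then show ?thesis using a False c by (simp add: act_co)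
   qed
   then have "h ?x (co (?v (a # u))) = co (?v u)" using g(2)[OF x(1) top] nxt top h(2) x by simp
   then have "h (inv\<^bsub>?F\<^esub> ?x) (co (?v u)) = co (?v (a # u))" using h_inv[OF c(2) top] by simp
   moreover have "h (?v (a # u)) (co \<one>\<^bsub>?F\<^esub>) = h (inv\<^bsub>?F\<^esub> ?x) (co (?v u))"
    using a False c y0 IH h_mult[of "inv\<^bsub>?F\<^esub> ?x" "?v u"] by simp
   ultimately show ?thesis by simp
  qed
 qed
 have hx: "h x (co \<one>\<^bsub>?F\<^esub>) = co x" if "x \<in> insert w W" for x
 proof -
  have "x \<in> carrier ?F" using that W w by blast
  then have "rep x \<in> words E" "?v (rep x) = x" using rep by auto
  moreover have "T (rep x) \<subseteq> Y" using that unfolding Y_def by blast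
  ultimately show ?thesis using traj by metis
 qed
 show ?thesis
 proof (intro exI conjI ballI)
  show "finite Y" "h \<in> hom ?F (BijGroup Y)" "co \<one>\<^bsub>?F\<^esub> \<in> Y" by fact+
  show "h x (co \<one>\<^bsub>?F\<^esub>) = co \<one>\<^bsub>?F\<^esub>" if "x \<in> W" for x
   using hx[of x] co_one[of x] generate.incl[OF that] that W by auto
  show "h w (co \<one>\<^bsub>?F\<^esub>) \<noteq> co \<one>\<^bsub>?F\<^esub>" using hx[of w] co_one[of w] w by auto
 qed
qed

context lattice_quotient
begin

abbreviation "univ_label \<equiv> label (free_group edge_cosets) (free_gen edge_cosets)"

lemma univ_label: "free_gen edge_cosets \<in> edge_cosets \<rightarrow> carrier (free_group edge_cosets)"
 by simp

text \<open>Elements of \<open>N\<close> fix the trivial position, so there the cocycle becomes a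
  homomorphism on \<open>N\<close>.\<close>

lemma label_mult_N:
 assumes K: "group K" "\<kappa> \<in> edge_cosets \<rightarrow> carrier K" and gh: "g \<in> carrier FT" "h \<in> N"
 shows "label K \<kappa> (j (g \<cdot> h)) \<one>\<^bsub>Q\<^esub> = label K \<kappa> (j g) \<one>\<^bsub>Q\<^esub> \<otimes>\<^bsub>K\<^esub> label K \<kappa> (j h) \<one>\<^bsub>Q\<^esub>"
proof -
 have hc: "h \<in> carrier FT" using gh N_subgroup by (metis subgroup.mem_carrier)
 have "pos (j h) = \<one>\<^bsub>Q\<^esub>" using pos_one_iff[OF hc] gh by simp
 then show ?thesis using cocycleD(5)[OF label_cocycle[OF K], of "\<one>\<^bsub>Q\<^esub>" "j g" "j h"] gh hc by simp
qed

text \<open>Specialise the free generators to the ping-pong matrices; a trivial free label gives a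
  trivial matrix label.\<close>

lemma univ_label_kernel:
 assumes g: "g \<in> N" and one: "univ_label (j g) \<one>\<^bsub>Q\<^esub> = \<one>\<^bsub>free_group edge_cosets\<^esub>"
 shows "g \<in> power_set FT M l"
proof -
 interpret F: group "free_group edge_cosets" by (rule group_presented_group)
 have gc: "g \<in> carrier FT" using g N_subgroup by (metis subgroup.mem_carrier)
 obtain f where f: "f \<in> hom (free_group edge_cosets) SL2"
   "\<And>\<epsilon>. \<epsilon> \<in> edge_cosets \<Longrightarrow> f (free_gen edge_cosets \<epsilon>) = ping_mat (int (edge_index \<epsilon>)) 1"
  using free_group_hom[OF group_SL2 sl_label] by blast
 have "sl_label (j g) \<one>\<^bsub>Q\<^esub> = f (univ_label (j g) \<one>\<^bsub>Q\<^esub>)"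
  by (rule label_hom[OF F.group_axioms group_SL2 univ_label f(1)]) (use f(2) gc in auto)
 also have "\<dots> = (1, 0, 0, 1)"
  using one group_hom.hom_one[of "free_group edge_cosets" SL2 f] f(1) group_SL2 F.group_axioms
  by (simp add: group_hom_def group_hom_axioms_def)
 finally show ?thesis using sl_label_kernel[OF g] by simp
qed

text \<open>The free label maps \<open>N\<close> to a free group with kernel inside the
  \<open>l\<close>-th powers of \<open>M\<close>. By Schreier the image of the given subgroup is
  finitely generated, and it misses the image of \<open>z\<close>, since otherwise \<open>z\<close>
  would lie in it up to such a power. The separating permutations of the free group are then induced
  to the whole group.\<close>

lemma separate_in_N:
 assumes S: "finite S" "S \<subseteq> carrier FT" and z: "z \<in> N"
  and zH: "\<And>h m. h \<in> generate FT S \<inter> N \<Longrightarrow> m \<in> power_set FT M l \<Longrightarrow> z \<noteq> m \<cdot> h"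
 obtains N' where "finite_index_normal N' FT" "N' \<subseteq> N" "\<And>h x. h \<in> generate FT S \<inter> N \<Longrightarrow> x \<in> N' \<Longrightarrow> z \<noteq> h \<cdot> x"
proof -
 let ?F = "free_group edge_cosets"
 interpret F: group ?F by (rule group_presented_group)
 obtain S1 where S1: "finite S1" "S1 \<subseteq> generate FT S \<inter> N" "generate FT S \<inter> N \<subseteq> generate FT S1"
  using G.schreier_generators[OF N S] by blast
 have Nc: "x \<in> carrier FT" if "x \<in> N" for x using N_subgroup that by (rule subgroup.mem_carrier)
 define \<Lambda> where "\<Lambda> x = univ_label (j x) \<one>\<^bsub>Q\<^esub>" for x
 have \<Lambda>c: "\<Lambda> x \<in> carrier ?F" if "x \<in> carrier FT" for x
  unfolding \<Lambda>_def using cocycleD(2)[OF label_cocycle[OF F.group_axioms univ_label], of "\<one>\<^bsub>Q\<^esub>" "j x"] that by simp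
 have \<Lambda>_mult: "\<Lambda> (x \<cdot> y) = \<Lambda> x \<otimes>\<^bsub>?F\<^esub> \<Lambda> y" if "x \<in> carrier FT" "y \<in> N" for x y
  unfolding \<Lambda>_def by (rule label_mult_N[OF F.group_axioms univ_label that])
 have \<Lambda>_gen: "generate ?F (\<Lambda> ` S1) \<subseteq> \<Lambda> ` (generate FT S \<inter> N)"
 proof
  have sub: "subgroup (generate FT S \<inter> N) FT"
   using G.generate_is_subgroup[OF S(2)] N_subgroup by (rule G.subgroups_Inter_pair)
  have \<Lambda>_one: "\<Lambda> \<one>\<^bsub>FT\<^esub> = \<one>\<^bsub>?F\<^esub>"
   unfolding \<Lambda>_def using cocycle_one[OF label_cocycle[OF F.group_axioms univ_label] _ F.group_axioms U.group_axioms, of "\<one>\<^bsub>Q\<^esub>"] by simp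
  fix y assume "y \<in> generate ?F (\<Lambda> ` S1)"
  then show "y \<in> \<Lambda> ` (generate FT S \<inter> N)"
  proof (induction rule: generate.induct)
   case one
   show ?case by (rule image_eqI[where f = \<Lambda>, OF \<Lambda>_one[symmetric] subgroup.one_closed[OF sub]])
  next
   case (incl y)
   then show ?case using S1 by blast
  next
   case (inv y)
   then obtain x where x: "x \<in> S1" "y = \<Lambda> x" by blast
   have xN: "x \<in> generate FT S \<inter> N" using x S1 by blast
   have ixN: "inv\<^bsub>FT\<^esub> x \<in> generate FT S \<inter> N" using subgroup.m_inv_closed[OF sub xN] .
   have "\<Lambda> (inv\<^bsub>FT\<^esub> x) \<otimes>\<^bsub>?F\<^esub> \<Lambda> x = \<one>\<^bsub>?F\<^esub>" using \<Lambda>_mult[of "inv\<^bsub>FT\<^esub> x" x] xN Nc \<Lambda>_one by simp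
   then have "inv\<^bsub>?F\<^esub> y = \<Lambda> (inv\<^bsub>FT\<^esub> x)" using F.inv_equality \<Lambda>c xN ixN Nc x by simp
   then show ?case using ixN by blast
  next
   case (eng y1 y2)
   then obtain x1 x2 where "x1 \<in> generate FT S \<inter> N" "x2 \<in> generate FT S \<inter> N" "y1 = \<Lambda> x1" "y2 = \<Lambda> x2" by blast
   then show ?case using \<Lambda>_mult[of x1 x2] Nc subgroup.m_closed[OF sub, of x1 x2] by (metis IntD2 imageI)
  qed
 qed
 have "\<Lambda> z \<notin> generate ?F (\<Lambda> ` S1)"
 proof
  assume "\<Lambda> z \<in> generate ?F (\<Lambda> ` S1)"
  then obtain h where h: "h \<in> generate FT S \<inter> N" "\<Lambda> z = \<Lambda> h" using \<Lambda>_gen by blast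
  let ?x = "z \<cdot> inv\<^bsub>FT\<^esub> h"
  have xN: "?x \<in> N" using z h N_subgroup by (simp add: subgroup.m_closed subgroup.m_inv_closed)
  have hc: "h \<in> carrier FT" "z \<in> carrier FT" using h z Nc by auto
  have xh: "z = ?x \<cdot> h" using hc by (simp add: G.m_assoc)
  have "\<Lambda> z = \<Lambda> ?x \<otimes>\<^bsub>?F\<^esub> \<Lambda> h" using \<Lambda>_mult[of ?x h] h xh hc by simp
  then have "\<Lambda> ?x \<otimes>\<^bsub>?F\<^esub> \<Lambda> h = \<Lambda> h" using h by simp
  then have "\<Lambda> ?x = \<one>\<^bsub>?F\<^esub>" using \<Lambda>c[of ?x] \<Lambda>c[of h] hc by simp
  then have "?x \<in> power_set FT M l" using univ_label_kernel[OF xN] by (simp add: \<Lambda>_def)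
  then show False using zH[OF h(1)] xh by blast
 qed
 note notin = this
 have sub: "\<Lambda> ` S1 \<subseteq> carrier ?F" "finite (\<Lambda> ` S1)" using S1 \<Lambda>c Nc by auto
 have zc: "\<Lambda> z \<in> carrier ?F" using \<Lambda>c z Nc by simp
 obtain Y f y0 where all: "finite (Y :: ('e \<times> ('v, 'e, 'g) generator word set set set) word set set set) \<and> f \<in> hom ?F (BijGroup Y) \<and> y0 \<in> Y \<and> (\<forall>x\<in>\<Lambda> ` S1. f x y0 = y0) \<and> f (\<Lambda> z) y0 \<noteq> y0"
  using free_group_separable[OF sub(2,1) zc notin] by (elim exE) (rule that)
 then have Y: "finite Y" "f \<in> hom ?F (BijGroup Y)" "y0 \<in> Y" "f (\<Lambda> z) y0 \<noteq> y0" by simp_all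
 have Yfix: "f x y0 = y0" if "x \<in> \<Lambda> ` S1" for x using all that by blast
 let ?B = "BijGroup Y"
 interpret B: group ?B by (rule group_BijGroup)
 interpret f: group_hom ?F ?B f using Y(2) by unfold_locales
 have Bmult: "(a \<otimes>\<^bsub>?B\<^esub> b) y = a (b y)" if "a \<in> carrier ?B" "b \<in> carrier ?B" "y \<in> Y" for a b y
  using that by (simp add: BijGroup_def compose_def)
 have BY: "a y \<in> Y" if "a \<in> carrier ?B" "y \<in> Y" for a y
  using that Bij_imp_funcset by (fastforce simp: BijGroup_def)
 define \<Phi> where "\<Phi> g p = f (univ_label (j g) p)" for g p
 note cc = cocycleD[OF label_cocycle[OF F.group_axioms univ_label]]
 have \<Phi>c: "\<Phi> g p \<in> carrier ?B" if "g \<in> carrier FT" "p \<in> carrier Q" for g p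
  unfolding \<Phi>_def using cc(2)[OF that(2), of "j g"] that by simp
 \<comment> \<open>The induced permutation representation: positions are moved by the group and
   points of \<open>Y\<close> by the label read at the position.\<close>
 define act where "act g = (\<lambda>(p, y). (pos (j g) \<otimes>\<^bsub>Q\<^esub> p, \<Phi> g p y))" for g
 define N' where "N' = {g \<in> carrier FT. \<forall>z\<in>carrier Q \<times> Y. act g z = z}"
 have fN': "finite_index_normal N' FT"
  unfolding N'_def
 proof (rule G.finite_index_normal_action_kernel)
  show "finite (carrier Q \<times> Y)" using Y(1) by simp
  fix g z assume g: "g \<in> carrier FT" and z: "z \<in> carrier Q \<times> Y"
  obtain p y where py: "z = (p, y)" "p \<in> carrier Q" "y \<in> Y" using z by auto
  show "act g z \<in> carrier Q \<times> Y" using g py \<Phi>c BY by (simp add: act_def)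
 next
  fix z assume z: "z \<in> carrier Q \<times> Y"
  obtain p y where py: "z = (p, y)" "p \<in> carrier Q" "y \<in> Y" using z by auto
  have "univ_label \<one>\<^bsub>UG\<^esub> p = \<one>\<^bsub>?F\<^esub>"
   by (rule cocycle_one[OF label_cocycle[OF F.group_axioms univ_label] py(2) F.group_axioms U.group_axioms])
  then have "\<Phi> \<one>\<^bsub>FT\<^esub> p = \<one>\<^bsub>?B\<^esub>" by (simp add: \<Phi>_def)
  then show "act \<one>\<^bsub>FT\<^esub> z = z" using py by (simp add: act_def) (simp add: BijGroup_def)
 next
  fix g h z assume gh: "g \<in> carrier FT" "h \<in> carrier FT" and z: "z \<in> carrier Q \<times> Y"
  obtain p y where py: "z = (p, y)" "p \<in> carrier Q" "y \<in> Y" using z by auto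
  have "\<Phi> (g \<cdot> h) p = \<Phi> g (pos (j h) \<otimes>\<^bsub>Q\<^esub> p) \<otimes>\<^bsub>?B\<^esub> \<Phi> h p"
   unfolding \<Phi>_def using cc(5)[OF py(2), of "j g" "j h"] cc(2)[OF py(2), of "j h"]
    cc(2)[of "pos (j h) \<otimes>\<^bsub>Q\<^esub> p" "j g"] gh py by simp
  then show "act (g \<cdot> h) z = act g (act h z)"
   using py gh Bmult[OF \<Phi>c \<Phi>c] by (simp add: act_def Q.m_assoc)
 qed
 have N'D: "x \<in> carrier FT" "x \<in> N" "\<Phi> x \<one>\<^bsub>Q\<^esub> y = y" if "x \<in> N'" "y \<in> Y" for x y
 proof -
  show x: "x \<in> carrier FT" using that by (simp add: N'_def)
  have "act x (\<one>\<^bsub>Q\<^esub>, y) = (\<one>\<^bsub>Q\<^esub>, y)" using that by (simp add: N'_def)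
  then show "\<Phi> x \<one>\<^bsub>Q\<^esub> y = y" "x \<in> N" using x pos_one_iff[OF x] by (auto simp: act_def)
 qed
 have gen_fix: "f y y0 = y0" if "y \<in> generate ?F (\<Lambda> ` S1)" for y
 proof -
  have sub: "subgroup {x \<in> carrier ?F. f x y0 = y0} ?F"
  proof (rule F.subgroupI)
   have "f \<one>\<^bsub>?F\<^esub> y0 = y0" using Y(3) f.hom_one by (simp add: BijGroup_def)
   then show "{x \<in> carrier ?F. f x y0 = y0} \<noteq> {}" by blast
   show "inv\<^bsub>?F\<^esub> x \<in> {x \<in> carrier ?F. f x y0 = y0}" if x: "x \<in> {x \<in> carrier ?F. f x y0 = y0}" for x
   proof -
    have "f (inv\<^bsub>?F\<^esub> x) (f x y0) = f (inv\<^bsub>?F\<^esub> x \<otimes>\<^bsub>?F\<^esub> x) y0" using x Bmult[of "f (inv\<^bsub>?F\<^esub> x)" "f x" y0] Y(3) f.hom_mult[of "inv\<^bsub>?F\<^esub> x" x] by simp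
    also have "\<dots> = y0" using x Y(3) by simp (simp add: BijGroup_def)
    finally show ?thesis using x by simp
   qed
  qed (use Bmult Y(3) in auto)
  have "generate ?F (\<Lambda> ` S1) \<subseteq> {x \<in> carrier ?F. f x y0 = y0}"
   by (rule F.generate_subgroup_incl[OF _ sub]) (use Yfix \<Lambda>c S1 Nc in auto)
  then show ?thesis using that by blast
 qed
 show thesis
 proof (rule that[OF fN'])
  show "N' \<subseteq> N" using N'D(2) Y(3) by blast
  fix h x assume h: "h \<in> generate FT S \<inter> N" and x: "x \<in> N'"
  have hgen: "\<Lambda> h \<in> generate ?F (\<Lambda> ` S1)"
  proof -
   have "h \<in> generate FT S1" using S1 h by blast
   then show ?thesis
   proof (induction rule: generate.induct)
    case one
    have "\<Lambda> \<one>\<^bsub>FT\<^esub> = \<one>\<^bsub>?F\<^esub>"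
     unfolding \<Lambda>_def using cocycle_one[OF label_cocycle[OF F.group_axioms univ_label] _ F.group_axioms U.group_axioms, of "\<one>\<^bsub>Q\<^esub>"] by simp
    then show ?case by (simp add: generate.one)
   next
    case (incl h)
    then show ?case by (auto intro: generate.incl)
   next
    case (inv h)
    have hN: "h \<in> N" "inv\<^bsub>FT\<^esub> h \<in> N" using inv S1 N_subgroup by (auto simp: subgroup.m_inv_closed)
    have "\<Lambda> \<one>\<^bsub>FT\<^esub> = \<one>\<^bsub>?F\<^esub>"
     unfolding \<Lambda>_def using cocycle_one[OF label_cocycle[OF F.group_axioms univ_label] _ F.group_axioms U.group_axioms, of "\<one>\<^bsub>Q\<^esub>"] by simp
    then have "\<Lambda> (inv\<^bsub>FT\<^esub> h) \<otimes>\<^bsub>?F\<^esub> \<Lambda> h = \<one>\<^bsub>?F\<^esub>" using \<Lambda>_mult[of "inv\<^bsub>FT\<^esub> h" h] hN Nc by simp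
    then have "\<Lambda> (inv\<^bsub>FT\<^esub> h) = inv\<^bsub>?F\<^esub> \<Lambda> h" using F.inv_equality \<Lambda>c hN Nc by simp
    then show ?case using inv generate.inv[of "\<Lambda> h" "\<Lambda> ` S1" ?F] by simp
   next
    case (eng h1 h2)
    have "generate FT S1 \<subseteq> N" using S1 N_subgroup by (intro G.generate_subgroup_incl) auto
    then have "h1 \<in> N" "h2 \<in> N" using eng by auto
    then show ?case using \<Lambda>_mult[of h1 h2] Nc eng generate.eng by metis
   qed
  qed
  show "z \<noteq> h \<cdot> x"
  proof
   assume e: "z = h \<cdot> x"
   have xc: "x \<in> carrier FT" "x \<in> N" "\<Phi> x \<one>\<^bsub>Q\<^esub> y0 = y0" using N'D[OF x Y(3)] by auto
   have hc: "h \<in> carrier FT" using h Nc by auto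
   have "f (\<Lambda> z) y0 = f (\<Lambda> h) (f (\<Lambda> x) y0)"
    using \<Lambda>_mult[OF hc xc(2)] e Bmult[of "f (\<Lambda> h)" "f (\<Lambda> x)" y0] Y(3) \<Lambda>c hc xc by simp
   also have "f (\<Lambda> x) y0 = y0" using xc(3) by (simp add: \<Phi>_def \<Lambda>_def)
   also have "f (\<Lambda> h) y0 = y0" using gen_fix[OF hgen] .
   finally show False using Y(4) by simp
  qed
 qed
qed

end

context normal_lattice
begin

lemma quotient_exists:
 assumes "(l::nat) > 0"
 obtains N where "lattice_quotient X Gv Ge \<phi> T r j q \<gamma> n \<eta> M d l N"
proof -
 obtain N where N: "finite_index_normal N FT \<and>
   (\<forall>v\<in>verts X. \<forall>g\<in>carrier (Gv v). ve v g \<in> N \<longleftrightarrow> ve v g \<in> power_set FT M l)"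
  using lattice_quotient[OF assms] by metis
 have "lattice_quotient X Gv Ge \<phi> T r j q \<gamma> n \<eta> M d l N"
  by (rule lattice_quotient.intro[OF normal_lattice_axioms], rule lattice_quotient_axioms.intro) (use assms N in auto)
 then show thesis by (rule that)
qed

text \<open>Separability of lattices, applied to the part of \<open>H\<close> inside
  \<open>M\<close>.\<close>

lemma separate_in_M:
 assumes H: "subgroup H FT" and m: "m \<in> M" "m \<notin> H"
 obtains l :: nat where "l > 0" "\<And>h x. h \<in> H \<inter> M \<Longrightarrow> x \<in> power_set FT M l \<Longrightarrow> m \<noteq> h \<cdot> x"
proof -
 obtain k \<theta> where \<theta>: "coordinates (FT\<lparr>carrier := M\<rparr>) k \<theta>" by (rule coordinates_M)
 let ?M = "FT\<lparr>carrier := M\<rparr>"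
 have grM: "group ?M" using M_subgroup by (rule G.subgroup_imp_group)
 interpret C: coordinate_group ?M k \<theta> using \<theta> grM by (simp add: coordinate_group_def coordinate_group_axioms_def)
 have inv: "inv\<^bsub>?M\<^esub> x = inv\<^bsub>FT\<^esub> x" if "x \<in> M" for x using G.m_inv_consistent[OF M_subgroup that] by simp
 have lat: "int_lattice k (\<theta> ` (H \<inter> M))"
  unfolding int_lattice_def
 proof (intro conjI ballI)
  show "\<theta> ` (H \<inter> M) \<subseteq> int_vecs k" using C.\<eta>_mem by auto
  show "(\<lambda>_. 0) \<in> \<theta> ` (H \<inter> M)"
   using C.\<eta>_one subgroup.one_closed[OF H] subgroup.one_closed[OF M_subgroup] by (intro image_eqI[of _ _ "\<one>\<^bsub>FT\<^esub>"]) auto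
  fix f g assume "f \<in> \<theta> ` (H \<inter> M)" "g \<in> \<theta> ` (H \<inter> M)"
  then obtain x y where xy: "x \<in> H \<inter> M" "y \<in> H \<inter> M" "f = \<theta> x" "g = \<theta> y" by blast
  then have e: "\<theta> (x \<otimes>\<^bsub>?M\<^esub> inv\<^bsub>?M\<^esub> y) = (\<lambda>i. f i - g i)" using C.\<eta>_mult[of x "inv\<^bsub>?M\<^esub> y"] C.\<eta>_inv[of y] C.inv_closed[of y] by simp
  have c: "x \<otimes>\<^bsub>?M\<^esub> inv\<^bsub>?M\<^esub> y \<in> H \<inter> M"
   using xy inv subgroup.m_closed[OF H] subgroup.m_inv_closed[OF H] subgroup.m_closed[OF M_subgroup] subgroup.m_inv_closed[OF M_subgroup] by simp
  show "(\<lambda>i. f i - g i) \<in> \<theta> ` (H \<inter> M)" by (rule image_eqI[where f = \<theta>, OF e[symmetric] c])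
 qed
 have "\<theta> m \<notin> \<theta> ` (H \<inter> M)" using m C.\<eta>_eq_iff by auto
 then obtain l :: nat where l: "l > 0" "\<And>b z. b \<in> \<theta> ` (H \<inter> M) \<Longrightarrow> z \<in> int_vecs k \<Longrightarrow> \<theta> m \<noteq> (\<lambda>i. b i + int l * z i)"
 proof -
  have "\<theta> m \<in> int_vecs k" using C.\<eta>_mem m by simp
  from int_lattice_separable[OF lat this \<open>\<theta> m \<notin> \<theta> ` (H \<inter> M)\<close>]
  obtain l :: nat where "l > 0" "\<forall>b\<in>\<theta> ` (H \<inter> M). \<forall>z\<in>int_vecs k. \<theta> m \<noteq> (\<lambda>i. b i + int l * z i)" by blast
  then show thesis using that by blast
 qed
 show thesis
 proof (rule that[OF l(1)])
  fix h x assume h: "h \<in> H \<inter> M" and x: "x \<in> power_set FT M l"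
  obtain y where y: "y \<in> M" "x = y [^]\<^bsub>FT\<^esub> l" using x by (auto simp: power_set_def)
  have xM: "x \<in> M" using y M_pow_closed by simp
  have "x = y [^]\<^bsub>?M\<^esub> l" using y by (simp add: nat_pow_def)
  then have "\<theta> x = (\<lambda>i. int l * \<theta> y i)" using C.\<eta>_pow[of y l] y by simp
  then have "\<theta> (h \<cdot> x) = (\<lambda>i. \<theta> h i + int l * \<theta> y i)" using C.\<eta>_mult[of h x] h xM by simp
  then show "m \<noteq> h \<cdot> x" using l(2)[of "\<theta> h" "\<theta> y"] h y C.\<eta>_mem by auto
 qed
qed

text \<open>Separation of an element \<open>g\<close> from a finitely generated subgroup proceeds in
  two layers. First \<open>l\<close> is chosen such that no \<open>l\<close>-th power from
  \<open>M\<close> moves \<open>g\<close> into the subgroup. Then \<open>g\<close> is separated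
  modulo the corresponding \<open>N\<close>, or it is shifted into \<open>N\<close> and separated
  there by free labels.\<close>

lemma separable: "subgroup_separable FT"
proof -
 have sep: "\<exists>N'. finite_index_normal N' FT \<and> (\<forall>h\<in>generate FT S. \<forall>x\<in>N'. g \<noteq> h \<cdot> x)"
  if S: "finite S" "S \<subseteq> carrier FT" and g: "g \<in> carrier FT" "g \<notin> generate FT S" for S g
 proof -
  let ?H = "generate FT S"
  have H: "subgroup ?H FT" using S by (intro G.generate_is_subgroup)
  have Hc: "x \<in> carrier FT" if "x \<in> ?H" for x using H that by (rule subgroup.mem_carrier)
  \<comment> \<open>Outside the product of the subgroup with \<open>M\<close> every \<open>l\<close>
    works. Inside it the question concerns only the \<open>M\<close>-part \<open>m\<close> of
    \<open>g\<close>, for which lattices are separable.\<close>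
  have "\<exists>l::nat. l > 0 \<and> (\<forall>h\<in>?H. \<forall>m\<in>power_set FT M l. g \<noteq> h \<cdot> m)"
  proof (cases "\<exists>h\<in>?H. \<exists>m\<in>M. g = h \<cdot> m")
   case False
   then show ?thesis using power_set_M[of 1] by (intro exI[of _ 1]) auto
  next
   case True
   then obtain h m where hm: "h \<in> ?H" "m \<in> M" "g = h \<cdot> m" by blast
   have "m \<notin> ?H" using hm g subgroup.m_closed[OF H] by blast
   then obtain l :: nat where l: "l > 0" "\<And>h x. h \<in> ?H \<inter> M \<Longrightarrow> x \<in> power_set FT M l \<Longrightarrow> m \<noteq> h \<cdot> x"
    using separate_in_M[OF H hm(2)] by metis
   have "g \<noteq> h' \<cdot> x" if h': "h' \<in> ?H" "x \<in> power_set FT M l" for h' x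
   proof
    assume e: "g = h' \<cdot> x"
    let ?h = "inv\<^bsub>FT\<^esub> h \<cdot> h'"
    have xM: "x \<in> M" using h' power_set_M by auto
    have c: "h \<in> carrier FT" "h' \<in> carrier FT" "m \<in> carrier FT" "x \<in> carrier FT" using hm h' Hc xM by auto
    have "m = inv\<^bsub>FT\<^esub> h \<cdot> (h \<cdot> m)" using c by (simp add: G.m_assoc[symmetric])
    also have "\<dots> = ?h \<cdot> x" using hm e c by (simp add: G.m_assoc)
    finally have mh: "m = ?h \<cdot> x" .
    have "?h = m \<cdot> inv\<^bsub>FT\<^esub> x" using c by (subst mh) (simp add: G.m_assoc)
    then have "?h \<in> M" using hm xM by (simp add: subgroup.m_closed[OF M_subgroup] subgroup.m_inv_closed[OF M_subgroup])
    moreover have "?h \<in> ?H" using hm h' by (simp add: subgroup.m_closed[OF H] subgroup.m_inv_closed[OF H])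
    ultimately show False using l(2)[of ?h x] h' mh by blast
   qed
   then show ?thesis using l(1) by blast
  qed
  then obtain l :: nat where l: "l > 0" "\<And>h m. h \<in> ?H \<Longrightarrow> m \<in> power_set FT M l \<Longrightarrow> g \<noteq> h \<cdot> m" by blast
  obtain N where "lattice_quotient X Gv Ge \<phi> T r j q \<gamma> n \<eta> M d l N" using quotient_exists[OF l(1)] .
  then interpret L: lattice_quotient X Gv Ge \<phi> T r j q \<gamma> n \<eta> M d l N .
  show ?thesis
  proof (cases "\<exists>h\<in>?H. \<exists>x\<in>N. g = h \<otimes>\<^bsub>FT\<^esub> x")
   case False
   then show ?thesis using L.N by blast
  next
   case True
   then obtain h n' where hn: "h \<in> ?H" "n' \<in> N" "g = h \<otimes>\<^bsub>FT\<^esub> n'" by blast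
   have nc: "n' \<in> carrier FT" "h \<in> carrier FT" using hn Hc subgroup.mem_carrier[OF L.N_subgroup] by auto
   \<comment> \<open>The powers of \<open>M\<close> form a normal subgroup, so they can be moved to
     the other side of \<open>h'\<close> to contradict the choice of \<open>l\<close>.\<close>
   have nH: "n' \<noteq> m \<otimes>\<^bsub>FT\<^esub> h'" if h': "h' \<in> ?H \<inter> N" "m \<in> power_set FT M l" for h' m
   proof
    assume e: "n' = m \<otimes>\<^bsub>FT\<^esub> h'"
    have mM: "m \<in> M" using h' power_set_M by auto
    have c: "h' \<in> carrier FT" "m \<in> carrier FT" using h' Hc mM by auto
    let ?m = "inv\<^bsub>FT\<^esub> h' \<otimes>\<^bsub>FT\<^esub> m \<otimes>\<^bsub>FT\<^esub> h'"
    have "?m \<in> power_set FT M l" using power_set_conj[OF G.inv_closed[OF c(1)] h'(2)] c by simp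
    moreover have "g = (h \<otimes>\<^bsub>FT\<^esub> h') \<otimes>\<^bsub>FT\<^esub> ?m"
    proof -
     have "h' \<otimes>\<^bsub>FT\<^esub> (inv\<^bsub>FT\<^esub> h' \<otimes>\<^bsub>FT\<^esub> (m \<otimes>\<^bsub>FT\<^esub> h')) = m \<otimes>\<^bsub>FT\<^esub> h'" using c by (simp add: G.m_assoc[symmetric])
     then show ?thesis using hn e c nc by (simp add: G.m_assoc)
    qed
    moreover have "h \<otimes>\<^bsub>FT\<^esub> h' \<in> ?H" using hn h' by (simp add: subgroup.m_closed[OF H])
    ultimately show False using l(2) by blast
   qed
   obtain N' where N': "finite_index_normal N' FT" "N' \<subseteq> N" "\<And>h x. h \<in> ?H \<inter> N \<Longrightarrow> x \<in> N' \<Longrightarrow> n' \<noteq> h \<otimes>\<^bsub>FT\<^esub> x"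
    using L.separate_in_N[OF S hn(2) nH] by metis
   have "g \<noteq> h' \<otimes>\<^bsub>FT\<^esub> x" if h': "h' \<in> ?H" "x \<in> N'" for h' x
   proof
    assume e: "g = h' \<otimes>\<^bsub>FT\<^esub> x"
    let ?h = "inv\<^bsub>FT\<^esub> h \<otimes>\<^bsub>FT\<^esub> h'"
    have xN: "x \<in> N" using h' N' by blast
    have c: "h' \<in> carrier FT" "x \<in> carrier FT" using h' Hc xN subgroup.mem_carrier[OF L.N_subgroup] by auto
    have "n' = inv\<^bsub>FT\<^esub> h \<otimes>\<^bsub>FT\<^esub> (h \<otimes>\<^bsub>FT\<^esub> n')" using nc by (simp add: G.m_assoc[symmetric])
    also have "\<dots> = ?h \<otimes>\<^bsub>FT\<^esub> x" using hn e c nc by (simp add: G.m_assoc)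
    finally have nh: "n' = ?h \<otimes>\<^bsub>FT\<^esub> x" .
    have "?h = n' \<otimes>\<^bsub>FT\<^esub> inv\<^bsub>FT\<^esub> x" using c nc by (subst nh) (simp add: G.m_assoc)
    then have "?h \<in> N" using hn xN by (simp add: subgroup.m_closed[OF L.N_subgroup] subgroup.m_inv_closed[OF L.N_subgroup])
    moreover have "?h \<in> ?H" using hn h' by (simp add: subgroup.m_closed[OF H] subgroup.m_inv_closed[OF H])
    ultimately show False using N'(3)[of ?h x] h' nh by blast
   qed
   then show ?thesis using N'(1) by blast
  qed
 qed
 \<comment> \<open>Two different subgroups differ by an element of one of them; separating it from
   the other subgroup makes the images different.\<close>
 have diff: "\<exists>N. N \<lhd> FT \<and> finite (carrier (FT Mod N)) \<and> (\<lambda>g. N #>\<^bsub>FT\<^esub> g) ` H \<noteq> (\<lambda>g. N #>\<^bsub>FT\<^esub> g) ` K"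
  if HK: "fg_subgroup H FT" "fg_subgroup K FT" and g: "g \<in> K" "g \<notin> H" for H K g
 proof -
  obtain S S' where S: "finite S" "S \<subseteq> carrier FT" "H = generate FT S" and S': "S' \<subseteq> carrier FT" "K = generate FT S'"
   using HK by (auto simp: fg_subgroup_def)
  have gc: "g \<in> carrier FT" using G.generate_in_carrier[OF S'(1)] g S' by blast
  obtain N' where N': "finite_index_normal N' FT" "\<forall>h\<in>generate FT S. \<forall>x\<in>N'. g \<noteq> h \<otimes>\<^bsub>FT\<^esub> x"
   using sep[OF S(1,2) gc] g S by blast
  have nor: "N' \<lhd> FT" using N' by (simp add: finite_index_normal_def)
  have "N' #>\<^bsub>FT\<^esub> g \<notin> (\<lambda>g. N' #>\<^bsub>FT\<^esub> g) ` H"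
  proof
   assume "N' #>\<^bsub>FT\<^esub> g \<in> (\<lambda>g. N' #>\<^bsub>FT\<^esub> g) ` H"
   then obtain h where h: "h \<in> H" "N' #>\<^bsub>FT\<^esub> g = N' #>\<^bsub>FT\<^esub> h" by blast
   have hc: "h \<in> carrier FT" using G.generate_in_carrier[OF S(2)] h S by blast
   have "g \<in> h <#\<^bsub>FT\<^esub> N'"
    using G.rcos_self[OF gc normal_imp_subgroup[OF nor]] h(2) normal.coset_eq[OF nor] hc by blast
   then show False using N'(2) h S by (auto simp: l_coset_def)
  qed
  then show ?thesis using N'(1) g(1) unfolding finite_index_normal_def by blast
 qed
 show ?thesis
  unfolding subgroup_separable_def
 proof (intro allI impI)
  fix H K assume a: "fg_subgroup H FT \<and> fg_subgroup K FT \<and> H \<noteq> K"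
  then consider g where "g \<in> K" "g \<notin> H" | g where "g \<in> H" "g \<notin> K" by blast
  then show "\<exists>N. N \<lhd> FT \<and> finite (carrier (FT Mod N)) \<and> (\<lambda>g. N #>\<^bsub>FT\<^esub> g) ` H \<noteq> (\<lambda>g. N #>\<^bsub>FT\<^esub> g) ` K"
  proof cases
   case (1 g)
   then show ?thesis using diff[OF _ _ 1] a by simp
  next
   case (2 g)
   then show ?thesis using diff[OF _ _ 2] a by (simp add: eq_commute[of "_ ` H"])
  qed
 qed
qed

end

section \<open>Self-similarity through recursions; the easy implications\<close>

section \<open>Self-similar actions from recursions\<close>

fun tree_act :: "('a \<Rightarrow> nat \<Rightarrow> nat) \<Rightarrow> ('a \<Rightarrow> nat \<Rightarrow> 'a) \<Rightarrow> 'a \<Rightarrow> nat list \<Rightarrow> nat list" where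
 "tree_act act \<mu> g [] = []"
| "tree_act act \<mu> g (x # w) = act g x # tree_act act \<mu> (\<mu> g x) w"

lemma length_tree_act [simp]: "length (tree_act act \<mu> g w) = length w"
 by (induction w arbitrary: g) auto

lemma tree_act_snoc: "\<exists>y. tree_act act \<mu> g (w @ [x]) = tree_act act \<mu> g w @ [y]"
 by (induction w arbitrary: g) auto

text \<open>A cocycle with values in the group itself prescribes the first-level action and the
  states. The kernel of the resulting tree action is normal, fixes the first level and contains its
  own states, which is what \<open>core\<close> excludes for nontrivial subgroups.\<close>

lemma self_similar_tree_act:
 fixes G :: "('a, 'b) monoid_scheme" and act :: "'a \<Rightarrow> nat \<Rightarrow> nat"
 assumes G: "group G" and m: "2 \<le> m" and c: "cocycle G {..<m} G act \<mu>"
  and core: "\<And>Z. Z \<lhd> G \<Longrightarrow> (\<And>g x. g \<in> Z \<Longrightarrow> x < m \<Longrightarrow> act g x = x \<and> \<mu> g x \<in> Z) \<Longrightarrow> Z \<subseteq> {\<one>\<^bsub>G\<^esub>}"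
 shows "self_similar G"
proof -
 interpret G: group G by fact
 let ?W = "lists {..<m}" and ?t = "tree_act act \<mu>"
 note c' = cocycleD[OF c]
 have closed: "?t g w \<in> ?W" if "g \<in> carrier G" "w \<in> ?W" for g w
  using that c' by (induction w arbitrary: g) auto
 have mult: "?t (g \<otimes>\<^bsub>G\<^esub> h) w = ?t g (?t h w)" if "g \<in> carrier G" "h \<in> carrier G" "w \<in> ?W" for g h w
  using that c' by (induction w arbitrary: g h) auto
 have one: "?t \<one>\<^bsub>G\<^esub> w = w" if "w \<in> ?W" for w
  using that c'(3) cocycle_one[OF c _ G G] by (induction w) auto
 have inv: "?t (inv\<^bsub>G\<^esub> g) (?t g w) = w" "?t g (?t (inv\<^bsub>G\<^esub> g) w) = w" if "g \<in> carrier G" "w \<in> ?W" for g w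
  using mult[of "inv\<^bsub>G\<^esub> g" g w] mult[of g "inv\<^bsub>G\<^esub> g" w] one that by simp_all
 define \<rho> where "\<rho> g = restrict (?t g) ?W" for g
 have bij: "\<rho> g \<in> Bij ?W" if g: "g \<in> carrier G" for g
 proof -
  have "bij_betw (\<rho> g) ?W ?W"
   by (intro bij_betw_byWitness[where f' = "\<rho> (inv\<^bsub>G\<^esub> g)"] ballI image_subsetI)
    (simp_all add: \<rho>_def closed inv g del: in_lists_conv_set)
  then show ?thesis by (simp add: Bij_def \<rho>_def)
 qed
 have aut: "\<rho> g \<in> tree_aut m" if g: "g \<in> carrier G" for g
  unfolding tree_aut_def
 proof (intro CollectI conjI ballI bij[OF g])
  show "\<rho> g [] = []" by (simp add: \<rho>_def)
  fix u v assume uv: "u \<in> ?W" "v \<in> ?W"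
  have "\<exists>y. ?t (inv\<^bsub>G\<^esub> g) (?t g v) = ?t (inv\<^bsub>G\<^esub> g) (?t g u) @ [y]" if "\<exists>y. ?t g v = ?t g u @ [y]"
   using that tree_act_snoc by metis
  then show "(\<exists>x. v = u @ [x]) \<longleftrightarrow> (\<exists>y. \<rho> g v = \<rho> g u @ [y])"
   using tree_act_snoc[of act \<mu> g u] uv inv g by (auto simp: \<rho>_def simp del: in_lists_conv_set)
 qed
 have hom: "\<rho> \<in> hom G (tree_aut_group m)"
 proof (rule homI)
  fix g h assume gh: "g \<in> carrier G" "h \<in> carrier G"
  have "\<rho> (g \<otimes>\<^bsub>G\<^esub> h) = compose ?W (\<rho> g) (\<rho> h)"
   using mult gh closed by (auto simp: \<rho>_def compose_def restrict_def simp del: in_lists_conv_set)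
  then show "\<rho> (g \<otimes>\<^bsub>G\<^esub> h) = \<rho> g \<otimes>\<^bsub>tree_aut_group m\<^esub> \<rho> h"
   using bij gh by (simp add: tree_aut_group_def BijGroup_def)
 qed (use aut in \<open>simp add: tree_aut_group_def\<close>)
 interpret h: group_hom G "tree_aut_group m" \<rho>
  using hom group_tree_aut_group by (simp add: group_hom_def group_hom_axioms_def G)
 have one_aut: "\<one>\<^bsub>tree_aut_group m\<^esub> = (\<lambda>w\<in>?W. w)" by (simp add: tree_aut_group_def BijGroup_def)
 let ?Z = "kernel G (tree_aut_group m) \<rho>"
 have Zfix: "?t g w = w" if "g \<in> ?Z" "w \<in> ?W" for g w
 proof -
  have "\<rho> g = (\<lambda>w\<in>?W. w)" using that one_aut by (simp add: kernel_def)
  from fun_cong[OF this, of w] show ?thesis using that(2) by (simp add: \<rho>_def del: in_lists_conv_set)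
 qed
 have "?Z \<subseteq> {\<one>\<^bsub>G\<^esub>}"
 proof (rule core)
  show "?Z \<lhd> G" by (rule h.normal_kernel)
  fix g x assume g: "g \<in> ?Z" and x: "x < m"
  have gc: "g \<in> carrier G" using g by (simp add: kernel_def)
  have "?t (\<mu> g x) w = w" if "w \<in> ?W" for w using Zfix[OF g, of "x # w"] that x by simp
  then have "\<mu> g x \<in> ?Z" using c'(2)[of x g] x gc one_aut by (auto simp: kernel_def \<rho>_def simp del: in_lists_conv_set)
  then show "act g x = x \<and> \<mu> g x \<in> ?Z" using Zfix[OF g, of "[x]"] x by simp
 qed
 moreover have "\<one>\<^bsub>G\<^esub> \<in> ?Z" by (simp add: kernel_def)
 ultimately have "inj_on \<rho> (carrier G)" by (intro h.trivial_ker_imp_inj) blast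
 then have "\<rho> \<in> mon G (tree_aut_group m)" using hom by (simp add: mon_def)
 moreover have "state m (\<rho> g) x = \<rho> (\<mu> g x)" if "g \<in> carrier G" "x < m" for g x
  using that by (auto simp: state_def \<rho>_def restrict_def simp del: in_lists_conv_set)
 then have "\<forall>g\<in>carrier G. \<forall>x<m. state m (\<rho> g) x \<in> \<rho> ` carrier G" using c'(2) by simp
 ultimately show ?thesis unfolding self_similar_def using m by blast
qed

text \<open>Two dummy positions keep the degree at least two.\<close>

lemma self_similar_of_cocycles:
 fixes G :: "('a, 'b) monoid_scheme"
 assumes G: "group G" and I: "finite I" and Q: "\<And>i. i \<in> I \<Longrightarrow> finite (Q i)"
  and c: "\<And>i. i \<in> I \<Longrightarrow> cocycle G (Q i) G (act i) (\<mu> i)"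
  and core: "\<And>Z. Z \<lhd> G \<Longrightarrow>
   (\<And>i g p. i \<in> I \<Longrightarrow> g \<in> Z \<Longrightarrow> p \<in> Q i \<Longrightarrow> act i g p = p \<and> \<mu> i g p \<in> Z) \<Longrightarrow> Z \<subseteq> {\<one>\<^bsub>G\<^esub>}"
 shows "self_similar G"
proof -
 interpret G: group G by fact
 let ?S = "Sigma I Q"
 define N where "N = card ?S"
 have "finite ?S" using I Q by blast
 then obtain f where f: "bij_betw f {..<N} ?S"
  using ex_bij_betw_nat_finite[of ?S] by (auto simp: N_def atLeast0LessThan)
 let ?f' = "inv_into {..<N} f"
 have f': "?f' y < N" "f (?f' y) = y" if "y \<in> ?S" for y
  using bij_betw_apply[OF bij_betw_inv_into[OF f] that] bij_betw_inv_into_right[OF f that] by auto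
 have f'f: "?f' (f x) = x" if "x < N" for x using bij_betw_inv_into_left[OF f] that by simp
 have fS: "f x \<in> ?S" if "x < N" for x using bij_betw_apply[OF f, of x] that by simp
 \<comment> \<open>The disjoint union of the position sets is numbered from zero; the two positions
   beyond it are fixed, with state \<open>g\<close> itself, so they put no new condition on an
   invariant subgroup.\<close>
 define a where "a g x = (if x < N then ?f' (fst (f x), act (fst (f x)) g (snd (f x))) else x)" for g x
 define \<nu> where "\<nu> g x = (if x < N then \<mu> (fst (f x)) g (snd (f x)) else g)" for g x
 have fst_snd: "fst (f x) \<in> I" "snd (f x) \<in> Q (fst (f x))" if "x < N" for x
  using fS[OF that] by auto
 have mv: "(fst (f x), act (fst (f x)) g (snd (f x))) \<in> ?S" if "x < N" "g \<in> carrier G" for x g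
  using fst_snd[OF that(1)] cocycleD(1)[OF c] that by auto
 show ?thesis
 proof (rule self_similar_tree_act[OF G])
  show "2 \<le> N + 2" by simp
  show "cocycle G {..<N + 2} G a \<nu>"
  proof (rule cocycleI)
   fix g x assume gx: "g \<in> carrier G" "x \<in> {..<N + 2}"
   show "a g x \<in> {..<N + 2}" using gx f'(1)[OF mv] by (force simp: a_def)
   show "\<nu> g x \<in> carrier G" using gx fst_snd cocycleD(2)[OF c] by (simp add: \<nu>_def)
  next
   fix x assume "x \<in> {..<N + 2}"
   then show "a \<one>\<^bsub>G\<^esub> x = x" using fst_snd cocycleD(3)[OF c] f'f by (simp add: a_def)
  next
   fix g h x assume gh: "g \<in> carrier G" "h \<in> carrier G" and x: "x \<in> {..<N + 2}"
   have "f (a h x) = (fst (f x), act (fst (f x)) h (snd (f x)))" "a h x < N" if "x < N"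
    using f'[OF mv[OF that gh(2)]] that by (simp_all add: a_def)
   then show "a (g \<otimes>\<^bsub>G\<^esub> h) x = a g (a h x)" "\<nu> (g \<otimes>\<^bsub>G\<^esub> h) x = \<nu> g (a h x) \<otimes>\<^bsub>G\<^esub> \<nu> h x"
    using fst_snd[of x] cocycleD(4,5)[OF c] gh by (simp_all add: a_def \<nu>_def)
  qed
  fix Z assume Z: "Z \<lhd> G" "\<And>g x. g \<in> Z \<Longrightarrow> x < N + 2 \<Longrightarrow> a g x = x \<and> \<nu> g x \<in> Z"
  show "Z \<subseteq> {\<one>\<^bsub>G\<^esub>}"
  proof (rule core[OF Z(1)])
   fix i g p assume h: "i \<in> I" "g \<in> Z" "p \<in> Q i"
   have gc: "g \<in> carrier G" using h Z(1) by (meson normal_imp_subgroup subgroup.mem_carrier)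
   have ip: "(i, p) \<in> ?S" using h by simp
   note x = f'[OF ip]
   have "a g (?f' (i, p)) = ?f' (i, p)" "\<nu> g (?f' (i, p)) \<in> Z" using Z(2)[OF h(2)] x(1) by auto
   moreover have "(i, act i g p) \<in> ?S" using mv[OF x(1) gc] x(2) by simp
   ultimately have "(i, act i g p) = (i, p)" "\<mu> i g p \<in> Z"
    using x f'(2)[of "(i, act i g p)"] by (simp_all add: a_def \<nu>_def)
   then show "act i g p = p \<and> \<mu> i g p \<in> Z" by simp
  qed
 qed
qed


section \<open>Residual finiteness\<close>

lemma residually_finiteI:
 assumes "\<And>g. g \<in> carrier G \<Longrightarrow> g \<noteq> \<one>\<^bsub>G\<^esub> \<Longrightarrow> \<exists>N. finite_index_normal N G \<and> g \<notin> N"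
 shows "residually_finite G"
 using assms unfolding residually_finite_def finite_index_normal_def by blast

lemma tree_aut_length:
 assumes f: "f \<in> tree_aut m" and w: "w \<in> lists {..<m}"
 shows "length (f w) = length w"
 using w
proof (induction w rule: rev_induct)
 case Nil
 then show ?case using f by (simp add: tree_aut_def)
next
 case (snoc x w)
 have "w \<in> lists {..<m}" "w @ [x] \<in> lists {..<m}" using snoc.prems by auto
 then have "\<exists>y. f (w @ [x]) = f w @ [y]" using f unfolding tree_aut_def by blast
 then show ?case using snoc by auto
qed

text \<open>An element that moves some word acts nontrivially on the finite level of that
  word.\<close>

lemma self_similar_imp_residually_finite:
 assumes G: "group G" and ss: "self_similar G"
 shows "residually_finite G"
proof (rule residually_finiteI)
 interpret G: group G by fact
 obtain m \<rho> where \<rho>: "\<rho> \<in> mon G (tree_aut_group m)" using ss unfolding self_similar_def by blast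
 let ?W = "lists {..<m}"
 interpret h: group_hom G "tree_aut_group m" \<rho>
  using \<rho> group_tree_aut_group by (simp add: group_hom_def group_hom_axioms_def G mon_def)
 have aut: "\<rho> g \<in> tree_aut m" if "g \<in> carrier G" for g using h.hom_closed[OF that] by (simp add: tree_aut_group_def)
 have bij: "\<rho> g \<in> Bij ?W" if "g \<in> carrier G" for g using aut[OF that] by (simp add: tree_aut_def)
 have closed: "\<rho> g w \<in> ?W" if "g \<in> carrier G" "w \<in> ?W" for g w
  using Bij_imp_funcset[OF bij[OF that(1)]] that(2) by blast
 have mult: "\<rho> (g \<otimes>\<^bsub>G\<^esub> k) w = \<rho> g (\<rho> k w)" if "g \<in> carrier G" "k \<in> carrier G" "w \<in> ?W" for g k w
  using that h.hom_mult bij by (simp add: tree_aut_group_def BijGroup_def compose_def)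
 have one: "\<one>\<^bsub>tree_aut_group m\<^esub> = (\<lambda>w\<in>?W. w)" by (simp add: tree_aut_group_def BijGroup_def)
 fix g assume g: "g \<in> carrier G" "g \<noteq> \<one>\<^bsub>G\<^esub>"
 have "\<rho> g \<noteq> \<rho> \<one>\<^bsub>G\<^esub>" using \<rho> g inj_onD[of \<rho> "carrier G" g "\<one>\<^bsub>G\<^esub>"] by (auto simp: mon_def)
 then have "\<rho> g \<noteq> (\<lambda>w\<in>?W. w)" using h.hom_one one by simp
 then obtain w where w: "w \<in> ?W" "\<rho> g w \<noteq> w"
  using bij[OF g(1)] extensionalityI[of "\<rho> g" ?W "\<lambda>w\<in>?W. w"] by (auto simp: Bij_def simp del: in_lists_conv_set)
 let ?Y = "{u \<in> ?W. length u = length w}"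
 have "finite ?Y" using finite_lists_length_eq[of "{..<m}" "length w"] by (simp add: lists_eq_set)
 then have "finite_index_normal {g \<in> carrier G. \<forall>y\<in>?Y. \<rho> g y = y} G"
  using closed tree_aut_length[OF aut] mult h.hom_one one by (intro G.finite_index_normal_action_kernel) auto
 then show "\<exists>N. finite_index_normal N G \<and> g \<notin> N" using w by blast
qed

text \<open>Congruence quotients, realised as kernels of the action on vectors with entries reduced
  modulo \<open>b\<close>.\<close>

lemma linear_over_int_imp_residually_finite:
 assumes G: "group G" and lin: "linear_over_int G"
 shows "residually_finite G"
proof (rule residually_finiteI)
 interpret G: group G by fact
 obtain k \<rho> where \<rho>: "\<rho> \<in> mon G (GL_int k)" using lin unfolding linear_over_int_def by blast
 interpret R: ring "ring_mat TYPE(int) k ()" by (rule ring_mat)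
 have grp: "group (GL_int k)" unfolding GL_int_def by (rule R.units_group)
 interpret h: group_hom G "GL_int k" \<rho>
  using \<rho> grp by (simp add: group_hom_def group_hom_axioms_def G mon_def)
 have closed: "\<rho> g \<in> carrier_mat k k" if "g \<in> carrier G" for g
  using h.hom_closed[OF that] R.Units_closed by (auto simp: GL_int_def units_of_def ring_mat_def)
 have mult: "\<rho> (g \<otimes>\<^bsub>G\<^esub> h) = \<rho> g * \<rho> h" if "g \<in> carrier G" "h \<in> carrier G" for g h
  using h.hom_mult[OF that] by (simp add: GL_int_def units_of_def ring_mat_def)
 have one: "\<rho> \<one>\<^bsub>G\<^esub> = 1\<^sub>m k" using h.hom_one by (simp add: GL_int_def units_of_def ring_mat_def)
 fix g assume g: "g \<in> carrier G" "g \<noteq> \<one>\<^bsub>G\<^esub>"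
 have "\<rho> g \<noteq> \<rho> \<one>\<^bsub>G\<^esub>" using \<rho> g inj_onD[of \<rho> "carrier G" g "\<one>\<^bsub>G\<^esub>"] by (auto simp: mon_def)
 then have "\<rho> g \<noteq> 1\<^sub>m k" using one by simp
 then obtain i j where ij: "i < k" "j < k" "\<rho> g $$ (i, j) \<noteq> 1\<^sub>m k $$ (i, j)"
  using closed[OF g(1)] by (metis eq_matI index_one_mat(2,3) carrier_matD)
 \<comment> \<open>A nonnegative entry is smaller than \<open>b\<close> and keeps its value; a
   negative entry is reduced to 2. In both cases the result differs from the entry of the identity
   matrix, which is 0 or 1.\<close>
 define b where "b = \<bar>\<rho> g $$ (i, j)\<bar> + 2"
 have b: "b > 1" by (simp add: b_def)
 let ?Y = "{v \<in> carrier_vec k. \<forall>i<k. v $ i \<in> {0..<b}}"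
 define act where "act g v = map_vec (\<lambda>a. a mod b) (\<rho> g *\<^sub>v v)" for g v
 have "?Y \<subseteq> vec k ` (PiE {..<k} (\<lambda>_. {0..<b}))"
 proof
  fix v assume v: "v \<in> ?Y"
  have "v = vec k (restrict (vec_index v) {..<k})" using v by (intro eq_vecI) auto
  moreover have "restrict (vec_index v) {..<k} \<in> PiE {..<k} (\<lambda>_. {0..<b})" using v by auto
  ultimately show "v \<in> vec k ` (PiE {..<k} (\<lambda>_. {0..<b}))" by blast
 qed
 then have fin: "finite ?Y" by (rule finite_subset) (simp add: finite_PiE)
 have kernel: "finite_index_normal {g \<in> carrier G. \<forall>y\<in>?Y. act g y = y} G"
 proof (rule G.finite_index_normal_action_kernel[OF fin])
  fix g v assume gv: "g \<in> carrier G" "v \<in> ?Y"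
  then show "act g v \<in> ?Y" using b closed[OF gv(1)] by (auto simp: act_def)
 next
  fix v assume "v \<in> ?Y"
  then show "act \<one>\<^bsub>G\<^esub> v = v" by (intro eq_vecI) (auto simp: act_def one simp del: h.hom_one)
 next
  fix g h v assume gh: "g \<in> carrier G" "h \<in> carrier G" and v: "v \<in> ?Y"
  have vc: "v \<in> carrier_vec k" using v by simp
  have hv: "\<rho> h *\<^sub>v v \<in> carrier_vec k" using closed[OF gh(2)] vc by simp
  have "act (g \<otimes>\<^bsub>G\<^esub> h) v = map_vec (\<lambda>a. a mod b) (\<rho> g *\<^sub>v (\<rho> h *\<^sub>v v))"
   using gh closed vc by (simp add: act_def mult assoc_mult_mat_vec[of _ k k _ k] del: h.hom_mult)
  also have "\<dots> = act g (act h v)"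
  proof (rule eq_vecI)
   fix i assume "i < dim_vec (act g (act h v))"
   then have i: "i < k" using closed[OF gh(1)] by (simp add: act_def)
   have "(\<Sum>x = 0..<k. \<rho> g $$ (i, x) * ((\<rho> h *\<^sub>v v) $ x mod b)) mod b
     = (\<Sum>x = 0..<k. (\<rho> g $$ (i, x) * ((\<rho> h *\<^sub>v v) $ x mod b)) mod b) mod b" by (simp add: mod_sum_eq)
   also have "\<dots> = (\<Sum>x = 0..<k. \<rho> g $$ (i, x) * (\<rho> h *\<^sub>v v) $ x) mod b" by (simp add: mod_mult_right_eq mod_sum_eq)
   finally show "map_vec (\<lambda>a. a mod b) (\<rho> g *\<^sub>v (\<rho> h *\<^sub>v v)) $ i = act g (act h v) $ i"
    using i closed[OF gh(1)] closed[OF gh(2)] by (simp add: act_def scalar_prod_def)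
  qed (use closed[OF gh(1)] in \<open>simp add: act_def\<close>)
  finally show "act (g \<otimes>\<^bsub>G\<^esub> h) v = act g (act h v)" .
 qed
 have "act g (Matrix.unit_vec k j) $ i = \<rho> g $$ (i, j) mod b"
  using ij closed[OF g(1)] by (simp add: act_def)
 moreover have "\<rho> g $$ (i, j) mod b \<noteq> 1\<^sub>m k $$ (i, j)"
 proof (cases "\<rho> g $$ (i, j) \<ge> 0")
  case True
  then show ?thesis using ij by (simp add: b_def)
 next
  case False
  have "\<rho> g $$ (i, j) mod b = (\<rho> g $$ (i, j) + b) mod b" by simp
  also have "\<dots> = 2" using False by (simp add: b_def)
  finally have "\<rho> g $$ (i, j) mod b = 2" .
  then show ?thesis using ij by simp
 qed
 ultimately have "act g (Matrix.unit_vec k j) \<noteq> Matrix.unit_vec k j" using ij by (metis index_one_mat(1) index_unit_vec(1))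
 moreover have "Matrix.unit_vec k j \<in> ?Y" using b by (auto simp: Matrix.unit_vec_def)
 ultimately show "\<exists>N. finite_index_normal N G \<and> g \<notin> N" using kernel by blast
qed

text \<open>Separate the trivial subgroup from the cyclic subgroup generated by
  \<open>g\<close>.\<close>

lemma subgroup_separable_imp_residually_finite:
 assumes G: "group G" and sep: "subgroup_separable G"
 shows "residually_finite G"
proof (rule residually_finiteI)
 interpret G: group G by fact
 fix g assume g: "g \<in> carrier G" "g \<noteq> \<one>\<^bsub>G\<^esub>"
 let ?H = "generate G {}" and ?K = "generate G {g}"
 have "fg_subgroup ?H G" "fg_subgroup ?K G" unfolding fg_subgroup_def using g by blast+
 moreover have "?H \<noteq> ?K" using g(2) generate.incl[of g "{g}" G] by (auto simp: G.generate_empty)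
 ultimately obtain N where N: "N \<lhd> G" "finite (carrier (G Mod N))" "(\<lambda>x. N #>\<^bsub>G\<^esub> x) ` ?H \<noteq> (\<lambda>x. N #>\<^bsub>G\<^esub> x) ` ?K"
  using sep unfolding subgroup_separable_def by meson
 have sN: "subgroup N G" using N(1) by (rule normal_imp_subgroup)
 have "g \<notin> N"
 proof
  assume "g \<in> N"
  then have "?K \<subseteq> N" using sN by (intro G.generate_subgroup_incl) auto
  moreover have "?H \<subseteq> N" using sN by (intro G.generate_subgroup_incl) auto
  moreover have "\<one>\<^bsub>G\<^esub> \<in> ?H" "\<one>\<^bsub>G\<^esub> \<in> ?K" by (rule generate.one)+
  moreover have "N #>\<^bsub>G\<^esub> x = N" if "x \<in> N" for x using G.coset_join2[OF _ sN that] sN that by (metis subgroup.mem_carrier)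
  ultimately have "(\<lambda>x. N #>\<^bsub>G\<^esub> x) ` ?H = {N}" "(\<lambda>x. N #>\<^bsub>G\<^esub> x) ` ?K = {N}" by blast+
  then show False using N(3) by simp
 qed
 then show "\<exists>N. finite_index_normal N G \<and> g \<notin> N" using N unfolding finite_index_normal_def by blast
qed

section \<open>A recursion on the free group of rank two\<close>

lemma zero_if_all_powers_dvd:
 fixes z b :: int
 assumes "2 \<le> b" "\<And>k. b ^ k dvd z"
 shows "z = 0"
proof (rule ccontr)
 let ?k = "nat \<bar>z\<bar>"
 assume "z \<noteq> 0"
 then have "\<bar>b ^ ?k\<bar> \<le> \<bar>z\<bar>" using assms(2) by (rule dvd_imp_le_int)
 moreover have "\<bar>z\<bar> < 2 ^ ?k" using of_nat_less_two_power[of ?k, where 'a = int] by simp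
 moreover have "2 ^ ?k \<le> b ^ ?k" using assms(1) by (intro power_mono) auto
 ultimately show False by simp
qed

lemma mat2_mult_assoc: "mat2_mult (mat2_mult x y) z = mat2_mult x (mat2_mult y z)"
proof -
 obtain a b c d a' b' c' d' a'' b'' c'' d'' where
  "x = (a, b, c, d)" "y = (a', b', c', d')" "z = (a'', b'', c'', d'')" by (metis prod.exhaust)
 then show ?thesis by (simp add: algebra_simps)
qed

lemma mat2_mult_one [simp]: "mat2_mult x (1, 0, 0, 1) = x" "mat2_mult (1, 0, 0, 1) x = x"
 by (cases x; simp)+

abbreviation "F2 \<equiv> free_group (UNIV :: bool set)"
abbreviation "gen_a \<equiv> free_gen (UNIV :: bool set) True"
abbreviation "gen_b \<equiv> free_gen (UNIV :: bool set) False"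

definition flip_group :: "bool monoid" where
 "flip_group = \<lparr>carrier = UNIV, monoid.mult = (\<noteq>), one = False\<rparr>"

lemma group_flip_group: "group flip_group"
 by (rule groupI) (auto simp: flip_group_def)

text \<open>The recursion is read off from \<open>\<rho>(w) D\<^sub>c = D\<^bsub>wc\<^esub> \<rho>(\<nu>(w, c))\<close> for the matrices \<open>D\<^sub>0 = diag(2, 1)\<close> and
 \<open>D\<^sub>1 = A D\<^sub>0\<close>.  Conjugation by \<open>D\<^sub>0\<close> halves the upper right entry, so that this entry vanishes on the
 kernel of the action.\<close>

definition lattice_rep :: "bool \<Rightarrow> mat2" where
 "lattice_rep c = (if c then (2, 2, 0, 1) else (2, 0, 0, 1))"

text \<open>The cocycle is prescribed on the two generators through the wreath product with the
  group of order two. The matrix identity then has to be checked on generators only, because it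
  passes to products and inverses.\<close>

lemma F2_recursion_exists:
 shows "\<exists>act \<nu> \<rho>. cocycle F2 (UNIV :: bool set) F2 act \<nu> \<and> \<rho> \<in> hom F2 SL2 \<and>
  \<rho> gen_a = (1, 2, 0, 1) \<and> \<rho> gen_b = (1, 0, 2, 1) \<and>
  (\<forall>w\<in>carrier F2. \<forall>c. mat2_mult (\<rho> w) (lattice_rep c) = mat2_mult (lattice_rep (act w c)) (\<rho> (\<nu> w c)))"
proof -
 interpret F: group F2 by (rule group_presented_group)
 interpret S: group SL2 by (rule group_SL2)
 have gc: "gen_a \<in> carrier F2" "gen_b \<in> carrier F2" by simp_all
 obtain \<rho> where \<rho>: "\<rho> \<in> hom F2 SL2" "\<And>x. \<rho> (free_gen UNIV x) = (if x then (1, 2, 0, 1) else (1, 0, 2, 1))"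
  using free_group_hom[OF group_SL2, of "\<lambda>x. if x then (1, 2, 0, 1) else (1, 0, 2, 1)" "UNIV :: bool set"] by auto
 interpret \<rho>: group_hom F2 SL2 \<rho> using \<rho>(1) by unfold_locales
 let ?u = "inv\<^bsub>F2\<^esub> gen_b \<otimes>\<^bsub>F2\<^esub> gen_a"
 \<comment> \<open>The generator \<open>gen_a\<close> exchanges the two letters, with states the
   identity and \<open>gen_a\<close>; the generator \<open>gen_b\<close> fixes both, with states the
   squares of \<open>gen_b\<close> and of \<open>?u\<close>. The exponents solve the matrix
   identity: for example \<open>B D\<^sub>0 = D\<^sub>0 B\<^sup>2\<close>.\<close>
 define f :: "bool \<Rightarrow> bool \<Rightarrow> bool word set" where
  "f x c = (if x then (if c then gen_a else \<one>\<^bsub>F2\<^esub>) else (if c then ?u \<otimes>\<^bsub>F2\<^esub> ?u else gen_b \<otimes>\<^bsub>F2\<^esub> gen_b))" for x c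
 have "(\<lambda>x. (f x, x)) \<in> UNIV \<rightarrow> carrier (wreath_group flip_group F2)"
  using gc by (auto simp: wreath_group_def flip_group_def f_def PiE_def)
 then obtain h where h: "h \<in> hom F2 (wreath_group flip_group F2)" "\<And>x. h (free_gen UNIV x) = (f x, x)"
  using free_group_hom[OF group_wreath_group[OF group_flip_group F.group_axioms], of "\<lambda>x. (f x, x)" "UNIV :: bool set"] by auto
 define act where "act w c = (snd (h w) \<noteq> c)" for w c
 define \<nu> where "\<nu> w = fst (h w)" for w
 have c: "cocycle F2 (UNIV :: bool set) F2 act \<nu>"
  using cocycle_wreath_hom[OF h(1) F.group_axioms group_flip_group F.group_axioms]
  by (simp add: flip_group_def act_def[abs_def] \<nu>_def[abs_def])
 note c' = cocycleD[OF c UNIV_I]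
 define E where "E w \<longleftrightarrow> (\<forall>c. mat2_mult (\<rho> w) (lattice_rep c) = mat2_mult (lattice_rep (act w c)) (\<rho> (\<nu> w c)))" for w
 have E_mult: "E (u \<otimes>\<^bsub>F2\<^esub> w)" if "E u" "E w" "u \<in> carrier F2" "w \<in> carrier F2" for u w
  unfolding E_def
 proof
  fix c
  have "mat2_mult (\<rho> (u \<otimes>\<^bsub>F2\<^esub> w)) (lattice_rep c) = mat2_mult (mat2_mult (\<rho> u) (lattice_rep (act w c))) (\<rho> (\<nu> w c))"
   using that(2-) by (simp add: mat2_mult_assoc E_def)
  also have "\<dots> = mat2_mult (lattice_rep (act u (act w c))) (mat2_mult (\<rho> (\<nu> u (act w c))) (\<rho> (\<nu> w c)))"
   using spec[OF that(1)[unfolded E_def], of "act w c"] by (simp add: mat2_mult_assoc)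
  finally show "mat2_mult (\<rho> (u \<otimes>\<^bsub>F2\<^esub> w)) (lattice_rep c)
    = mat2_mult (lattice_rep (act (u \<otimes>\<^bsub>F2\<^esub> w) c)) (\<rho> (\<nu> (u \<otimes>\<^bsub>F2\<^esub> w) c))"
   using that(3,4) c' by simp
 qed
 have E_inv: "E (inv\<^bsub>F2\<^esub> u)" if "E u" "u \<in> carrier F2" for u
  unfolding E_def
 proof
  fix c
  let ?c = "act (inv\<^bsub>F2\<^esub> u) c"
  let ?z = "\<rho> (\<nu> u ?c)"
  note ci = cocycle_inv[OF c UNIV_I F.group_axioms F.group_axioms that(2), of c]
  have z: "?z \<in> carrier SL2" using c'(2) that by simp
  have "mat2_mult (\<rho> u) (lattice_rep ?c) = mat2_mult (lattice_rep c) ?z"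
   using spec[OF that(1)[unfolded E_def], of ?c] by (simp only: ci(2))
  then have e: "mat2_mult (\<rho> (inv\<^bsub>F2\<^esub> u)) (mat2_mult (mat2_mult (\<rho> u) (lattice_rep ?c)) (inv\<^bsub>SL2\<^esub> ?z))
    = mat2_mult (\<rho> (inv\<^bsub>F2\<^esub> u)) (mat2_mult (mat2_mult (lattice_rep c) ?z) (inv\<^bsub>SL2\<^esub> ?z))" by simp
  have r: "mat2_mult ?z (inv\<^bsub>SL2\<^esub> ?z) = (1, 0, 0, 1)" using S.r_inv[OF z] by simp
  have l: "mat2_mult (\<rho> (inv\<^bsub>F2\<^esub> u)) (\<rho> u) = (1, 0, 0, 1)" using S.l_inv[of "\<rho> u"] that by simp
  have "mat2_mult (\<rho> (inv\<^bsub>F2\<^esub> u)) (mat2_mult (mat2_mult (\<rho> u) (lattice_rep ?c)) (inv\<^bsub>SL2\<^esub> ?z))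
    = mat2_mult (lattice_rep ?c) (inv\<^bsub>SL2\<^esub> ?z)"
   by (simp only: mat2_mult_assoc[symmetric] l mat2_mult_one)
  moreover have "mat2_mult (\<rho> (inv\<^bsub>F2\<^esub> u)) (mat2_mult (mat2_mult (lattice_rep c) ?z) (inv\<^bsub>SL2\<^esub> ?z))
    = mat2_mult (\<rho> (inv\<^bsub>F2\<^esub> u)) (lattice_rep c)"
   by (simp only: mat2_mult_assoc r mat2_mult_one)
  ultimately have "mat2_mult (lattice_rep ?c) (inv\<^bsub>SL2\<^esub> ?z) = mat2_mult (\<rho> (inv\<^bsub>F2\<^esub> u)) (lattice_rep c)"
   using e by simp
  moreover have "\<rho> (\<nu> (inv\<^bsub>F2\<^esub> u) c) = inv\<^bsub>SL2\<^esub> ?z" using ci(1) c'(2) that by simp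
  ultimately show "mat2_mult (\<rho> (inv\<^bsub>F2\<^esub> u)) (lattice_rep c)
    = mat2_mult (lattice_rep ?c) (\<rho> (\<nu> (inv\<^bsub>F2\<^esub> u) c))" by simp
 qed
 have E_gen: "E (free_gen UNIV x)" for x
 proof -
  have ib: "inv\<^bsub>SL2\<^esub> (1, 0, 2, 1) = (1, 0, - 2, 1)" by (subst SL2_inv) auto
  have "mat2_mult (\<rho> (free_gen UNIV x)) (lattice_rep c) = mat2_mult (lattice_rep (x \<noteq> c)) (\<rho> (f x c))" for c
   by (cases x; cases c) (simp_all add: f_def \<rho>(2) ib gc lattice_rep_def)
  then show ?thesis by (simp add: E_def act_def \<nu>_def h(2))
 qed
 have E: "E w" if "w \<in> carrier F2" for w
  using that
 proof (induction rule: presented_induct)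
  case one
  have "\<nu> \<one>\<^bsub>F2\<^esub> c = \<one>\<^bsub>F2\<^esub>" for c by (rule cocycle_one[OF c UNIV_I F.group_axioms F.group_axioms])
  then show ?case using c'(3) by (simp add: E_def)
 next
  case (gen x A)
  then show ?case using E_mult[OF E_gen] by simp
 next
  case (inv x A)
  then show ?case using E_mult[OF E_inv[OF E_gen]] by simp
 qed
 show ?thesis
  using c \<rho> E unfolding E_def by (intro exI[of _ act] exI[of _ \<nu>] exI[of _ \<rho>]) simp
qed

text \<open>The core statement asks only that the lower left entry vanish, which is all that the
  kernel of the ping-pong labels requires. Thus injectivity of the matrix representation does not
  enter.\<close>

lemma F2_recursion:
 shows "\<exists>act \<nu> \<rho>. cocycle F2 (UNIV :: bool set) F2 act \<nu> \<and> \<rho> \<in> hom F2 SL2 \<and>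
  (\<forall>i :: nat. \<exists>w\<in>carrier F2. \<rho> w = ping_mat (int i) 1) \<and>
  (\<forall>Z. Z \<lhd> F2 \<longrightarrow> (\<forall>w\<in>Z. \<forall>c. act w c = c \<and> \<nu> w c \<in> Z) \<longrightarrow> (\<forall>w\<in>Z. fst (snd (snd (\<rho> w))) = 0))"
proof -
 interpret F: group F2 by (rule group_presented_group)
 interpret S: group SL2 by (rule group_SL2)
 obtain act \<nu> \<rho> where c: "cocycle F2 (UNIV :: bool set) F2 act \<nu>" and \<rho>: "\<rho> \<in> hom F2 SL2"
   "\<rho> gen_a = (1, 2, 0, 1)" "\<rho> gen_b = (1, 0, 2, 1)"
  and E: "\<forall>w\<in>carrier F2. \<forall>c. mat2_mult (\<rho> w) (lattice_rep c) = mat2_mult (lattice_rep (act w c)) (\<rho> (\<nu> w c))"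
  using F2_recursion_exists by blast
 interpret \<rho>: group_hom F2 SL2 \<rho> using \<rho>(1) by unfold_locales
 have gc: "gen_a \<in> carrier F2" "gen_b \<in> carrier F2" by simp_all
 \<comment> \<open>The ping-pong matrices are values of words in the two generators, so matrix
   labels can be lifted to labels in the free group of rank two.\<close>
 have ping: "\<exists>w\<in>carrier F2. \<rho> w = ping_mat (int i) 1" for i
 proof -
  have pow: "\<rho> (gen_a [^]\<^bsub>F2\<^esub> i) = (1, 2 * int i, 0, 1)"
   by (induction i) (simp_all add: \<rho>(2) gc)
  let ?w = "gen_a [^]\<^bsub>F2\<^esub> i \<otimes>\<^bsub>F2\<^esub> (gen_b \<otimes>\<^bsub>F2\<^esub> gen_b) \<otimes>\<^bsub>F2\<^esub> inv\<^bsub>F2\<^esub> (gen_a [^]\<^bsub>F2\<^esub> i)"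
  have "inv\<^bsub>SL2\<^esub> (1, 2 * int i, 0, 1) = (1, - (2 * int i), 0, 1)" by (subst SL2_inv) auto
  then have "\<rho> ?w = ping_mat (int i) 1"
   using pow by (simp add: \<rho>(3) gc ping_mat_def algebra_simps)
  then show ?thesis by (rule bexI) (simp add: gc)
 qed
 have core: "fst (snd (snd (\<rho> w))) = 0"
  if Z: "Z \<lhd> F2" "\<forall>w\<in>Z. \<forall>c. act w c = c \<and> \<nu> w c \<in> Z" and w: "w \<in> Z" for Z w
 proof -
  have Zc: "w \<in> carrier F2" if "w \<in> Z" for w
   using normal_imp_subgroup[OF Z(1)] that by (rule subgroup.mem_carrier)
  \<comment> \<open>Passing to the state at the letter \<open>False\<close> halves the upper right
    entry and stays in \<open>Z\<close>, so this entry is divisible by every power of two.\<close>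
  have dvd: "2 ^ k dvd fst (snd (\<rho> w))" if "w \<in> Z" for k w
   using that
  proof (induction k arbitrary: w)
   case (Suc k)
   let ?w' = "\<nu> w False"
   have w': "?w' \<in> Z" "act w False = False" using Z(2) Suc.prems by auto
   obtain x y z t x' y' z' t' where xy: "\<rho> w = (x, y, z, t)" "\<rho> ?w' = (x', y', z', t')" by (metis prod.exhaust)
   have "y = 2 * y'" using bspec[OF E Zc[OF Suc.prems], THEN spec, of False] w'(2) xy by (simp add: lattice_rep_def)
   then show ?case using Suc.IH[OF w'(1)] xy by simp
  qed simp
  have zero: "fst (snd (\<rho> w)) = 0" if w: "w \<in> Z" for w
   by (rule zero_if_all_powers_dvd[of 2]) (simp_all add: dvd[OF w])
  obtain x y z t where xy: "\<rho> w = (x, y, z, t)" by (metis prod.exhaust)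
  have y: "y = 0" using zero[OF w] xy by simp
  have "\<rho> w \<in> carrier SL2" using Zc[OF w] by simp
  then have xt: "x * t = 1" using xy y by simp
  \<comment> \<open>A second condition comes from a conjugate in \<open>Z\<close>: its upper right
    entry vanishes too, which gives \<open>t = x + 2 * z\<close>. As \<open>x * t = 1\<close> makes
    \<open>x\<close> and \<open>t\<close> equal, \<open>z\<close> is zero.\<close>
  have "gen_a \<otimes>\<^bsub>F2\<^esub> w \<otimes>\<^bsub>F2\<^esub> inv\<^bsub>F2\<^esub> gen_a \<in> Z" by (rule normal.inv_op_closed2[OF Z(1) gc(1) w])
  moreover have "inv\<^bsub>SL2\<^esub> (1, 2, 0, 1) = (1, - 2, 0, 1)" by (subst SL2_inv) auto
  ultimately have "t = x + 2 * z" using zero[of "gen_a \<otimes>\<^bsub>F2\<^esub> w \<otimes>\<^bsub>F2\<^esub> inv\<^bsub>F2\<^esub> gen_a"] xy y Zc[OF w] gc \<rho>(2) by simp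
  moreover have "x = t" using xt by (auto simp: zmult_eq_1_iff)
  ultimately show ?thesis using xy by simp
 qed
 show ?thesis
  by (rule exI[of _ act], rule exI[of _ \<nu>], rule exI[of _ \<rho>]) (use c \<rho>(1) ping core in blast)
qed

section \<open>Self-similarity of the fundamental group\<close>

section \<open>Self-similarity of the fundamental group\<close>

context normal_lattice
begin

text \<open>The recursion given by the virtual endomorphism inverse to \<open>sigma\<close>; on \<open>M\<close> it divides by \<open>d + 1\<close>.\<close>

lemma sigma_recursion:
 "\<exists>R act \<mu>. finite (R :: ('v, 'e, 'g) generator word set set set) \<and> cocycle FT R FT act \<mu> \<and>
  (\<forall>Z. Z \<lhd> FT \<longrightarrow> (\<forall>g\<in>Z. \<forall>p\<in>R. act g p = p \<and> \<mu> g p \<in> Z) \<longrightarrow> Z \<inter> M \<subseteq> {\<one>\<^bsub>FT\<^esub>})"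
proof -
 let ?H = "sigma ` carrier FT"
 have H: "subgroup ?H FT" by (rule sigma.img_is_subgroup)
 have Hc: "?H \<subseteq> carrier FT" by (rule subgroup.subset[OF H])
 let ?c = "\<lambda>x. x <#\<^bsub>FT\<^esub> ?H"
 define R where "R = ?c ` carrier FT"
 define act where "act g C = g <#\<^bsub>FT\<^esub> C" for g C
 \<comment> \<open>The representative of the image of \<open>sigma\<close> itself is the identity,
   so the state there of an element of the image is just its preimage under
   \<open>sigma\<close>.\<close>
 define rep where "rep C = (if C = ?H then \<one>\<^bsub>FT\<^esub> else SOME y. y \<in> carrier FT \<and> C = ?c y)" for C
 have one_H: "?c \<one>\<^bsub>FT\<^esub> = ?H" by (rule G.coset_join3[OF G.one_closed H subgroup.one_closed[OF H]])
 have H_R: "?H \<in> R" unfolding R_def by (rule image_eqI[where x = "\<one>\<^bsub>FT\<^esub>"]) (simp_all only: one_H G.one_closed)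
 have rep: "rep C \<in> carrier FT" "?c (rep C) = C" if "C \<in> R" for C
 proof -
  have ex: "\<exists>y. y \<in> carrier FT \<and> C = ?c y" using that unfolding R_def by blast
  have "rep C \<in> carrier FT \<and> C = ?c (rep C)"
  proof (cases "C = ?H")
   case True
   then have "rep C = \<one>\<^bsub>FT\<^esub>" unfolding rep_def by (rule if_P)
   then show ?thesis using True one_H by (simp only: G.one_closed)
  next
   case False
   then have "rep C = (SOME y. y \<in> carrier FT \<and> C = ?c y)" unfolding rep_def by (rule if_not_P)
   then show ?thesis using someI_ex[OF ex] by (simp only:)
  qed
  then show "rep C \<in> carrier FT" "?c (rep C) = C" by simp_all
 qed
 have act_c: "act g (?c y) = ?c (g \<cdot> y)" if "g \<in> carrier FT" "y \<in> carrier FT" for g y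
  unfolding act_def using G.lcos_m_assoc[OF Hc that] .
 have act_R: "act g C \<in> R" if "g \<in> carrier FT" "C \<in> R" for g C
  using act_c[OF that(1) rep(1)[OF that(2)]] rep[OF that(2)] that(1) unfolding R_def by (intro image_eqI[where x = "g \<cdot> rep C"]) simp_all
 have quot: "inv\<^bsub>FT\<^esub> y \<cdot> x \<in> ?H" if "?c x = ?c y" "x \<in> carrier FT" "y \<in> carrier FT" for x y
 proof -
  have "x \<in> ?c x" unfolding l_coset_def by (rule UN_I[OF subgroup.one_closed[OF H]]) (simp add: that(2))
  then have "x \<in> ?c y" using that(1) by simp
  then obtain h where h: "h \<in> ?H" "x = y \<cdot> h" unfolding l_coset_def by blast
  have "inv\<^bsub>FT\<^esub> y \<cdot> x = h" using h that(3) Hc by (simp add: G.m_assoc[symmetric] subset_iff)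
  then show ?thesis using h(1) by simp
 qed
 define \<mu> where "\<mu> g C = inv_into (carrier FT) sigma (inv\<^bsub>FT\<^esub> rep (act g C) \<cdot> (g \<cdot> rep C))" for g C
 have \<mu>: "\<mu> g C \<in> carrier FT" "sigma (\<mu> g C) = inv\<^bsub>FT\<^esub> rep (act g C) \<cdot> (g \<cdot> rep C)"
  if "g \<in> carrier FT" "C \<in> R" for g C
 proof -
  have "?c (g \<cdot> rep C) = ?c (rep (act g C))"
   using act_c[OF that(1) rep(1)[OF that(2)]] rep(2)[OF that(2)] rep(2)[OF act_R[OF that]] by simp
  then have m: "inv\<^bsub>FT\<^esub> rep (act g C) \<cdot> (g \<cdot> rep C) \<in> ?H"
   using quot rep(1)[OF that(2)] rep(1)[OF act_R[OF that]] that(1) by simp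
  show "\<mu> g C \<in> carrier FT" unfolding \<mu>_def using m by (rule inv_into_into)
  show "sigma (\<mu> g C) = inv\<^bsub>FT\<^esub> rep (act g C) \<cdot> (g \<cdot> rep C)"
   unfolding \<mu>_def using m by (rule f_inv_into_f)
 qed
 have R_sub: "C \<subseteq> carrier FT" if "C \<in> R" for C
  using rep[OF that] G.l_coset_subset_G[OF Hc, of "rep C"] by simp
 have act_mult: "act (g \<cdot> h) C = act g (act h C)" if "g \<in> carrier FT" "h \<in> carrier FT" "C \<in> R" for g h C
  unfolding act_def using G.lcos_m_assoc[OF R_sub[OF that(3)] that(1,2)] by simp
 have coc: "cocycle FT R FT act \<mu>"
 proof (rule cocycleI)
  fix C assume C: "C \<in> R"
  then show "act \<one>\<^bsub>FT\<^esub> C = C" unfolding act_def using G.lcos_mult_one[OF R_sub] by simp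
 next
  fix g h C assume gh: "g \<in> carrier FT" "h \<in> carrier FT" "C \<in> R"
  note hC = act_R[OF gh(2,3)]
  have c: "rep C \<in> carrier FT" "rep (act h C) \<in> carrier FT" "rep (act g (act h C)) \<in> carrier FT"
   using rep(1) gh hC act_R by auto
  have ghc: "g \<cdot> h \<in> carrier FT" using gh by simp
  have "rep (act h C) \<cdot> (inv\<^bsub>FT\<^esub> rep (act h C) \<cdot> (h \<cdot> rep C)) = h \<cdot> rep C"
   using c gh by (simp add: G.m_assoc[symmetric])
  then have "sigma (\<mu> (g \<cdot> h) C) = sigma (\<mu> g (act h C)) \<cdot> sigma (\<mu> h C)"
   using \<mu>(2)[OF ghc gh(3)] \<mu>(2)[OF gh(1) hC] \<mu>(2)[OF gh(2,3)] act_mult[OF gh] c gh by (simp add: G.m_assoc)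
  then have "sigma (\<mu> (g \<cdot> h) C) = sigma (\<mu> g (act h C) \<cdot> \<mu> h C)"
   using \<mu>(1) gh hC by simp
  then show "\<mu> (g \<cdot> h) C = \<mu> g (act h C) \<cdot> \<mu> h C"
   by (rule inj_onD[OF sigma_inj]) (use \<mu>(1) gh hC in auto)
 qed (use act_R \<mu> act_mult in auto)
 have fin: "finite R"
 proof -
  let ?P = "power_set FT M (Suc d)"
  have PH: "x \<in> ?H" if xP: "x \<in> ?P" for x
  proof -
   obtain m where m: "m \<in> M" "x = m [^]\<^bsub>FT\<^esub> Suc d" using xP unfolding power_set_def by blast
   show ?thesis by (rule image_eqI[where x = m]) (simp_all only: m(2) sigma_M[OF m(1)] M_carrier[OF m(1)])
  qed
  have shift: "?c (x \<cdot> h) = ?c x" if "x \<in> carrier FT" "h \<in> ?H" for x h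
  proof -
   have "x \<cdot> h \<in> ?c x" using that(2) unfolding l_coset_def by blast
   then show ?thesis using G.l_repr_independence[OF _ that(1) H] by simp
  qed
  have "R \<subseteq> (\<lambda>A. \<Union>y\<in>A. ?c y) ` ((\<lambda>m. (\<lambda>x. m \<cdot> x) ` ?P) ` M)"
  proof
   fix C assume "C \<in> R"
   then obtain g where g: "g \<in> carrier FT" "C = ?c g" by (auto simp: R_def)
   \<comment> \<open>Multiplying \<open>g\<close> on the right by a value of \<open>sigma\<close>
     keeps its coset and moves the representative into \<open>M\<close>. There the powers with
     exponent \<open>d + 1\<close> are values of \<open>sigma\<close>, so finitely many cosets
     remain.\<close>
   let ?m = "g \<cdot> sigma (inv\<^bsub>FT\<^esub> g)"
   have m: "?m \<in> M"
   proof -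
    have "inv\<^bsub>FT\<^esub> (sigma (inv\<^bsub>FT\<^esub> (inv\<^bsub>FT\<^esub> g)) \<cdot> inv\<^bsub>FT\<^esub> (inv\<^bsub>FT\<^esub> (inv\<^bsub>FT\<^esub> g))) \<in> M"
     using subgroup.m_inv_closed[OF M_subgroup sigma_mod[of g]] g by simp
    then show ?thesis using g by (simp add: G.inv_mult_group)
   qed
   have Cm: "C = ?c ?m" using shift[OF g(1) imageI[OF G.inv_closed[OF g(1)], of sigma]] g(2) by (simp only:)
   have "?c y = C" if "y \<in> (\<lambda>x. ?m \<cdot> x) ` ?P" for y using that shift[OF M_carrier[OF m]] PH Cm by auto
   moreover have "(\<lambda>x. ?m \<cdot> x) ` ?P \<noteq> {}" using subgroup.one_closed[OF power_set_subgroup] by blast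
   ultimately have "(\<Union>y\<in>(\<lambda>x. ?m \<cdot> x) ` ?P. ?c y) = C" by (simp cong: SUP_cong)
   then show "C \<in> (\<lambda>A. \<Union>y\<in>A. ?c y) ` ((\<lambda>m. (\<lambda>x. m \<cdot> x) ` ?P) ` M)" 
    by (intro image_eqI[where x = "(\<lambda>x. ?m \<cdot> x) ` ?P"] imageI m) simp
  qed
  then show ?thesis using finite_M_cosets[of "Suc d"] finite_subset by blast
 qed
 have core: "Z \<inter> M \<subseteq> {\<one>\<^bsub>FT\<^esub>}" if Z: "Z \<lhd> FT" "\<forall>g\<in>Z. \<forall>p\<in>R. act g p = p \<and> \<mu> g p \<in> Z" for Z
 proof -
  interpret V: coordinate_group "Gv r" n "\<eta> r" using coordinate_group_Gv[OF r] .
  \<comment> \<open>The state of \<open>x\<close> at the base coset is a root of order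
    \<open>d + 1\<close>, again in \<open>Z\<close> and in \<open>M\<close>. Iterating, the
    coordinates of \<open>x\<close> are divisible by all powers of \<open>d + 1\<close>, hence
    zero.\<close>
  have root: "\<exists>y\<in>Z \<inter> M. x = y [^]\<^bsub>FT\<^esub> Suc d" if x: "x \<in> Z \<inter> M" for x
  proof -
   have "act x ?H = ?H" "\<mu> x ?H \<in> Z" using Z(2) x H_R by auto
   moreover have xc: "x \<in> carrier FT" using x by simp
   ultimately have s: "sigma (\<mu> x ?H) = x" using \<mu>(2)[OF xc H_R] by (simp add: rep_def)
   then have "\<mu> x ?H \<in> M" using sigma_mem_M_iff[OF \<mu>(1)[OF xc H_R]] x by simp
   then show ?thesis using sigma_M[of "\<mu> x ?H"] s \<open>\<mu> x ?H \<in> Z\<close> by (intro bexI[of _ "\<mu> x ?H"]) auto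
  qed
  have dvd: "int (Suc d) ^ k dvd \<eta> r g i" if "g \<in> carrier (Gv r)" "ve r g \<in> Z \<inter> M" for k g i
   using that
  proof (induction k arbitrary: g)
   case (Suc k)
   obtain y where y: "y \<in> Z \<inter> M" "ve r g = y [^]\<^bsub>FT\<^esub> Suc d" using root[OF Suc.prems(2)] by blast
   obtain h where h: "h \<in> carrier (Gv r)" "y = ve r h" using M_vertex[OF r] y(1) by blast
   have "ve r g = ve r (h [^]\<^bsub>Gv r\<^esub> Suc d)" using y(2) h ve_pow[OF r h(1), of "Suc d"] by simp
   then have "ve r g [^]\<^bsub>FT\<^esub> (1::nat) = ve r (h [^]\<^bsub>Gv r\<^esub> Suc d) [^]\<^bsub>FT\<^esub> (1::nat)" by simp
   then have "g = h [^]\<^bsub>Gv r\<^esub> Suc d" using ve_pow_inj[OF r Suc.prems(1), of "h [^]\<^bsub>Gv r\<^esub> Suc d" 1] h by simp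
   then have "\<eta> r g i = int (Suc d) * \<eta> r h i" using V.\<eta>_pow[OF h(1), of "Suc d"] by (simp del: V.nat_pow_Suc)
   then show ?case using Suc.IH[OF h(1)] y(1) h(2) by (simp del: of_nat_Suc)
  qed simp
  show ?thesis
  proof
   fix x assume x: "x \<in> Z \<inter> M"
   then obtain g where g: "g \<in> carrier (Gv r)" "x = ve r g" using M_vertex[OF r] by blast
   have "\<eta> r g i = 0" for i
    by (rule zero_if_all_powers_dvd[of "int (Suc d)"]) (use d dvd[OF g(1)] x g in auto)
   then have "\<eta> r g = \<eta> r \<one>\<^bsub>Gv r\<^esub>" using V.\<eta>_one by auto
   then have "g = \<one>\<^bsub>Gv r\<^esub>" using V.\<eta>_eq_iff[of g "\<one>\<^bsub>Gv r\<^esub>"] g by simp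
   then show "x \<in> {\<one>\<^bsub>FT\<^esub>}" using g group_hom.hom_one[OF vertex_elem_group_hom[OF r]] by simp
  qed
 qed
 show ?thesis
  by (rule exI[of _ R], rule exI[of _ act], rule exI[of _ \<mu>]) (use fin coc core in blast)
qed

end

context lattice_quotient
begin

subsection \<open>The covering graph of the kernel\<close>

text \<open>The vertices over \<open>v\<close> are the orbits of the vertex group on the positions; the arcs are the
 elements of \<open>edge_cosets\<close>.\<close>

definition vertex_coset :: "'v \<Rightarrow> ('v, 'e, 'g) generator word set set \<Rightarrow> ('v, 'e, 'g) generator word set set set" where
 "vertex_coset v p = (\<lambda>g. pos (vel v g) \<otimes>\<^bsub>Q\<^esub> p) ` carrier (Gv v)"

text \<open>All positions of an arc lie in one orbit of the vertex group, so the union is over a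
  constant family and avoids choosing a representative. The head is treated in the same way.\<close>

definition cover_tail :: "'e \<times> ('v, 'e, 'g) generator word set set set \<Rightarrow> 'v \<times> ('v, 'e, 'g) generator word set set set" where
 "cover_tail \<epsilon> = (tail X (fst \<epsilon>), \<Union>p\<in>snd \<epsilon>. vertex_coset (tail X (fst \<epsilon>)) p)"

definition cover_head :: "'e \<times> ('v, 'e, 'g) generator word set set set \<Rightarrow> 'v \<times> ('v, 'e, 'g) generator word set set set" where
 "cover_head \<epsilon> = (head X (fst \<epsilon>), \<Union>p\<in>snd \<epsilon>. vertex_coset (head X (fst \<epsilon>)) (pos (stl (fst \<epsilon>)) \<otimes>\<^bsub>Q\<^esub> p))"

abbreviation "cover_grown \<equiv> grown cover_tail cover_head edge_cosets (r, vertex_coset r \<one>\<^bsub>Q\<^esub>)"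

lemma vertex_coset_shift:
 assumes v: "v \<in> verts X" "g \<in> carrier (Gv v)" "p \<in> carrier Q"
 shows "vertex_coset v (pos (vel v g) \<otimes>\<^bsub>Q\<^esub> p) = vertex_coset v p"
proof -
 interpret h: group_hom "Gv v" UG "vel v" using v(1) by (rule vertex_elem_group_hom)
 have sub: "vertex_coset v (pos (vel v g) \<otimes>\<^bsub>Q\<^esub> p) \<subseteq> vertex_coset v p" if "g \<in> carrier (Gv v)" "p \<in> carrier Q" for g p
 proof
  fix x assume "x \<in> vertex_coset v (pos (vel v g) \<otimes>\<^bsub>Q\<^esub> p)"
  then obtain h where h: "h \<in> carrier (Gv v)" "x = pos (vel v h) \<otimes>\<^bsub>Q\<^esub> (pos (vel v g) \<otimes>\<^bsub>Q\<^esub> p)"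
   unfolding vertex_coset_def by (rule imageE) 
  then have "x = pos (vel v (h \<otimes>\<^bsub>Gv v\<^esub> g)) \<otimes>\<^bsub>Q\<^esub> p" using that v by (simp add: Q.m_assoc)
  then show "x \<in> vertex_coset v p" unfolding vertex_coset_def by (rule image_eqI[where x = "h \<otimes>\<^bsub>Gv v\<^esub> g"]) (use h(1) that in simp_all)
 qed
 have "pos (vel v (inv\<^bsub>Gv v\<^esub> g)) \<otimes>\<^bsub>Q\<^esub> (pos (vel v g) \<otimes>\<^bsub>Q\<^esub> p) = p"
  using v by (simp add: Q.m_assoc[symmetric])
 then have "vertex_coset v p \<subseteq> vertex_coset v (pos (vel v g) \<otimes>\<^bsub>Q\<^esub> p)"
  using sub[of "inv\<^bsub>Gv v\<^esub> g" "pos (vel v g) \<otimes>\<^bsub>Q\<^esub> p"] v by simp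
 then show ?thesis using sub[OF v(2,3)] by simp
qed

lemma vertex_coset_eqD:
 assumes v: "v \<in> verts X" "p \<in> carrier Q" and e: "vertex_coset v p = vertex_coset v p'"
 shows "\<exists>g\<in>carrier (Gv v). p = pos (vel v g) \<otimes>\<^bsub>Q\<^esub> p'"
proof -
 interpret h: group_hom "Gv v" UG "vel v" using v(1) by (rule vertex_elem_group_hom)
 have "p \<in> vertex_coset v p"
  unfolding vertex_coset_def by (rule image_eqI[where x = "\<one>\<^bsub>Gv v\<^esub>"]) (use v in simp_all)
 then have "p \<in> vertex_coset v p'" using e by simp
 then show ?thesis unfolding vertex_coset_def by blast
qed

lemma cover_tail_coset:
 assumes e: "e \<in> arcs X" "p \<in> carrier Q"
 shows "cover_tail (e, edge_coset e p) = (tail X e, vertex_coset (tail X e) p)"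
proof -
 have "(\<Union>p'\<in>edge_coset e p. vertex_coset (tail X e) p') = vertex_coset (tail X e) p"
 proof (rule SUP_eq_const)
  show "edge_coset e p \<noteq> {}" using edge_coset_self[OF e] by blast
  fix p' assume "p' \<in> edge_coset e p"
  then obtain g where "g \<in> Ge e" "p' = pos (vel (tail X e) g) \<otimes>\<^bsub>Q\<^esub> p" unfolding edge_coset_def by (rule imageE)
  then show "vertex_coset (tail X e) p' = vertex_coset (tail X e) p" using vertex_coset_shift[of "tail X e" g p] e by simp
 qed
 then show ?thesis by (simp add: cover_tail_def)
qed

lemma cover_head_coset:
 assumes e: "e \<in> arcs X" "p \<in> carrier Q"
 shows "cover_head (e, edge_coset e p) = (head X e, vertex_coset (head X e) (pos (stl e) \<otimes>\<^bsub>Q\<^esub> p))"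
proof -
 have "(\<Union>p'\<in>edge_coset e p. vertex_coset (head X e) (pos (stl e) \<otimes>\<^bsub>Q\<^esub> p')) = vertex_coset (head X e) (pos (stl e) \<otimes>\<^bsub>Q\<^esub> p)"
 proof (rule SUP_eq_const)
  show "edge_coset e p \<noteq> {}" using edge_coset_self[OF e] by blast
  fix p' assume "p' \<in> edge_coset e p"
  then obtain g where g: "g \<in> Ge e" "p' = pos (vel (tail X e) g) \<otimes>\<^bsub>Q\<^esub> p" unfolding edge_coset_def by (rule imageE)
  have c: "g \<in> carrier (Gv (tail X e))" "\<phi> e g \<in> carrier (Gv (head X e))" using e g by simp_all
  have "pos (stl e) \<otimes>\<^bsub>Q\<^esub> pos (vel (tail X e) g) = pos (vel (head X e) (\<phi> e g)) \<otimes>\<^bsub>Q\<^esub> pos (stl e)"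
   using arg_cong[OF stable_elem_rel[OF e(1) g(1), of "X\<lparr>arcs := {}\<rparr>"], of pos] e c by simp
  then have "pos (stl e) \<otimes>\<^bsub>Q\<^esub> p' = pos (vel (head X e) (\<phi> e g)) \<otimes>\<^bsub>Q\<^esub> (pos (stl e) \<otimes>\<^bsub>Q\<^esub> p)"
   using e c g(2) by (simp add: Q.m_assoc[symmetric])
  then show "vertex_coset (head X e) (pos (stl e) \<otimes>\<^bsub>Q\<^esub> p') = vertex_coset (head X e) (pos (stl e) \<otimes>\<^bsub>Q\<^esub> p)"
   using vertex_coset_shift[of "head X e" "\<phi> e g" "pos (stl e) \<otimes>\<^bsub>Q\<^esub> p"] e c by simp
 qed
 then show ?thesis by (simp add: cover_head_def)
qed

lemma edge_cosetsE:
 assumes "\<epsilon> \<in> edge_cosets"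
 obtains e p where "e \<in> arcs X" "p \<in> carrier Q" "\<epsilon> = (e, edge_coset e p)"
 using assms unfolding edge_cosets_def by blast

lemma label_steps:
 assumes K: "group K" and \<kappa>: "\<kappa> \<in> edge_cosets \<rightarrow> carrier K" and x: "x \<in> carrier UG"
 shows "v \<in> verts X \<Longrightarrow> g \<in> carrier (Gv v) \<Longrightarrow> label K \<kappa> (vel v g \<otimes>\<^bsub>UG\<^esub> x) \<one>\<^bsub>Q\<^esub> = label K \<kappa> x \<one>\<^bsub>Q\<^esub>"
  and "e \<in> arcs X \<Longrightarrow> label K \<kappa> (stl e \<otimes>\<^bsub>UG\<^esub> x) \<one>\<^bsub>Q\<^esub> = \<kappa> (e, edge_coset e (pos x)) \<otimes>\<^bsub>K\<^esub> label K \<kappa> x \<one>\<^bsub>Q\<^esub>"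
  and "e \<in> arcs X \<Longrightarrow> label K \<kappa> (inv\<^bsub>UG\<^esub> stl e \<otimes>\<^bsub>UG\<^esub> x) \<one>\<^bsub>Q\<^esub>
   = inv\<^bsub>K\<^esub> \<kappa> (e, edge_coset e (inv\<^bsub>Q\<^esub> pos (stl e) \<otimes>\<^bsub>Q\<^esub> pos x)) \<otimes>\<^bsub>K\<^esub> label K \<kappa> x \<one>\<^bsub>Q\<^esub>"
proof -
 interpret K: group K by fact
 note c = cocycleD[OF label_cocycle[OF K \<kappa>] Q.one_closed]
 have lx: "label K \<kappa> x \<one>\<^bsub>Q\<^esub> \<in> carrier K" using c(2)[OF x] .
 have px: "pos x \<in> carrier Q" using x by simp
 show "label K \<kappa> (vel v g \<otimes>\<^bsub>UG\<^esub> x) \<one>\<^bsub>Q\<^esub> = label K \<kappa> x \<one>\<^bsub>Q\<^esub>" if "v \<in> verts X" "g \<in> carrier (Gv v)"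
  using c(5)[of "vel v g" x] label_vel[OF K \<kappa> that px] that x lx px by simp
 show "label K \<kappa> (stl e \<otimes>\<^bsub>UG\<^esub> x) \<one>\<^bsub>Q\<^esub> = \<kappa> (e, edge_coset e (pos x)) \<otimes>\<^bsub>K\<^esub> label K \<kappa> x \<one>\<^bsub>Q\<^esub>" if "e \<in> arcs X"
  using c(5)[of "stl e" x] label_stl[OF K \<kappa> that px] that x px by simp
 show "label K \<kappa> (inv\<^bsub>UG\<^esub> stl e \<otimes>\<^bsub>UG\<^esub> x) \<one>\<^bsub>Q\<^esub>
   = inv\<^bsub>K\<^esub> \<kappa> (e, edge_coset e (inv\<^bsub>Q\<^esub> pos (stl e) \<otimes>\<^bsub>Q\<^esub> pos x)) \<otimes>\<^bsub>K\<^esub> label K \<kappa> x \<one>\<^bsub>Q\<^esub>" if "e \<in> arcs X"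
  using c(5)[of "inv\<^bsub>UG\<^esub> stl e" x] label_stl_inv[OF K \<kappa> that px] that x px by simp
qed

text \<open>Every vertex of the tree in the cover is reached from the base by a path along tree
  arcs, whose label is trivial. Vertex elements adjust the position within an orbit at no
  cost.\<close>

lemma cover_lift:
 assumes g: "cover_grown W B" and K: "group K" and \<kappa>: "\<kappa> \<in> edge_cosets \<rightarrow> carrier K"
  and one: "\<forall>\<beta>\<in>B. \<kappa> \<beta> = \<one>\<^bsub>K\<^esub>"
 shows "\<forall>w\<in>W. \<exists>x. path r (fst w) x \<and> snd w = vertex_coset (fst w) (pos x) \<and> label K \<kappa> x \<one>\<^bsub>Q\<^esub> = \<one>\<^bsub>K\<^esub>"
 using g one
proof (induction rule: grown.induct)
 case root
 have "label K \<kappa> \<one>\<^bsub>UG\<^esub> \<one>\<^bsub>Q\<^esub> = \<one>\<^bsub>K\<^esub>"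
  by (rule cocycle_one[OF label_cocycle[OF K \<kappa>] Q.one_closed K U.group_axioms])
 then show ?case using path.refl[OF r] by (intro ballI exI[of _ "\<one>\<^bsub>UG\<^esub>"]) simp
next
 case (out W B \<epsilon>)
 interpret K: group K by fact
 obtain e p where e: "e \<in> arcs X" "p \<in> carrier Q" "\<epsilon> = (e, edge_coset e p)" using edge_cosetsE[OF out.hyps(2)] .
 have "\<exists>x. path r (tail X e) x \<and> vertex_coset (tail X e) p = vertex_coset (tail X e) (pos x) \<and> label K \<kappa> x \<one>\<^bsub>Q\<^esub> = \<one>\<^bsub>K\<^esub>"
  using bspec[OF out.IH out.hyps(3)] out.prems e by (simp add: cover_tail_coset)
 then obtain x where x: "path r (tail X e) x" "vertex_coset (tail X e) p = vertex_coset (tail X e) (pos x)" "label K \<kappa> x \<one>\<^bsub>Q\<^esub> = \<one>\<^bsub>K\<^esub>"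
  by blast
 obtain g where g: "g \<in> carrier (Gv (tail X e))" "p = pos (vel (tail X e) g) \<otimes>\<^bsub>Q\<^esub> pos x"
  using vertex_coset_eqD[OF tail_in_verts[OF e(1)] e(2) x(2)] by blast
 have xc: "x \<in> carrier UG" using path_closed[OF x(1)] by simp
 let ?z = "vel (tail X e) g \<otimes>\<^bsub>UG\<^esub> x"
 have z: "?z \<in> carrier UG" "pos ?z = p" using xc g e by simp_all
 have pth: "path r (head X e) (stl e \<otimes>\<^bsub>UG\<^esub> ?z)" using path.forward[OF path.vertex[OF x(1) g(1)] e(1)] .
 have pp: "pos (stl e \<otimes>\<^bsub>UG\<^esub> ?z) = pos (stl e) \<otimes>\<^bsub>Q\<^esub> p" using pos.hom_mult[of "stl e" ?z] z e by simp
 have l1: "\<kappa> \<epsilon> = \<one>\<^bsub>K\<^esub>" using out.prems by simp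
 have "label K \<kappa> (stl e \<otimes>\<^bsub>UG\<^esub> ?z) \<one>\<^bsub>Q\<^esub> = \<one>\<^bsub>K\<^esub>"
  using label_steps(2)[OF K \<kappa> z(1) e(1)] label_steps(1)[OF K \<kappa> xc _ g(1)] e z(2) x(3) l1 by simp
 then have "path r (fst (cover_head \<epsilon>)) (stl e \<otimes>\<^bsub>UG\<^esub> ?z) \<and>
   snd (cover_head \<epsilon>) = vertex_coset (fst (cover_head \<epsilon>)) (pos (stl e \<otimes>\<^bsub>UG\<^esub> ?z)) \<and> label K \<kappa> (stl e \<otimes>\<^bsub>UG\<^esub> ?z) \<one>\<^bsub>Q\<^esub> = \<one>\<^bsub>K\<^esub>"
  unfolding e(3) cover_head_coset[OF e(1,2)] fst_conv snd_conv pp using pth by simp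
 then show ?case using out.IH out.prems by (intro ballI) (elim insertE, blast+)
next
 case (inn W B \<epsilon>)
 interpret K: group K by fact
 obtain e p where e: "e \<in> arcs X" "p \<in> carrier Q" "\<epsilon> = (e, edge_coset e p)" using edge_cosetsE[OF inn.hyps(2)] .
 let ?p = "pos (stl e) \<otimes>\<^bsub>Q\<^esub> p"
 have pc: "?p \<in> carrier Q" using e by simp
 have "\<exists>x. path r (head X e) x \<and> vertex_coset (head X e) ?p = vertex_coset (head X e) (pos x) \<and> label K \<kappa> x \<one>\<^bsub>Q\<^esub> = \<one>\<^bsub>K\<^esub>"
  using bspec[OF inn.IH inn.hyps(3)] inn.prems e by (simp add: cover_head_coset)
 then obtain x where x: "path r (head X e) x" "vertex_coset (head X e) ?p = vertex_coset (head X e) (pos x)" "label K \<kappa> x \<one>\<^bsub>Q\<^esub> = \<one>\<^bsub>K\<^esub>"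
  by blast
 obtain g where g: "g \<in> carrier (Gv (head X e))" "?p = pos (vel (head X e) g) \<otimes>\<^bsub>Q\<^esub> pos x"
  using vertex_coset_eqD[OF head_in_verts[OF e(1)] pc x(2)] by blast
 have xc: "x \<in> carrier UG" using path_closed[OF x(1)] by simp
 let ?z = "vel (head X e) g \<otimes>\<^bsub>UG\<^esub> x"
 have z: "?z \<in> carrier UG" "pos ?z = ?p" using xc g e by simp_all
 have pth: "path r (tail X e) (inv\<^bsub>UG\<^esub> stl e \<otimes>\<^bsub>UG\<^esub> ?z)" using path.backward[OF path.vertex[OF x(1) g(1)] e(1)] .
 have ret: "inv\<^bsub>Q\<^esub> pos (stl e) \<otimes>\<^bsub>Q\<^esub> ?p = p" using e by (simp add: Q.m_assoc[symmetric])
 have pp: "pos (inv\<^bsub>UG\<^esub> stl e \<otimes>\<^bsub>UG\<^esub> ?z) = p" using pos.hom_mult[of "inv\<^bsub>UG\<^esub> stl e" ?z] z e ret by simp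
 have l1: "\<kappa> \<epsilon> = \<one>\<^bsub>K\<^esub>" using inn.prems by simp
 have "label K \<kappa> (inv\<^bsub>UG\<^esub> stl e \<otimes>\<^bsub>UG\<^esub> ?z) \<one>\<^bsub>Q\<^esub> = \<one>\<^bsub>K\<^esub>"
  using label_steps(3)[OF K \<kappa> z(1) e(1)] label_steps(1)[OF K \<kappa> xc _ g(1)] e z(2) ret x(3) l1 by simp
 then have "path r (fst (cover_tail \<epsilon>)) (inv\<^bsub>UG\<^esub> stl e \<otimes>\<^bsub>UG\<^esub> ?z) \<and>
   snd (cover_tail \<epsilon>) = vertex_coset (fst (cover_tail \<epsilon>)) (pos (inv\<^bsub>UG\<^esub> stl e \<otimes>\<^bsub>UG\<^esub> ?z)) \<and> label K \<kappa> (inv\<^bsub>UG\<^esub> stl e \<otimes>\<^bsub>UG\<^esub> ?z) \<one>\<^bsub>Q\<^esub> = \<one>\<^bsub>K\<^esub>"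
  unfolding e(3) cover_tail_coset[OF e(1,2)] fst_conv snd_conv pp using pth by simp
 then show ?case using inn.IH inn.prems by (intro ballI) (elim insertE, blast+)
qed

text \<open>Go to the tail of \<open>\<epsilon>\<close> inside the tree, cross it and return inside
  the tree. The loop ends at the trivial position, so it comes from an element of \<open>N\<close>,
  and its label is that of the single arc outside the tree.\<close>

lemma cover_loop:
 assumes g: "cover_grown W B" and K: "group K" and \<kappa>: "\<kappa> \<in> edge_cosets \<rightarrow> carrier K"
  and one: "\<forall>\<beta>\<in>B. \<kappa> \<beta> = \<one>\<^bsub>K\<^esub>"
  and \<epsilon>: "\<epsilon> \<in> edge_cosets" "cover_tail \<epsilon> \<in> W" "cover_head \<epsilon> \<in> W"
 shows "\<exists>c\<in>N. label K \<kappa> (j c) \<one>\<^bsub>Q\<^esub> = \<kappa> \<epsilon>"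
proof -
 interpret K: group K by fact
 note lift = bspec[OF cover_lift[OF g K \<kappa> one]]
 obtain e p where e: "e \<in> arcs X" "p \<in> carrier Q" "\<epsilon> = (e, edge_coset e p)" using edge_cosetsE[OF \<epsilon>(1)] .
 obtain x where x: "path r (tail X e) x" "vertex_coset (tail X e) p = vertex_coset (tail X e) (pos x)" "label K \<kappa> x \<one>\<^bsub>Q\<^esub> = \<one>\<^bsub>K\<^esub>"
  using lift[OF \<epsilon>(2)] unfolding e(3) cover_tail_coset[OF e(1,2)] fst_conv snd_conv by blast
 obtain z where z: "path r (head X e) z" "vertex_coset (head X e) (pos (stl e) \<otimes>\<^bsub>Q\<^esub> p) = vertex_coset (head X e) (pos z)"
   "label K \<kappa> z \<one>\<^bsub>Q\<^esub> = \<one>\<^bsub>K\<^esub>"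
  using lift[OF \<epsilon>(3)] unfolding e(3) cover_head_coset[OF e(1,2)] fst_conv snd_conv by blast
 have xc: "x \<in> carrier UG" "z \<in> carrier UG" using path_closed[OF x(1)] path_closed[OF z(1)] by simp_all
 obtain g where g: "g \<in> carrier (Gv (tail X e))" "p = pos (vel (tail X e) g) \<otimes>\<^bsub>Q\<^esub> pos x"
  using vertex_coset_eqD[OF tail_in_verts[OF e(1)] e(2) x(2)] by blast
 have zc: "pos z \<in> carrier Q" using xc by simp
 obtain h where h: "h \<in> carrier (Gv (head X e))" "pos z = pos (vel (head X e) h) \<otimes>\<^bsub>Q\<^esub> (pos (stl e) \<otimes>\<^bsub>Q\<^esub> p)"
  using vertex_coset_eqD[OF head_in_verts[OF e(1)] zc z(2)[symmetric]] by blast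
 let ?b = "vel (tail X e) g \<otimes>\<^bsub>UG\<^esub> x"
 let ?y = "stl e \<otimes>\<^bsub>UG\<^esub> ?b"
 let ?y' = "vel (head X e) h \<otimes>\<^bsub>UG\<^esub> ?y"
 let ?u = "inv\<^bsub>UG\<^esub> z \<otimes>\<^bsub>UG\<^esub> ?y'"
 have y0: "?b \<in> carrier UG" "pos ?b = p" using xc g e by simp_all
 have sc: "stl e \<in> carrier UG" "vel (head X e) h \<in> carrier UG" using e h by simp_all
 have y: "?y \<in> carrier UG" using sc y0 by simp
 have py: "pos ?y = pos (stl e) \<otimes>\<^bsub>Q\<^esub> p" using pos.hom_mult[OF sc(1) y0(1)] unfolding y0(2) .
 have y': "?y' \<in> carrier UG" using sc y by simp
 have py': "pos ?y' = pos z" using pos.hom_mult[OF sc(2) y] unfolding py h(2)[symmetric] .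
 have \<kappa>c: "\<kappa> \<epsilon> \<in> carrier K" using \<kappa> \<epsilon>(1) by blast
 have "label K \<kappa> ?y \<one>\<^bsub>Q\<^esub> = \<kappa> \<epsilon> \<otimes>\<^bsub>K\<^esub> \<one>\<^bsub>K\<^esub>"
  using label_steps(2)[OF K \<kappa> y0(1) e(1)] label_steps(1)[OF K \<kappa> xc(1) _ g(1)] e y0(2) x(3) by simp
 then have ly: "label K \<kappa> ?y' \<one>\<^bsub>Q\<^esub> = \<kappa> \<epsilon>"
  using label_steps(1)[OF K \<kappa> y _ h(1)] e(1) K.r_one[OF \<kappa>c] by simp
 note inv_z = cocycle_inv[OF label_cocycle[OF K \<kappa>] zc K U.group_axioms xc(2)]
 have "label K \<kappa> (inv\<^bsub>UG\<^esub> z) (pos z) = \<one>\<^bsub>K\<^esub>" using inv_z(1) xc(2) z(3) by simp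
 then have lu: "label K \<kappa> ?u \<one>\<^bsub>Q\<^esub> = \<kappa> \<epsilon>"
  using cocycleD(5)[OF label_cocycle[OF K \<kappa>] Q.one_closed, of "inv\<^bsub>UG\<^esub> z" ?y', OF U.inv_closed[OF xc(2)] y']
  \<open>label K \<kappa> (inv\<^bsub>UG\<^esub> z) (pos z) = \<one>\<^bsub>K\<^esub>\<close>
  unfolding py' Q.r_one[OF zc] ly by (simp only: K.l_one[OF \<kappa>c])
 have pu: "path r r ?u"
  by (rule path_trans[OF path_inv[OF z(1)] path.vertex[OF path.forward[OF path.vertex[OF x(1) g(1)] e(1)] h(1)]])
 have uc: "q ?u \<in> carrier FT" using path_closed[OF pu] by simp
 have "pos ?u = \<one>\<^bsub>Q\<^esub>" using pos.hom_mult[OF U.inv_closed[OF xc(2)] y'] unfolding py' using xc(2) zc by simp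
 then have "q ?u \<in> N" using pos_one_iff[OF uc] j_q_closed[OF pu] by simp
 then show ?thesis using lu j_q_closed[OF pu] by (intro bexI[of _ "q ?u"]) simp_all
qed

text \<open>If all arcs outside the spanning tree carry the same gauged label \<open>w\<close>, then the label of a closed
 path is the power of \<open>w\<close> that counts these arcs.\<close>

lemma cover_gauge:
 assumes g: "cover_grown W B" and closed: "\<And>\<epsilon>. \<epsilon> \<in> edge_cosets \<Longrightarrow> cover_tail \<epsilon> \<in> W \<longleftrightarrow> cover_head \<epsilon> \<in> W"
  and K: "group K" and \<kappa>: "\<kappa> \<in> edge_cosets \<rightarrow> carrier K" and w: "w \<in> carrier K"
  and \<delta>: "\<delta> (r, vertex_coset r \<one>\<^bsub>Q\<^esub>) = \<one>\<^bsub>K\<^esub>" "\<And>v. v \<in> W \<Longrightarrow> \<delta> v \<in> carrier K"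
   "\<And>\<epsilon>. \<epsilon> \<in> edge_cosets \<Longrightarrow> cover_tail \<epsilon> \<in> W \<Longrightarrow>
    \<delta> (cover_head \<epsilon>) \<otimes>\<^bsub>K\<^esub> \<kappa> \<epsilon> = w [^]\<^bsub>K\<^esub> (ind \<epsilon> :: int) \<otimes>\<^bsub>K\<^esub> \<delta> (cover_tail \<epsilon>)"
  and x: "path r v x"
 shows "(v, vertex_coset v (pos x)) \<in> W \<and>
  \<delta> (v, vertex_coset v (pos x)) \<otimes>\<^bsub>K\<^esub> label K \<kappa> x \<one>\<^bsub>Q\<^esub> = w [^]\<^bsub>K\<^esub> label integer_group ind x \<one>\<^bsub>Q\<^esub>"
 using x
proof (induction rule: path.induct)
 interpret K: group K by fact
 have ind: "ind \<in> edge_cosets \<rightarrow> carrier integer_group" by simp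
 note lc = cocycleD(2)[OF label_cocycle[OF K \<kappa>] Q.one_closed]
 note stepsK = label_steps[OF K \<kappa>] and stepsZ = label_steps[OF group_integer_group ind]
 have \<kappa>c: "\<kappa> \<epsilon> \<in> carrier K" if "\<epsilon> \<in> edge_cosets" for \<epsilon> using \<kappa> that by blast
 {
  case refl
  have "label K \<kappa> \<one>\<^bsub>UG\<^esub> \<one>\<^bsub>Q\<^esub> = \<one>\<^bsub>K\<^esub>"
   by (rule cocycle_one[OF label_cocycle[OF K \<kappa>] Q.one_closed K U.group_axioms])
  moreover have "label integer_group ind \<one>\<^bsub>UG\<^esub> \<one>\<^bsub>Q\<^esub> = 0"
   using cocycle_one[OF label_cocycle[OF group_integer_group ind] Q.one_closed group_integer_group U.group_axioms] by simp
  moreover have "(r, vertex_coset r \<one>\<^bsub>Q\<^esub>) \<in> W" using grown_basic[OF g] by simp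
  ultimately show ?case using \<delta>(1) by simp
 next
  case (vertex v x h)
  have c: "v \<in> verts X" "x \<in> carrier UG" using path_closed[OF vertex.hyps(1)] by simp_all
  have "vertex_coset v (pos (vel v h \<otimes>\<^bsub>UG\<^esub> x)) = vertex_coset v (pos x)"
   using vertex_coset_shift[OF c(1) vertex.hyps(2), of "pos x"] c vertex.hyps(2) by simp
  then show ?case
   using vertex.IH stepsK(1)[OF c(2,1) vertex.hyps(2)] stepsZ(1)[OF c(2,1) vertex.hyps(2)] by (simp only:)
 next
  case (forward e x)
  have c: "x \<in> carrier UG" using path_closed[OF forward.hyps(1)] by simp
  let ?\<epsilon> = "(e, edge_coset e (pos x))"
  have px: "pos x \<in> carrier Q" using c by simp
  have \<epsilon>: "?\<epsilon> \<in> edge_cosets" using forward.hyps(2) px by simp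
  note ct = cover_tail_coset[OF forward.hyps(2) px] and ch = cover_head_coset[OF forward.hyps(2) px]
  have tW: "cover_tail ?\<epsilon> \<in> W" using forward.IH ct by simp
  have hW: "cover_head ?\<epsilon> \<in> W" using closed[OF \<epsilon>] tW by simp
  have ps: "pos (stl e \<otimes>\<^bsub>UG\<^esub> x) = pos (stl e) \<otimes>\<^bsub>Q\<^esub> pos x" using c forward.hyps(2) by simp
  have "\<delta> (cover_head ?\<epsilon>) \<otimes>\<^bsub>K\<^esub> (\<kappa> ?\<epsilon> \<otimes>\<^bsub>K\<^esub> label K \<kappa> x \<one>\<^bsub>Q\<^esub>)
    = w [^]\<^bsub>K\<^esub> ind ?\<epsilon> \<otimes>\<^bsub>K\<^esub> (\<delta> (cover_tail ?\<epsilon>) \<otimes>\<^bsub>K\<^esub> label K \<kappa> x \<one>\<^bsub>Q\<^esub>)"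
   using \<delta>(3)[OF \<epsilon> tW] \<delta>(2)[OF tW] \<delta>(2)[OF hW] \<kappa>c[OF \<epsilon>] lc[OF c] w by (simp add: K.m_assoc[symmetric])
  also have "\<dots> = w [^]\<^bsub>K\<^esub> (ind ?\<epsilon> + label integer_group ind x \<one>\<^bsub>Q\<^esub>)"
   using forward.IH w ct by (simp add: K.int_pow_mult)
  finally show ?case
   using hW ch ps stepsK(2)[OF c forward.hyps(2)] stepsZ(2)[OF c forward.hyps(2)] by simp
 next
  case (backward e x)
  have c: "x \<in> carrier UG" using path_closed[OF backward.hyps(1)] by simp
  let ?p = "inv\<^bsub>Q\<^esub> pos (stl e) \<otimes>\<^bsub>Q\<^esub> pos x"
  let ?\<epsilon> = "(e, edge_coset e ?p)"
  have px: "?p \<in> carrier Q" using c backward.hyps(2) by simp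
  have \<epsilon>: "?\<epsilon> \<in> edge_cosets" using backward.hyps(2) px by simp
  have ret: "pos (stl e) \<otimes>\<^bsub>Q\<^esub> ?p = pos x" using c backward.hyps(2) by (simp add: Q.m_assoc[symmetric])
  note ct = cover_tail_coset[OF backward.hyps(2) px] and ch = cover_head_coset[OF backward.hyps(2) px, unfolded ret]
  have hW: "cover_head ?\<epsilon> \<in> W" using backward.IH ch by simp
  have tW: "cover_tail ?\<epsilon> \<in> W" using closed[OF \<epsilon>] hW by simp
  have ps: "pos (inv\<^bsub>UG\<^esub> stl e \<otimes>\<^bsub>UG\<^esub> x) = ?p" using c backward.hyps(2) by simp
  let ?t = "\<delta> (cover_tail ?\<epsilon>)" and ?h = "\<delta> (cover_head ?\<epsilon>)" and ?k = "\<kappa> ?\<epsilon>" and ?i = "ind ?\<epsilon>"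
  let ?l = "label K \<kappa> x \<one>\<^bsub>Q\<^esub>" and ?m = "label integer_group ind x \<one>\<^bsub>Q\<^esub>"
  have cc: "?t \<in> carrier K" "?h \<in> carrier K" "?k \<in> carrier K" "?l \<in> carrier K"
   using \<delta>(2)[OF tW] \<delta>(2)[OF hW] \<kappa>c[OF \<epsilon>] lc[OF c] by simp_all
  have "?t = w [^]\<^bsub>K\<^esub> (- ?i) \<otimes>\<^bsub>K\<^esub> (w [^]\<^bsub>K\<^esub> ?i \<otimes>\<^bsub>K\<^esub> ?t)"
   using cc w by (simp add: K.m_assoc[symmetric] K.int_pow_neg)
  also have "\<dots> = w [^]\<^bsub>K\<^esub> (- ?i) \<otimes>\<^bsub>K\<^esub> (?h \<otimes>\<^bsub>K\<^esub> ?k)" using \<delta>(3)[OF \<epsilon> tW] by simp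
  finally have t: "?t = w [^]\<^bsub>K\<^esub> (- ?i) \<otimes>\<^bsub>K\<^esub> (?h \<otimes>\<^bsub>K\<^esub> ?k)" .
  have "?k \<otimes>\<^bsub>K\<^esub> (inv\<^bsub>K\<^esub> ?k \<otimes>\<^bsub>K\<^esub> ?l) = ?l" using cc by (simp add: K.m_assoc[symmetric])
  then have "?t \<otimes>\<^bsub>K\<^esub> (inv\<^bsub>K\<^esub> ?k \<otimes>\<^bsub>K\<^esub> ?l) = w [^]\<^bsub>K\<^esub> (- ?i) \<otimes>\<^bsub>K\<^esub> (?h \<otimes>\<^bsub>K\<^esub> ?l)"
   unfolding t using cc w by (simp add: K.m_assoc)
  also have "\<dots> = w [^]\<^bsub>K\<^esub> (- ?i) \<otimes>\<^bsub>K\<^esub> w [^]\<^bsub>K\<^esub> ?m" using backward.IH ch by simp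
  also have "\<dots> = w [^]\<^bsub>K\<^esub> (- ?i + ?m)" using w by (rule K.int_pow_mult[symmetric])
  finally show ?case
   using tW ct ps stepsK(3)[OF c backward.hyps(2)] stepsZ(3)[OF c backward.hyps(2)] by simp
 }
qed

end

lemma cocycle_compose:
 assumes c: "cocycle U P K act l" and G: "group G" and U: "group U" and f: "f \<in> hom G U" and h: "h \<in> hom K K'"
 shows "cocycle G P K' (\<lambda>g. act (f g)) (\<lambda>g p. h (l (f g) p))"
proof -
 interpret f: group_hom G U f using f G U by (simp add: group_hom_def group_hom_axioms_def)
 note c' = cocycleD[OF c]
 show ?thesis
  by (rule cocycleI) (use c' hom_in_carrier[OF h] hom_mult[OF h] in simp_all)
qed

text \<open>Feeds the labels of one cocycle into another one: this turns a recursion on the free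
  group into one on a group labelled by it.\<close>

lemma cocycle_skew:
 assumes c: "cocycle U P F act l" and d: "cocycle F C K act' l'" and U: "group U" and F: "group F"
 shows "cocycle U (P \<times> C) K (\<lambda>g (p, c). (act g p, act' (l g p) c)) (\<lambda>g (p, c). l' (l g p) c)"
proof -
 note c' = cocycleD[OF c] and d' = cocycleD[OF d]
 show ?thesis
  by (rule cocycleI) (use c' d' cocycle_one[OF c _ F U] in auto)
qed

text \<open>Brings the positions of different recursions to one type.\<close>

lemma cocycle_trivial_factor:
 assumes "cocycle G P K act l"
 shows "cocycle G (P \<times> C) K (\<lambda>g (p, c). (act g p, c)) (\<lambda>g (p, c). l g p)"
 using cocycleD[OF assms] by (intro cocycleI) auto

lemma normal_preimage:
 assumes G: "group G" and K: "group K" and h: "h \<in> hom G K" and Z: "Z \<lhd> K"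
 shows "{x \<in> carrier G. h x \<in> Z} \<lhd> G"
proof -
 interpret h: group_hom G K h using h G K by (simp add: group_hom_def group_hom_axioms_def)
 note sZ = normal_imp_subgroup[OF Z]
 show ?thesis
 proof (rule h.G.normalI_conj)
  show "subgroup {x \<in> carrier G. h x \<in> Z} G"
  proof (rule h.G.subgroupI)
   show "{x \<in> carrier G. h x \<in> Z} \<noteq> {}"
    using subgroup.one_closed[OF sZ] h.hom_one h.G.one_closed by (metis (mono_tags, lifting) empty_iff mem_Collect_eq)
  qed (use subgroup.m_inv_closed[OF sZ] subgroup.m_closed[OF sZ] in auto)
  fix g x assume "g \<in> carrier G" "x \<in> {x \<in> carrier G. h x \<in> Z}"
  then show "g \<otimes>\<^bsub>G\<^esub> x \<otimes>\<^bsub>G\<^esub> inv\<^bsub>G\<^esub> g \<in> {x \<in> carrier G. h x \<in> Z}"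
   using normal.inv_op_closed2[OF Z, of "h g" "h x"] by simp
 qed
qed

context lattice_quotient
begin

text \<open>The recursion of \<open>sigma\<close> already makes invariant subgroups meet
  \<open>M\<close> trivially. The further positions therefore need only force an invariant subgroup
  into \<open>M\<close>.\<close>

lemma self_similar_criterion:
 fixes P :: "nat \<Rightarrow> (('v, 'e, 'g) generator word set set \<times> bool) set"
 assumes I: "finite I" and P: "\<And>i. i \<in> I \<Longrightarrow> finite (P i)" and c: "\<And>i. i \<in> I \<Longrightarrow> cocycle FT (P i) FT (act i) (lab i)"
  and core: "\<And>Z. Z \<lhd> FT \<Longrightarrow> Z \<inter> M \<subseteq> {\<one>\<^bsub>FT\<^esub>} \<Longrightarrow>
   (\<And>i g p. i \<in> I \<Longrightarrow> g \<in> Z \<Longrightarrow> p \<in> P i \<Longrightarrow> act i g p = p \<and> lab i g p \<in> Z) \<Longrightarrow> Z \<subseteq> M"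
 shows "self_similar FT"
proof -
 obtain R a0 lab0 where R: "finite (R :: ('v, 'e, 'g) generator word set set set)" "cocycle FT R FT a0 lab0"
  and R_core: "\<forall>Z. Z \<lhd> FT \<longrightarrow> (\<forall>g\<in>Z. \<forall>p\<in>R. a0 g p = p \<and> lab0 g p \<in> Z) \<longrightarrow> Z \<inter> M \<subseteq> {\<one>\<^bsub>FT\<^esub>}"
  using sigma_recursion by (elim exE conjE) (rule that)
 let ?I = "insert None (Some ` I)"
 let ?P = "\<lambda>i. case i of None \<Rightarrow> R \<times> {True} | Some i \<Rightarrow> P i"
 let ?a = "\<lambda>i. case i of None \<Rightarrow> (\<lambda>g (p, c). (a0 g p, c)) | Some i \<Rightarrow> act i"
 let ?m = "\<lambda>i. case i of None \<Rightarrow> (\<lambda>g (p, c). lab0 g p) | Some i \<Rightarrow> lab i"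
 show ?thesis
 proof (rule self_similar_of_cocycles[where I = ?I and Q = ?P and act = ?a and \<mu> = ?m])
  show "group FT" by (rule G.group_axioms)
  show "finite ?I" using I by simp
  show "finite (?P i)" if "i \<in> ?I" for i using that P R by auto
  show "cocycle FT (?P i) FT (?a i) (?m i)" if "i \<in> ?I" for i
   using that c cocycle_trivial_factor[OF R(2)] by auto
  fix Z assume Z: "Z \<lhd> FT" and inv: "\<And>i g p. i \<in> ?I \<Longrightarrow> g \<in> Z \<Longrightarrow> p \<in> ?P i \<Longrightarrow> ?a i g p = p \<and> ?m i g p \<in> Z"
  have "\<forall>g\<in>Z. \<forall>p\<in>R. a0 g p = p \<and> lab0 g p \<in> Z"
  proof (intro ballI)
   fix g p assume "g \<in> Z" "p \<in> R"
   then show "a0 g p = p \<and> lab0 g p \<in> Z" using inv[of None g "(p, True)"] by simp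
  qed
  then have ZM: "Z \<inter> M \<subseteq> {\<one>\<^bsub>FT\<^esub>}" using R_core Z by blast
  have "Z \<subseteq> M"
  proof (rule core[OF Z ZM])
   fix i g p assume "i \<in> I" "g \<in> Z" "p \<in> P i"
   then show "act i g p = p \<and> lab i g p \<in> Z" using inv[of "Some i" g p] by simp
  qed
  then show "Z \<subseteq> {\<one>\<^bsub>FT\<^esub>}" using ZM by blast
 qed
qed

text \<open>Two arcs outside the tree let \<open>N\<close> map onto a free group of rank two with a
  section \<open>\<iota>\<close>. One set of positions returns the word \<open>?w\<close> that
  carries the ping-pong label of \<open>g\<close>; the other one transports the recursion of the
  free group. The preimage under \<open>\<iota>\<close> of an invariant subgroup is then invariant
  for that recursion, so the label of \<open>g\<close> has lower left entry zero and
  \<open>g\<close> lies in \<open>M\<close>.\<close>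

lemma self_similar_two_arcs:
 assumes g: "cover_grown W B" and D: "\<epsilon>1 \<in> edge_cosets" "\<epsilon>2 \<in> edge_cosets" "\<epsilon>1 \<notin> B" "\<epsilon>2 \<notin> B" "\<epsilon>1 \<noteq> \<epsilon>2"
  and W: "cover_tail \<epsilon>1 \<in> W" "cover_head \<epsilon>1 \<in> W" "cover_tail \<epsilon>2 \<in> W" "cover_head \<epsilon>2 \<in> W"
 shows "self_similar FT"
proof -
 interpret F: group F2 by (rule group_presented_group)
 obtain act \<nu> \<rho> where c: "cocycle F2 (UNIV :: bool set) F2 act \<nu>" and \<rho>: "\<rho> \<in> hom F2 SL2"
  and ping: "\<forall>i :: nat. \<exists>w. w \<in> carrier F2 \<and> \<rho> w = ping_mat (int i) 1"
  and F2_core: "\<forall>Z. Z \<lhd> F2 \<longrightarrow> (\<forall>w\<in>Z. \<forall>c. act w c = c \<and> \<nu> w c \<in> Z) \<longrightarrow> (\<forall>w\<in>Z. fst (snd (snd (\<rho> w))) = 0)"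
  using F2_recursion unfolding Bex_def by (elim exE conjE) (rule that)
 define \<kappa>0 where "\<kappa>0 \<epsilon> = (if \<epsilon> = \<epsilon>1 then gen_a else if \<epsilon> = \<epsilon>2 then gen_b else \<one>\<^bsub>F2\<^esub>)" for \<epsilon>
 have \<kappa>0: "\<kappa>0 \<in> edge_cosets \<rightarrow> carrier F2" by (simp add: \<kappa>0_def)
 have \<kappa>0B: "\<forall>\<beta>\<in>B. \<kappa>0 \<beta> = \<one>\<^bsub>F2\<^esub>" using D by (auto simp: \<kappa>0_def)
 note loop = cover_loop[OF g F.group_axioms \<kappa>0 \<kappa>0B]
 define \<theta> where "\<theta> g = label F2 \<kappa>0 (j g) \<one>\<^bsub>Q\<^esub>" for g
 have \<kappa>0v: "\<kappa>0 \<epsilon>1 = gen_a" "\<kappa>0 \<epsilon>2 = gen_b" using D(5) by (auto simp: \<kappa>0_def)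
 obtain c1 where c1: "c1 \<in> N" "\<theta> c1 = gen_a" using loop[OF D(1) W(1,2)] unfolding \<kappa>0v \<theta>_def[symmetric] by blast
 obtain c2 where c2: "c2 \<in> N" "\<theta> c2 = gen_b" using loop[OF D(2) W(3,4)] unfolding \<kappa>0v \<theta>_def[symmetric] by blast
 have Nc: "x \<in> carrier FT" if "x \<in> N" for x using N_subgroup that by (rule subgroup.mem_carrier)
 \<comment> \<open>Loops through the two arcs are chosen as images of the generators, so that the
   label \<open>\<theta>\<close> undoes \<open>\<iota>\<close>.\<close>
 obtain \<iota> where \<iota>: "\<iota> \<in> hom F2 FT" "\<And>x. \<iota> (free_gen UNIV x) = (if x then c1 else c2)"
  using free_group_hom[OF G.group_axioms, of "\<lambda>x. if x then c1 else c2" "UNIV :: bool set"] c1 c2 Nc by auto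
 interpret \<iota>: group_hom F2 FT \<iota> using \<iota>(1) by unfold_locales
 have \<theta>_mult: "\<theta> (x \<cdot> y) = \<theta> x \<otimes>\<^bsub>F2\<^esub> \<theta> y" if "x \<in> carrier FT" "y \<in> N" for x y
  unfolding \<theta>_def by (rule label_mult_N[OF F.group_axioms \<kappa>0 that])
 have \<theta>_one: "\<theta> \<one>\<^bsub>FT\<^esub> = \<one>\<^bsub>F2\<^esub>"
  using cocycle_one[OF label_cocycle[OF F.group_axioms \<kappa>0] Q.one_closed F.group_axioms U.group_axioms] by (simp add: \<theta>_def)
 have \<theta>c: "\<theta> x \<in> carrier F2" if "x \<in> carrier FT" for x
  unfolding \<theta>_def using cocycleD(2)[OF label_cocycle[OF F.group_axioms \<kappa>0] Q.one_closed, of "j x"] that by simp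
 have \<theta>_inv: "\<theta> (inv\<^bsub>FT\<^esub> x) = inv\<^bsub>F2\<^esub> \<theta> x" if x: "x \<in> N" for x
 proof -
  have "\<theta> (inv\<^bsub>FT\<^esub> x) \<otimes>\<^bsub>F2\<^esub> \<theta> x = \<one>\<^bsub>F2\<^esub>" using \<theta>_mult[of "inv\<^bsub>FT\<^esub> x" x] x Nc[OF x] \<theta>_one by simp
  then show ?thesis using F.inv_equality \<theta>c Nc[OF x] by simp
 qed
 have gens: "\<iota> (free_gen UNIV x) \<in> N" "\<theta> (\<iota> (free_gen UNIV x)) = free_gen UNIV x" for x
  using c1 c2 \<iota>(2)[of x] by (cases x; simp)+
 have \<iota>_N: "\<iota> w \<in> N \<and> \<theta> (\<iota> w) = w" if "w \<in> carrier F2" for w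
  using that
 proof (induction rule: presented_induct)
  case one
  show ?case using subgroup.one_closed[OF N_subgroup] \<theta>_one by simp
 next
  case (gen x A)
  have "\<iota> (free_gen UNIV x \<otimes>\<^bsub>F2\<^esub> A) = \<iota> (free_gen UNIV x) \<cdot> \<iota> A" using gen(2) by simp
  then show ?case
   using \<theta>_mult[of "\<iota> (free_gen UNIV x)" "\<iota> A"] Nc[OF gens(1)[of x]]
    gens[of x] gen(3) subgroup.m_closed[OF N_subgroup] by simp
 next
  case (inv x A)
  have "\<iota> (inv\<^bsub>F2\<^esub> free_gen UNIV x \<otimes>\<^bsub>F2\<^esub> A) = inv\<^bsub>FT\<^esub> \<iota> (free_gen UNIV x) \<cdot> \<iota> A" using inv(2) by simp
  then show ?case
   using \<theta>_mult[of "inv\<^bsub>FT\<^esub> \<iota> (free_gen UNIV x)" "\<iota> A"] \<theta>_inv[OF gens(1), of x] Nc[OF gens(1)[of x]] gens[of x] inv(3)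
    subgroup.m_closed[OF N_subgroup] subgroup.m_inv_closed[OF N_subgroup] by simp
 qed
 from choice[OF ping] obtain wd where wd: "\<forall>i :: nat. wd i \<in> carrier F2 \<and> \<rho> (wd i) = ping_mat (int i) 1" by blast
 define \<kappa>1 where "\<kappa>1 \<epsilon> = wd (edge_index \<epsilon>)" for \<epsilon>
 have \<kappa>1: "\<kappa>1 \<in> edge_cosets \<rightarrow> carrier F2" using wd by (simp add: \<kappa>1_def)
 note l0 = label_cocycle[OF F.group_axioms \<kappa>0] and l1 = label_cocycle[OF F.group_axioms \<kappa>1]
 note coc0 = cocycle_trivial_factor[OF cocycle_compose[OF l1 G.group_axioms U.group_axioms j_hom \<iota>(1)], of "UNIV :: bool set"]
 note coc1 = cocycle_compose[OF cocycle_skew[OF l0 c U.group_axioms F.group_axioms] G.group_axioms U.group_axioms j_hom \<iota>(1)]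
 let ?a0 = "\<lambda>g (p, c). (pos (j g) \<otimes>\<^bsub>Q\<^esub> p, c)" and ?m0 = "\<lambda>g (p, c). \<iota> (label F2 \<kappa>1 (j g) p)"
 let ?a1 = "\<lambda>g (p, c). (pos (j g) \<otimes>\<^bsub>Q\<^esub> p, act (label F2 \<kappa>0 (j g) p) c)"
  and ?m1 = "\<lambda>g pc. \<iota> (case pc of (p, c) \<Rightarrow> \<nu> (label F2 \<kappa>0 (j g) p) c)"
 show ?thesis
 proof (rule self_similar_criterion[where I = "{0, 1}" and P = "\<lambda>_. carrier Q \<times> UNIV"
    and act = "\<lambda>i. if i = 0 then ?a0 else ?a1" and lab = "\<lambda>i. if i = 0 then ?m0 else ?m1"])
  show "cocycle FT (carrier Q \<times> UNIV) FT (if i = 0 then ?a0 else ?a1) (if i = 0 then ?m0 else ?m1)" if "i \<in> {0, 1}" for i :: nat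
   using coc0 coc1 by (cases "i = 0") simp_all
  fix Z assume Z: "Z \<lhd> FT" "Z \<inter> M \<subseteq> {\<one>\<^bsub>FT\<^esub>}" and inv: "\<And>i g p. i \<in> {0, 1 :: nat} \<Longrightarrow> g \<in> Z \<Longrightarrow> p \<in> carrier Q \<times> (UNIV :: bool set) \<Longrightarrow>
   (if i = 0 then ?a0 else ?a1) g p = p \<and> (if i = 0 then ?m0 else ?m1) g p \<in> Z"
  have inv0: "pos (j g) \<otimes>\<^bsub>Q\<^esub> \<one>\<^bsub>Q\<^esub> = \<one>\<^bsub>Q\<^esub>" "\<iota> (label F2 \<kappa>1 (j g) \<one>\<^bsub>Q\<^esub>) \<in> Z" if "g \<in> Z" for g
   using inv[of 0 g "(\<one>\<^bsub>Q\<^esub>, True)"] that by simp_all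
  have inv1: "act (\<theta> g) c = c" "\<iota> (\<nu> (\<theta> g) c) \<in> Z" if "g \<in> Z" for g c
   using inv[of 1 g "(\<one>\<^bsub>Q\<^esub>, c)"] that by (simp_all add: \<theta>_def)
  let ?N = "{w \<in> carrier F2. \<iota> w \<in> Z}"
  have "?N \<lhd> F2" by (rule normal_preimage[OF F.group_axioms G.group_axioms \<iota>(1) Z(1)])
  moreover have "act w c = c \<and> \<nu> w c \<in> ?N" if "w \<in> ?N" for w c
   using inv1[of "\<iota> w" c] \<iota>_N[of w] that cocycleD(2)[OF \<open>cocycle F2 UNIV F2 act \<nu>\<close> UNIV_I] by simp
  ultimately have zero: "fst (snd (snd (\<rho> w))) = 0" if "w \<in> ?N" for w
   using F2_core that by blast
  show "Z \<subseteq> M"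
  proof
   fix g assume gZ: "g \<in> Z"
   have gc: "g \<in> carrier FT" using normal_imp_subgroup[OF Z(1)] gZ by (rule subgroup.mem_carrier)
   have gN: "g \<in> N" using inv0(1)[OF gZ] pos_one_iff[OF gc] gc by simp
   let ?w = "label F2 \<kappa>1 (j g) \<one>\<^bsub>Q\<^esub>"
   have "?w \<in> ?N" using inv0(2)[OF gZ] cocycleD(2)[OF l1 Q.one_closed, of "j g"] gc by simp
   moreover have "sl_label (j g) \<one>\<^bsub>Q\<^esub> = \<rho> ?w"
    by (rule label_hom[OF F.group_axioms group_SL2 \<kappa>1 \<rho>]) (use wd gc in \<open>simp_all add: \<kappa>1_def\<close>)
   ultimately have "g \<in> power_set FT M l" using sl_label_kernel[OF gN] zero by simp
   then show "g \<in> M" using power_set_M by blast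
  qed
 qed simp_all
qed

text \<open>With at most one arc outside the tree, a gauge makes the label of every closed path a
  power of a single matrix, so an integer carries all the information. It is stored as an exponent
  of \<open>m\<close>, an element of infinite order in \<open>M\<close>, where the recursion of
  \<open>sigma\<close> recognises it.\<close>

lemma self_similar_one_arc:
 assumes g: "cover_grown W B" and closed: "\<And>\<epsilon>. \<epsilon> \<in> edge_cosets \<Longrightarrow> cover_tail \<epsilon> \<in> W \<longleftrightarrow> cover_head \<epsilon> \<in> W"
  and D: "\<And>\<epsilon>. \<epsilon> \<in> edge_cosets \<Longrightarrow> \<epsilon> \<notin> B \<Longrightarrow> cover_tail \<epsilon> \<in> W \<Longrightarrow> \<epsilon> = \<epsilon>0"
  and m: "m \<in> M" "m \<noteq> \<one>\<^bsub>FT\<^esub>"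
 shows "self_similar FT"
proof -
 interpret S: group SL2 by (rule group_SL2)
 let ?\<kappa> = "\<lambda>\<epsilon>. ping_mat (int (edge_index \<epsilon>)) 1"
 obtain \<delta> where \<delta>: "\<delta> (r, vertex_coset r \<one>\<^bsub>Q\<^esub>) = \<one>\<^bsub>SL2\<^esub>" "\<And>v. v \<in> W \<Longrightarrow> \<delta> v \<in> carrier SL2"
  "\<And>\<epsilon>. \<epsilon> \<in> B \<Longrightarrow> \<delta> (cover_head \<epsilon>) \<otimes>\<^bsub>SL2\<^esub> ?\<kappa> \<epsilon> = \<delta> (cover_tail \<epsilon>)"
  using grown_potential[OF group_SL2 g sl_label] by blast
 define ind where "ind \<epsilon> = (if \<epsilon> \<in> B then 0 else 1 :: int)" for \<epsilon>
 \<comment> \<open>The gauged label of the extra arc; the identity if the component has no such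
   arc.\<close>
 define w where "w = (if \<epsilon>0 \<in> edge_cosets \<and> cover_tail \<epsilon>0 \<in> W
  then \<delta> (cover_head \<epsilon>0) \<otimes>\<^bsub>SL2\<^esub> ?\<kappa> \<epsilon>0 \<otimes>\<^bsub>SL2\<^esub> inv\<^bsub>SL2\<^esub> \<delta> (cover_tail \<epsilon>0) else \<one>\<^bsub>SL2\<^esub>)"
 have \<kappa>c: "?\<kappa> \<epsilon> \<in> carrier SL2" for \<epsilon> by (rule ping_mat_SL2)
 have wc: "w \<in> carrier SL2"
 proof (cases "\<epsilon>0 \<in> edge_cosets \<and> cover_tail \<epsilon>0 \<in> W")
  case True
  then have "\<delta> (cover_head \<epsilon>0) \<in> carrier SL2" "\<delta> (cover_tail \<epsilon>0) \<in> carrier SL2" using closed \<delta>(2) by blast+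
  then show ?thesis unfolding w_def if_P[OF True] by (intro S.m_closed S.inv_closed \<kappa>c)
 next
  case False
  show ?thesis unfolding w_def if_not_P[OF False] by (rule S.one_closed)
 qed
 have rel: "\<delta> (cover_head \<epsilon>) \<otimes>\<^bsub>SL2\<^esub> ?\<kappa> \<epsilon> = w [^]\<^bsub>SL2\<^esub> ind \<epsilon> \<otimes>\<^bsub>SL2\<^esub> \<delta> (cover_tail \<epsilon>)"
  if \<epsilon>: "\<epsilon> \<in> edge_cosets" "cover_tail \<epsilon> \<in> W" for \<epsilon>
 proof -
  have t: "\<delta> (cover_tail \<epsilon>) \<in> carrier SL2" using \<delta>(2) \<epsilon>(2) .
  have h: "\<delta> (cover_head \<epsilon>) \<in> carrier SL2" using \<delta>(2) closed \<epsilon> by blast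
  show ?thesis
  proof (cases "\<epsilon> \<in> B")
   case True
   then have "ind \<epsilon> = 0" by (simp add: ind_def)
   then show ?thesis unfolding \<delta>(3)[OF True] using S.l_one[OF t] by (simp only: int_pow_0)
  next
   case False
   then have e: "\<epsilon> = \<epsilon>0" using D \<epsilon> by blast
   have i: "ind \<epsilon> = 1" using False by (simp add: ind_def)
   have w: "w = \<delta> (cover_head \<epsilon>) \<otimes>\<^bsub>SL2\<^esub> ?\<kappa> \<epsilon> \<otimes>\<^bsub>SL2\<^esub> inv\<^bsub>SL2\<^esub> \<delta> (cover_tail \<epsilon>)"
    unfolding w_def using \<epsilon> by (simp only: e simp_thms if_True)
   have "w \<otimes>\<^bsub>SL2\<^esub> \<delta> (cover_tail \<epsilon>) = \<delta> (cover_head \<epsilon>) \<otimes>\<^bsub>SL2\<^esub> ?\<kappa> \<epsilon>"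
    unfolding w using S.m_assoc[OF S.m_closed[OF h \<kappa>c] S.inv_closed[OF t] t] S.l_inv[OF t] S.r_one[OF S.m_closed[OF h \<kappa>c]]
    by (simp only:)
   then show ?thesis unfolding i S.int_pow_1[OF wc] by (rule HOL.sym)
  qed
 qed
 have ind: "ind \<in> edge_cosets \<rightarrow> carrier integer_group" by simp
 note lZ = label_cocycle[OF group_integer_group ind]
 have mc: "m \<in> carrier FT" using m(1) by (rule M_carrier)
 note coc = cocycle_trivial_factor[OF cocycle_compose[OF lZ G.group_axioms U.group_axioms j_hom G.hom_integer_group_pow[OF mc]], of "{True}"]
 show ?thesis
 proof (rule self_similar_criterion[where I = "{0}" and P = "\<lambda>_. carrier Q \<times> {True}" and act = "\<lambda>_ g (p, c). (pos (j g) \<otimes>\<^bsub>Q\<^esub> p, c)"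
    and lab = "\<lambda>_ g (p, c). m [^]\<^bsub>FT\<^esub> label integer_group ind (j g) p"])
  show "cocycle FT (carrier Q \<times> {True}) FT (\<lambda>g (p, c). (pos (j g) \<otimes>\<^bsub>Q\<^esub> p, c)) (\<lambda>g (p, c). m [^]\<^bsub>FT\<^esub> label integer_group ind (j g) p)" for i :: nat
   by (rule coc)
  fix Z assume Z: "Z \<lhd> FT" and ZM: "Z \<inter> M \<subseteq> {\<one>\<^bsub>FT\<^esub>}" and "\<And>i g p. i \<in> {0 :: nat} \<Longrightarrow> g \<in> Z \<Longrightarrow> p \<in> carrier Q \<times> {True} \<Longrightarrow>
   (case p of (p, c) \<Rightarrow> (pos (j g) \<otimes>\<^bsub>Q\<^esub> p, c)) = p \<and> (case p of (p, c) \<Rightarrow> m [^]\<^bsub>FT\<^esub> label integer_group ind (j g) p) \<in> Z"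
  from this(3)[of 0 _ "(\<one>\<^bsub>Q\<^esub>, True)"]
  have inv: "pos (j g) \<otimes>\<^bsub>Q\<^esub> \<one>\<^bsub>Q\<^esub> = \<one>\<^bsub>Q\<^esub>" "m [^]\<^bsub>FT\<^esub> label integer_group ind (j g) \<one>\<^bsub>Q\<^esub> \<in> Z" if "g \<in> Z" for g
   using that by simp_all
  show "Z \<subseteq> M"
  proof
   fix g assume gZ: "g \<in> Z"
   have gc: "g \<in> carrier FT" using normal_imp_subgroup[OF Z] gZ by (rule subgroup.mem_carrier)
   have pg: "pos (j g) = \<one>\<^bsub>Q\<^esub>" using inv(1)[OF gZ] gc by simp
   have gN: "g \<in> N" using pg pos_one_iff[OF gc] by simp
   let ?k = "label integer_group ind (j g) \<one>\<^bsub>Q\<^esub>"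
   have "m [^]\<^bsub>FT\<^esub> ?k \<in> M" by (rule G.subgroup_int_pow_closed[OF M_subgroup m(1)])
   then have mk: "m [^]\<^bsub>FT\<^esub> ?k = \<one>\<^bsub>FT\<^esub>" using inv(2)[OF gZ] ZM by blast
   \<comment> \<open>The state is a power of \<open>m\<close> in both \<open>Z\<close> and
     \<open>M\<close>, hence trivial, and \<open>m\<close> has infinite order.\<close>
   have k: "?k = 0"
   proof (rule ccontr)
    assume nz: "?k \<noteq> 0"
    have "m [^]\<^bsub>FT\<^esub> nat \<bar>?k\<bar> = \<one>\<^bsub>FT\<^esub>"
    proof (cases "?k \<ge> 0")
     case True
     then show ?thesis using mk int_pow_int[of FT m "nat \<bar>?k\<bar>"] by simp
    next
     case False
     then have e: "- int (nat \<bar>?k\<bar>) = ?k" by simp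
     have "inv\<^bsub>FT\<^esub> (m [^]\<^bsub>FT\<^esub> nat \<bar>?k\<bar>) = m [^]\<^bsub>FT\<^esub> (- int (nat \<bar>?k\<bar>))"
      by (rule G.int_pow_neg_int[OF mc, symmetric])
     also have "\<dots> = \<one>\<^bsub>FT\<^esub>" unfolding e by (rule mk)
     finally have "inv\<^bsub>FT\<^esub> (m [^]\<^bsub>FT\<^esub> nat \<bar>?k\<bar>) = \<one>\<^bsub>FT\<^esub>" .
     then show ?thesis using G.inv_eq_1_iff[OF G.nat_pow_closed[OF mc]] by blast
    qed
    then have "m = \<one>\<^bsub>FT\<^esub>"
     using M_pow_inj[OF m(1) subgroup.one_closed[OF M_subgroup], of "nat \<bar>?k\<bar>"] nz by simp
    then show False using m(2) by simp
   qed
   have "\<delta> (r, vertex_coset r (pos (j g))) \<otimes>\<^bsub>SL2\<^esub> sl_label (j g) \<one>\<^bsub>Q\<^esub> = w [^]\<^bsub>SL2\<^esub> ?k"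
    using cover_gauge[OF g closed group_SL2 sl_label wc \<delta>(1,2) rel path_j[OF gc]] by blast
   then have "sl_label (j g) \<one>\<^bsub>Q\<^esub> = (1, 0, 0, 1)" unfolding pg \<delta>(1) k int_pow_0 by simp
   then have "g \<in> power_set FT M l" using sl_label_kernel[OF gN] by simp
   then show "g \<in> M" using power_set_M by blast
  qed
 qed simp_all
qed

text \<open>Then vertex groups have trivial \<open>d\<close>-th powers and, being torsion-free, are
  trivial. A trivial group has no proper subgroup, so there are no arcs either.\<close>

lemma trivial_if_M_trivial:
 assumes M: "M \<subseteq> {\<one>\<^bsub>FT\<^esub>}"
 shows "carrier FT \<subseteq> {\<one>\<^bsub>FT\<^esub>}"
proof -
 have one: "g = \<one>\<^bsub>Gv v\<^esub>" if v: "v \<in> verts X" "g \<in> carrier (Gv v)" for v g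
 proof -
  interpret h: group_hom "Gv v" FT "ve v" using v(1) by (rule vertex_elem_group_hom)
  have "ve v g [^]\<^bsub>FT\<^esub> d = ve v \<one>\<^bsub>Gv v\<^esub> [^]\<^bsub>FT\<^esub> d" using vertex_pow_M[OF v] M by auto
  then show ?thesis using ve_pow_inj[OF v h.G.one_closed d] by simp
 qed
 have arcs: "arcs X = {}"
 proof (rule ccontr)
  assume "arcs X \<noteq> {}"
  then obtain e where e: "e \<in> arcs X" by blast
  then obtain g where "g \<in> carrier (Gv (tail X e))" "g \<notin> Ge e" using Ge_proper[OF e] by blast
  then show False using one[OF tail_in_verts[OF e]] subgroup.one_closed[OF subgroup_Ge[OF e]] by metis
 qed
 have "x = \<one>\<^bsub>FT\<^esub>" if "x \<in> carrier FT" for x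
  using that
 proof (induction rule: FG_induct)
  case (vertex v g x)
  then show ?case using one[OF vertex(1,2)] group_hom.hom_one[OF vertex_elem_group_hom[OF vertex(1)]] by simp
 qed (use arcs in auto)
 then show ?thesis by blast
qed

lemma self_similar: "self_similar FT"
proof (cases "M \<subseteq> {\<one>\<^bsub>FT\<^esub>}")
 case True
 show ?thesis
 proof (rule self_similar_of_cocycles[where I = "{} :: unit set"])
  fix Z assume "Z \<lhd> FT"
  then show "Z \<subseteq> {\<one>\<^bsub>FT\<^esub>}"
   using subgroup.subset[OF normal_imp_subgroup] trivial_if_M_trivial[OF True] by blast
 qed (use G.group_axioms in simp_all)
next
 case False
 then obtain m where m: "m \<in> M" "m \<noteq> \<one>\<^bsub>FT\<^esub>" by blast
 obtain W B where g: "cover_grown W B" and closed: "\<And>\<epsilon>. \<epsilon> \<in> edge_cosets \<Longrightarrow> cover_tail \<epsilon> \<in> W \<longleftrightarrow> cover_head \<epsilon> \<in> W"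
  using grown_maximal[OF finite_edge_cosets, of cover_tail cover_head "(r, vertex_coset r \<one>\<^bsub>Q\<^esub>)"] by blast
 \<comment> \<open>The arcs outside the spanning tree in the component of the base vertex. Two of
   them generate a free group of rank two; with at most one, a counting label suffices.\<close>
 let ?D = "{\<epsilon> \<in> edge_cosets - B. cover_tail \<epsilon> \<in> W}"
 show ?thesis
 proof (cases "\<exists>\<epsilon>1\<in>?D. \<exists>\<epsilon>2\<in>?D. \<epsilon>1 \<noteq> \<epsilon>2")
  case True
  then obtain \<epsilon>1 \<epsilon>2 where \<epsilon>: "\<epsilon>1 \<in> ?D" "\<epsilon>2 \<in> ?D" "\<epsilon>1 \<noteq> \<epsilon>2" by blast
  moreover have "cover_head \<epsilon>1 \<in> W" "cover_head \<epsilon>2 \<in> W" using \<epsilon> closed[of \<epsilon>1] closed[of \<epsilon>2] by auto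
  ultimately show ?thesis using self_similar_two_arcs[OF g, of \<epsilon>1 \<epsilon>2] by simp
 next
  case False
  have D: "\<epsilon> = (SOME \<epsilon>. \<epsilon> \<in> ?D)" if "\<epsilon> \<in> edge_cosets" "\<epsilon> \<notin> B" "cover_tail \<epsilon> \<in> W" for \<epsilon>
  proof -
   have \<epsilon>: "\<epsilon> \<in> ?D" using that by simp
   then have "(SOME \<epsilon>. \<epsilon> \<in> ?D) \<in> ?D" by (rule someI[where P = "\<lambda>\<epsilon>. \<epsilon> \<in> ?D"])
   then show ?thesis using False \<epsilon> by blast
  qed
  show ?thesis by (rule self_similar_one_arc[OF g closed D m])
 qed
qed

end

section \<open>Assembly\<close>

section \<open>The theorem\<close>

text \<open>Turns the rank hypotheses into coordinates and finite-index exponents. The rank of the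
  image at the head is inherited from the edge group through \<phi>.\<close>

lemma (in graph_of_groups) lattice_graph_exists:
 assumes T: "maximal_subtree X T"
  and v: "\<And>v. v \<in> verts X \<Longrightarrow> free_abelian_of_rank (Gv v) n"
  and e: "\<And>e. e \<in> arcs X \<Longrightarrow> free_abelian_of_rank (Gv (tail X e)\<lparr>carrier := Ge e\<rparr>) n"
  and proper: "\<And>e. e \<in> arcs X \<Longrightarrow> Ge e \<subset> carrier (Gv (tail X e))"
   "\<And>e. e \<in> arcs X \<Longrightarrow> \<phi> e ` Ge e \<subset> carrier (Gv (head X e))"
 shows "\<exists>r j q \<gamma> \<eta>. lattice_graph_of_groups X Gv Ge \<phi> T r j q \<gamma> n \<eta>"
proof -
 have "\<forall>v\<in>verts X. \<exists>\<eta>. coordinates (Gv v) n \<eta>"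
 proof
  fix w assume "w \<in> verts X"
  then obtain \<eta> where "coordinates (Gv w) n \<eta>" using free_abelian_coordinates[OF v] by blast
  then show "\<exists>\<eta>. coordinates (Gv w) n \<eta>" by blast
 qed
 from bchoice[OF this] obtain \<eta> where \<eta>: "\<forall>v\<in>verts X. coordinates (Gv v) n (\<eta> v)" by blast
 have cg: "coordinate_group (Gv v) n (\<eta> v)" if "v \<in> verts X" for v
  using group_Gv[OF that] \<eta> that by (simp add: coordinate_group_def coordinate_group_axioms_def)
 have pow: "\<exists>k::nat. k > 0 \<and> (\<forall>x\<in>carrier (Gv v). x [^]\<^bsub>Gv v\<^esub> k \<in> H)"
  if w: "v \<in> verts X" "subgroup H (Gv v)" "free_abelian_of_rank (Gv v\<lparr>carrier := H\<rparr>) n" for v H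
 proof -
  obtain \<eta>' where \<eta>': "coordinates (Gv v\<lparr>carrier := H\<rparr>) n \<eta>'" using free_abelian_coordinates[OF w(3)] by blast
  show ?thesis
  proof (rule coordinate_group.subgroup_same_rank[OF cg[OF w(1)] w(2) \<eta>'])
   fix k :: nat assume "k > 0" "\<And>x. x \<in> carrier (Gv v) \<Longrightarrow> x [^]\<^bsub>Gv v\<^esub> k \<in> H"
   then show "\<exists>k::nat. k > 0 \<and> (\<forall>x\<in>carrier (Gv v). x [^]\<^bsub>Gv v\<^esub> k \<in> H)" by (intro exI[of _ k]) simp
  qed
 qed
 obtain r j q \<gamma> where b: "based_graph_of_groups X Gv Ge \<phi> T r j q \<gamma>" using based_exists[OF T] by blast
 have "lattice_graph_of_groups X Gv Ge \<phi> T r j q \<gamma> n \<eta>"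
 proof (rule lattice_graph_of_groups.intro[OF b], rule lattice_graph_of_groups_axioms.intro)
  show "coordinates (Gv v) n (\<eta> v)" if "v \<in> verts X" for v using \<eta> that by blast
  fix a assume a: "a \<in> arcs X"
  show "\<exists>k::nat. k > 0 \<and> (\<forall>x\<in>carrier (Gv (tail X a)). x [^]\<^bsub>Gv (tail X a)\<^esub> k \<in> Ge a)"
   by (rule pow[OF tail_in_verts[OF a] subgroup_Ge[OF a] e[OF a]])
  have "Gv (tail X a)\<lparr>carrier := Ge a\<rparr> \<cong> Gv (head X a)\<lparr>carrier := \<phi> a ` Ge a\<rparr>"
   using iso_\<phi>[OF a] by (auto simp: is_iso_def)
  moreover have "group (Gv (tail X a)\<lparr>carrier := Ge a\<rparr>)"
   using group.subgroup_imp_group[OF group_Gv[OF tail_in_verts[OF a]] subgroup_Ge[OF a]] .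
  ultimately have "Gv (head X a)\<lparr>carrier := \<phi> a ` Ge a\<rparr> \<cong> Gv (tail X a)\<lparr>carrier := Ge a\<rparr>"
   by (rule group.iso_sym[rotated])
  then have "free_abelian_of_rank (Gv (head X a)\<lparr>carrier := \<phi> a ` Ge a\<rparr>) n"
   using e[OF a] iso_trans unfolding free_abelian_of_rank_def by blast
  then show "\<exists>k::nat. k > 0 \<and> (\<forall>x\<in>carrier (Gv (head X a)). x [^]\<^bsub>Gv (head X a)\<^esub> k \<in> \<phi> a ` Ge a)"
   by (rule pow[OF head_in_verts[OF a] subgroup_image[OF a]])
  show "Ge a \<subset> carrier (Gv (tail X a))" "\<phi> a ` Ge a \<subset> carrier (Gv (head X a))" using proper[OF a] by simp_all
 qed
 then show ?thesis by blast
qed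

theorem theorem1p2:
  fixes X T :: "('v, 'e) pre_digraph"
    and Gv :: "'v \<Rightarrow> 'g monoid" and Ge :: "'e \<Rightarrow> 'g set" and \<phi> :: "'e \<Rightarrow> 'g \<Rightarrow> 'g"
    and n :: nat
  assumes "graph_of_groups X Gv Ge \<phi>"
    and "maximal_subtree X T"
    and "G = fundamental_group X Gv Ge \<phi> T"
    and "\<And>v. v \<in> verts X \<Longrightarrow> free_abelian_of_rank (Gv v) n"
    and "\<And>e. e \<in> arcs X \<Longrightarrow> free_abelian_of_rank (Gv (tail X e)\<lparr>carrier := Ge e\<rparr>) n"
    and "\<And>e. e \<in> arcs X \<Longrightarrow> Ge e \<subset> carrier (Gv (tail X e))"
    and "\<And>e. e \<in> arcs X \<Longrightarrow> \<phi> e ` Ge e \<subset> carrier (Gv (head X e))"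
  shows "(self_similar G \<longleftrightarrow> residually_finite G) \<and>
         (residually_finite G \<longleftrightarrow> linear_over_int G) \<and>
         (linear_over_int G \<longleftrightarrow> subgroup_separable G)"
proof -
 have grp: "group G" unfolding assms(3) fundamental_group_def by (rule group_presented_group)
 have "self_similar G \<and> linear_over_int G \<and> subgroup_separable G" if rf: "residually_finite G"
 proof -
  obtain r j q \<gamma> \<eta> where L: "lattice_graph_of_groups X Gv Ge \<phi> T r j q \<gamma> n \<eta>"
   using graph_of_groups.lattice_graph_exists[OF assms(1,2,4-7)] by blast
  obtain M d where NL: "normal_lattice X Gv Ge \<phi> T r j q \<gamma> n \<eta> M d"
   using lattice_graph_of_groups.normal_lattice_exists[OF L rf[unfolded assms(3)]] by blast
  \<comment> \<open>Here \<open>l = 1\<close>; separability makes its own choices of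
    \<open>l\<close> from the normal lattice.\<close>
  obtain N where LQ: "lattice_quotient X Gv Ge \<phi> T r j q \<gamma> n \<eta> M d (Suc 0) N"
   using normal_lattice.quotient_exists[OF NL zero_less_Suc[of 0]] by blast
  show ?thesis
   unfolding assms(3)
   by (intro conjI lattice_quotient.self_similar[OF LQ] lattice_quotient.linear[OF LQ] normal_lattice.separable[OF NL])
 qed
 then show ?thesis
  using self_similar_imp_residually_finite[OF grp] linear_over_int_imp_residually_finite[OF grp]
   subgroup_separable_imp_residually_finite[OF grp] by blast
qed

end
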